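(* Let $\alpha>0$ be irrational and let $q$ be a non-zero integer. Let $A_{\alpha q}=\{n\in\mathbb{N}:\{\alpha n\}<\{\alpha q\}\}$ and $$g_{\alpha q}(s)=\sum_{n\in A_{\alpha q}}\frac{1}{n^s},$$ which converges for $\mathrm{Re}(s)>1$. Then $g_{\alpha q}$ can be continued analytically to the half-plane $\{s\in\mathbb{C}:\mathrm{Re}(s)>-\frac{1}{\tau_\alpha}\}$ except for a simple pole at $s=1$ with residue $\{\alpha q\}$. If $\tau_\alpha>1$, the vertical line $-\frac{1}{\tau_\alpha}+i\mathbb{R}$ is the natural boundary for $g_{\alpha q}$. Moreover, if $\alpha$ is a positive quadratic irrational, then $g_{\alpha q}$ has a meromorphic continuation to the whole complex plane with a simple pole at $s=1$ and at most simple poles at the points $s=-k\pm\frac{2\pi i n}{\log\eta_\alpha}$, $(k,n)\in\mathbb{N}\times\mathbb{N}_0$.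
   Context: $\{x\}$ denotes the fractional part of a real number $x$; $\mathbb{N}=\{1,2,\dots\}$, $\mathbb{N}_0=\{0,1,2,\dots\}$. For irrational $\alpha=[a_0,a_1,a_2,\dots]$ (continued fraction expansion) with convergents $p_n/q_n=[a_0,\dots,a_n]$, define $\tau_\alpha=\limsup_{n\to\infty}\frac{\log q_{n+1}}{\log q_n}\in[1,\infty]$ (with $-1/\tau_\alpha=0$ if $\tau_\alpha=\infty$). The $n$-th complete quotient is $\theta_n=[a_n,a_{n+1},\dots]$. For a quadratic irrational $\alpha$, whose continued fraction is eventually periodic with periodic part $(a_p,a_{p+1},\dots,a_{p+q-1})$, define $\eta_\alpha$ by $\eta_\alpha^{-1}=\theta_{p+1}\theta_{p+2}\cdots\theta_{p+q}$. For a Dirichlet series $f$, $\sigma_\mu(f)$ denotes the infimum of the real numbers $x$ such that $f$ has a meromorphic continuation to $\{\mathrm{Re}(s)>x\}$; when $\sigma_\mu(f)$ is finite, the line $\sigma_\mu(f)+i\mathbb{R}$ is called the natural boundary of $f$ (i.e. $f$ admits no meromorphic continuation to any half-plane $\{\mathrm{Re}(s)>x\}$ with $x<\sigma_\mu(f)$).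
   Formalization: The periodic part defining η_α is taken to be the shortest one of even length (an odd primitive period is written twice); with the primitive period the pole claim fails, e.g. for the golden ratio, which has poles at −1 plus odd multiples of πi/log((1+√5)/2). *)

theory Defs
  imports "HOL-Complex_Analysis.Complex_Analysis"
begin

section \<open>Continued fractions of irrational numbers\<close>

text \<open>
  The functions below are meant for irrational \<open>\<alpha>\<close>, whose expansion never terminates:
  \<open>\<theta>\<^sub>n\<close> is then never an integer, \<open>a\<^sub>n = \<lfloor>\<theta>\<^sub>n\<rfloor>\<close> and \<open>\<theta>\<^sub>n = [a\<^sub>n, a\<^sub>n\<^sub>+\<^sub>1, \<dots>]\<close>.
\<close>

primrec complete_quotient :: "real \<Rightarrow> nat \<Rightarrow> real" where
  "complete_quotient \<alpha> 0 = \<alpha>"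
| "complete_quotient \<alpha> (Suc n) = 1 / frac (complete_quotient \<alpha> n)"

definition partial_quotient :: "real \<Rightarrow> nat \<Rightarrow> int" where
  "partial_quotient \<alpha> n = \<lfloor>complete_quotient \<alpha> n\<rfloor>"

text \<open>The denominator \<open>q\<^sub>n\<close> of the convergent \<open>p\<^sub>n / q\<^sub>n = [a\<^sub>0, \<dots>, a\<^sub>n]\<close> in lowest terms.\<close>

fun convergent_denom :: "real \<Rightarrow> nat \<Rightarrow> int" where
  "convergent_denom \<alpha> 0 = 1"
| "convergent_denom \<alpha> (Suc 0) = partial_quotient \<alpha> 1"
| "convergent_denom \<alpha> (Suc (Suc n)) =
     partial_quotient \<alpha> (Suc (Suc n)) * convergent_denom \<alpha> (Suc n) + convergent_denom \<alpha> n"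

text \<open>
  Since \<open>1 / \<infinity> = 0\<close> in \<^typ>\<open>ereal\<close>, the expression \<open>- (1 / cf_tau \<alpha>)\<close> is \<open>0\<close> if \<open>\<tau>\<^sub>\<alpha> = \<infinity>\<close>. The
  indices with \<open>q\<^sub>n = 1\<close>, where a logarithm in the denominator vanishes, are at most \<open>0\<close> and \<open>1\<close>.
\<close>

definition cf_tau :: "real \<Rightarrow> ereal" where
  "cf_tau \<alpha> = limsup (\<lambda>n. ereal (ln (real_of_int (convergent_denom \<alpha> (Suc n)))
                                / ln (real_of_int (convergent_denom \<alpha> n))))"

definition quadratic_irrational :: "real \<Rightarrow> bool" where
  "quadratic_irrational \<alpha> \<longleftrightarrow> \<alpha> \<notin> \<rat> \<and>
     (\<exists>a b c :: int. a \<noteq> 0 \<and> of_int a * \<alpha>\<^sup>2 + of_int b * \<alpha> + of_int c = 0)"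

text \<open>
  The periodic part \<open>(a\<^sub>p, \<dots>, a\<^sub>p\<^sub>+\<^sub>l\<^sub>-\<^sub>1)\<close> of an eventually periodic expansion is taken to be the
  shortest one of even length \<open>l\<close>, i.e. an odd primitive period is written twice. The
  parity matters: each step of the expansion reverses the sign of the sum of
  \<open>{n \<alpha>} - 1/2\<close> over \<open>n \<le> x\<close>, up to elementary terms, so only an even number of steps gives back
  the same quantity, and for the golden ratio poles at odd multiples of \<open>pi i / ln ((1 + sqrt 5) / 2)\<close>
  above and below \<open>-1\<close> do occur. The value \<open>\<eta>\<^sub>\<alpha>\<close> does not depend on
  the starting index \<open>p\<close>.
\<close>

definition cf_period :: "real \<Rightarrow> nat" where
  "cf_period \<alpha> = (LEAST l. 0 < l \<and> even l \<and>
     (\<exists>p. \<forall>n\<ge>p. partial_quotient \<alpha> (n + l) = partial_quotient \<alpha> n))"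

definition cf_preperiod :: "real \<Rightarrow> nat" where
  "cf_preperiod \<alpha> = (LEAST p. \<forall>n\<ge>p. partial_quotient \<alpha> (n + cf_period \<alpha>) = partial_quotient \<alpha> n)"

definition cf_eta :: "real \<Rightarrow> real" where
  "cf_eta \<alpha> = inverse (\<Prod>i=1..cf_period \<alpha>. complete_quotient \<alpha> (cf_preperiod \<alpha> + i))"


section \<open>Meromorphic continuation and natural boundary\<close>

text \<open>
  Here \<open>f\<close> is the sum function of a Dirichlet series; its values matter only on some right
  half-plane, on which the continuation has to agree with it.
\<close>

definition meromorphic_continuation :: "(complex \<Rightarrow> complex) \<Rightarrow> real \<Rightarrow> (complex \<Rightarrow> complex) \<Rightarrow> bool" where
  "meromorphic_continuation f x h \<longleftrightarrow>
     h meromorphic_on {s. x < Re s} \<and> (\<exists>c. \<forall>s. c < Re s \<longrightarrow> h s = f s)"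

definition sigma_mu :: "(complex \<Rightarrow> complex) \<Rightarrow> ereal" where
  "sigma_mu f = Inf {ereal x | x. \<exists>h. meromorphic_continuation f x h}"

definition is_natural_boundary :: "(complex \<Rightarrow> complex) \<Rightarrow> complex set \<Rightarrow> bool" where
  "is_natural_boundary f L \<longleftrightarrow> \<bar>sigma_mu f\<bar> \<noteq> \<infinity> \<and> L = {s. ereal (Re s) = sigma_mu f}"

definition has_simple_pole :: "(complex \<Rightarrow> complex) \<Rightarrow> complex \<Rightarrow> bool" where
  "has_simple_pole f z \<longleftrightarrow> is_pole f z \<and> zorder f z = -1"


section \<open>The Dirichlet series\<close>

definition A_set :: "real \<Rightarrow> int \<Rightarrow> nat set" where
  "A_set \<alpha> q = {n. 1 \<le> n \<and> frac (\<alpha> * of_nat n) < frac (\<alpha> * of_int q)}"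

definition g_series :: "real \<Rightarrow> int \<Rightarrow> complex \<Rightarrow> complex" where
  "g_series \<alpha> q s = (\<Sum>\<^sub>\<infinity>n\<in>A_set \<alpha> q. 1 / of_nat n powr s)"

definition pole_lattice :: "real \<Rightarrow> complex set" where
  "pole_lattice \<alpha> =
     {- of_nat k + of_real (2 * pi * real n / ln (cf_eta \<alpha>)) * \<i> | k n :: nat. 1 \<le> k} \<union>
     {- of_nat k - of_real (2 * pi * real n / ln (cf_eta \<alpha>)) * \<i> | k n :: nat. 1 \<le> k}"

end

theory Submission
  imports Defs
begin

text \<open>
  Multiplying \<open>g\<close> by \<open>\<Gamma>\<close> gives the Mellin transform of the Lambert series \<open>\<Sum>n\<in>A. e\<^sup>-\<^sup>n\<^sup>t\<close>. Cutting the cone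
  below the line of slope \<open>\<alpha>\<close> along consecutive convergents into unimodular cones turns this series, up
  to a factor \<open>1 - e\<^sup>-\<^sup>q\<^sup>t\<close> and elementary terms, into \<open>\<Sum>k. (-1)\<^sup>k b(q\<^sub>k t) b(q\<^sub>k\<^sub>+\<^sub>1 t)\<close> with
  \<open>b(x) = 1 / (e\<^sup>x - 1)\<close>. Its behaviour as \<open>t \<rightarrow> 0\<close> is governed by \<open>\<Sum>k. q\<^sub>k\<^sub>+\<^sub>1\<^sup>\<mu> / q\<^sub>k\<close>, which converges for
  \<open>\<mu> < 1 / \<tau>\<close>: this is the continuation. If \<open>\<tau> > 1\<close>, the leading part of the Mellin transform is a
  Dirichlet-type series over the \<open>q\<^sub>k\<close> whose exponents have proportional gaps, and a gap argument in the
  style of Hadamard and Ostrowski excludes a meromorphic continuation. For a quadratic irrational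
  \<open>q\<^sub>k = X\<^sub>k + Y\<^sub>k\<close>, where a shift by the even period \<open>l\<close> multiplies \<open>X\<close> by \<open>\<epsilon> = 1 / \<eta>\<close> and divides \<open>Y\<close> by
  \<open>\<epsilon>\<close>. The Mellin transform of the \<open>n\<close>-th period is then \<open>\<epsilon>\<^sup>-\<^sup>n\<^sup>s I(s, \<epsilon>\<^sup>-\<^sup>n)\<close> with \<open>I\<close> entire in \<open>s\<close> and holomorphic
  near \<open>0\<close> in its second argument (by Hankel's contour), and expanding \<open>I\<close> in powers of the latter gives
  geometric series with poles only where \<open>\<epsilon>\<^sup>s\<^sup>+\<^sup>m = 1\<close>.
\<close>

section \<open>Continued fraction denominators\<close>

text \<open>Membership in \<open>A_set\<close> is a borrow in a subtraction: its indicator is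
  floor(\<beta> n) - floor(\<beta> (n - q)) - floor(\<beta> q), \<beta> the fractional part of
  \<alpha>. This is where the factor 1 - exp(-q t) comes from. It vanishes at t = 0 and so gains one
  power of t: the remainder of the bose series is only O(t^(mu - 1)), but the Lambert series has
  error O(t^mu), and the half-plane reaches -mu. For the boundary, replacing b(q_k t) by its pole 1
  / (q_k t) costs only something continuable to Re s > -1; what remains has as transform the series
  over q_(k+1)^(1-z) / q_k, z = s + 1, times Gamma(z-1) zeta(z-1). A meromorphic continuation may
  have poles, but they are isolated, so the gap argument can be run at a regular point of the line.
  In the quadratic case the kernels have a pole at the origin, so their Mellin integrals converge
  only for Re s > 1. Hankel's loop removes this restriction at the price of a factor exp(2 pi i s) -
  1; the reflection formula divides it out together with Gamma and leaves, for Re s < 2, only the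
  pole at s = 1.\<close>

declare complete_quotient.simps(2) [simp del]

lemma frac_irrational: "x \<notin> \<rat> \<Longrightarrow> frac x \<notin> \<rat>" for x :: real
proof
  assume "x \<notin> \<rat>" "frac x \<in> \<rat>"
  moreover have "x = frac x + of_int \<lfloor>x\<rfloor>" by (simp add: frac_def)
  ultimately show False by (metis Rats_add Rats_of_int)
qed

lemma frac_irrational_pos: "x \<notin> \<rat> \<Longrightarrow> 0 < frac x" for x :: real
  by (metis frac_ge_0 frac_irrational Rats_0 order_le_less)

lemma inverse_irrational: "x \<notin> \<rat> \<Longrightarrow> 1 / x \<notin> \<rat>" for x :: real
  by (metis Rats_divide Rats_1 divide_divide_eq_right div_by_1 mult_1 )

definition cf_denom :: "real \<Rightarrow> nat \<Rightarrow> real" where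
  "cf_denom \<alpha> n = real_of_int (convergent_denom \<alpha> n)"

locale irrational_number =
  fixes \<alpha> :: real
  assumes irr: "\<alpha> \<notin> \<rat>"
begin

abbreviation "\<theta> \<equiv> complete_quotient \<alpha>"
abbreviation "a \<equiv> partial_quotient \<alpha>"
abbreviation "Q \<equiv> cf_denom \<alpha>"

lemma theta_irrational: "\<theta> n \<notin> \<rat>"
proof (induction n)
  case 0
  then show ?case using irr by simp
next
  case (Suc n)
  then show ?case using inverse_irrational[OF frac_irrational] by (simp add: complete_quotient.simps)
qed

lemma theta_gt_1: "1 < \<theta> (Suc n)"
  using frac_irrational_pos[OF theta_irrational[of n]] frac_lt_1[of "\<theta> n"] by (simp add: complete_quotient.simps field_simps)

lemma theta_Suc: "\<theta> (Suc n) = 1 / (\<theta> n - a n)"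
  by (simp add: complete_quotient.simps partial_quotient_def frac_def)

lemma theta_diff_pos: "0 < \<theta> n - a n"
  using frac_irrational_pos[OF theta_irrational[of n]] by (simp add: partial_quotient_def frac_def)

lemma theta_eq: "\<theta> n = a n + 1 / \<theta> (Suc n)"
  using theta_diff_pos[of n] by (simp add: theta_Suc)

lemma a_ge_1: "1 \<le> a (Suc n)"
  using theta_gt_1[of n] by (simp add: partial_quotient_def)

lemma Q_0: "Q 0 = 1" and Q_1: "Q (Suc 0) = a 1"
  and Q_rec: "Q (Suc (Suc n)) = a (Suc (Suc n)) * Q (Suc n) + Q n"
  by (simp_all add: cf_denom_def)

lemma Q_ge_1: "1 \<le> Q n"
proof -
  have "1 \<le> Q n \<and> 1 \<le> Q (Suc n)"
  proof (induction n)
    case 0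
    then show ?case using a_ge_1[of 0] by (simp add: Q_0 Q_1)
  next
    case (Suc n)
    have "1 * 1 \<le> a (Suc (Suc n)) * Q (Suc n)"
      using Suc a_ge_1[of "Suc n"] by (intro mult_mono) auto
    with Suc show ?case by (simp add: Q_rec)
  qed
  thus ?thesis by simp
qed

lemma Q_pos: "0 < Q n" using Q_ge_1[of n] by simp

lemma Q_rec_ge: "Q (Suc n) + Q n \<le> Q (Suc (Suc n))"
  using mult_right_mono[of 1 "real_of_int (a (Suc (Suc n)))" "Q (Suc n)"] a_ge_1[of "Suc n"] Q_ge_1[of "Suc n"]
  by (simp add: Q_rec)

lemma Q_le_Suc: "Q n \<le> Q (Suc n)"
proof (cases n)
  case 0
  then show ?thesis using Q_ge_1[of 1] by (simp add: Q_0)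
next
  case (Suc m)
  then show ?thesis using Q_rec_ge[of m] Q_pos[of m] by simp
qed

lemma Q_mono: "m \<le> n \<Longrightarrow> Q m \<le> Q n"
  by (rule lift_Suc_mono_le[of Q]) (auto intro: Q_le_Suc)

lemma Q_double: "2 * Q n \<le> Q (Suc (Suc n))"
  using Q_rec_ge[of n] Q_le_Suc[of n] by simp

text \<open>Two steps of the recursion at least double the denominator. The shift by 1 in the
  exponent accommodates the start, where \<open>Q 1\<close> may still be 1.\<close>

lemma Q_growth: "2 powr ((real n - 1) / 2) \<le> Q n"
proof (induction n rule: less_induct)
  case (less n)
  consider "n = 0" | "n = 1" | m where "n = Suc (Suc m)" by (metis One_nat_def not0_implies_Suc)
  then show ?case
  proof cases
    case 1
    then show ?thesis using powr_mono[of "- 1/2" 0 "2::real"] by (simp add: Q_0)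
  next
    case 2
    then show ?thesis using Q_ge_1[of 1] by simp
  next
    case 3
    have "2 powr ((real n - 1) / 2) = 2 powr (1 + (real m - 1) / 2)" by (simp add: 3 field_simps)
    also have "\<dots> = 2 * 2 powr ((real m - 1) / 2)" by (subst powr_add) simp
    also have "\<dots> \<le> 2 * Q m" using less[of m] 3 by simp
    also have "\<dots> \<le> Q n" using Q_double[of m] 3 by simp
    finally show ?thesis .
  qed
qed

lemma summable_Q_powr:
  assumes "0 < d"
  shows "summable (\<lambda>n. Q n powr (- d))"
proof (rule summable_comparison_test')
  have "2 powr (- d / 2) < 2 powr 0" using assms by (subst powr_less_cancel_iff) auto
  then show "summable (\<lambda>n. 2 powr (d / 2) * (2 powr (- d / 2)) ^ n)"
    by (intro summable_mult summable_geometric) auto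
next
  fix n :: nat
  have "Q n powr (- d) \<le> (2 powr ((real n - 1) / 2)) powr (- d)"
    using assms Q_growth[of n] by (intro powr_mono2') auto
  also have "\<dots> = 2 powr (d / 2) * 2 powr (- d / 2 * n)"
    by (simp add: powr_powr powr_add[symmetric] field_simps)
  also have "2 powr (- d / 2 * n) = (2 powr (- d / 2)) ^ n"
    by (simp add: powr_power algebra_simps)
  finally show "norm (Q n powr (- d)) \<le> 2 powr (d / 2) * (2 powr (- d / 2)) ^ n" by simp
qed

lemma summable_inverse_Q: "summable (\<lambda>n. 1 / Q n)"
proof -
  have "Q n powr (-1) = 1 / Q n" for n using Q_pos[of n] by (simp add: powr_minus_divide)
  with summable_Q_powr[of 1] show ?thesis by simp
qed

lemma Q_filterlim: "filterlim Q at_top sequentially"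
proof -
  have "filterlim (\<lambda>n. 1 / Q n) (at_right 0) sequentially"
    using summable_LIMSEQ_zero[OF summable_inverse_Q] Q_pos
    by (auto simp: filterlim_at intro!: always_eventually less_imp_neq[symmetric] )
  then have "filterlim (\<lambda>n. inverse (1 / Q n)) at_top sequentially"
    by (rule filterlim_compose[OF filterlim_inverse_at_top_right])
  thus ?thesis by simp
qed

text \<open>Both values are the areas (to leading order) under the cones of \<open>cone_sum\<close> below, which
  explains why they obey the same recursion.\<close>

lemma alternating_sum_area: "(\<lambda>k. (- 1) ^ k / (Q k * Q (Suc k))) sums frac \<alpha>"
proof -
  \<comment> \<open>\<open>S k / t^2\<close> is the integral of exp(-(i x + j y)) over the cone 0 <
    j < \<open>\<theta> (k+2)\<close> i with x = \<open>Q k * t\<close> and y =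
    \<open>Q (Suc k) * t\<close>. So \<open>step\<close> is the continuous counterpart of the
    reciprocity of cone sums, and \<open>S\<close> is the tail of the series in closed form, up to
    sign.\<close>
  define S where "S = (\<lambda>k. \<theta> (k+2) / (Q k * (Q k + \<theta> (k+2) * Q (Suc k))))"
  have th: "0 < \<theta> (Suc n)" for n using theta_gt_1[of n] by simp
  have step: "S k + S (Suc k) = 1 / (Q k * Q (Suc k))" for k
  proof -
    define x y t s A where "x = Q k" and "y = Q (Suc k)" and "t = \<theta> (k+2)" and "s = \<theta> (k+3)" and "A = real_of_int (a (k+2))"
    have pos: "0 < x" "0 < y" "0 < t" "0 < s" using Q_pos th unfolding x_def y_def t_def s_def
      by (auto simp add: eval_nat_numeral)
    have t: "t = A + 1 / s" unfolding t_def A_def s_def using theta_eq[of "k+2"]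
      by (simp add: eval_nat_numeral)
    have A: "0 \<le> A" using a_ge_1[of "Suc k"] by (simp add: A_def)
    have z: "Q (Suc (Suc k)) = A * y + x" by (simp add: Q_rec A_def x_def y_def)
    have "S (Suc k) = s / (y * (y + s * (A * y + x)))"
      by (simp add: S_def s_def y_def z eval_nat_numeral)
    also have "y + s * (A * y + x) = s * (x + t * y)" using pos by (simp add: t field_simps)
    also have "s / (y * (s * (x + t * y))) = 1 / (y * (x + t * y))" using pos by simp
    finally have 1: "S (Suc k) = 1 / (y * (x + t * y))" .
    have 2: "S k = t / (x * (x + t * y))" by (simp add: S_def t_def x_def y_def)
    have "0 < x + t * y" using pos by (simp add: add_pos_pos)
    then show ?thesis unfolding 1 2 x_def[symmetric] y_def[symmetric] using pos by (simp add: divide_simps)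
  qed
  have part: "(\<Sum>k<n. (- 1) ^ k / (Q k * Q (Suc k))) = S 0 - (-1) ^ n * S n" for n
  proof (induction n)
    case (Suc n)
    have "(- 1) ^ n / (Q n * Q (Suc n)) = (- 1) ^ n * (S n + S (Suc n))" by (simp add: step)
    with Suc show ?case by (simp add: algebra_simps)
  qed simp
  have S0: "S 0 = frac \<alpha>"
  proof -
    have "S 0 = \<theta> 2 / (1 + \<theta> 2 * a 1)" by (simp add: S_def Q_0 Q_1 numeral_2_eq_2)
    also have "\<dots> = 1 / (a 1 + 1 / \<theta> 2)" using th[of 1] by (simp add: divide_simps numeral_2_eq_2 mult.commute add.commute)
    also have "a 1 + 1 / \<theta> 2 = \<theta> 1" using theta_eq[of 1] by (simp add: numeral_2_eq_2)
    finally show ?thesis by (simp add: complete_quotient.simps)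
  qed
  have "S \<longlonglongrightarrow> 0"
  proof (rule Lim_null_comparison[OF always_eventually summable_LIMSEQ_zero[OF summable_inverse_Q]], rule allI)
    fix k
    have t: "0 < \<theta> (k+2)" using th[of "k+1"] by simp
    have "\<theta> (k+2) * 1 \<le> \<theta> (k+2) * Q (Suc k)" using t Q_ge_1[of "Suc k"] by (intro mult_left_mono) auto
    then have "\<theta> (k+2) \<le> Q k + \<theta> (k+2) * Q (Suc k)" using Q_pos[of k] by (simp only:)
    then have "\<theta> (k+2) / (Q k + \<theta> (k+2) * Q (Suc k)) \<le> 1" using t by (simp add: divide_le_eq)
    then have le: "1 / Q k * (\<theta> (k+2) / (Q k + \<theta> (k+2) * Q (Suc k))) \<le> 1 / Q k * 1" using Q_pos[of k]
      by (intro mult_left_mono) auto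
    have eq: "S k = 1 / Q k * (\<theta> (k+2) / (Q k + \<theta> (k+2) * Q (Suc k)))" unfolding S_def by simp
    have "0 \<le> S k" using t Q_pos[of k] Q_pos[of "Suc k"] unfolding S_def
      by (intro divide_nonneg_nonneg mult_nonneg_nonneg add_nonneg_nonneg) auto
    then show "norm (S k) \<le> 1 / Q k" using le unfolding eq[symmetric] by simp
  qed
  then have "(\<lambda>n. (-1) ^ n * S n) \<longlonglongrightarrow> 0"
    by (rule tendsto_rabs_zero_cancel[OF Lim_transform_eventually[OF tendsto_rabs_zero]]) (simp add: abs_mult power_abs)
  then have "(\<lambda>n. S 0 - (-1) ^ n * S n) \<longlonglongrightarrow> S 0 - 0" by (intro tendsto_intros)
  then show ?thesis by (simp add: sums_def part S0)
qed

lemma alternating_sum_inverse: "(\<lambda>k. (- 1) ^ k * (1 / Q k + 1 / Q (Suc k))) sums 1"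
proof -
  have part: "(\<Sum>k<n. (- 1) ^ k * (1 / Q k + 1 / Q (Suc k))) = 1 - (-1) ^ n * (1 / Q n)" for n
    by (induction n) (auto simp: Q_0 algebra_simps)
  have "(\<lambda>n. (-1) ^ n * (1 / Q n)) \<longlonglongrightarrow> 0"
    by (rule tendsto_rabs_zero_cancel[OF Lim_transform_eventually[OF tendsto_rabs_zero[OF summable_LIMSEQ_zero[OF summable_inverse_Q]]]]) (simp add: abs_mult power_abs)
  then have "(\<lambda>n. 1 - (-1) ^ n * (1 / Q n)) \<longlonglongrightarrow> 1 - 0" by (intro tendsto_intros)
  then show ?thesis by (simp add: sums_def part)
qed

end

section \<open>Lattice sums over unimodular cones\<close>

text \<open>The Bose-Einstein function, the sum of exp(-i z) over i >= 1 for Re z > 0. One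
  polymorphic definition serves both the real estimates on the half-line and the complex loops
  around the pole at 0.\<close>

definition bose :: "'a::{real_normed_field,banach} \<Rightarrow> 'a" where
  "bose z = 1 / (exp z - 1)"

lemma bose_of_real: "bose (of_real x :: complex) = of_real (bose x)"
  by (simp add: bose_def exp_of_real)

lemma bose_pos: "0 < x \<Longrightarrow> 0 < bose x" for x :: real
  by (simp add: bose_def)

lemma bose_has_sum:
  assumes "0 < (x::real)"
  shows "((\<lambda>i::nat. exp (- (real i * x))) has_sum bose x) {1..}"
proof -
  have 1: "norm (exp (- x)) < 1" using assms by simp
  have "(\<lambda>n. exp (- x) ^ n * exp (- x)) sums (1 / (1 - exp (- x)) * exp (- x))"
    by (intro sums_mult2 geometric_sums 1)
  also have "1 / (1 - exp (- x)) * exp (- x) = bose x"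
    using assms by (simp add: bose_def exp_minus divide_simps)
  also have "(\<lambda>n. exp (- x) ^ n * exp (- x)) = (\<lambda>n. exp (- (real (Suc n) * x)))"
    by (auto simp: exp_of_nat_mult[symmetric] exp_add[symmetric] algebra_simps)
  finally have "((\<lambda>n. exp (- (real (Suc n) * x))) has_sum bose x) UNIV"
    by (intro norm_summable_imp_has_sum) (auto dest: sums_summable)
  also have "?this \<longleftrightarrow> ?thesis"
    by (rule has_sum_reindex_bij_witness[of _ "\<lambda>n. n - 1" Suc]) auto
  finally show ?thesis .
qed

lemma bose_product_has_sum:
  assumes "0 < (x::real)" "0 < y"
  shows "((\<lambda>(i::nat,j::nat). exp (- (real i * x + real j * y))) has_sum (bose x * bose y)) ({1..} \<times> {1..})"
proof -
  have inner: "((\<lambda>j. case (i, j) of (i::nat,j::nat) \<Rightarrow> exp (- (real i * x + real j * y))) has_sum (exp (- (real i * x)) * bose y)) {1..}"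
    for i :: nat
    using has_sum_cmult_right[OF bose_has_sum[OF assms(2)], of "exp (- (real i * x))"]
    by (simp add: exp_add exp_minus exp_diff divide_simps)
  have outer: "((\<lambda>i::nat. exp (- (real i * x)) * bose y) has_sum (bose x * bose y)) {1..}"
    using has_sum_cmult_left[OF bose_has_sum[OF assms(1)], of "bose y"] by simp
  show ?thesis
    using inner outer by (intro has_sum_SigmaI summable_on_SigmaI[OF inner]) (auto intro: has_sum_imp_summable)
qed

text \<open>Here (i, j) are coordinates with respect to two consecutive convergent vectors, and x, y
  are the values on these vectors of the functional n t. The summand is therefore exp(-n t) in
  disguise.\<close>

definition cone_sum :: "real \<Rightarrow> real \<Rightarrow> real \<Rightarrow> real" where
  "cone_sum x y \<theta> =
     infsum (\<lambda>(i::nat,j::nat). exp (- (real i * x + real j * y))) {(i,j). 1 \<le> i \<and> 1 \<le> j \<and> real j < \<theta> * real i}"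

lemma cone_summable:
  assumes "0 < x" "0 < y" "A \<subseteq> {1..} \<times> {1..}"
  shows "(\<lambda>(i::nat,j::nat). exp (- (real i * x + real j * y))) summable_on A"
  using bose_product_has_sum[OF assms(1,2)] assms(3) has_sum_imp_summable summable_on_subset_banach by blast

lemma cone_sum_nonneg: "0 \<le> cone_sum x y \<theta>"
  unfolding cone_sum_def by (rule infsum_nonneg) auto

lemma cone_sum_le:
  assumes "0 < x" "0 < y"
  shows "cone_sum x y \<theta> \<le> bose x * bose y"
proof -
  have "cone_sum x y \<theta> \<le> infsum (\<lambda>(i::nat,j::nat). exp (- (real i * x + real j * y))) ({1..} \<times> {1..})"
    unfolding cone_sum_def using assms
    by (intro infsum_mono_neutral cone_summable) auto
  also have "\<dots> = bose x * bose y" by (rule infsumI[OF bose_product_has_sum[OF assms]])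
  finally show ?thesis .
qed

text \<open>The unimodular cone spanned by two consecutive convergent vectors is cut by the irrational ray
  of slope \<open>\<alpha>\<close>; the part on the far side is a cone of the same shape for the next pair.\<close>

lemma cone_sum_reciprocity:
  assumes "0 < x" "0 < y" and irr: "\<theta> \<notin> \<rat>" and "0 < \<theta>"
  shows "cone_sum x y \<theta> + cone_sum y (x + of_int \<lfloor>\<theta>\<rfloor> * y) (1 / frac \<theta>) = bose x * bose y"
proof -
  define f where "f = (\<lambda>(i::nat,j::nat). exp (- (real i * x + real j * y)))"
  define A where "A = {(i::nat,j::nat). 1 \<le> i \<and> 1 \<le> j \<and> real j < \<theta> * real i}"
  define A' where "A' = {(i::nat,j::nat). 1 \<le> i \<and> 1 \<le> j \<and> \<theta> * real i < real j}"
  define N where "N = nat \<lfloor>\<theta>\<rfloor>"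
  have N: "real N = of_int \<lfloor>\<theta>\<rfloor>" using assms by (simp add: N_def)
  have fr: "0 < frac \<theta>" "frac \<theta> = \<theta> - real N" using frac_irrational_pos[OF irr] by (simp_all add: frac_def N)
  \<comment> \<open>Irrationality of the slope: no lattice point lies on the ray, so
    \<open>A\<close> and \<open>A'\<close> exhaust the open quadrant.\<close>
  have ne: "real j \<noteq> \<theta> * real i" if "1 \<le> i" for i j :: nat
  proof
    assume "real j = \<theta> * real i"
    then have "\<theta> = real j / real i" using that by (simp add: field_simps)
    then show False using irr by simp
  qed
  have un: "{1..} \<times> {1..} = A \<union> A'" using ne by (auto simp: A_def A'_def) (meson linorder_neqE_linordered_idom)
  have "infsum f A + infsum f A' = infsum f (A \<union> A')"
  proof (rule infsum_Un_disjoint[symmetric])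
    show "f summable_on A" "f summable_on A'" unfolding f_def A_def A'_def
      by (rule cone_summable[OF assms(1,2)]; auto)+
  qed (auto simp: A_def A'_def)
  also have "\<dots> = bose x * bose y" unfolding un[symmetric] f_def by (rule infsumI[OF bose_product_has_sum[OF assms(1,2)]])
  \<comment> \<open>The shear by \<open>N\<close> followed by a swap sends a point above the ray to
    (j - N i, i). Above the ray \<theta> i < j, hence N i < j, so the subtraction of natural numbers
    is a genuine one.\<close>
  also have "infsum f A' = cone_sum y (x + of_int \<lfloor>\<theta>\<rfloor> * y) (1 / frac \<theta>)"
    unfolding cone_sum_def
  proof (rule infsum_reindex_bij_witness[of _ "\<lambda>(j,i). (i, j + N * i)" "\<lambda>(i,j). (j - N * i, i)"])
    fix p assume "p \<in> A'"
    then obtain i j where p: "p = (i,j)" "1 \<le> i" "1 \<le> j" "\<theta> * real i < real j" by (auto simp: A'_def)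
    have "real N * real i \<le> \<theta> * real i" using fr by (intro mult_right_mono) auto
    then have lt: "N * i < j" using p(4) by (metis of_nat_less_iff of_nat_mult order_le_less_trans)
    show "(case (case p of (i, j) \<Rightarrow> (j - N * i, i)) of (j, i) \<Rightarrow> (i, j + N * i)) = p" using p lt by simp
    have "real i * frac \<theta> < real (j - N * i)" using p(4) lt by (simp add: fr(2) of_nat_diff algebra_simps)
    then have "real i < 1 / frac \<theta> * real (j - N * i)" using fr(1) by (simp add: pos_less_divide_eq)
    then show "(case p of (i, j) \<Rightarrow> (j - N * i, i)) \<in> {(i, j). 1 \<le> i \<and> 1 \<le> j \<and> real j < 1 / frac \<theta> * real i}"
      using p lt by simp
    show "(case case p of (i, j) \<Rightarrow> (j - N * i, i) of (i, j) \<Rightarrow> exp (- (real i * y + real j * (x + of_int \<lfloor>\<theta>\<rfloor> * y)))) = f p"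
      using lt p by (simp add: f_def of_nat_diff N[symmetric] algebra_simps)
  next
    fix p assume "p \<in> {(i, j). 1 \<le> i \<and> 1 \<le> j \<and> real j < 1 / frac \<theta> * real i}"
    then obtain i j where p: "p = (i,j)" "1 \<le> i" "1 \<le> j" "real j < 1 / frac \<theta> * real i" by auto
    show "(case (case p of (j, i) \<Rightarrow> (i, j + N * i)) of (i, j) \<Rightarrow> (j - N * i, i)) = p" using p by simp
    have "frac \<theta> * real j < real i" using p(4) fr(1) by (simp add: field_simps)
    then show "(case p of (j, i) \<Rightarrow> (i, j + N * i)) \<in> A'" using p fr(2) by (simp add: A'_def algebra_simps)
  qed
  finally show ?thesis by (simp add: cone_sum_def f_def A_def)
qed

context irrational_number
begin

text \<open>Under reciprocity the weights reproduce the recursion of the denominators and the slope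
  that of the complete quotients, so each cone leads to the next cone of the same chain.\<close>

lemma cone_sum_step:
  assumes "0 < t"
  shows "cone_sum (Q k * t) (Q (Suc k) * t) (\<theta> (k + 2)) + cone_sum (Q (Suc k) * t) (Q (Suc (Suc k)) * t) (\<theta> (Suc k + 2))
    = bose (Q k * t) * bose (Q (Suc k) * t)"
proof -
  have "Q k * t + of_int \<lfloor>\<theta> (k + 2)\<rfloor> * (Q (Suc k) * t) = Q (Suc (Suc k)) * t"
    by (simp add: Q_rec partial_quotient_def algebra_simps)
  moreover have "1 / frac (\<theta> (k + 2)) = \<theta> (Suc k + 2)" by (simp add: complete_quotient.simps)
  moreover have "0 < \<theta> (k + 2)" using theta_gt_1[of "Suc k"] by simp
  ultimately show ?thesis
    using cone_sum_reciprocity[of "Q k * t" "Q (Suc k) * t" "\<theta> (k + 2)"] assms Q_pos theta_irrational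
    by simp
qed

lemma bose_Q_le:
  assumes "0 < t"
  shows "bose (Q k * t) \<le> 1 / (Q k * t)"
proof -
  have "Q k * t \<le> exp (Q k * t) - 1" using exp_ge_add_one_self[of "Q k * t"] by linarith
  moreover have "0 < Q k * t" using assms Q_pos[of k] by simp
  ultimately show ?thesis unfolding bose_def by (intro divide_left_mono) auto
qed

text \<open>Iterating \<open>cone_sum_step\<close> leaves a remainder cone with sign (-1)^n. It is
  bounded by the bose product of the full quadrant, hence by a multiple of 1 / \<open>Q n\<close>
  for fixed t.\<close>

lemma bose_series_sums_cone:
  assumes "0 < t"
  shows "(\<lambda>k. (-1) ^ k * (bose (Q k * t) * bose (Q (Suc k) * t))) sums cone_sum (Q 0 * t) (Q 1 * t) (\<theta> 2)"
proof -
  define S where "S = (\<lambda>k. cone_sum (Q k * t) (Q (Suc k) * t) (\<theta> (k + 2)))"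
  have part: "(\<Sum>k<n. (-1) ^ k * (bose (Q k * t) * bose (Q (Suc k) * t))) = S 0 - (-1) ^ n * S n" for n
  proof (induction n)
    case (Suc n)
    have "bose (Q n * t) * bose (Q (Suc n) * t) = S n + S (Suc n)" using cone_sum_step[OF assms, of n] by (simp add: S_def)
    with Suc show ?case by (simp add: algebra_simps)
  qed simp
  have "S \<longlonglongrightarrow> 0"
  proof (rule Lim_null_comparison[OF always_eventually], rule allI)
    fix k
    have "S k \<le> bose (Q k * t) * bose (Q (Suc k) * t)"
      unfolding S_def using assms Q_pos by (intro cone_sum_le) auto
    also have "\<dots> \<le> 1 / (Q k * t) * (1 / (Q (Suc k) * t))"
      using assms Q_pos by (intro mult_mono bose_Q_le less_imp_le[OF bose_pos]) (auto simp: less_imp_le)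
    also have "\<dots> \<le> 1 / (Q k * t) * (1 / (1 * t))"
      using assms Q_pos[of k] Q_ge_1[of "Suc k"] by (intro mult_left_mono divide_left_mono mult_right_mono) auto
    finally show "norm (S k) \<le> 1 / Q k * (1 / t * (1 / t))"
      using cone_sum_nonneg by (simp add: S_def)
    show "(\<lambda>k. 1 / Q k * (1 / t * (1 / t))) \<longlonglongrightarrow> 0"
      using tendsto_mult_right[OF summable_LIMSEQ_zero[OF summable_inverse_Q], of "1 / t * (1 / t)"] by simp
  qed
  then have "(\<lambda>n. (-1) ^ n * S n) \<longlonglongrightarrow> 0"
    by (rule tendsto_rabs_zero_cancel[OF Lim_transform_eventually[OF tendsto_rabs_zero]]) (simp add: abs_mult power_abs)
  then have "(\<lambda>n. S 0 - (-1) ^ n * S n) \<longlonglongrightarrow> S 0 - 0" by (intro tendsto_intros)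
  then show ?thesis by (simp add: sums_def part S_def numeral_2_eq_2)
qed

text \<open>floor(\<beta> n) counts the j >= 1 with \<open>\<theta> 1\<close> j < n, equality being
  excluded by irrationality. Writing n = i + \<open>a 1\<close> j turns the pairs (n, j) into the
  lattice points of the first cone, where exp(-n t) has the weights \<open>Q 0 = 1\<close> and
  \<open>Q 1 = a 1\<close>.\<close>

lemma floor_series_has_sum_cone:
  assumes "0 < t"
  shows "((\<lambda>n::nat. of_int \<lfloor>frac \<alpha> * n\<rfloor> * exp (- (real n * t))) has_sum cone_sum (Q 0 * t) (Q 1 * t) (\<theta> 2)) {1..}"
proof -
  define N where "N = nat (a 1)"
  have N: "real N = a 1" using a_ge_1[of 0] by (simp add: N_def)
  define B where "B = (\<lambda>n::nat. {1..nat \<lfloor>frac \<alpha> * n\<rfloor>})"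
  have fr: "0 < frac \<alpha>" using frac_irrational_pos[OF irr] .
  have th1: "\<theta> 1 = 1 / frac \<alpha>" by (simp add: complete_quotient.simps)
  have th2: "\<theta> 2 = 1 / (\<theta> 1 - N)" by (simp add: theta_Suc N numeral_2_eq_2)
  have d: "0 < \<theta> 1 - N" using theta_diff_pos[of 1] by (simp add: N)
  have memB: "j \<in> B n \<longleftrightarrow> 1 \<le> j \<and> \<theta> 1 * real j < real n" for n j :: nat
  proof -
    have "real j \<noteq> frac \<alpha> * real n" if "1 \<le> j"
    proof
      assume e: "real j = frac \<alpha> * real n"
      with that have "n \<noteq> 0" by (intro notI) auto
      then have "frac \<alpha> = real j / real n" using e by (simp add: field_simps)
      then show False using frac_irrational[OF irr] by simp
    qed
    then have "1 \<le> j \<Longrightarrow> real j \<le> frac \<alpha> * real n \<longleftrightarrow> real j < frac \<alpha> * real n" by (auto simp: order_le_less)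
    moreover have "j \<le> nat \<lfloor>frac \<alpha> * n\<rfloor> \<longleftrightarrow> real j \<le> frac \<alpha> * real n" if "1 \<le> j"
    proof -
      have "j \<le> nat \<lfloor>frac \<alpha> * n\<rfloor> \<longleftrightarrow> int j \<le> \<lfloor>frac \<alpha> * n\<rfloor>" using that by (simp add: le_nat_iff)
      then show ?thesis by (simp add: le_floor_iff)
    qed
    ultimately show ?thesis unfolding B_def th1 using fr by (auto simp: field_simps)
  qed
  have "((\<lambda>(i::nat,j::nat). exp (- (real i * (Q 0 * t) + real j * (Q 1 * t)))) has_sum cone_sum (Q 0 * t) (Q 1 * t) (\<theta> 2))
     {(i,j). 1 \<le> i \<and> 1 \<le> j \<and> real j < \<theta> 2 * real i}"
    unfolding cone_sum_def using assms Q_pos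
    by (intro has_sum_infsum cone_summable) auto
  also have "?this \<longleftrightarrow> ((\<lambda>(n,j). exp (- (real n * t))) has_sum cone_sum (Q 0 * t) (Q 1 * t) (\<theta> 2)) (Sigma {1..} B)"
  proof (rule has_sum_reindex_bij_witness[of _ "\<lambda>(n,j). (n - N * j, j)" "\<lambda>(i,j). (i + N * j, j)"])
    fix p assume "p \<in> {(i::nat,j::nat). 1 \<le> i \<and> 1 \<le> j \<and> real j < \<theta> 2 * real i}"
    then obtain i j where p: "p = (i,j)" "1 \<le> i" "1 \<le> j" "real j < \<theta> 2 * real i" by auto
    show "(case (case p of (i,j) \<Rightarrow> (i + N * j, j)) of (n,j) \<Rightarrow> (n - N * j, j)) = p" using p by simp
    have "\<theta> 1 * real j < real (i + N * j)" using p d by (simp add: th2 field_simps)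
    then show "(case p of (i,j) \<Rightarrow> (i + N * j, j)) \<in> Sigma {1..} B" using p by (simp add: memB)
    show "(case case p of (i,j) \<Rightarrow> (i + N * j, j) of (n, j) \<Rightarrow> exp (- (real n * t))) =
         (case p of (i, j) \<Rightarrow> exp (- (real i * (Q 0 * t) + real j * (Q 1 * t))))"
      using p N by (simp add: Q_0 Q_1 algebra_simps)
  next
    fix p assume "p \<in> Sigma {1..} B"
    then obtain n j where p: "p = (n,j)" "1 \<le> n" "1 \<le> j" "\<theta> 1 * real j < real n" by (auto simp: memB)
    have "real N * real j \<le> \<theta> 1 * real j" using d by (intro mult_right_mono) auto
    then have lt: "N * j < n" using p(4) by (metis of_nat_less_iff of_nat_mult order_le_less_trans)
    show "(case (case p of (n,j) \<Rightarrow> (n - N * j, j)) of (i,j) \<Rightarrow> (i + N * j, j)) = p" using p lt by simp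
    have "real j < \<theta> 2 * real (n - N * j)" using p d lt by (simp add: th2 field_simps of_nat_diff)
    then show "(case p of (n,j) \<Rightarrow> (n - N * j, j)) \<in> {(i,j). 1 \<le> i \<and> 1 \<le> j \<and> real j < \<theta> 2 * real i}"
      using p lt by simp
  qed auto
  finally have *: "((\<lambda>(n,j). exp (- (real n * t))) has_sum cone_sum (Q 0 * t) (Q 1 * t) (\<theta> 2)) (Sigma {1..} B)" .
  show ?thesis
  proof (rule has_sum_Sigma'[OF *])
    fix n :: nat
    have "((\<lambda>j. exp (- (real n * t))) has_sum (\<Sum>j\<in>B n. exp (- (real n * t)))) (B n)"
      by (rule has_sum_finite) (simp add: B_def)
    then show "((\<lambda>j. case (n, j) of (n,j) \<Rightarrow> exp (- (real n * t))) has_sum of_int \<lfloor>frac \<alpha> * n\<rfloor> * exp (- (real n * t))) (B n)"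
      using fr by (simp add: B_def)
  qed
qed

end

section \<open>Mellin transforms\<close>

text \<open>Dominated convergence for difference quotients, where only \<open>F\<close> itself has
  to be dominated locally. The measure is arbitrary: the lemma is used for Mellin integrals, for
  loops, for Cauchy's coefficient formula and, with counting measure, for series.\<close>

lemma holomorphic_on_integral:
  fixes F :: "complex \<Rightarrow> 'a \<Rightarrow> complex"
  assumes "open U"
    and meas: "\<And>s. s \<in> U \<Longrightarrow> F s \<in> borel_measurable M"
    and hol: "\<And>x. x \<in> space M \<Longrightarrow> (\<lambda>s. F s x) holomorphic_on U"
    and dom: "\<And>s0. s0 \<in> U \<Longrightarrow> \<exists>r>0. \<exists>w. integrable M w \<and> (\<forall>s\<in>ball s0 r \<inter> U. \<forall>x\<in>space M. norm (F s x) \<le> w x)"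
  shows "(\<lambda>s. LINT x|M. F s x) holomorphic_on U"
proof -
  have "\<exists>D. ((\<lambda>s. LINT x|M. F s x) has_field_derivative D) (at s0)" if "s0 \<in> U" for s0
  proof -
    from dom[OF that] obtain r1 w where r1: "0 < r1" and w: "integrable M w"
      and bd1: "\<And>s x. s \<in> ball s0 r1 \<inter> U \<Longrightarrow> x \<in> space M \<Longrightarrow> norm (F s x) \<le> w x" by blast
    from \<open>open U\<close> that obtain r2 where r2: "0 < r2" "ball s0 r2 \<subseteq> U" by (meson openE)
    define r where "r = min r1 r2"
    have r: "0 < r" "ball s0 r \<subseteq> U" using r1 r2 by (auto simp: r_def)
    have bd: "norm (F s x) \<le> w x" if "s \<in> ball s0 r" "x \<in> space M" for s x
      using that bd1 r by (auto simp: r_def)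
    have int: "integrable M (F s)" if "s \<in> ball s0 r" for s
    proof (rule Bochner_Integration.integrable_bound[OF w])
      show "F s \<in> borel_measurable M" using that r by (intro meas) auto
      show "AE x in M. norm (F s x) \<le> norm (w x)"
        using bd[OF that] by (intro AE_I2) (metis abs_ge_self order_trans real_norm_def)
    qed
    have w0: "0 \<le> w x" if "x \<in> space M" for x
      using bd[of s0 x] that r norm_ge_zero order_trans by (metis centre_in_ball)
    define D where "D = (\<lambda>x. deriv (\<lambda>s. F s x) s0)"
    define q where "q = (\<lambda>h x. (F (s0 + h) x - F s0 x) / h)"
    \<comment> \<open>A disc of radius r/4 about a point of \<open>ball s0 (r/2)\<close> stays in
      \<open>ball s0 r\<close>, so Cauchy's inequality bounds the derivative by 4/r times
      \<open>w\<close>; this is then a Lipschitz constant on the convex half-size ball.\<close>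
    have lip: "norm (q h x) \<le> 4 / r * w x" if h: "h \<in> ball 0 (r/2) - {0}" and x: "x \<in> space M" for h x
    proof -
      have holr: "(\<lambda>s. F s x) holomorphic_on ball s0 r" using hol[OF x] r holomorphic_on_subset by blast
      have "norm (F (s0 + h) x - F s0 x) \<le> (4 / r * w x) * norm ((s0 + h) - s0)"
      proof (rule field_differentiable_bound[where S = "ball s0 (r/2)" and f' = "\<lambda>s. deriv (\<lambda>s. F s x) s"])
        fix s assume s: "s \<in> ball s0 (r/2)"
        then have "s \<in> ball s0 r" using r by auto
        then show "((\<lambda>s. F s x) has_field_derivative deriv (\<lambda>s. F s x) s) (at s within ball s0 (r/2))"
          using holr by (meson DERIV_subset holomorphic_derivI open_ball subset_UNIV)
        have sub: "cball s (r/4) \<subseteq> ball s0 r"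
        proof
          fix y assume "y \<in> cball s (r/4)"
          then show "y \<in> ball s0 r" using s r dist_triangle[of s0 y s] by (auto simp: dist_commute)
        qed
        have "norm ((deriv ^^ 1) (\<lambda>s. F s x) s) \<le> fact 1 * w x / (r/4) ^ 1"
        proof (rule Cauchy_inequality)
          show "(\<lambda>s. F s x) holomorphic_on ball s (r/4)"
            using sub holr by (meson ball_subset_cball holomorphic_on_subset order_trans)
          show "continuous_on (cball s (r/4)) (\<lambda>s. F s x)"
            using sub holr by (meson holomorphic_on_imp_continuous_on holomorphic_on_subset)
          show "norm (F y x) \<le> w x" if "norm (s - y) = r/4" for y
          proof -
            have "y \<in> cball s (r/4)" using that by (simp add: dist_norm)
            then show ?thesis using sub x by (meson bd subsetD)
          qed
        qed (use r in auto)
        then show "norm (deriv (\<lambda>s. F s x) s) \<le> 4 / r * w x" by (simp add: field_simps)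
      qed (use h r in \<open>auto simp: dist_norm\<close>)
      then show ?thesis using h by (simp add: q_def norm_divide field_simps)
    qed
    have lim: "((\<lambda>h. q h x) \<longlongrightarrow> D x) (at 0)" if x: "x \<in> space M" for x
    proof -
      have "((\<lambda>s. F s x) has_field_derivative D x) (at s0)"
        unfolding D_def using hol[OF x] \<open>open U\<close> \<open>s0 \<in> U\<close> by (rule holomorphic_derivI)
      then show ?thesis by (simp add: DERIV_def q_def)
    qed
    have main: "((\<lambda>h. LINT x|M. q h x) \<longlongrightarrow> (LINT x|M. D x)) (at 0 within (ball 0 (r/2)))"
      unfolding tendsto_at_iff_sequentially comp_def
    proof (intro allI impI)
      fix X :: "nat \<Rightarrow> complex" assume X: "\<forall>i. X i \<in> ball 0 (r/2) - {0}" "X \<longlonglongrightarrow> 0"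
      have X': "s0 + X i \<in> U" for i using X(1) r(1) by (intro subsetD[OF r(2)]) (auto simp: dist_norm norm_minus_commute dest!: spec[of _ i])
      have Xlim: "(\<lambda>i. q (X i) x) \<longlonglongrightarrow> D x" if "x \<in> space M" for x
        using tendsto_at_iff_sequentially[THEN iffD1, OF lim[OF that]] X by (auto simp: comp_def)
      have mq: "q (X i) \<in> borel_measurable M" for i
        unfolding q_def using meas[OF X'] meas[OF \<open>s0 \<in> U\<close>] by measurable
      show "(\<lambda>i. LINT x|M. q (X i) x) \<longlonglongrightarrow> (LINT x|M. D x)"
      proof (rule integral_dominated_convergence[where w = "\<lambda>x. 4 / r * w x"])
        show "D \<in> borel_measurable M" by (rule borel_measurable_LIMSEQ_metric[OF mq Xlim])
      qed (use w lip Xlim X mq in auto)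
    qed
    then have "((\<lambda>h. LINT x|M. q h x) \<longlongrightarrow> (LINT x|M. D x)) (at 0)"
      using r by (subst (asm) at_within_open) auto
    moreover have "eventually (\<lambda>h. (LINT x|M. q h x) = ((LINT x|M. F (s0 + h) x) - (LINT x|M. F s0 x)) / h) (at 0)"
      unfolding eventually_at
    proof (intro exI[of _ r] conjI ballI impI r)
      fix h :: complex assume "h \<noteq> 0 \<and> dist h 0 < r"
      then have "s0 + h \<in> ball s0 r" "s0 \<in> ball s0 r" using r by (auto simp: dist_norm)
      then show "(LINT x|M. q h x) = ((LINT x|M. F (s0 + h) x) - (LINT x|M. F s0 x)) / h"
        unfolding q_def using int by simp
    qed
    ultimately have "((\<lambda>h. ((LINT x|M. F (s0 + h) x) - (LINT x|M. F s0 x)) / h) \<longlongrightarrow> (LINT x|M. D x)) (at 0)"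
      by (rule Lim_transform_eventually)
    then show ?thesis by (auto simp: DERIV_def)
  qed
  then show ?thesis using \<open>open U\<close> by (auto simp: holomorphic_on_open)
qed

text \<open>The domain is a parameter because the parts near 0 and near infinity are continued by
  different means: the latter is entire, the former is limited by the behaviour of \<open>f\<close>
  at 0.\<close>

definition mellin :: "real set \<Rightarrow> (real \<Rightarrow> complex) \<Rightarrow> complex \<Rightarrow> complex" where
  "mellin S f s = (LINT t:S|lborel. of_real t powr (s - 1) * f t)"

lemma set_integrable_lborel_nonneg:
  fixes f :: "real \<Rightarrow> real"
  assumes "f integrable_on S" "\<And>x. x \<in> S \<Longrightarrow> 0 \<le> f x" "f \<in> borel_measurable borel" "S \<in> sets borel"
  shows "set_integrable lborel S f"
proof -
  have "f absolutely_integrable_on S" using assms by (intro nonnegative_absolutely_integrable_1) auto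
  then show ?thesis using assms unfolding set_integrable_def by (subst (asm) integrable_completion) auto
qed

lemma set_integrable_powr_0:
  assumes "0 < a" "0 \<le> r"
  shows "set_integrable lborel {0<..r} (\<lambda>t::real. t powr (a - 1))"
proof (rule set_integrable_lborel_nonneg)
  have "(\<lambda>t. t powr (a - 1)) integrable_on {0..r}" using assms by (intro integrable_on_powr_from_0) auto
  then show "(\<lambda>t. t powr (a - 1)) integrable_on {0<..r}"
    by (rule integrable_spike_set) (rule negligible_subset[OF negligible_sing[of 0]], force)+
qed auto

lemma set_integrable_powr_exp:
  assumes "0 < c" "0 < r"
  shows "set_integrable lborel {r<..} (\<lambda>t::real. t powr a * exp (- (c * t)))"
proof -
  \<comment> \<open>The exponent is raised to one for which the Gamma integral converges at 0 as
    well. As a - (b - 1) is at most 0, the missing power of t is bounded on t > r by its value at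
    r.\<close>
  define b where "b = max 1 (a + 1)"
  have "(\<lambda>t. complex_of_real t powr (of_real b - 1) / of_real (exp (c * t))) absolutely_integrable_on {0<..}"
    using assms by (intro absolutely_integrable_Gamma_integral) (auto simp: b_def)
  then have "(\<lambda>t. norm (complex_of_real t powr (of_real b - 1) / of_real (exp (c * t)))) integrable_on {0<..}"
    by (simp add: absolutely_integrable_on_def)
  also have "?this \<longleftrightarrow> (\<lambda>t. t powr (b - 1) * exp (- (c * t))) integrable_on {0<..}"
    by (rule integrable_cong) (auto simp: norm_divide norm_mult norm_powr_real_powr exp_minus field_simps)
  finally have "set_integrable lborel {0<..} (\<lambda>t. t powr (b - 1) * exp (- (c * t)))"
    by (intro set_integrable_lborel_nonneg) auto
  then have "set_integrable lborel {r<..} (\<lambda>t. t powr (b - 1) * exp (- (c * t)))"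
    by (rule set_integrable_subset) (use assms in auto)
  then have *: "set_integrable lborel {r<..} (\<lambda>t. r powr (a - (b - 1)) * (t powr (b - 1) * exp (- (c * t))))"
    by (rule set_integrable_mult_right)
  show ?thesis
  proof (rule set_integrable_bound[OF *])
    show "set_borel_measurable lborel {r<..} (\<lambda>t. t powr a * exp (- (c * t)))"
      unfolding set_borel_measurable_def by measurable
    show "AE t in lborel. t \<in> {r<..} \<longrightarrow> norm (t powr a * exp (- (c * t))) \<le> norm (r powr (a - (b - 1)) * (t powr (b - 1) * exp (- (c * t))))"
    proof (intro AE_I2 impI)
      fix t assume "t \<in> {r<..}"
      then have t: "r < t" by simp
      have "t powr a = t powr (a - (b - 1)) * t powr (b - 1)" using t assms by (simp flip: powr_add)
      also have "\<dots> \<le> r powr (a - (b - 1)) * t powr (b - 1)"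
        using t assms by (intro mult_right_mono powr_mono2') (auto simp: b_def)
      finally show "norm (t powr a * exp (- (c * t))) \<le> norm (r powr (a - (b - 1)) * (t powr (b - 1) * exp (- (c * t))))"
        by simp
    qed
  qed
qed

definition mellin_conv :: "real set \<Rightarrow> (real \<Rightarrow> complex) \<Rightarrow> complex \<Rightarrow> bool" where
  "mellin_conv S f s \<longleftrightarrow> set_integrable lborel S (\<lambda>t. of_real t powr (s - 1) * f t)"

lemma norm_of_real_powr: "0 < t \<Longrightarrow> norm (complex_of_real t powr s) = t powr Re s"
  by (simp add: norm_powr_real_powr)

text \<open>One integrable majorant for a whole vertical strip: the left edge controls t < 1, the
  right edge t >= 1.\<close>

lemma powr_le_sum:
  assumes "0 < t" "a \<le> x" "x \<le> b"
  shows "t powr x \<le> t powr a + t powr (b::real)"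
proof (cases "1 \<le> t")
  case True
  then have "t powr x \<le> t powr b" using assms by (intro powr_mono) auto
  then show ?thesis by (smt (verit) powr_ge_zero)
next
  case False
  then have "t powr x \<le> t powr a" using assms by (intro powr_mono') auto
  then show ?thesis by (smt (verit) powr_ge_zero)
qed

lemma mellin_conv_dominated:
  assumes S: "S \<subseteq> {0<..}" "S \<in> sets borel" and f: "f \<in> borel_measurable borel"
    and le: "\<And>t. t \<in> S \<Longrightarrow> norm (f t) \<le> g t"
    and g: "set_integrable lborel S (\<lambda>t. t powr (Re s - 1) * g t)"
  shows "mellin_conv S f s"
  unfolding mellin_conv_def
proof (rule set_integrable_bound[OF g])
  show "set_borel_measurable lborel S (\<lambda>t. complex_of_real t powr (s - 1) * f t)"
    using S f unfolding set_borel_measurable_def by measurable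
  show "AE t in lborel. t \<in> S \<longrightarrow> norm (complex_of_real t powr (s - 1) * f t) \<le> norm (t powr (Re s - 1) * g t)"
  proof (intro AE_I2 impI)
    fix t assume "t \<in> S"
    then have "0 < t" "norm (f t) \<le> g t" using S le by auto
    then have "norm (complex_of_real t powr (s - 1) * f t) \<le> t powr (Re s - 1) * g t"
      by (simp add: norm_mult norm_of_real_powr mult_left_mono)
    then show "norm (complex_of_real t powr (s - 1) * f t) \<le> norm (t powr (Re s - 1) * g t)"
      by (metis abs_ge_self order_trans real_norm_def)
  qed
qed

lemma mellin_norm_le:
  assumes S: "S \<subseteq> {0<..}" "S \<in> sets borel" and f: "f \<in> borel_measurable borel"
    and le: "\<And>t. t \<in> S \<Longrightarrow> norm (f t) \<le> g t"
    and g: "set_integrable lborel S (\<lambda>t. t powr (lo - 1) * g t)" "set_integrable lborel S (\<lambda>t. t powr (hi - 1) * g t)"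
    and s: "lo \<le> Re s" "Re s \<le> hi"
  shows "norm (mellin S f s) \<le> (LINT t:S|lborel. t powr (lo - 1) * g t) + (LINT t:S|lborel. t powr (hi - 1) * g t)"
proof -
  have int: "set_integrable lborel S (\<lambda>t. t powr (lo - 1) * g t + t powr (hi - 1) * g t)"
    using g by (rule set_integral_add)
  have "norm (mellin S f s) \<le> (LINT t|lborel. indicator S t *\<^sub>R (t powr (lo - 1) * g t + t powr (hi - 1) * g t))"
    unfolding mellin_def set_lebesgue_integral_def
  proof (rule Bochner_Integration.integral_norm_bound_integral)
    show "integrable lborel (\<lambda>t. indicator S t *\<^sub>R (t powr (lo - 1) * g t + t powr (hi - 1) * g t))"
      using int by (simp add: set_integrable_def)
    fix t
    show "norm (indicator S t *\<^sub>R (complex_of_real t powr (s - 1) * f t))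
          \<le> indicator S t *\<^sub>R (t powr (lo - 1) * g t + t powr (hi - 1) * g t)"
    proof (cases "t \<in> S")
      case True
      then have t: "0 < t" "norm (f t) \<le> g t" using S le by auto
      have "t powr (Re s - 1) * norm (f t) \<le> (t powr (lo - 1) + t powr (hi - 1)) * g t"
        using t s by (intro mult_mono powr_le_sum) auto
      then show ?thesis using True t by (simp add: norm_mult norm_of_real_powr algebra_simps)
    qed auto
  next
    have "set_integrable lborel S (\<lambda>t. of_real t powr (s - 1) * f t)"
    proof (rule set_integrable_bound[OF int])
      show "set_borel_measurable lborel S (\<lambda>t. complex_of_real t powr (s - 1) * f t)"
        using S f unfolding set_borel_measurable_def by measurable
      show "AE t in lborel. t \<in> S \<longrightarrow> norm (complex_of_real t powr (s - 1) * f t) \<le> norm (t powr (lo - 1) * g t + t powr (hi - 1) * g t)"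
      proof (intro AE_I2 impI)
        fix t assume "t \<in> S"
        then have t: "0 < t" "norm (f t) \<le> g t" using S le by auto
        have "t powr (Re s - 1) * norm (f t) \<le> (t powr (lo - 1) + t powr (hi - 1)) * g t"
          using t s by (intro mult_mono powr_le_sum) auto
        then show "norm (complex_of_real t powr (s - 1) * f t) \<le> norm (t powr (lo - 1) * g t + t powr (hi - 1) * g t)"
          using t by (simp add: norm_mult norm_of_real_powr algebra_simps)
      qed
    qed
    then show "integrable lborel (\<lambda>t. indicator S t *\<^sub>R (complex_of_real t powr (s - 1) * f t))"
      by (simp add: set_integrable_def)
  qed
  then show ?thesis using set_integral_add(2)[OF g] by (simp add: set_lebesgue_integral_def)
qed

lemma mellin_holomorphic:
  assumes S: "S \<subseteq> {0<..}" "S \<in> sets borel" and f: "f \<in> borel_measurable borel"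
    and le: "\<And>t. t \<in> S \<Longrightarrow> norm (f t) \<le> g t"
    and g: "\<And>\<sigma>. \<sigma> \<in> I \<Longrightarrow> set_integrable lborel S (\<lambda>t. t powr (\<sigma> - 1) * g t)"
    and I: "open I"
  shows "mellin S f holomorphic_on {s. Re s \<in> I}"
  unfolding mellin_def set_lebesgue_integral_def
proof (rule holomorphic_on_integral)
  show "open {s. Re s \<in> I}" using open_vimage[OF I, of Re] by (simp add: vimage_def continuous_on_Re)
  show "(\<lambda>t. indicator S t *\<^sub>R (complex_of_real t powr (s - 1) * f t)) \<in> borel_measurable lborel" for s
    using S f by measurable
  show "(\<lambda>s. indicator S t *\<^sub>R (complex_of_real t powr (s - 1) * f t)) holomorphic_on {s. Re s \<in> I}" for t
    by (intro holomorphic_intros)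
  fix s0 assume "s0 \<in> {s. Re s \<in> I}"
  then obtain e where e: "0 < e" "ball (Re s0) e \<subseteq> I" using I by (auto elim: openE)
  define a b where "a = Re s0 - e/2" and "b = Re s0 + e/2"
  have ab: "a \<in> I" "b \<in> I" using e by (auto simp: a_def b_def dist_real_def intro!: subsetD[OF e(2)])
  define w where "w = (\<lambda>t. indicator S t *\<^sub>R (t powr (a - 1) * g t + t powr (b - 1) * g t))"
  have "integrable lborel w" using set_integral_add(1)[OF g[OF ab(1)] g[OF ab(2)]] by (simp add: w_def set_integrable_def)
  moreover have "norm (indicator S t *\<^sub>R (complex_of_real t powr (s - 1) * f t)) \<le> w t"
    if "s \<in> ball s0 (e/2)" for s t
  proof (cases "t \<in> S")
    case True
    then have t: "0 < t" "norm (f t) \<le> g t" using S le by auto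
    have "\<bar>Re s - Re s0\<bar> < e / 2" using that abs_Re_le_cmod[of "s - s0"] by (auto simp: dist_norm norm_minus_commute)
    then have "a \<le> Re s" "Re s \<le> b" unfolding a_def b_def by linarith+
    then have "t powr (Re s - 1) * norm (f t) \<le> (t powr (a - 1) + t powr (b - 1)) * g t"
      using t by (intro mult_mono powr_le_sum) auto
    then show ?thesis using True t by (simp add: w_def norm_mult norm_of_real_powr algebra_simps)
  qed (simp add: w_def)
  ultimately show "\<exists>r>0. \<exists>w. integrable lborel w \<and> (\<forall>s\<in>ball s0 r \<inter> {s. Re s \<in> I}. \<forall>t\<in>space lborel.
      norm (indicator S t *\<^sub>R (complex_of_real t powr (s - 1) * f t)) \<le> w t)"
    using e by (intro exI[of _ "e/2"] conjI exI[of _ w]) auto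
qed

lemma set_integrable_near_0:
  assumes "- a < \<sigma>" "0 < r"
  shows "set_integrable lborel {0<..r} (\<lambda>t::real. t powr (\<sigma> - 1) * (C * t powr a))"
proof -
  have "set_integrable lborel {0<..r} (\<lambda>t::real. C * t powr ((\<sigma> + a) - 1))"
    by (intro set_integrable_mult_right set_integrable_powr_0) (use assms in auto)
  moreover have "C * t powr (\<sigma> + a - 1) = t powr (\<sigma> - 1) * (C * t powr a)" for t
    by (simp add: powr_add[symmetric] algebra_simps)
  ultimately show ?thesis by simp
qed

lemma mellin_conv_near_0:
  assumes "f \<in> borel_measurable borel" "\<And>t. 0 < t \<Longrightarrow> t \<le> r \<Longrightarrow> norm (f t) \<le> C * t powr a"
    and "- a < Re s" "0 < r"
  shows "mellin_conv {0<..r} f s"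
  by (rule mellin_conv_dominated[where g = "\<lambda>t. C * t powr a"])
    (use assms set_integrable_near_0 in auto)

lemma mellin_near_0_holomorphic:
  assumes "f \<in> borel_measurable borel" "\<And>t. 0 < t \<Longrightarrow> t \<le> r \<Longrightarrow> norm (f t) \<le> C * t powr a" "0 < r"
  shows "mellin {0<..r} f holomorphic_on {s. - a < Re s}"
proof -
  have "mellin {0<..r} f holomorphic_on {s. Re s \<in> {-a<..}}"
    by (rule mellin_holomorphic[where g = "\<lambda>t. C * t powr a"])
      (use assms in \<open>auto intro!: set_integrable_near_0\<close>)
  then show ?thesis by simp
qed

lemma set_integrable_at_infinity:
  assumes "0 < c" "0 < r"
  shows "set_integrable lborel {r<..} (\<lambda>t::real. t powr (\<sigma> - 1) * (C * exp (- (c * t))))"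
  using set_integrable_mult_right[OF set_integrable_powr_exp[OF assms, of "\<sigma> - 1"], of C]
  by (simp add: mult.left_commute)

lemma mellin_conv_at_infinity:
  assumes "f \<in> borel_measurable borel" "\<And>t. r < t \<Longrightarrow> norm (f t) \<le> C * exp (- (c * t))" "0 < c" "0 < r"
  shows "mellin_conv {r<..} f s"
  by (rule mellin_conv_dominated[where g = "\<lambda>t. C * exp (- (c * t))"])
    (use assms set_integrable_at_infinity in auto)

lemma mellin_at_infinity_holomorphic:
  assumes "f \<in> borel_measurable borel" "\<And>t. r < t \<Longrightarrow> norm (f t) \<le> C * exp (- (c * t))" "0 < c" "0 < r"
  shows "mellin {r<..} f holomorphic_on A"
proof -
  have "mellin {r<..} f holomorphic_on {s. Re s \<in> UNIV}"
    by (rule mellin_holomorphic[where g = "\<lambda>t. C * exp (- (c * t))"])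
      (use assms in \<open>auto intro!: set_integrable_at_infinity\<close>)
  then show ?thesis by (rule holomorphic_on_subset) auto
qed

lemma mellin_cong: "S \<in> sets borel \<Longrightarrow> (\<And>t. t \<in> S \<Longrightarrow> f t = g t) \<Longrightarrow> mellin S f s = mellin S g s"
  unfolding mellin_def by (intro set_lebesgue_integral_cong) auto

lemma mellin_conv_cong: "S \<in> sets borel \<Longrightarrow> (\<And>t. t \<in> S \<Longrightarrow> f t = g t) \<Longrightarrow> mellin_conv S f s = mellin_conv S g s"
  unfolding mellin_conv_def by (intro set_integrable_cong) auto

lemma mellin_conv_add: "mellin_conv S f s \<Longrightarrow> mellin_conv S g s \<Longrightarrow> mellin_conv S (\<lambda>t. f t + g t) s"
  and mellin_add: "mellin_conv S f s \<Longrightarrow> mellin_conv S g s \<Longrightarrow> mellin S (\<lambda>t. f t + g t) s = mellin S f s + mellin S g s"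
  using set_integral_add[of lborel S "\<lambda>t. of_real t powr (s - 1) * f t" "\<lambda>t. of_real t powr (s - 1) * g t"]
  by (auto simp: mellin_conv_def mellin_def distrib_left)

lemma mellin_conv_cmult: "mellin_conv S f s \<Longrightarrow> mellin_conv S (\<lambda>t. c * f t) s"
  using set_integrable_mult_right[of c lborel S "\<lambda>t. of_real t powr (s - 1) * f t"]
  by (simp add: mellin_conv_def mult.left_commute)

lemma mellin_cmult: "mellin S (\<lambda>t. c * f t) s = c * mellin S f s"
  using set_integral_mult_right[of lborel S c "\<lambda>t. of_real t powr (s - 1) * f t"]
  by (simp add: mellin_def mult.left_commute)

lemma mellin_conv_diff: "mellin_conv S f s \<Longrightarrow> mellin_conv S g s \<Longrightarrow> mellin_conv S (\<lambda>t. f t - g t) s"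
  and mellin_diff: "mellin_conv S f s \<Longrightarrow> mellin_conv S g s \<Longrightarrow> mellin S (\<lambda>t. f t - g t) s = mellin S f s - mellin S g s"
  using mellin_conv_add[of S f s "\<lambda>t. -1 * g t"] mellin_add[of S f s "\<lambda>t. -1 * g t"]
    mellin_conv_cmult[of S g s "-1"] mellin_cmult[of S "-1" g s] by auto

lemma mellin_conv_subset: "mellin_conv S f s \<Longrightarrow> T \<in> sets borel \<Longrightarrow> T \<subseteq> S \<Longrightarrow> mellin_conv T f s"
  unfolding mellin_conv_def by (rule set_integrable_subset) auto

lemma mellin_conv_split:
  assumes "mellin_conv {0<..r} f s" "mellin_conv {r<..} f s" "0 < r"
  shows "mellin_conv {0<..} f s"
proof -
  have "{0<..} = {0<..r} \<union> {r<..}" using assms by auto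
  then show ?thesis using assms set_integrable_Un[of lborel "{0<..r}" _ "{r<..}"] by (simp add: mellin_conv_def)
qed

lemma mellin_split:
  assumes "mellin_conv {0<..} f s" "0 < r"
  shows "mellin {0<..} f s = mellin {0<..r} f s + mellin {r<..} f s"
proof -
  have eq: "{0<..} = {0<..r} \<union> {r<..}" using assms by auto
  have "mellin_conv {0<..r} f s" "mellin_conv {r<..} f s"
    using assms by (auto intro: mellin_conv_subset)
  then show ?thesis unfolding mellin_def mellin_conv_def eq by (intro set_integral_Un) auto
qed

lemma mellin_mult_t:
  assumes "S \<subseteq> {0<..}" "S \<in> sets borel"
  shows "mellin S (\<lambda>t. of_real t * f t) s = mellin S f (s + 1)"
    and "mellin_conv S (\<lambda>t. of_real t * f t) s = mellin_conv S f (s + 1)"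
proof -
  have *: "of_real t powr (s - 1) * (of_real t * f t) = of_real t powr (s + 1 - 1) * f t" if "t \<in> S" for t
  proof -
    have "complex_of_real t \<noteq> 0" using that assms by auto
    then have "of_real t powr (s + 1 - 1) = of_real t powr (s - 1) * complex_of_real t"
      using powr_add[of "complex_of_real t" "s - 1" 1] by simp
    then show ?thesis by simp
  qed
  show "mellin S (\<lambda>t. of_real t * f t) s = mellin S f (s + 1)"
    unfolding mellin_def using assms * by (intro set_lebesgue_integral_cong) auto
  show "mellin_conv S (\<lambda>t. of_real t * f t) s = mellin_conv S f (s + 1)"
    unfolding mellin_conv_def by (rule set_integrable_cong) (use * in auto)
qed

lemma mellin_divide_t:
  assumes "S \<subseteq> {0<..}" "S \<in> sets borel"
  shows "mellin S (\<lambda>t. f t / of_real t) s = mellin S f (s - 1)"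
    and "mellin_conv S (\<lambda>t. f t / of_real t) s = mellin_conv S f (s - 1)"
proof -
  have *: "of_real t * (f t / of_real t) = f t" if "t \<in> S" for t using that assms by auto
  show "mellin S (\<lambda>t. f t / of_real t) s = mellin S f (s - 1)"
    using mellin_mult_t(1)[OF assms, of "\<lambda>t. f t / of_real t" "s - 1"]
      mellin_cong[OF assms(2) *, where s = "s - 1"] by (simp only: diff_add_cancel)
  show "mellin_conv S (\<lambda>t. f t / of_real t) s = mellin_conv S f (s - 1)"
    using mellin_mult_t(2)[OF assms, of "\<lambda>t. f t / of_real t" "s - 1"]
      mellin_conv_cong[OF assms(2) *, where s = "s - 1"] by (simp only: diff_add_cancel)
qed

lemma mellin_one:
  assumes "0 < Re s" "0 < r"
  shows "mellin {0<..r} (\<lambda>_. 1) s = of_real r powr s / s" and "mellin_conv {0<..r} (\<lambda>_. 1) s"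
proof -
  show conv: "mellin_conv {0<..r} (\<lambda>_. 1) s"
    by (rule mellin_conv_near_0[where a = 0 and C = 1]) (use assms in auto)
  have s: "s \<noteq> 0" using assms by auto
  have "((\<lambda>t. of_real t powr (s - 1)) has_integral (of_real r powr s / s - of_real 0 powr s / s)) {0..r}"
  proof (rule fundamental_theorem_of_calculus_interior)
    show "continuous_on {0..r} (\<lambda>t. complex_of_real t powr s / s)"
      using assms s by (intro continuous_intros) auto
    fix t assume "t \<in> {0<..<r}"
    then show "((\<lambda>t. complex_of_real t powr s / s) has_vector_derivative of_real t powr (s - 1)) (at t)"
      using s by (intro has_vector_derivative_real_field) (auto intro!: derivative_eq_intros)
  qed (use assms in auto)
  then have "((\<lambda>t. of_real t powr (s - 1)) has_integral (of_real r powr s / s)) {0..r}" using s by simp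
  then have "((\<lambda>t. of_real t powr (s - 1)) has_integral (of_real r powr s / s)) {0<..r}"
    by (rule has_integral_spike_set_eq[THEN iffD1, rotated 2]) (rule negligible_subset[OF negligible_sing[of 0]], force)+
  moreover have "(LINT t:{0<..r}|lborel. of_real t powr (s - 1)) = integral {0<..r} (\<lambda>t. complex_of_real t powr (s - 1))"
    using conv by (intro set_borel_integral_eq_integral) (simp add: mellin_conv_def)
  ultimately show "mellin {0<..r} (\<lambda>_. 1) s = of_real r powr s / s"
    by (simp add: mellin_def integral_unique)
qed

lemma set_integral_scale:
  fixes h :: "real \<Rightarrow> 'b :: {banach, second_countable_topology}"
  assumes "0 < c"
  shows "(LINT t:{0<..}|lborel. h t) = c *\<^sub>R (LINT t:{0<..}|lborel. h (c * t))"
    and "set_integrable lborel {0<..} (\<lambda>t. h (c * t)) \<longleftrightarrow> set_integrable lborel {0<..} h"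
proof -
  have ind: "indicator {0<..} (c * t) = (indicator {0<..} t :: real)" for t
    using assms by (auto simp: indicator_def zero_less_mult_iff)
  show "(LINT t:{0<..}|lborel. h t) = c *\<^sub>R (LINT t:{0<..}|lborel. h (c * t))"
    unfolding set_lebesgue_integral_def using assms
    by (subst lborel_integral_real_affine[where c = c and t = 0]) (auto simp: ind)
  show "set_integrable lborel {0<..} (\<lambda>t. h (c * t)) \<longleftrightarrow> set_integrable lborel {0<..} h"
    unfolding set_integrable_def using assms
    by (subst lborel_integrable_real_affine_iff[where c = c and t = 0, symmetric]) (auto simp: ind)
qed

lemma mellin_scale:
  assumes "0 < c"
  shows "mellin {0<..} (\<lambda>t. f (c * t)) s = of_real c powr (- s) * mellin {0<..} f s"
    and "mellin_conv {0<..} (\<lambda>t. f (c * t)) s \<longleftrightarrow> mellin_conv {0<..} f s"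
proof -
  define h where "h = (\<lambda>t. complex_of_real t powr (s - 1) * f t)"
  have h: "complex_of_real t powr (s - 1) * f (c * t) = of_real c powr (1 - s) * h (c * t)" if "t \<in> {0<..}" for t
  proof -
    have "complex_of_real (c * t) powr (s - 1) = of_real c powr (s - 1) * of_real t powr (s - 1)"
      using that assms by (simp add: powr_times_real)
    moreover have "complex_of_real c powr (1 - s) * of_real c powr (s - 1) = 1"
      using assms by (simp flip: powr_add)
    ultimately show ?thesis by (simp add: h_def)
  qed
  have c: "complex_of_real c \<noteq> 0" using assms by simp
  have "mellin {0<..} (\<lambda>t. f (c * t)) s = (LINT t:{0<..}|lborel. of_real c powr (1 - s) * h (c * t))"
    unfolding mellin_def using h by (intro set_lebesgue_integral_cong) auto
  also have "\<dots> = of_real c powr (1 - s) * (LINT t:{0<..}|lborel. h (c * t))" by simp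
  also have "(LINT t:{0<..}|lborel. h (c * t)) = (1 / c) *\<^sub>R mellin {0<..} f s"
    using set_integral_scale(1)[OF assms, of h] assms by (simp add: mellin_def h_def)
  also have "of_real c powr (1 - s) * ((1 / c) *\<^sub>R mellin {0<..} f s) = of_real c powr (- s) * mellin {0<..} f s"
    using powr_add[of "complex_of_real c" "-s" 1] c by (simp add: scaleR_conv_of_real)
  finally show "mellin {0<..} (\<lambda>t. f (c * t)) s = of_real c powr (- s) * mellin {0<..} f s" .
  have "mellin_conv {0<..} (\<lambda>t. f (c * t)) s \<longleftrightarrow> set_integrable lborel {0<..} (\<lambda>t. of_real c powr (1 - s) * h (c * t))"
    unfolding mellin_conv_def using h by (intro set_integrable_cong) auto
  also have "\<dots> \<longleftrightarrow> set_integrable lborel {0<..} (\<lambda>t. h (c * t))" using c by simp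
  also have "\<dots> \<longleftrightarrow> mellin_conv {0<..} f s" unfolding set_integral_scale(2)[OF assms] by (simp add: mellin_conv_def h_def)
  finally show "mellin_conv {0<..} (\<lambda>t. f (c * t)) s \<longleftrightarrow> mellin_conv {0<..} f s" .
qed

lemma mellin_exp:
  assumes "0 < Re s" "0 < c"
  shows "mellin {0<..} (\<lambda>t. of_real (exp (- (c * t)))) s = Gamma s * of_real c powr (- s)"
    and "mellin_conv {0<..} (\<lambda>t. of_real (exp (- (c * t)))) s"
proof -
  have 1: "mellin_conv {0<..} (\<lambda>t. of_real (exp (- t))) s"
  proof (rule mellin_conv_split[where r = 1])
    show "mellin_conv {0<..1} (\<lambda>t. of_real (exp (- t))) s"
      by (rule mellin_conv_near_0[where a = 0 and C = 1]) (use assms in auto)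
    show "mellin_conv {1<..} (\<lambda>t. of_real (exp (- t))) s"
      by (rule mellin_conv_at_infinity[where c = 1 and C = 1]) auto
  qed simp
  have "mellin {0<..} (\<lambda>t. of_real (exp (- t))) s = integral {0<..} (\<lambda>t. of_real t powr (s - 1) * of_real (exp (- t)))"
    unfolding mellin_def using 1 by (intro set_borel_integral_eq_integral) (simp add: mellin_conv_def)
  also have "\<dots> = Gamma s"
    using Gamma_integral_complex'[OF assms(1)] by (simp add: exp_minus divide_inverse integral_unique)
  finally show "mellin {0<..} (\<lambda>t. of_real (exp (- (c * t)))) s = Gamma s * of_real c powr (- s)"
    using mellin_scale(1)[OF assms(2), of "\<lambda>t. of_real (exp (- t))" s] by simp
  show "mellin_conv {0<..} (\<lambda>t. of_real (exp (- (c * t)))) s"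
    using mellin_scale(2)[OF assms(2), of "\<lambda>t. of_real (exp (- t))" s] 1 by simp
qed

lemma mellin_sums:
  assumes S: "S \<subseteq> {0<..}" "S \<in> sets borel"
    and conv: "\<And>k. mellin_conv S (f k) s"
    and pw: "\<And>t. t \<in> S \<Longrightarrow> summable (\<lambda>k. norm (f k t))"
    and sum: "summable (\<lambda>k. LINT t:S|lborel. t powr (Re s - 1) * norm (f k t))"
  shows "(\<lambda>k. mellin S (f k) s) sums mellin S (\<lambda>t. \<Sum>k. f k t) s"
    and "mellin_conv S (\<lambda>t. \<Sum>k. f k t) s"
proof -
  define F where "F = (\<lambda>k t. indicator S t *\<^sub>R (complex_of_real t powr (s - 1) * f k t))"
  have int: "integrable lborel (F k)" for k using conv[of k] by (simp add: F_def mellin_conv_def set_integrable_def)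
  have ae: "AE t in lborel. summable (\<lambda>k. norm (F k t))"
  proof (intro AE_I2)
    fix t show "summable (\<lambda>k. norm (F k t))"
      using pw[of t] by (cases "t \<in> S") (auto simp: F_def norm_mult intro: summable_mult)
  qed
  have nrm: "norm (F k t) = indicator S t *\<^sub>R (t powr (Re s - 1) * norm (f k t))" for k t
    using S by (cases "t \<in> S") (auto simp: F_def norm_mult norm_of_real_powr)
  have sm: "summable (\<lambda>k. LINT t|lborel. norm (F k t))"
    using sum by (simp add: nrm set_lebesgue_integral_def)
  have eq: "(\<Sum>k. F k t) = indicator S t *\<^sub>R (complex_of_real t powr (s - 1) * (\<Sum>k. f k t))" for t
    using pw[of t, THEN summable_norm_cancel] by (cases "t \<in> S") (auto simp: F_def suminf_mult)
  show "(\<lambda>k. mellin S (f k) s) sums mellin S (\<lambda>t. \<Sum>k. f k t) s"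
    using sums_integral[OF int ae sm] unfolding eq by (simp add: F_def mellin_def set_lebesgue_integral_def)
  show "mellin_conv S (\<lambda>t. \<Sum>k. f k t) s"
    using integrable_suminf[OF int ae sm] unfolding eq by (simp add: mellin_conv_def set_integrable_def)
qed

section \<open>The Lambert series of the set A\<close>

text \<open>\<open>bose\<close> without the terms 1/x - 1/2 of its Laurent expansion at 0. What is
  left tends to 0 at the origin and stays between 0 and 1/2.\<close>

definition bose_reg :: "real \<Rightarrow> real" where
  "bose_reg x = bose x - 1 / x + 1 / 2"

text \<open>The product (1/x - 1/2)(1/y - 1/2) is subtracted except for its constant 1/4. Precisely
  these singular terms, taken along the denominators, have alternating sums known in closed form,
  \<open>alternating_sum_area\<close> and \<open>alternating_sum_inverse\<close>.\<close>

definition bose_rem :: "real \<Rightarrow> real \<Rightarrow> real" where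
  "bose_rem x y = bose x * bose y - 1 / (x * y) + (1 / x + 1 / y) / 2"

lemma bose_le: "0 < x \<Longrightarrow> bose x \<le> 1 / x" for x :: real
proof -
  assume x: "0 < x"
  have "x \<le> exp x - 1" using exp_ge_add_one_self[of x] by linarith
  then show ?thesis unfolding bose_def using x by (intro divide_left_mono) auto
qed

lemma bose_reg_le_half: "0 < x \<Longrightarrow> bose_reg x \<le> 1 / 2"
  using bose_le[of x] by (simp add: bose_reg_def)

lemma bose_reg_nonneg:
  assumes "0 < x"
  shows "0 \<le> bose_reg x"
proof -
  \<comment> \<open>Multiplied by the positive quantity 2 x (exp x - 1) the claim becomes
    \<open>f x \<ge> 0\<close>, and \<open>f 0 = 0\<close>.\<close>
  define f where "f = (\<lambda>x::real. 2 + x - (2 - x) * exp x)"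
  have "f 0 \<le> f x"
  proof (rule DERIV_nonneg_imp_nondecreasing[where f = f])
    fix y :: real assume "0 \<le> y" "y \<le> x"
    have "(f has_real_derivative (1 - (1 - y) * exp y)) (at y)"
      unfolding f_def by (auto intro!: derivative_eq_intros simp: algebra_simps)
    moreover have "(1 - y) * exp y \<le> exp (- y) * exp y"
      using exp_ge_add_one_self[of "- y"] by (intro mult_right_mono) auto
    then have "0 \<le> 1 - (1 - y) * exp y" by (simp flip: exp_add)
    ultimately show "\<exists>z. (f has_real_derivative z) (at y) \<and> 0 \<le> z" by blast
  qed (use assms in auto)
  then have "0 \<le> 2 + x - (2 - x) * exp x" by (simp add: f_def)
  moreover have "1 < exp x" using assms by simp
  ultimately show ?thesis using assms by (simp add: bose_reg_def bose_def field_simps)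
qed

lemma bose_reg_le:
  assumes "0 < x"
  shows "bose_reg x \<le> x / 4"
proof -
  have e: "1 + x + x\<^sup>2 / 2 \<le> exp x" using exp_lower_Taylor_quadratic[of x] assms by simp
  have p: "0 < x + x\<^sup>2 / 2" using assms by (simp add: add_pos_pos)
  have "bose x \<le> 1 / (x + x\<^sup>2 / 2)" unfolding bose_def using e p assms by (intro divide_left_mono mult_pos_pos) auto
  also have "\<dots> \<le> 1 / x - 1 / 2 + x / 4"
  proof -
    have "1 \<le> (1 / x - 1 / 2 + x / 4) * (x + x\<^sup>2 / 2)"
      using assms by (simp add: field_simps power2_eq_square power3_eq_cube)
    then show ?thesis using p by (simp add: pos_divide_le_eq)
  qed
  finally show ?thesis by (simp add: bose_reg_def)
qed

text \<open>Insert bose x = 1/x - (1/2 - \<open>bose_reg x\<close>) in both factors. Since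
  \<open>bose_reg\<close> lies in [0, 1/2], all three summands are nonnegative and can be estimated
  one by one.\<close>

lemma bose_rem_eq:
  assumes "0 < x" "0 < y"
  shows "bose_rem x y = bose_reg y / x + bose_reg x / y + (1 / 2 - bose_reg x) * (1 / 2 - bose_reg y)"
  by (simp add: bose_rem_def bose_reg_def algebra_simps add_divide_distrib diff_divide_distrib)

text \<open>The factor \<open>min y 1\<close> is at most y^mu for every mu in [0, 1]. With x and y
  multiples of consecutive denominators this yields the ratio
  \<open>Q (Suc k) powr \<mu> / Q k\<close> that decides how far the continuation reaches.\<close>

lemma bose_rem_bound:
  assumes "0 < x" "x \<le> y"
  shows "\<bar>bose_rem x y\<bar> \<le> 3 * min y 1 / x"
proof -
  have y: "0 < y" using assms by simp
  note cx = bose_reg_nonneg[OF assms(1)] bose_reg_le_half[OF assms(1)] bose_reg_le[OF assms(1)]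
  note cy = bose_reg_nonneg[OF y] bose_reg_le_half[OF y] bose_reg_le[OF y]
  have nn: "0 \<le> bose_rem x y" unfolding bose_rem_eq[OF assms(1) y] using cx cy assms y
    by (intro add_nonneg_nonneg mult_nonneg_nonneg divide_nonneg_pos) auto
  have 1: "bose_reg y / x \<le> min y 1 / x" using cy y assms by (intro divide_right_mono) auto
  have 2: "bose_reg x / y \<le> min y 1 / x"
  proof -
    have "bose_reg x / y \<le> min 1 x / y" using cx assms y by (intro divide_right_mono) auto
    also have "\<dots> \<le> min y 1 / x"
    proof (cases "y \<le> 1")
      case True
      have "x * x \<le> y * y" using assms by (intro mult_mono) auto
      moreover have "min 1 x = x" "min y 1 = y" using True assms by auto
      ultimately show ?thesis using assms y by (simp add: field_simps)
    next
      case False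
      have "min 1 x * x \<le> 1 * y" using assms False by (intro mult_mono) auto
      then show ?thesis using False assms y by (simp add: field_simps)
    qed
    finally show ?thesis .
  qed
  have 3: "(1 / 2 - bose_reg x) * (1 / 2 - bose_reg y) \<le> min y 1 / x"
  proof (cases "y \<le> 1")
    case True
    have "(1 / 2 - bose_reg x) * (1 / 2 - bose_reg y) \<le> 1 * 1" using cx cy by (intro mult_mono) auto
    also have "1 * 1 \<le> min y 1 / x" using True assms by simp
    finally show ?thesis .
  next
    case False
    have "1 / 2 - bose_reg x \<le> 1 / x" using bose_pos[OF assms(1)] by (simp add: bose_reg_def)
    then have "(1 / 2 - bose_reg x) * (1 / 2 - bose_reg y) \<le> 1 / x * 1" using cx cy assms by (intro mult_mono) auto
    then show ?thesis using False by simp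
  qed
  show ?thesis using nn 1 2 3 unfolding bose_rem_eq[OF assms(1) y] by simp
qed

lemma bose_le_exp: "1 \<le> x \<Longrightarrow> bose x \<le> 2 * exp (- x)" for x :: real
proof -
  assume x: "1 \<le> x"
  have "2 \<le> exp x" using exp_ge_add_one_self[of x] x by linarith
  then have "1 / (exp x - 1) \<le> 1 / (exp x / 2)" using x by (intro divide_left_mono mult_pos_pos) auto
  then show ?thesis unfolding bose_def exp_minus by (simp add: field_simps)
qed

text \<open>(exp(c z) - 1) / z with the singularity at 0 removed. Functions with a simple pole at 0
  are written through it as a holomorphic function divided by z.\<close>

definition expm1_div :: "complex \<Rightarrow> complex \<Rightarrow> complex" where
  "expm1_div c z = (if z = 0 then c else (exp (c * z) - 1) / z)"

lemma expm1_div_holomorphic: "expm1_div c holomorphic_on A"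
proof -
  have "(\<lambda>z. if z = 0 then deriv (\<lambda>z. exp (c * z)) 0 else (exp (c * z) - exp (c * 0)) / (z - 0)) holomorphic_on UNIV"
    by (rule pole_lemma) (auto intro!: holomorphic_intros)
  moreover have "deriv (\<lambda>z. exp (c * z)) 0 = c"
    by (rule DERIV_imp_deriv) (auto intro!: derivative_eq_intros)
  ultimately have "expm1_div c holomorphic_on UNIV" by (simp add: expm1_div_def[abs_def] cong: if_cong)
  then show ?thesis by (rule holomorphic_on_subset) auto
qed

text \<open>6 is a convenient number below 2 pi, the distance from 0 to the next zero of exp z - 1.
  The discs of radius 6 around the origin below come from here.\<close>

lemma exp_eq_1_small: "norm z < 6 \<Longrightarrow> exp z = 1 \<Longrightarrow> z = (0::complex)"
proof -
  assume z: "norm z < 6" "exp z = 1"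
  then obtain n :: int where n: "Re z = 0" "Im z = of_int (2 * n) * pi" using exp_eq_1[of z] by auto
  have "\<bar>Im z\<bar> < 6" using z(1) abs_Im_le_cmod[of z] by simp
  then have "\<bar>of_int n :: real\<bar> * (2 * pi) < 6" using n by (simp add: abs_mult)
  moreover have "(6::real) < 2 * pi" using pi_gt3 by simp
  ultimately have "\<bar>of_int n :: real\<bar> < 1"
    by (smt (verit) mult_le_cancel_right1 mult_right_mono)
  then have "n = 0" by linarith
  then show "z = 0" using n by (simp add: complex_eq_iff)
qed

lemma expm1_div_nonzero: "norm (c * z) < 6 \<Longrightarrow> c \<noteq> 0 \<Longrightarrow> expm1_div c z \<noteq> 0"
proof -
  assume "norm (c * z) < 6" "c \<noteq> 0"
  then show ?thesis using exp_eq_1_small[of "c * z"] by (cases "z = 0") (simp_all add: expm1_div_def, blast)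
qed

lemma set_integral_powr_exp:
  assumes "0 < \<sigma>" "0 < (c::real)"
  shows "(LINT t:{0<..}|lborel. t powr (\<sigma> - 1) * exp (- (c * t))) = Gamma \<sigma> * c powr (- \<sigma>)"
proof -
  have "complex_of_real (LINT t:{0<..}|lborel. t powr (\<sigma> - 1) * exp (- (c * t))) = 
     (LINT t:{0<..}|lborel. of_real t powr (of_real \<sigma> - 1) * of_real (exp (- (c * t))))"
    unfolding set_integral_complex_of_real[symmetric]
  proof (intro set_lebesgue_integral_cong allI impI)
    fix t :: real assume "t \<in> {0<..}"
    then show "complex_of_real (t powr (\<sigma> - 1) * exp (- (c * t))) = of_real t powr (of_real \<sigma> - 1) * of_real (exp (- (c * t)))"
      using powr_of_real[of t "\<sigma> - 1"] by simp
  qed simp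
  also have "\<dots> = Gamma (of_real \<sigma>) * of_real c powr (- of_real \<sigma>)"
    using mellin_exp(1)[of "of_real \<sigma>" c] assms by (simp add: mellin_def)
  also have "\<dots> = of_real (Gamma \<sigma> * c powr (- \<sigma>))"
    using assms powr_of_real[of c "- \<sigma>"] by (simp add: Gamma_complex_of_real)
  finally show ?thesis unfolding of_real_eq_iff .
qed

lemma has_sum_diff_real:
  fixes f g :: "'a \<Rightarrow> real"
  assumes "(f has_sum a) A" "(g has_sum b) A"
  shows "((\<lambda>x. f x - g x) has_sum (a - b)) A"
  using has_sum_add[OF assms(1) has_sum_cmult_right[OF assms(2), of "-1"]] by simp

text \<open>Replacing n by n - q multiplies the series by exp(-q t) up to finitely many terms. For
  positive q terms with nonpositive argument enter, for negative q the first ones are lost, so at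
  most one of the two interval sums is nonempty.\<close>

lemma shifted_exponential_has_sum:
  fixes f :: "int \<Rightarrow> real" and q :: int
  assumes "((\<lambda>n::nat. f (int n) * exp (- (real n * t))) has_sum S) {1..}"
  shows "((\<lambda>n::nat. f (int n - q) * exp (- (real n * t))) has_sum
    (exp (- (of_int q * t)) * S + ((\<Sum>n=1..q. f (n - q) * exp (- (of_int n * t)))
      - (\<Sum>m=1..-q. f m * exp (- (of_int (m + q) * t)))))) {1..}"
proof -
  define g where "g = (\<lambda>m::int. exp (- (of_int q * t)) * (f m * exp (- (of_int m * t))))"
  have g: "g m = f m * exp (- (of_int (m + q) * t))" for m by (simp add: g_def exp_add[symmetric] algebra_simps)
  have "((\<lambda>m::int. f m * exp (- (of_int m * t))) has_sum S) {1..}"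
    using assms by (subst has_sum_reindex_bij_witness[of "{1..}" int nat "{1..}" "\<lambda>n::nat. f (int n) * exp (- (real n * t))" _ S S]) auto
  from has_sum_cmult_right[OF this, of "exp (- (of_int q * t))"]
  have g1: "(g has_sum (exp (- (of_int q * t)) * S)) {1..}" by (simp add: g_def)
  have "(g has_sum (exp (- (of_int q * t)) * S + ((\<Sum>n=1..q. f (n - q) * exp (- (of_int n * t)))
      - (\<Sum>m=1..-q. f m * exp (- (of_int (m + q) * t)))))) {1-q..}"
  proof (cases "0 \<le> q")
    case True
    have "(g has_sum (\<Sum>m\<in>{1-q..0}. g m)) {1-q..0}" by (rule has_sum_finite) simp
    from has_sum_Un_disjoint[OF g1 this] 
    have "(g has_sum (exp (- (of_int q * t)) * S + (\<Sum>m\<in>{1-q..0}. g m))) ({1..} \<union> {1-q..0})" by auto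
    moreover have "{1..} \<union> {1-q..0} = {1-q..}" using True by auto
    moreover have "(\<Sum>m\<in>{1-q..0}. g m) = (\<Sum>n=1..q. f (n - q) * exp (- (of_int n * t)))"
      by (rule sum.reindex_bij_witness[of _ "\<lambda>n. n - q" "\<lambda>m. m + q"]) (auto simp: g)
    ultimately show ?thesis using True by (cases "q = 0") auto
  next
    case False
    have "(g has_sum (\<Sum>m\<in>{1..-q}. g m)) {1..-q}" by (rule has_sum_finite) simp
    from has_sum_Diff[OF g1 this]
    have "(g has_sum (exp (- (of_int q * t)) * S - (\<Sum>m\<in>{1..-q}. g m))) ({1..} - {1..-q})" by auto
    moreover have "{1..} - {1..-q} = {1-q..}" using False by auto
    ultimately show ?thesis using False by (simp add: g)
  qed
  also have "(g has_sum (exp (- (of_int q * t)) * S + ((\<Sum>n=1..q. f (n - q) * exp (- (of_int n * t)))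
      - (\<Sum>m=1..-q. f m * exp (- (of_int (m + q) * t)))))) {1-q..} \<longleftrightarrow> ?thesis"
    by (rule has_sum_reindex_bij_witness[of _ "\<lambda>n. int n - q" "\<lambda>m. nat (m + q)"]) (auto simp: g)
  finally show ?thesis .
qed

context irrational_number
begin

section \<open>The set A through floor values, and its Lambert series near 0\<close>

abbreviation "\<beta> \<equiv> frac \<alpha>"

text \<open>The fractional part of x is below that of y exactly when subtracting y from x borrows,
  i.e. when floor(x - y) is floor x - floor y - 1. Replacing \<alpha> by \<beta> changes the
  arguments only by integers.\<close>

lemma A_set_iff_floor:
  "(of_bool (n \<in> A_set \<alpha> q) :: real) = (if 1 \<le> n then of_int (\<lfloor>\<beta> * n\<rfloor> - \<lfloor>\<beta> * of_int (int n - q)\<rfloor> - \<lfloor>\<beta> * of_int q\<rfloor>) else 0)"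
proof (cases "1 \<le> n")
  case True
  have fr: "frac (\<alpha> * of_int m) = frac (\<beta> * of_int m)" for m
  proof -
    have "\<alpha> * of_int m = \<beta> * of_int m + of_int (\<lfloor>\<alpha>\<rfloor> * m)" by (simp add: frac_def algebra_simps)
    then have "frac (\<alpha> * of_int m) = frac (\<beta> * of_int m + of_int (\<lfloor>\<alpha>\<rfloor> * m))" by (simp only:)
    also have "\<dots> = frac (\<beta> * of_int m)" by (simp only: frac_def floor_add_int) simp
    finally show ?thesis .
  qed
  define x y where "x = \<beta> * of_int (int n)" and "y = \<beta> * of_int q"
  have mem: "n \<in> A_set \<alpha> q \<longleftrightarrow> frac x < frac y"
    using True fr[of "int n"] fr[of q] by (simp add: A_set_def x_def y_def)
  have "\<lfloor>x - y\<rfloor> = (if frac x < frac y then \<lfloor>x\<rfloor> - \<lfloor>y\<rfloor> - 1 else \<lfloor>x\<rfloor> - \<lfloor>y\<rfloor>)"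
  proof -
    have "x = of_int \<lfloor>x\<rfloor> + frac x" "y = of_int \<lfloor>y\<rfloor> + frac y" by (simp_all add: frac_def)
    then show ?thesis using frac_lt_1[of x] frac_lt_1[of y] frac_ge_0[of x] frac_ge_0[of y]
      by (cases "frac x < frac y") (simp_all, (intro floor_unique; simp; linarith)+)
  qed
  then show ?thesis using True mem by (auto simp: x_def y_def algebra_simps)
qed (auto simp: A_set_def)

definition A_lambert :: "int \<Rightarrow> real \<Rightarrow> real" where
  "A_lambert q t = (\<Sum>n. of_bool (n \<in> A_set \<alpha> q) * exp (- (real n * t)))"

text \<open>Defined by the alternating bose series, whose terms can be analysed as t tends to 0.
  That it generates the numbers floor(\<beta> n) is \<open>floor_lambert_has_sum\<close>.\<close>

definition floor_lambert :: "real \<Rightarrow> real" where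
  "floor_lambert t = (\<Sum>k. (-1) ^ k * (bose (Q k * t) * bose (Q (Suc k) * t)))"

definition rem_lambert :: "real \<Rightarrow> real" where
  "rem_lambert t = (\<Sum>k. (-1) ^ k * bose_rem (Q k * t) (Q (Suc k) * t))"

lemma A_lambert_summable:
  assumes "0 < t"
  shows "summable (\<lambda>n. of_bool (n \<in> A_set \<alpha> q) * exp (- (real n * t)))"
proof (rule summable_comparison_test')
  have "norm (exp (- t)) < 1" using assms by simp
  then show "summable (\<lambda>n. exp (- t) ^ n)" by (rule summable_geometric)
  show "norm (of_bool (n \<in> A_set \<alpha> q) * exp (- (real n * t))) \<le> exp (- t) ^ n" for n
    by (auto simp: exp_of_nat_mult[symmetric])
qed

lemma A_lambert_has_sum:
  assumes "0 < t"
  shows "((\<lambda>n. of_bool (n \<in> A_set \<alpha> q) * exp (- (real n * t))) has_sum A_lambert q t) {1..}"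
proof -
  have "((\<lambda>n. of_bool (n \<in> A_set \<alpha> q) * exp (- (real n * t))) has_sum A_lambert q t) UNIV"
    unfolding A_lambert_def using A_lambert_summable[OF assms, of q]
    by (intro norm_summable_imp_has_sum) (auto simp: summable_sums)
  also have "?this \<longleftrightarrow> ?thesis"
    by (rule has_sum_cong_neutral) (auto simp: A_set_def)
  finally show ?thesis .
qed

lemma A_lambert_bounds:
  assumes "0 < t"
  shows "0 \<le> A_lambert q t" "A_lambert q t \<le> bose t"
proof -
  show "0 \<le> A_lambert q t" by (rule has_sum_nonneg[OF A_lambert_has_sum[OF assms]]) auto
  show "A_lambert q t \<le> bose t"
    by (rule has_sum_mono[OF A_lambert_has_sum[OF assms] bose_has_sum[OF assms]]) auto
qed

lemma floor_lambert_has_sum: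
  assumes "0 < t"
  shows "((\<lambda>n::nat. of_int \<lfloor>\<beta> * n\<rfloor> * exp (- (real n * t))) has_sum floor_lambert t) {1..}"
proof -
  have "floor_lambert t = cone_sum (Q 0 * t) (Q 1 * t) (\<theta> 2)"
    unfolding floor_lambert_def using bose_series_sums_cone[OF assms] by (simp add: sums_iff)
  then show ?thesis using floor_series_has_sum_cone[OF assms] by simp
qed

text \<open>The three floor values of \<open>A_set_iff_floor\<close> contribute the floor series,
  its shift by q, and a multiple of the plain geometric series. \<open>E\<close> collects the
  finitely many exponentials produced by the shift.\<close>

lemma A_lambert_eq_floor_lambert:
  obtains E where "E holomorphic_on UNIV"
    "\<And>t. 0 < t \<Longrightarrow> of_real (A_lambert q t) = (1 - exp (- (of_int q * of_real t))) * of_real (floor_lambert t)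
       + E (of_real t) - of_int \<lfloor>\<beta> * of_int q\<rfloor> * bose (complex_of_real t)"
proof -
  define f where "f = (\<lambda>n::int. real_of_int \<lfloor>\<beta> * of_int n\<rfloor>)"
  define E where "E = (\<lambda>z::complex. - ((\<Sum>n=1..q. of_real (f (n - q)) * exp (- (of_int n * z)))
      - (\<Sum>m=1..-q. of_real (f m) * exp (- (of_int (m + q) * z)))))"
  have "E holomorphic_on UNIV" unfolding E_def by (intro holomorphic_intros)
  moreover have "of_real (A_lambert q t) = (1 - exp (- (of_int q * of_real t))) * of_real (floor_lambert t)
       + E (of_real t) - of_int \<lfloor>\<beta> * of_int q\<rfloor> * bose (complex_of_real t)" if t: "0 < t" for t
  proof -
    define E' where "E' = ((\<Sum>n=1..q. f (n - q) * exp (- (of_int n * t)))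
      - (\<Sum>m=1..-q. f m * exp (- (of_int (m + q) * t))))"
    have 1: "((\<lambda>n::nat. f (int n) * exp (- (real n * t))) has_sum floor_lambert t) {1..}"
      using floor_lambert_has_sum[OF t] by (simp add: f_def)
    have 2: "((\<lambda>n::nat. f (int n - q) * exp (- (real n * t))) has_sum (exp (- (of_int q * t)) * floor_lambert t + E')) {1..}"
      using shifted_exponential_has_sum[OF 1] by (simp add: E'_def)
    have 3: "((\<lambda>n::nat. f q * exp (- (real n * t))) has_sum (f q * bose t)) {1..}"
      by (intro has_sum_cmult_right bose_has_sum t)
    have "((\<lambda>n::nat. f (int n) * exp (- (real n * t)) - f (int n - q) * exp (- (real n * t)) - f q * exp (- (real n * t)))
        has_sum (floor_lambert t - (exp (- (of_int q * t)) * floor_lambert t + E') - f q * bose t)) {1..}"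
      by (intro has_sum_diff_real 1 2 3)
    also have "?this \<longleftrightarrow> ((\<lambda>n. of_bool (n \<in> A_set \<alpha> q) * exp (- (real n * t))) has_sum
        (floor_lambert t - (exp (- (of_int q * t)) * floor_lambert t + E') - f q * bose t)) {1..}"
      by (intro has_sum_cong) (simp only: A_set_iff_floor, simp add: f_def algebra_simps)
    finally have r: "A_lambert q t = floor_lambert t - (exp (- (of_int q * t)) * floor_lambert t + E') - f q * bose t"
      by (rule has_sum_unique[OF A_lambert_has_sum[OF t]])
    have "E (of_real t) = of_real (- E')"
      by (simp add: E_def E'_def exp_of_real[symmetric])
    moreover have "exp (- (of_int q * complex_of_real t)) = of_real (exp (- (of_int q * t)))"
      by (simp add: exp_of_real[symmetric])
    ultimately show ?thesis unfolding r by (simp add: bose_of_real f_def algebra_simps)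
  qed
  ultimately show ?thesis using that by blast
qed

lemma bose_rem_Q_bound:
  assumes "0 < t" "0 \<le> \<mu>" "\<mu> \<le> 1"
  shows "\<bar>bose_rem (Q k * t) (Q (Suc k) * t)\<bar> \<le> 3 * (Q (Suc k) powr \<mu> / Q k) * t powr (\<mu> - 1)"
proof -
  have pos: "0 < Q k" "0 < Q (Suc k)" by (rule Q_pos)+
  define y where "y = Q (Suc k) * t"
  have y: "0 < y" using pos assms by (simp add: y_def)
  have my: "min y 1 \<le> y powr \<mu>"
  proof (cases "y \<le> 1")
    case True
    then have "y powr 1 \<le> y powr \<mu>" using y assms by (intro powr_mono') auto
    then show ?thesis using y True by simp
  next
    case False
    then show ?thesis using ge_one_powr_ge_zero[of y \<mu>] assms by simp
  qed
  have "\<bar>bose_rem (Q k * t) y\<bar> \<le> 3 * min y 1 / (Q k * t)"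
    using pos assms Q_le_Suc[of k] unfolding y_def by (intro bose_rem_bound mult_right_mono) auto
  also have "\<dots> \<le> 3 * y powr \<mu> / (Q k * t)" using my pos assms by (intro divide_right_mono) auto
  also have "\<dots> = 3 * (Q (Suc k) powr \<mu> / Q k) * t powr (\<mu> - 1)"
    using pos assms by (simp add: y_def powr_mult powr_diff)
  finally show ?thesis by (simp add: y_def)
qed

lemma rem_lambert_summable:
  assumes "0 < t"
  shows "summable (\<lambda>k. \<bar>bose_rem (Q k * t) (Q (Suc k) * t)\<bar>)"
proof (rule summable_comparison_test')
  show "summable (\<lambda>k. 3 * (1 / Q k) * t powr (- 1))"
    by (intro summable_mult summable_mult2 summable_inverse_Q)
  show "norm \<bar>bose_rem (Q k * t) (Q (Suc k) * t)\<bar> \<le> 3 * (1 / Q k) * t powr (- 1)" for k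
    using bose_rem_Q_bound[OF assms, of 0 k] Q_pos[of "Suc k"] by simp
qed

lemma rem_lambert_bound:
  assumes "0 \<le> \<mu>" "\<mu> \<le> 1" and sm: "summable (\<lambda>k. Q (Suc k) powr \<mu> / Q k)"
  obtains C where "0 < C" "\<And>t. 0 < t \<Longrightarrow> \<bar>rem_lambert t\<bar> \<le> C * t powr (\<mu> - 1)"
proof -
  define C where "C = 3 * (\<Sum>k. Q (Suc k) powr \<mu> / Q k)"
  have "\<bar>rem_lambert t\<bar> \<le> C * t powr (\<mu> - 1)" if t: "0 < t" for t
  proof -
    have "\<bar>rem_lambert t\<bar> \<le> (\<Sum>k. \<bar>(-1) ^ k * bose_rem (Q k * t) (Q (Suc k) * t)\<bar>)"
      unfolding rem_lambert_def using rem_lambert_summable[OF t]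
      by (intro summable_rabs) (simp add: abs_mult)
    also have "\<dots> \<le> (\<Sum>k. 3 * (Q (Suc k) powr \<mu> / Q k) * t powr (\<mu> - 1))"
      using rem_lambert_summable[OF t] bose_rem_Q_bound[OF t assms(1,2)]
      by (intro suminf_le summable_mult summable_mult2 sm) (simp_all add: abs_mult)
    also have "\<dots> = C * t powr (\<mu> - 1)"
      unfolding C_def by (intro sums_unique[symmetric] sums_mult sums_mult2 summable_sums sm)
    finally show ?thesis .
  qed
  moreover have "C * t powr (\<mu> - 1) \<le> (\<bar>C\<bar> + 1) * t powr (\<mu> - 1)" for t by (intro mult_right_mono) auto
  ultimately have "\<And>t. 0 < t \<Longrightarrow> \<bar>rem_lambert t\<bar> \<le> (\<bar>C\<bar> + 1) * t powr (\<mu> - 1)" using order_trans by blast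
  then show ?thesis using that[of "\<bar>C\<bar> + 1"] by auto
qed

text \<open>The singular terms removed in \<open>bose_rem\<close> sum exactly, with values \<beta>
  and 1, to the two explicit poles.\<close>

lemma floor_lambert_eq:
  assumes "0 < t"
  shows "floor_lambert t = \<beta> / t\<^sup>2 - 1 / (2 * t) + rem_lambert t"
proof -
  have "summable (\<lambda>k. (-1) ^ k * bose_rem (Q k * t) (Q (Suc k) * t))"
    by (rule summable_rabs_cancel) (use rem_lambert_summable[OF assms] in \<open>simp add: abs_mult\<close>)
  then have r: "(\<lambda>k. (-1) ^ k * bose_rem (Q k * t) (Q (Suc k) * t)) sums rem_lambert t"
    by (simp add: rem_lambert_def summable_sums)
  have "(\<lambda>k. (- 1) ^ k / (Q k * Q (Suc k)) * (1 / t\<^sup>2) - (- 1) ^ k * (1 / Q k + 1 / Q (Suc k)) * (1 / (2 * t))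
      + (-1) ^ k * bose_rem (Q k * t) (Q (Suc k) * t)) sums (\<beta> * (1 / t\<^sup>2) - 1 * (1 / (2 * t)) + rem_lambert t)"
    by (intro sums_add sums_diff sums_mult2 alternating_sum_area alternating_sum_inverse r)
  also have "(\<lambda>k. (- 1) ^ k / (Q k * Q (Suc k)) * (1 / t\<^sup>2) - (- 1) ^ k * (1 / Q k + 1 / Q (Suc k)) * (1 / (2 * t))
      + (-1) ^ k * bose_rem (Q k * t) (Q (Suc k) * t)) = (\<lambda>k. (-1) ^ k * (bose (Q k * t) * bose (Q (Suc k) * t)))"
  proof
    fix k
    define m where "m = (-1 :: real) ^ k"
    have "bose (Q k * t) * bose (Q (Suc k) * t) = 1 / (Q k * Q (Suc k)) * (1 / t\<^sup>2)
        - (1 / Q k + 1 / Q (Suc k)) * (1 / (2 * t)) + bose_rem (Q k * t) (Q (Suc k) * t)"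
    proof -
      have "(1 / (Q k * t) + 1 / (Q (Suc k) * t)) / 2 = (1 / Q k + 1 / Q (Suc k)) * (1 / (2 * t))"
        using assms Q_pos[of k] Q_pos[of "Suc k"] by (simp add: field_simps)
      moreover have "1 / (Q k * t * (Q (Suc k) * t)) = 1 / (Q k * Q (Suc k)) * (1 / t\<^sup>2)"
        by (simp add: power2_eq_square)
      ultimately show ?thesis unfolding bose_rem_def by (simp only:)
    qed
    then have "m * (bose (Q k * t) * bose (Q (Suc k) * t)) = m * (1 / (Q k * Q (Suc k)) * (1 / t\<^sup>2))
        - m * ((1 / Q k + 1 / Q (Suc k)) * (1 / (2 * t))) + m * bose_rem (Q k * t) (Q (Suc k) * t)"
      by (simp only: distrib_left right_diff_distrib)
    then show "(- 1) ^ k / (Q k * Q (Suc k)) * (1 / t\<^sup>2) - (- 1) ^ k * (1 / Q k + 1 / Q (Suc k)) * (1 / (2 * t))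
      + (-1) ^ k * bose_rem (Q k * t) (Q (Suc k) * t) = (-1) ^ k * (bose (Q k * t) * bose (Q (Suc k) * t))"
      by (simp add: m_def mult.assoc)
  qed
  finally show ?thesis by (simp add: floor_lambert_def sums_iff)
qed

text \<open>The factor 1 - exp(-q t) lowers the double pole \<beta> / t^2 to \<beta> q / t, and the
  multiple of \<open>bose t\<close> takes away floor(\<beta> q) / t. Their difference is the
  fractional part of \<alpha> q, the later residue.\<close>

lemma A_lambert_near_0:
  obtains Gh where "Gh holomorphic_on ball 0 6" "Gh 0 = of_real (frac (\<alpha> * of_int q))"
    "\<And>t. 0 < t \<Longrightarrow> t < 6 \<Longrightarrow> of_real (A_lambert q t) =
       Gh (of_real t) / of_real t + (1 - exp (- (of_int q * of_real t))) * of_real (rem_lambert t)"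
proof -
  obtain E where E: "E holomorphic_on UNIV" "\<And>t. 0 < t \<Longrightarrow> of_real (A_lambert q t) = (1 - exp (- (of_int q * of_real t))) * of_real (floor_lambert t)
       + E (of_real t) - of_int \<lfloor>\<beta> * of_int q\<rfloor> * bose (complex_of_real t)"
    using A_lambert_eq_floor_lambert[of q] by blast
  define Gh where "Gh = (\<lambda>z. - expm1_div (- of_int q) z * (of_real \<beta> - z / 2) + z * E z
      - of_int \<lfloor>\<beta> * of_int q\<rfloor> * (1 / expm1_div 1 z))"
  have hol: "Gh holomorphic_on ball 0 6"
    unfolding Gh_def using expm1_div_nonzero[of 1]
    by (intro holomorphic_intros expm1_div_holomorphic holomorphic_on_subset[OF E(1)]) auto
  have "frac (\<alpha> * of_int q) = \<beta> * of_int q - of_int \<lfloor>\<beta> * of_int q\<rfloor>"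
  proof -
    have "\<alpha> * of_int q = \<beta> * of_int q + of_int (\<lfloor>\<alpha>\<rfloor> * q)" by (simp add: frac_def algebra_simps)
    then have "frac (\<alpha> * of_int q) = frac (\<beta> * of_int q + of_int (\<lfloor>\<alpha>\<rfloor> * q))" by (simp only:)
    also have "\<dots> = \<beta> * of_int q - of_int \<lfloor>\<beta> * of_int q\<rfloor>" by (simp only: frac_def floor_add_int) simp
    finally show ?thesis .
  qed
  then have "Gh 0 = of_real (frac (\<alpha> * of_int q))" by (simp add: Gh_def expm1_div_def)
  moreover have "of_real (A_lambert q t) =
       Gh (of_real t) / of_real t + (1 - exp (- (of_int q * of_real t))) * of_real (rem_lambert t)" if t: "0 < t" "t < 6" for t
  proof -
    define z where "z = complex_of_real t"
    define e where "e = exp (- (of_int q * z))"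
    have z: "z \<noteq> 0" using t by (simp add: z_def)
    define P where "P = of_real \<beta> / z\<^sup>2 - 1 / (2 * z)"
    have g: "Gh z / z = (1 - e) * P + E z - of_int \<lfloor>\<beta> * of_int q\<rfloor> * bose z"
      using z by (simp add: P_def Gh_def expm1_div_def bose_def e_def field_simps power2_eq_square)
    have fl: "of_real (floor_lambert t) = P + of_real (rem_lambert t)"
      unfolding floor_lambert_eq[OF t(1)] by (simp add: z_def P_def)
    have al: "of_real (A_lambert q t) = (1 - e) * of_real (floor_lambert t) + E z - of_int \<lfloor>\<beta> * of_int q\<rfloor> * bose z"
      using E(2)[OF t(1)] by (simp only: z_def e_def)
    have "of_real (A_lambert q t) = Gh z / z + (1 - e) * of_real (rem_lambert t)"
      unfolding al fl g by (simp add: algebra_simps)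
    then show ?thesis by (simp only: z_def e_def)
  qed
  ultimately show ?thesis using that hol by blast
qed

lemma measurable_A_lambert [measurable]: "A_lambert q \<in> borel_measurable borel"
  unfolding A_lambert_def[abs_def] by measurable

lemma measurable_rem_lambert [measurable]: "rem_lambert \<in> borel_measurable borel"
  unfolding rem_lambert_def[abs_def] bose_rem_def bose_def by (intro borel_measurable_suminf) measurable

lemma mellin_A_lambert:
  assumes "1 < Re s"
  shows "mellin {0<..} (\<lambda>t. of_real (A_lambert q t)) s = Gamma s * g_series \<alpha> q s"
    and "mellin_conv {0<..} (\<lambda>t. of_real (A_lambert q t)) s"
    and "(\<lambda>n. 1 / of_nat n powr s) summable_on A_set \<alpha> q"
proof -
  define f where "f = (\<lambda>(n::nat) t. complex_of_real (of_bool (n \<in> A_set \<alpha> q) * exp (- (real n * t))))"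
  define e where "e = (\<lambda>n::nat. if n \<in> A_set \<alpha> q then 1 / of_nat n powr s else (0::complex))"
  have pos: "n \<in> A_set \<alpha> q \<Longrightarrow> 0 < n" for n by (auto simp: A_set_def)
  have m: "mellin_conv {0<..} (f n) s \<and> mellin {0<..} (f n) s = Gamma s * e n" for n
  proof (cases "n \<in> A_set \<alpha> q")
    case True
    then show ?thesis using mellin_exp[of s "real n"] pos assms
      by (simp add: f_def e_def powr_minus_divide)
  next
    case False
    then show ?thesis by (simp add: f_def e_def mellin_conv_def mellin_def set_integrable_def set_lebesgue_integral_def)
  qed
  have pw: "summable (\<lambda>n. norm (f n t))" if "t \<in> {0<..}" for t
    using A_lambert_summable[of t q] that by (simp add: f_def norm_mult)
  have sm0: "summable (\<lambda>n::nat. real n powr (- Re s))" using assms by (subst summable_real_powr_iff) auto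
  have sm: "summable (\<lambda>n. LINT t:{0<..}|lborel. t powr (Re s - 1) * norm (f n t))"
  proof (rule summable_comparison_test'[OF summable_mult[OF sm0, of "Gamma (Re s)"]])
    fix n
    have G: "0 \<le> Gamma (Re s)" using assms by (simp add: Gamma_real_pos less_imp_le)
    show "norm (LINT t:{0<..}|lborel. t powr (Re s - 1) * norm (f n t)) \<le> Gamma (Re s) * real n powr (- Re s)"
    proof (cases "n \<in> A_set \<alpha> q")
      case True
      then show ?thesis using set_integral_powr_exp[of "Re s" "real n"] assms pos[OF True] G
        by (simp add: f_def norm_mult abs_mult)
    next
      case False
      then show ?thesis using G by (simp add: f_def set_lebesgue_integral_def)
    qed
  qed
  have eq: "(\<Sum>n. f n t) = of_real (A_lambert q t)" if "t \<in> {0<..}" for t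
    unfolding f_def A_lambert_def using A_lambert_summable[of t q] that by (intro suminf_of_real[symmetric]) auto
  have sums: "(\<lambda>n. mellin {0<..} (f n) s) sums mellin {0<..} (\<lambda>t. \<Sum>n. f n t) s"
    and conv: "mellin_conv {0<..} (\<lambda>t. \<Sum>n. f n t) s"
    using mellin_sums[of "{0<..}" f s] m pw sm by auto
  show "mellin_conv {0<..} (\<lambda>t. of_real (A_lambert q t)) s"
    using conv by (subst mellin_conv_cong[of _ _ "\<lambda>t. \<Sum>n. f n t"]) (auto simp: eq)
  have norm_e: "summable (\<lambda>n. norm (e n))"
    by (rule summable_comparison_test'[OF sm0])
      (auto simp: e_def norm_divide norm_powr_real_powr powr_minus_divide)
  then have hs: "(e has_sum (\<Sum>n. e n)) UNIV"
    by (intro norm_summable_imp_has_sum) (auto simp: summable_sums summable_norm_cancel)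
  also have "(e has_sum (\<Sum>n. e n)) UNIV \<longleftrightarrow> ((\<lambda>n. 1 / of_nat n powr s) has_sum (\<Sum>n. e n)) (A_set \<alpha> q)"
    by (rule has_sum_cong_neutral) (auto simp: e_def)
  finally have hs': "((\<lambda>n. 1 / of_nat n powr s) has_sum (\<Sum>n. e n)) (A_set \<alpha> q)" .
  then show "(\<lambda>n. 1 / of_nat n powr s) summable_on A_set \<alpha> q" by (rule has_sum_imp_summable)
  have g: "g_series \<alpha> q s = (\<Sum>n. e n)" unfolding g_series_def by (rule infsumI[OF hs'])
  have "(\<lambda>n. Gamma s * e n) sums (Gamma s * (\<Sum>n. e n))"
    by (intro sums_mult summable_sums summable_norm_cancel[OF norm_e])
  moreover have "(\<lambda>n. Gamma s * e n) sums mellin {0<..} (\<lambda>t. of_real (A_lambert q t)) s"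
    using sums m mellin_cong[of "{0<..}" "\<lambda>t. \<Sum>n. f n t" "\<lambda>t. of_real (A_lambert q t)" s] by (simp add: eq)
  ultimately show "mellin {0<..} (\<lambda>t. of_real (A_lambert q t)) s = Gamma s * g_series \<alpha> q s"
    unfolding g by (rule sums_unique2[symmetric])
qed

end

section \<open>Lacunary series of Poisson type\<close>

definition poisson :: "nat \<Rightarrow> real \<Rightarrow> real" where
  "poisson m x = x ^ m * exp (- x) / fact m"

lemma ln_tangent_le:
  assumes "0 < a" "0 < y"
  shows "ln y \<le> y / a - 1 + ln (a::real)"
  using ln_le_minus_one[of "y / a"] assms by (simp add: ln_div)

lemma poisson_nonneg: "0 \<le> x \<Longrightarrow> 0 \<le> poisson m x"
  by (simp add: poisson_def)

text \<open>With x = y U the quotient of the two kernels is y^m exp(U - U y). As ln y is at most 0,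
  m may be replaced by U - 1, which costs the factor exp 1 / a, and the tangent of ln at a yields
  the large deviation rate a - 1 - ln a.\<close>

lemma poisson_left:
  assumes "0 < a" "a < 1" "0 \<le> x" "x \<le> a * U" "1 \<le> U" and m: "m = nat \<lfloor>U\<rfloor>"
  shows "poisson m x \<le> exp 1 / a * exp (- ((a - 1 - ln a) * U)) * poisson m U"
proof (cases "x = 0")
  case True
  have "0 < m" using assms by (simp add: m)
  then have "poisson m x = 0" using True by (simp add: poisson_def)
  then show ?thesis using assms poisson_nonneg[of U m] by simp
next
  case False
  define y where "y = x / U"
  have y: "0 < y" "y \<le> a" using assms False by (auto simp: y_def field_simps)
  have x: "x = y * U" using assms by (simp add: y_def)
  have lny: "ln y \<le> 0" using y assms by simp
  have mU: "U - 1 \<le> real m" using assms by (simp add: m)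
  have "y ^ m = exp (real m * ln y)" using y by (simp add: exp_of_nat_mult)
  moreover have "real m * ln y \<le> (U - 1) * ln y" using mU lny by (intro mult_right_mono_neg) auto
  moreover have "(U - 1) * ln y \<le> (U - 1) * (y / a - 1 + ln a)"
    using ln_tangent_le[of a y] y assms by (intro mult_left_mono) auto
  moreover have "(U - 1) * (y / a - 1 + ln a) + U - U * y \<le> 1 - ln a - (a - 1 - ln a) * U"
  proof -
    have "y * (1 / a - 1) \<le> a * (1 / a - 1)" using y assms by (intro mult_right_mono) auto
    then have "y / a - y \<le> 1 - a" using assms by (simp add: algebra_simps)
    then have "U * (y / a - y) \<le> U * (1 - a)" using assms by (intro mult_left_mono) auto
    moreover have "0 \<le> y / a" using y assms by simp
    ultimately show ?thesis by (simp add: algebra_simps diff_divide_distrib)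
  qed
  ultimately have "y ^ m * exp (U - U * y) \<le> exp (1 - ln a - (a - 1 - ln a) * U)"
    by (simp add: exp_add[symmetric])
  also have "\<dots> = exp 1 / a * exp (- ((a - 1 - ln a) * U))"
    using assms by (simp add: exp_diff exp_minus divide_inverse)
  finally have "(y ^ m * exp (U - U * y)) * poisson m U \<le> exp 1 / a * exp (- ((a - 1 - ln a) * U)) * poisson m U"
    using assms poisson_nonneg[of U m] by (intro mult_right_mono) auto
  moreover have "(y ^ m * exp (U - U * y)) * poisson m U = poisson m x"
    by (simp add: poisson_def x power_mult_distrib exp_diff exp_minus field_simps)
  ultimately show ?thesis by simp
qed

text \<open>The decay is in x and not merely in U: infinitely many terms lie far to the right, and
  their coefficients may grow like a small power of exp x.\<close>

lemma poisson_far_right: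
  assumes "1 < a" "a * U \<le> x" "1 \<le> U" and m: "m = nat \<lfloor>U\<rfloor>"
  shows "poisson m x \<le> exp (- ((1 - ln a / (a - 1)) * (1 - 1 / a) * x)) * poisson m U"
proof -
  define y where "y = x / U"
  have y: "a \<le> y" using assms by (simp add: y_def field_simps)
  have y1: "1 < y" using y assms by simp
  have x: "x = y * U" using assms by (simp add: y_def)
  have mU: "real m \<le> U" using assms by (simp add: m)
  define r where "r = ln a / (a - 1)"
  have r: "0 \<le> r" using assms by (simp add: r_def)
  have "y ^ m = exp (real m * ln y)" using y1 by (simp add: exp_of_nat_mult)
  moreover have "real m * ln y \<le> U * ln y" using mU y1 by (intro mult_right_mono) auto
  moreover have "U * ln y \<le> U * (y / a - 1 + ln a)"
    using ln_tangent_le[of a y] y1 assms by (intro mult_left_mono) auto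
  moreover have "U * (y / a - 1 + ln a) + U - U * y \<le> - ((1 - r) * (1 - 1 / a) * x)"
  proof -
    have "ln a = r * (a * (1 - 1 / a))" using assms by (simp add: r_def field_simps)
    also have "\<dots> \<le> r * (y * (1 - 1 / a))" using r y assms by (intro mult_left_mono mult_right_mono) auto
    finally have "U * ln a \<le> U * (r * (y * (1 - 1 / a)))" using assms by (intro mult_left_mono) auto
    then show ?thesis by (simp add: x algebra_simps add_divide_distrib diff_divide_distrib)
  qed
  ultimately have "y ^ m * exp (U - U * y) \<le> exp (- ((1 - r) * (1 - 1 / a) * x))"
    by (simp add: exp_add[symmetric])
  then have "(y ^ m * exp (U - U * y)) * poisson m U \<le> exp (- ((1 - r) * (1 - 1 / a) * x)) * poisson m U"
    using assms poisson_nonneg[of U m] by (intro mult_right_mono) auto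
  moreover have "(y ^ m * exp (U - U * y)) * poisson m U = poisson m x"
    by (simp add: poisson_def x power_mult_distrib exp_diff exp_minus field_simps)
  ultimately show ?thesis by (simp add: r_def)
qed

lemma poisson_right:
  assumes "U \<le> x" "1 \<le> U" and m: "m = nat \<lfloor>U\<rfloor>"
  shows "poisson m x \<le> poisson m U"
proof -
  define y where "y = x / U"
  have y: "1 \<le> y" using assms by (simp add: y_def field_simps)
  have x: "x = y * U" using assms by (simp add: y_def)
  have mU: "real m \<le> U" using assms by (simp add: m)
  have "y ^ m = exp (real m * ln y)" using y by (simp add: exp_of_nat_mult)
  moreover have "real m * ln y \<le> U * ln y" using mU y by (intro mult_right_mono) auto
  moreover have "U * ln y \<le> U * (y - 1)"
    using ln_le_minus_one[of y] y assms by (intro mult_left_mono) auto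
  ultimately have "y ^ m * exp (U - U * y) \<le> 1"
    by (simp add: exp_add[symmetric] algebra_simps)
  then have "(y ^ m * exp (U - U * y)) * poisson m U \<le> 1 * poisson m U"
    using assms poisson_nonneg[of U m] by (intro mult_right_mono) auto
  moreover have "(y ^ m * exp (U - U * y)) * poisson m U = poisson m x"
    by (simp add: poisson_def x power_mult_distrib exp_diff exp_minus field_simps)
  ultimately show ?thesis by simp
qed

text \<open>A weak form of Stirling's formula, by induction from (m / (m + 1))^(m + 1) <= 1 / e. It
  loses a power of m, harmless against exponential gains.\<close>

lemma fact_le_powr: "1 \<le> m \<Longrightarrow> fact m \<le> real m * real m ^ m * exp (1 - real m)"
proof (induction m rule: dec_induct)
  case base
  then show ?case by simp
next
  case (step m)
  have m: "1 \<le> real m" using step by simp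
  have "ln (real m / (real m + 1)) \<le> real m / (real m + 1) - 1" using m by (intro ln_le_minus_one) auto
  then have "real (Suc m) * ln (real m / (real m + 1)) \<le> real (Suc m) * (real m / (real m + 1) - 1)"
    by (intro mult_left_mono) auto
  also have "\<dots> = - 1" using m by (simp add: field_simps)
  finally have "exp (real (Suc m) * ln (real m / (real m + 1))) \<le> exp (- 1)" by simp
  then have "(real m / (real m + 1)) ^ Suc m \<le> exp (- 1)" using m by (simp only: exp_of_nat_mult) simp
  then have "real m ^ Suc m \<le> exp (- 1) * (real m + 1) ^ Suc m" using m by (simp add: power_divide divide_le_eq)
  then have *: "real m * real m ^ m * exp (1 - real m) \<le> exp (- 1) * (real m + 1) ^ Suc m * exp (1 - real m)"
    by (intro mult_right_mono) auto
  have "fact (Suc m) = (real m + 1) * fact m" by simp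
  also have "\<dots> \<le> (real m + 1) * (exp (- 1) * (real m + 1) ^ Suc m * exp (1 - real m))"
    using order_trans[OF step.IH *] by (intro mult_left_mono) auto
  also have "\<dots> = real (Suc m) * real (Suc m) ^ Suc m * exp (1 - real (Suc m))"
    by (simp add: exp_diff exp_minus field_simps)
  finally show ?case .
qed

text \<open>At its peak the kernel is only polynomially small; this is what the geometric decay from
  Cauchy's inequality will contradict.\<close>

lemma poisson_ge:
  assumes "1 \<le> U" and m: "m = nat \<lfloor>U\<rfloor>"
  shows "1 / (exp 2 * U) \<le> poisson m U"
proof -
  have m1: "1 \<le> m" "real m \<le> U" "U \<le> real m + 1" using assms by (auto simp: m le_nat_iff)
  have "1 / (exp 2 * U) \<le> 1 / (exp 2 * real m)" using m1 by (intro divide_left_mono mult_left_mono) auto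
  also have "\<dots> = real m ^ m * exp (- (real m + 1)) / (real m * real m ^ m * exp (1 - real m))"
  proof -
    have "exp (- (real m + 1)) = exp (1 - real m) / exp 2"
      by (simp add: exp_diff[symmetric])
    then show ?thesis using m1 by simp
  qed
  also have "\<dots> \<le> real m ^ m * exp (- (real m + 1)) / fact m"
    using fact_le_powr[OF m1(1)] m1 by (intro divide_left_mono) auto
  also have "\<dots> \<le> U ^ m * exp (- U) / fact m"
    using m1 by (intro divide_right_mono mult_mono power_mono) auto
  finally show ?thesis by (simp add: poisson_def)
qed

text \<open>To be used with \<open>la k\<close> = ln(q_k) and signs \<open>e k\<close>: the terms
  are then q_(k+1)^(1-s) / q_k up to sign. \<open>abscissa\<close> says that the series converges to
  the right of \<open>\<sigma>0\<close>. \<open>gaps\<close> says that infinitely often the exponent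
  jumps by a fixed proportion, and that the term behind such a jump is nearly as large on the line
  Re s = \<open>\<sigma>0\<close> as \<open>abscissa\<close> permits.\<close>

locale lacunary_series =
  fixes la :: "nat \<Rightarrow> real" and \<sigma>0 :: real and e :: "nat \<Rightarrow> complex"
  assumes la_mono: "\<And>k. la k \<le> la (Suc k)" and la_nonneg: "0 \<le> la 0"
    and summ: "\<And>d. 0 < d \<Longrightarrow> summable (\<lambda>k. exp (- (d * la k)))"
    and sigma0: "0 < \<sigma>0" "\<sigma>0 \<le> 1"
    and norm_e: "\<And>k. norm (e k) = 1"
    and abscissa: "\<And>\<epsilon>. 0 < \<epsilon> \<Longrightarrow> \<exists>C. \<forall>k. (1 - \<sigma>0) * la (Suc k) - la k \<le> C + \<epsilon> * la (Suc k)"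
    and gaps: "\<And>\<epsilon>. 0 < \<epsilon> \<Longrightarrow> \<exists>\<^sub>F k in sequentially. la k \<le> (1 - \<sigma>0 + \<epsilon>) * la (Suc k)"
begin

definition trm :: "nat \<Rightarrow> nat \<Rightarrow> complex \<Rightarrow> complex" where
  "trm m k s = (- of_real (la (Suc k))) ^ m * (e k * exp (of_real (la (Suc k) - la k) - s * of_real (la (Suc k))))"

definition L :: "complex \<Rightarrow> complex" where "L s = (\<Sum>k. trm 0 k s)"

text \<open>The modulus of the k-th term on the line Re s = \<open>\<sigma>0\<close>.\<close>

definition w :: "nat \<Rightarrow> real" where "w k = exp ((1 - \<sigma>0) * la (Suc k) - la k)"

lemma la_le: "j \<le> k \<Longrightarrow> la j \<le> la k"
  by (rule lift_Suc_mono_le[of la]) (auto intro: la_mono)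

lemma la_ge_0: "0 \<le> la k"
  using la_le[of 0 k] la_nonneg by simp

lemma la_at_top: "filterlim la at_top sequentially"
proof -
  have "(\<lambda>k. exp (- (1 * la k))) \<longlonglongrightarrow> 0" by (rule summable_LIMSEQ_zero[OF summ]) simp
  then have "filterlim (\<lambda>k. exp (- la k)) (at_right 0) sequentially"
    by (simp add: filterlim_at)
  then have "filterlim (\<lambda>k. inverse (exp (- la k))) at_top sequentially"
    by (rule filterlim_compose[OF filterlim_inverse_at_top_right])
  then have "filterlim (\<lambda>k. ln (exp (la k))) at_top sequentially"
    by (intro filterlim_compose[OF ln_at_top]) (simp add: exp_minus)
  then show ?thesis by simp
qed

lemma summ': "0 < d \<Longrightarrow> summable (\<lambda>k. exp (- (d * la (Suc k))))"
  using summ[of d] by (subst summable_Suc_iff)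

lemma norm_term: "norm (trm m k s) = la (Suc k) ^ m * (w k * exp (- ((Re s - \<sigma>0) * la (Suc k))))"
proof -
  have "norm (trm m k s) = la (Suc k) ^ m * exp (la (Suc k) - la k - Re s * la (Suc k))"
    using la_ge_0[of "Suc k"] by (simp add: trm_def norm_mult norm_power norm_e norm_exp_eq_Re)
  also have "la (Suc k) - la k - Re s * la (Suc k) = ((1 - \<sigma>0) * la (Suc k) - la k) + (- ((Re s - \<sigma>0) * la (Suc k)))"
    by (simp add: algebra_simps)
  finally show ?thesis by (simp only: w_def exp_add)
qed

lemma w_le: 
  assumes "0 < \<epsilon>"
  obtains C where "0 < C" "\<And>k. w k \<le> C * exp (\<epsilon> * la (Suc k))"
proof -
  obtain C where C: "\<And>k. (1 - \<sigma>0) * la (Suc k) - la k \<le> C + \<epsilon> * la (Suc k)"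
    using abscissa[OF assms] by blast
  have "w k \<le> exp C * exp (\<epsilon> * la (Suc k))" for k
    using C[of k] by (simp add: w_def exp_add[symmetric])
  then show ?thesis using that[of "exp C"] by simp
qed

lemma power_le_exp:
  assumes "0 < (d::real)" "0 \<le> x"
  shows "x ^ m \<le> fact m / d ^ m * exp (d * x)"
proof -
  have "(d * x) ^ m / fact m \<le> exp (d * x)"
  proof -
    have "(\<lambda>n. (d * x) ^ n /\<^sub>R fact n) sums exp (d * x)" by (rule exp_converges)
    then have "(\<Sum>n\<in>{m}. (d * x) ^ n /\<^sub>R fact n) \<le> exp (d * x)"
      using assms by (intro sum_le_suminf[THEN order_trans] sums_unique[symmetric, THEN eq_refl])
        (auto simp: sums_iff)
    then show ?thesis by (simp add: divide_inverse mult.commute)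
  qed
  then show ?thesis using assms by (simp add: field_simps power_mult_distrib)
qed

lemma term_bound:
  assumes "\<sigma>0 < \<sigma>"
  obtains C d where "0 < C" "0 < d" "\<And>k s. \<sigma> \<le> Re s \<Longrightarrow> norm (trm m k s) \<le> C * exp (- (d * la (Suc k)))"
proof -
  \<comment> \<open>A third of the margin pays for the power of \<open>la\<close>, a third for
    \<open>w k\<close>, and the last third remains as decay.\<close>
  define d where "d = (\<sigma> - \<sigma>0) / 3"
  have d: "0 < d" using assms by (simp add: d_def)
  obtain C where C: "0 < C" "\<And>k. w k \<le> C * exp (d * la (Suc k))" using w_le[OF d] by blast
  have "norm (trm m k s) \<le> fact m / d ^ m * C * exp (- (d * la (Suc k)))" if s: "\<sigma> \<le> Re s" for k s
  proof -
    let ?x = "la (Suc k)"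
    have x: "0 \<le> ?x" by (rule la_ge_0)
    have s3: "3 * d \<le> Re s - \<sigma>0" using s by (simp add: d_def)
    have "norm (trm m k s) \<le> (fact m / d ^ m * exp (d * ?x)) * ((C * exp (d * ?x)) * exp (- ((3 * d) * ?x)))"
      unfolding norm_term using power_le_exp[OF d x, of m] C x d s3
      by (intro mult_mono) (auto simp: w_def mult_right_mono)
    also have "\<dots> = fact m / d ^ m * C * (exp (d * ?x) * exp (d * ?x) * exp (- ((3 * d) * ?x)))" by simp
    also have "exp (d * ?x) * exp (d * ?x) * exp (- ((3 * d) * ?x)) = exp (- (d * ?x))"
      by (simp add: exp_add[symmetric])
    finally show ?thesis .
  qed
  then show ?thesis using that[of "fact m / d ^ m * C" d] C d by simp
qed

lemma term_deriv: "(trm m k has_field_derivative trm (Suc m) k s) (at s)"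
proof -
  define A B where "A = complex_of_real (la (Suc k) - la k)" and "B = complex_of_real (la (Suc k))"
  have "((\<lambda>s. (- B) ^ m * (e k * exp (A - s * B))) has_field_derivative ((- B) ^ m * (e k * (exp (A - s * B) * (- B))))) (at s)"
    by (intro DERIV_cmult) (auto intro!: derivative_eq_intros)
  then show ?thesis unfolding trm_def[abs_def] A_def[symmetric] B_def[symmetric] by (simp add: algebra_simps)
qed

lemma term_summable: "\<sigma>0 < Re s \<Longrightarrow> summable (\<lambda>k. norm (trm m k s))"
proof -
  assume "\<sigma>0 < Re s"
  then obtain C d where C: "0 < C" "0 < d" "\<And>k s'. Re s \<le> Re s' \<Longrightarrow> norm (trm m k s') \<le> C * exp (- (d * la (Suc k)))"
    using term_bound by blast
  show ?thesis
    by (rule summable_comparison_test'[OF summable_mult[OF summ'[OF C(2)], of C]]) (use C(3) in simp)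
qed

lemma series_deriv:
  assumes "\<sigma>0 < Re s"
  shows "((\<lambda>s. \<Sum>k. trm m k s) has_field_derivative (\<Sum>k. trm (Suc m) k s)) (at s)"
proof -
  define S where "S = {s. \<sigma>0 < Re s}"
  have S: "open S" by (simp add: S_def open_halfspace_Re_gt)
  have "\<exists>g g'. \<forall>x \<in> S. ((\<lambda>n. trm m n x) sums g x) \<and> ((\<lambda>n. trm (Suc m) n x) sums g' x) \<and> (g has_field_derivative g' x) (at x)"
  proof (rule series_and_derivative_comparison_local[OF S term_deriv])
    fix s0 assume "s0 \<in> S"
    then have s0: "\<sigma>0 < Re s0" by (simp add: S_def)
    define \<sigma> where "\<sigma> = (\<sigma>0 + Re s0) / 2"
    have \<sigma>: "\<sigma>0 < \<sigma>" "\<sigma> < Re s0" using s0 by (auto simp: \<sigma>_def)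
    obtain C d where C: "0 < C" "0 < d" "\<And>k s'. \<sigma> \<le> Re s' \<Longrightarrow> norm (trm m k s') \<le> C * exp (- (d * la (Suc k)))"
      using term_bound[OF \<sigma>(1)] by blast
    have "norm (trm m n y) \<le> C * exp (- (d * la (Suc n)))" if "y \<in> ball s0 (Re s0 - \<sigma>) \<inter> S" for n y
    proof -
      have "Re s0 - Re y \<le> norm (s0 - y)" using complex_Re_le_cmod[of "s0 - y"] by simp
      then have "\<sigma> \<le> Re y" using that by (simp add: dist_norm)
      then show ?thesis by (rule C(3))
    qed
    then show "\<exists>d h. 0 < d \<and> summable h \<and> (\<forall>\<^sub>F n in sequentially. \<forall>y\<in>ball s0 d \<inter> S. norm (trm m n y) \<le> h n)"
      using \<sigma> summable_mult[OF summ'[OF C(2)], of C]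
      by (intro exI[of _ "Re s0 - \<sigma>"] exI[of _ "\<lambda>n. C * exp (- (d * la (Suc n)))"] conjI always_eventually) auto
  qed
  then obtain g g' where g: "\<And>x. x \<in> S \<Longrightarrow> (\<lambda>n. trm m n x) sums g x" "\<And>x. x \<in> S \<Longrightarrow> (\<lambda>n. trm (Suc m) n x) sums g' x"
     "\<And>x. x \<in> S \<Longrightarrow> (g has_field_derivative g' x) (at x)" by blast
  have sS: "s \<in> S" using assms by (simp add: S_def)
  have "((\<lambda>s. \<Sum>k. trm m k s) has_field_derivative g' s) (at s)"
    by (rule has_field_derivative_transform_within_open[OF g(3)[OF sS] S sS]) (use g(1) in \<open>auto simp: sums_iff\<close>)
  then show ?thesis using g(2)[OF sS] by (simp add: sums_iff)
qed

lemma higher_deriv_L: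
  assumes "\<sigma>0 < Re s"
  shows "(deriv ^^ m) L s = (\<Sum>k. trm m k s)"
  using assms
proof (induction m arbitrary: s)
  case 0
  then show ?case by (simp add: L_def)
next
  case (Suc m)
  have "eventually (\<lambda>x. (deriv ^^ m) L x = (\<Sum>k. trm m k x)) (nhds s)"
    using Suc by (intro eventually_nhds_in_open[of "{s. \<sigma>0 < Re s}", THEN eventually_mono] open_halfspace_Re_gt) auto
  then have "deriv ((deriv ^^ m) L) s = deriv (\<lambda>s. \<Sum>k. trm m k s) s" by (rule deriv_cong_ev) simp
  also have "\<dots> = (\<Sum>k. trm (Suc m) k s)" by (rule DERIV_imp_deriv[OF series_deriv[OF Suc.prems]])
  finally show ?case by simp
qed

lemma L_holomorphic: "L holomorphic_on {s. \<sigma>0 < Re s}"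
  unfolding L_def[abs_def] using series_deriv[of _ 0]
  by (auto simp: holomorphic_on_open open_halfspace_Re_gt)

text \<open>At distance 1 from the line, a term contributes to the m-th Taylor coefficient its
  boundary size times the Poisson probability of m with mean \<open>la (Suc k)\<close>. Choosing m
  close to one exponent thus singles out one term.\<close>

lemma term_ratio:
  assumes "Re s = \<sigma>0 + 1"
  shows "norm (trm m k s) / fact m = w k * poisson m (la (Suc k))"
  using assms by (simp add: norm_term poisson_def)

text \<open>At an index \<open>k0\<close> in front of which the exponents have a proportional gap, the Taylor coefficient
  of order \<open>\<lfloor>la (Suc k0)\<rfloor>\<close> is dominated by the single term \<open>k0\<close>: terms further left or far to the
  right are killed by the Poisson kernel, and those just to the right have small coefficients \<open>w k\<close>.\<close>

lemma other_terms:
  obtains D \<kappa> where "0 < D" "0 < \<kappa>"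
    "\<And>k0 U m. U = la (Suc k0) \<Longrightarrow> la k0 \<le> (1 - \<sigma>0 / 2) * U \<Longrightarrow> 1 \<le> U \<Longrightarrow> m = nat \<lfloor>U\<rfloor> \<Longrightarrow>
       (\<Sum>k. if k = k0 then 0 else w k * poisson m (la (Suc k))) \<le> D * exp (- (\<kappa> * U)) * poisson m U"
proof -
  \<comment> \<open>a lies strictly between the gap ratio 1 - \<open>\<sigma>0\<close> and 1, so
    everything in front of the gap is left of the peak. b is close enough to 1 that (1 -
    \<open>\<sigma>0\<close>) b - 1 <= -\<open>\<sigma>0\<close> / 2.\<close>
  define a where "a = 1 - \<sigma>0 / 2"
  define b where "b = 1 + \<sigma>0 / 2"
  define \<kappa>1 where "\<kappa>1 = a - 1 - ln a"
  define \<kappa>2 where "\<kappa>2 = (1 - ln b / (b - 1)) * (1 - 1 / b)"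
  have a: "0 < a" "a < 1" and b: "1 < b" "b \<le> 2" using sigma0 by (auto simp: a_def b_def)
  have k1: "0 < \<kappa>1" unfolding \<kappa>1_def using ln_le_minus_one[of a] ln_eq_minus_one[of a] a
    by (cases "ln a = a - 1") auto
  have k2: "0 < \<kappa>2" unfolding \<kappa>2_def using ln_le_minus_one[of b] ln_eq_minus_one[of b] b
    by (intro mult_pos_pos) (cases "ln b = b - 1"; auto simp: divide_less_eq)+
  \<comment> \<open>The smallest of the three decay rates available. The growth of \<open>w\<close>
    is allowed an eighth of it, which leaves \<open>\<kappa>\<close> = \<open>\<mu>\<close> / 2 as
    decay in U and \<open>\<epsilon>\<close> as decay in the exponent, for summing over k.\<close>
  define \<mu> where "\<mu> = min (min \<kappa>1 \<kappa>2) (\<sigma>0 / 2)"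
  have \<mu>: "0 < \<mu>" "\<mu> \<le> \<kappa>1" "\<mu> \<le> \<kappa>2" "\<mu> \<le> \<sigma>0 / 2" using k1 k2 sigma0 by (auto simp: \<mu>_def)
  define \<epsilon> where "\<epsilon> = \<mu> / 8"
  define \<kappa> where "\<kappa> = \<mu> / 2"
  have \<epsilon>: "0 < \<epsilon>" "\<mu> = 8 * \<epsilon>" "\<kappa> = 4 * \<epsilon>" using \<mu> by (auto simp: \<epsilon>_def \<kappa>_def)
  obtain C where C: "0 < C" "\<And>k. w k \<le> C * exp (\<epsilon> * la (Suc k))" using w_le[OF \<epsilon>(1)] by blast
  define D1 where "D1 = C * (exp 1 / a) + 1 + C"
  have D1: "0 < D1" "1 \<le> D1" "C \<le> D1" "C * (exp 1 / a) \<le> D1" using C a by (auto simp: D1_def add_pos_pos)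
  define S where "S = (\<Sum>k. exp (- (\<epsilon> * la (Suc k))))"
  have S: "0 \<le> S" unfolding S_def by (intro suminf_nonneg summ' \<epsilon>) auto
  have main: "w k * poisson m (la (Suc k)) \<le> D1 * exp (- (\<kappa> * U)) * exp (- (\<epsilon> * la (Suc k))) * poisson m U"
    if U: "U = la (Suc k0)" "la k0 \<le> a * U" "1 \<le> U" "m = nat \<lfloor>U\<rfloor>" and k: "k \<noteq> k0" for k0 U m k
  proof -
    define x where "x = la (Suc k)"
    have kU: "\<kappa> * U = 4 * (\<epsilon> * U)" "\<mu> * U = 8 * (\<epsilon> * U)" "\<mu> * y = 8 * (\<epsilon> * y)" for y using \<epsilon> by simp_all
    have eU0: "0 \<le> \<epsilon> * U" using \<epsilon> U(3) by simp
    have x: "0 \<le> x" by (simp add: x_def la_ge_0)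
    have pU: "0 \<le> poisson m U" using U by (intro poisson_nonneg) auto
    have wk: "w k \<le> C * exp (\<epsilon> * x)" "0 \<le> w k" using C by (auto simp: x_def w_def)
    have "\<exists>p q. w k \<le> p \<and> poisson m x \<le> q * poisson m U \<and> 0 \<le> p \<and> p * q \<le> D1 * exp (- (\<kappa> * U)) * exp (- (\<epsilon> * x))"
    proof (cases "k < k0")
      case True
      \<comment> \<open>In front of the gap: the exponent is at most \<open>la k0\<close>, hence
        well left of the peak.\<close>
      then have "x \<le> la k0" unfolding x_def by (intro la_le) auto
      then have xa: "x \<le> a * U" using U by simp
      have "a * U \<le> 1 * U" using a U(3) by (intro mult_right_mono) auto
      then have xU: "x \<le> U" using xa by linarith
      have eU: "\<epsilon> * x \<le> \<epsilon> * U" using xU \<epsilon> by simp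
      have "C * exp (\<epsilon> * x) * (exp 1 / a * exp (- (\<kappa>1 * U))) = C * (exp 1 / a) * exp (\<epsilon> * x - \<kappa>1 * U)"
        by (simp add: exp_diff exp_minus divide_inverse)
      also have "\<dots> \<le> D1 * exp (- (\<kappa> * U) - \<epsilon> * x)"
      proof (intro mult_mono D1(4))
        have "\<mu> * U \<le> \<kappa>1 * U" using \<mu> U by (intro mult_right_mono) auto
        then have "\<epsilon> * x - \<kappa>1 * U \<le> - (\<kappa> * U) - \<epsilon> * x" using eU kU eU0 by linarith
        then show "exp (\<epsilon> * x - \<kappa>1 * U) \<le> exp (- (\<kappa> * U) - \<epsilon> * x)" by simp
      qed (use D1 in auto)
      finally have "C * exp (\<epsilon> * x) * (exp 1 / a * exp (- (\<kappa>1 * U))) \<le> D1 * exp (- (\<kappa> * U)) * exp (- (\<epsilon> * x))"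
        by (simp add: exp_diff exp_minus divide_inverse mult.assoc)
      moreover have "poisson m x \<le> exp 1 / a * exp (- (\<kappa>1 * U)) * poisson m U"
        unfolding \<kappa>1_def using poisson_left[OF a x xa U(3,4)] .
      ultimately show ?thesis using wk C(1) by (intro exI[of _ "C * exp (\<epsilon> * x)"] exI[of _ "exp 1 / a * exp (- (\<kappa>1 * U))"] conjI) auto
    next
      case False
      with k have gt: "k0 < k" by simp
      then have lak: "U \<le> la k" unfolding U(1) by (intro la_le) auto
      then have Ux: "U \<le> x" using la_mono[of k] by (simp add: x_def)
      show ?thesis
      proof (cases "x \<le> b * U")
        case True
        \<comment> \<open>Just right of the peak the Poisson kernel gives nothing. But k > k0 forces
          \<open>la k \<ge> U\<close>, and \<open>la k\<close> enters \<open>w k\<close> negatively,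
          so the coefficient itself is exponentially small in U.\<close>
        have "(1 - \<sigma>0) * x \<le> (1 - \<sigma>0) * (b * U)" using True sigma0 by (intro mult_left_mono) auto
        moreover have "(1 - \<sigma>0) * b - 1 \<le> - (\<sigma>0 / 2)" using sigma0 by (simp add: b_def algebra_simps)
        then have "((1 - \<sigma>0) * b - 1) * U \<le> - (\<sigma>0 / 2) * U" using U(3) by (intro mult_right_mono) auto
        ultimately have "(1 - \<sigma>0) * x - la k \<le> - (\<sigma>0 / 2 * U)" using lak by (simp add: algebra_simps)
        moreover have "\<mu> * U \<le> \<sigma>0 / 2 * U" using \<mu> U by (intro mult_right_mono) auto
        moreover have "\<epsilon> * x \<le> \<epsilon> * (2 * U)" 
        proof (intro mult_left_mono)
          have "b * U \<le> 2 * U" using b U(3) by (intro mult_right_mono) auto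
          then show "x \<le> 2 * U" using True by linarith
        qed (use \<epsilon> in auto)
        ultimately have "(1 - \<sigma>0) * x - la k \<le> - (\<kappa> * U) - \<epsilon> * x" using kU(1,2) eU0 by linarith
        then have "w k \<le> exp (- (\<kappa> * U) - \<epsilon> * x)" by (simp add: w_def x_def)
        also have "\<dots> = 1 * (exp (- (\<kappa> * U)) * exp (- (\<epsilon> * x)))" by (simp add: exp_diff exp_minus divide_inverse)
        also have "\<dots> \<le> D1 * (exp (- (\<kappa> * U)) * exp (- (\<epsilon> * x)))" using D1 by (intro mult_right_mono) auto
        finally have "w k \<le> D1 * exp (- (\<kappa> * U)) * exp (- (\<epsilon> * x))" by (simp add: mult.assoc)
        moreover have "poisson m x \<le> 1 * poisson m U" using poisson_right[OF Ux U(3,4)] by simp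
        ultimately show ?thesis using wk by (intro exI[of _ "w k"] exI[of _ 1] conjI) auto
      next
        case False
        \<comment> \<open>Far to the right the kernel decays like exp(-\<open>\<kappa>2\<close> x),
          which beats the growth exp(\<open>\<epsilon>\<close> x) of the coefficient.\<close>
        then have xb: "b * U \<le> x" by simp
        have "C * exp (\<epsilon> * x) * exp (- (\<kappa>2 * x)) = C * exp (\<epsilon> * x - \<kappa>2 * x)"
          by (simp add: exp_diff exp_minus divide_inverse)
        also have "\<dots> \<le> D1 * exp (- (\<kappa> * U) - \<epsilon> * x)"
        proof (intro mult_mono D1(3))
          have "\<mu> * x \<le> \<kappa>2 * x" using \<mu> x by (intro mult_right_mono) auto
          moreover have "\<epsilon> * U \<le> \<epsilon> * x" using Ux \<epsilon> by simp
          moreover have "0 \<le> \<epsilon> * x" using x \<epsilon> by simp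
          ultimately have "\<epsilon> * x - \<kappa>2 * x \<le> - (\<kappa> * U) - \<epsilon> * x" using kU(1) kU(3)[of x] by linarith
          then show "exp (\<epsilon> * x - \<kappa>2 * x) \<le> exp (- (\<kappa> * U) - \<epsilon> * x)" by simp
        qed (use D1 in auto)
        finally have "C * exp (\<epsilon> * x) * exp (- (\<kappa>2 * x)) \<le> D1 * exp (- (\<kappa> * U)) * exp (- (\<epsilon> * x))"
          by (simp add: exp_diff exp_minus divide_inverse mult.assoc)
        moreover have "poisson m x \<le> exp (- (\<kappa>2 * x)) * poisson m U"
          unfolding \<kappa>2_def using poisson_far_right[OF b(1) xb U(3,4)] .
        ultimately show ?thesis using wk C(1) by (intro exI[of _ "C * exp (\<epsilon> * x)"] exI[of _ "exp (- (\<kappa>2 * x))"] conjI) auto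
      qed
    qed
    then obtain p q where pq: "w k \<le> p" "poisson m x \<le> q * poisson m U" "0 \<le> p" "p * q \<le> D1 * exp (- (\<kappa> * U)) * exp (- (\<epsilon> * x))" by blast
    have "w k * poisson m x \<le> p * (q * poisson m U)" using pq wk x by (intro mult_mono poisson_nonneg) auto
    also have "\<dots> = p * q * poisson m U" by simp
    also have "\<dots> \<le> D1 * exp (- (\<kappa> * U)) * exp (- (\<epsilon> * x)) * poisson m U" using pq pU by (intro mult_right_mono) auto
    finally show ?thesis by (simp add: x_def)
  qed
  show ?thesis
  proof (rule that[of "D1 * S + 1" \<kappa>])
    show "0 < D1 * S + 1" using D1 S by (simp add: add_nonneg_pos)
    show "0 < \<kappa>" using \<epsilon> by simp
    fix k0 U m assume U: "U = la (Suc k0)" "la k0 \<le> (1 - \<sigma>0 / 2) * U" "1 \<le> U" "m = nat \<lfloor>U\<rfloor>"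
    let ?f = "\<lambda>k. if k = k0 then 0 else w k * poisson m (la (Suc k))"
    let ?g = "\<lambda>k. D1 * exp (- (\<kappa> * U)) * exp (- (\<epsilon> * la (Suc k))) * poisson m U"
    have pU: "0 \<le> poisson m U" using U by (intro poisson_nonneg) auto
    have sg: "summable ?g" by (intro summable_mult summable_mult2 summ' \<epsilon>)
    have le: "?f k \<le> ?g k" for k using main[OF U(1) _ U(3,4), of k] U(2) D1 pU by (auto simp: a_def)
    have nf: "0 \<le> ?f k" for k using la_ge_0 by (auto simp: w_def intro!: mult_nonneg_nonneg poisson_nonneg)
    have sf: "summable ?f" by (rule summable_comparison_test'[OF sg]) (use le nf in \<open>simp only: real_norm_def abs_of_nonneg\<close>)
    have "suminf ?f \<le> suminf ?g" by (rule suminf_le[OF le sf sg])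
    also have "suminf ?g = D1 * exp (- (\<kappa> * U)) * S * poisson m U"
      unfolding S_def by (intro sums_unique[symmetric] sums_mult sums_mult2 summable_sums summ' \<epsilon>)
    also have "\<dots> = D1 * S * (exp (- (\<kappa> * U)) * poisson m U)" by simp
    also have "\<dots> \<le> (D1 * S + 1) * (exp (- (\<kappa> * U)) * poisson m U)" using pU by (intro mult_right_mono) auto
    finally show "suminf ?f \<le> (D1 * S + 1) * exp (- (\<kappa> * U)) * poisson m U" by (simp add: mult.assoc)
  qed
qed

text \<open>A continuation regular at one point of the line enlarges the Taylor disc about the point
  one unit to its right, so the Taylor coefficients decay geometrically. Behind a gap, however, a
  coefficient is essentially one term at the peak of its Poisson weight and decays at an arbitrarily
  small rate.\<close>

theorem no_meromorphic_continuation: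
  assumes mero: "Lm meromorphic_on {s. x1 < Re s}" and x1: "x1 < \<sigma>0"
    and U: "open U" "U \<noteq> {}" "U \<subseteq> {s. \<sigma>0 < Re s}" and eq: "\<And>s. s \<in> U \<Longrightarrow> Lm s = L s"
  shows False
proof -
  define Hp where "Hp = {s::complex. \<sigma>0 < Re s}"
  have Hp: "open Hp" "connected Hp" by (auto simp: Hp_def open_halfspace_Re_gt convex_halfspace_Re_gt convex_connected)
  have sub: "Hp \<subseteq> {s. x1 < Re s}" using x1 by (auto simp: Hp_def)
  have "(\<lambda>s. Lm s - L s) meromorphic_on Hp"
    using mero sub L_holomorphic Hp
    by (intro meromorphic_intros meromorphic_on_subset[OF mero] analytic_on_imp_meromorphic_on)
      (auto simp: analytic_on_open Hp_def[symmetric])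
  from meromorphic_imp_constant_or_avoid[OF this Hp, of 0]
  have "eventually (\<lambda>s. Lm s - L s = 0) (cosparse Hp)"
  proof
    assume ne: "eventually (\<lambda>s. Lm s - L s \<noteq> 0) (cosparse Hp)"
    obtain u where u: "u \<in> U" using U by blast
    have "u \<in> Hp" using U(3) u unfolding Hp_def by (rule subsetD)
    then have "eventually (\<lambda>s. Lm s - L s \<noteq> 0) (at u)"
      using ne[unfolded eventually_cosparse_open_eq[OF Hp(1)]] by (rule bspec[rotated])
    moreover have "eventually (\<lambda>s. s \<in> U) (at u)" using U u by (intro eventually_at_in_open') auto
    ultimately have "eventually (\<lambda>s. False) (at u)" by eventually_elim (use eq in auto)
    then show ?thesis by simp
  qed
  then have ev: "eventually (\<lambda>s. Lm s = L s) (at z)" if "z \<in> Hp" for z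
    using that by (simp add: eventually_cosparse_open_eq[OF Hp(1)])
  \<comment> \<open>The real point itself may be a pole. Singularities do not accumulate there, so a
    point of the line slightly above it is regular.\<close>
  have "\<not> of_real \<sigma>0 islimpt {w. \<not> Lm analytic_on {w}}"
    by (rule meromorphic_on_imp_not_islimpt_singularities[OF mero]) (use x1 in auto)
  then obtain \<eta>0 where \<eta>0: "0 < \<eta>0" "\<And>z. z \<noteq> of_real \<sigma>0 \<Longrightarrow> dist z (of_real \<sigma>0) < \<eta>0 \<Longrightarrow> Lm analytic_on {z}"
    unfolding islimpt_approachable by blast
  define s0 where "s0 = Complex \<sigma>0 (\<eta>0 / 2)"
  have "s0 \<noteq> of_real \<sigma>0" using \<eta>0 by (auto simp: s0_def complex_eq_iff)
  moreover have "dist s0 (of_real \<sigma>0) < \<eta>0" using \<eta>0 by (simp add: s0_def dist_norm cmod_def)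
  ultimately have "Lm analytic_on {s0}" by (rule \<eta>0(2))
  then obtain \<eta> where \<eta>: "0 < \<eta>" "Lm holomorphic_on ball s0 \<eta>" by (auto simp: analytic_on_def)
  have agree: "Lm z = L z" if z: "z \<in> ball s0 \<eta> \<inter> Hp" for z
  proof -
    have zin: "z \<in> ball s0 \<eta>" "z \<in> Hp" using z by auto
    have "Lm \<midarrow>z\<rightarrow> Lm z" using \<eta>(2) zin by (meson continuous_on_eq_continuous_at holomorphic_on_imp_continuous_on isCont_def open_ball)
    moreover have "L \<midarrow>z\<rightarrow> L z" using L_holomorphic Hp zin unfolding Hp_def[symmetric] by (meson continuous_on_eq_continuous_at holomorphic_on_imp_continuous_on isCont_def)
    then have "Lm \<midarrow>z\<rightarrow> L z" by (rule Lim_transform_eventually) (use ev[OF zin(2)] in \<open>auto elim: eventually_mono\<close>)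
    ultimately show ?thesis by (rule LIM_unique)
  qed
  \<comment> \<open>A meromorphic function may carry arbitrary values at isolated points, so
    \<open>Lm\<close> agrees with \<open>L\<close> in the half-plane only off a sparse set. Gluing
    with \<open>L\<close> itself gives an honestly holomorphic function.\<close>
  define H where "H = (\<lambda>s. if \<sigma>0 < Re s then L s else Lm s)"
  define V where "V = Hp \<union> ball s0 \<eta>"
  have "H holomorphic_on Hp \<union> ball s0 \<eta>"
  proof (rule holomorphic_on_Un)
    show "H holomorphic_on Hp" using L_holomorphic[folded Hp_def] by (rule holomorphic_transform) (auto simp: H_def Hp_def)
    show "H holomorphic_on ball s0 \<eta>" using \<eta>(2) by (rule holomorphic_transform) (use agree in \<open>auto simp: H_def Hp_def\<close>)
  qed (use Hp in auto)
  then have H: "H holomorphic_on V" by (simp add: V_def)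
  define s1 where "s1 = s0 + 1"
  \<comment> \<open>This disc meets the line Re s = \<open>\<sigma>0\<close> only at
    \<open>s0\<close>, and there the small ball covers it.\<close>
  have "cball s1 1 \<subseteq> V"
  proof
    fix z assume "z \<in> cball s1 1"
    then have n: "norm (z - s1) \<le> 1" by (simp add: dist_norm norm_minus_commute)
    show "z \<in> V"
    proof (cases "\<sigma>0 < Re z")
      case False
      have 1: "Re (s1 - z) \<ge> 1" using False by (simp add: s1_def s0_def)
      have "(Re (s1 - z))\<^sup>2 + (Im (s1 - z))\<^sup>2 \<le> 1"
        using n power_mono[of "norm (z - s1)" 1 2] cmod_power2[of "s1 - z"] by (simp add: norm_minus_commute)
      moreover have "1 \<le> (Re (s1 - z))\<^sup>2" using power_mono[OF 1, of 2] by simp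
      ultimately have "(Im (s1 - z))\<^sup>2 \<le> 0" "(Re (s1 - z))\<^sup>2 \<le> 1" using zero_le_power2[of "Im (s1 - z)"] by linarith+
      then have "Im (s1 - z) = 0" "Re (s1 - z) = 1" using 1 by (auto simp: power2_le_iff_abs_le abs_le_iff) (metis abs_square_le_1 abs_le_D1 order_antisym)
      then have "z = s0" by (simp add: s1_def complex_eq_iff)
      then show ?thesis using \<eta> by (simp add: V_def)
    qed (simp add: V_def Hp_def)
  qed
  moreover have "open V" using Hp by (simp add: V_def open_Un)
  \<comment> \<open>By compactness the disc can be enlarged by some r. The series alone guarantees
    only radius 1, so r is the gain that leads to the contradiction.\<close>
  ultimately obtain r where r: "0 < r" "(\<Union>x\<in>cball s1 1. cball x r) \<subseteq> V"
    using compact_subset_open_imp_cball_epsilon_subset[OF compact_cball] by blast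
  have rV: "cball s1 (1 + r) \<subseteq> V"
  proof
    fix z assume z: "z \<in> cball s1 (1 + r)"
    define x where "x = s1 + (1 / (1 + r)) *\<^sub>R (z - s1)"
    have n: "norm (z - s1) \<le> 1 + r" using z by (simp add: dist_norm norm_minus_commute)
    have "norm (x - s1) = norm (z - s1) / (1 + r)" using r by (simp add: x_def)
    then have x1: "norm (x - s1) \<le> 1" using n r by simp
    have "z - x = (r / (1 + r)) *\<^sub>R (z - s1)"
    proof -
      have "1 - 1 / (1 + r) = r / (1 + r)" using r by (simp add: field_simps)
      then have "(r / (1 + r)) *\<^sub>R (z - s1) = (z - s1) - (1 / (1 + r)) *\<^sub>R (z - s1)" by (metis scaleR_left_diff_distrib scaleR_one)
      then show ?thesis by (simp add: x_def)
    qed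
    then have "norm (z - x) = r / (1 + r) * norm (z - s1)" using r by simp
    also have "\<dots> \<le> r / (1 + r) * (1 + r)" using n r by (intro mult_left_mono) auto
    finally have "norm (z - x) \<le> r" using r by simp
    with x1 have "x \<in> cball s1 1" "z \<in> cball x r" by (auto simp: dist_norm norm_minus_commute)
    then show "z \<in> V" using r by blast
  qed
  have cont: "continuous_on (cball s1 (1 + r)) H" using H rV holomorphic_on_imp_continuous_on holomorphic_on_subset by blast
  then have "compact (H ` cball s1 (1 + r))" by (rule compact_continuous_image) simp
  then obtain B where B: "0 < B" "\<And>z. z \<in> cball s1 (1 + r) \<Longrightarrow> norm (H z) \<le> B"
    by (auto dest!: compact_imp_bounded simp: bounded_pos)
  have Re1: "Re s1 = \<sigma>0 + 1" by (simp add: s1_def s0_def)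
  have dH: "(deriv ^^ m) H s1 = (\<Sum>k. trm m k s1)" for m
  proof -
    have "eventually (\<lambda>x. H x = L x) (nhds s1)"
      by (rule eventually_nhds_in_open[of Hp, THEN eventually_mono]) (use Hp Re1 in \<open>auto simp: H_def Hp_def\<close>)
    then have "(deriv ^^ m) H s1 = (deriv ^^ m) L s1" by (rule higher_deriv_cong_ev) simp
    then show ?thesis using higher_deriv_L[of s1 m] Re1 by simp
  qed
  have cauchy: "norm (\<Sum>k. trm m k s1) / fact m \<le> B / (1 + r) ^ m" for m
  proof -
    have "norm ((deriv ^^ m) H s1) \<le> fact m * B / (1 + r) ^ m"
    proof (rule Cauchy_inequality[OF _ cont])
      show "H holomorphic_on ball s1 (1 + r)" using H rV by (meson ball_subset_cball holomorphic_on_subset order_trans)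
      show "norm (H x) \<le> B" if "norm (s1 - x) = 1 + r" for x using that by (intro B) (simp add: dist_norm)
    qed (use r in auto)
    then show ?thesis by (simp add: dH field_simps)
  qed
  obtain D \<kappa> where D: "0 < D" "0 < \<kappa>"
    "\<And>k0 U m. U = la (Suc k0) \<Longrightarrow> la k0 \<le> (1 - \<sigma>0 / 2) * U \<Longrightarrow> 1 \<le> U \<Longrightarrow> m = nat \<lfloor>U\<rfloor> \<Longrightarrow>
       (\<Sum>k. if k = k0 then 0 else w k * poisson m (la (Suc k))) \<le> D * exp (- (\<kappa> * U)) * poisson m U"
    using other_terms by blast
  define \<rho> where "\<rho> = ln (1 + r)"
  have \<rho>: "0 < \<rho>" using r by (simp add: \<rho>_def)
  \<comment> \<open>Below \<open>\<kappa>\<close> so that the chosen term dominates the others,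
    below \<open>\<rho>\<close> so that it contradicts Cauchy's bound, and at most
    \<open>\<sigma>0\<close> / 2 so that the gap is wide enough for
    \<open>other_terms\<close>.\<close>
  define \<epsilon> where "\<epsilon> = min (min (\<kappa> / 2) (\<rho> / 2)) (\<sigma>0 / 2)"
  have \<epsilon>: "0 < \<epsilon>" "\<epsilon> \<le> \<kappa> / 2" "\<epsilon> \<le> \<rho> / 2" "\<epsilon> \<le> \<sigma>0 / 2" using D \<rho> sigma0 by (auto simp: \<epsilon>_def)
  define K where "K = 2 * exp 2 * B * (1 + r)"
  have K: "0 < K" using B r by (simp add: K_def)
  \<comment> \<open>U >= 4 D / \<open>\<kappa>\<close> makes the other terms at most half of the
    chosen one. U > 8 K / \<open>\<rho>\<close>^2 contradicts exp(\<open>\<rho>\<close> U / 2) <= K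
    U, as the exponential exceeds its quadratic Taylor term.\<close>
  define U1 where "U1 = max (max 1 (4 * D / \<kappa>)) (8 * K / \<rho>\<^sup>2 + 1)"
  have "eventually (\<lambda>k. U1 \<le> la (Suc k)) sequentially"
    using filterlim_compose[OF la_at_top filterlim_Suc] by (auto simp: filterlim_at_top)
  from frequently_eventually_conj[OF gaps[OF \<epsilon>(1)] this]
  obtain k0 where k0: "la k0 \<le> (1 - \<sigma>0 + \<epsilon>) * la (Suc k0)" "U1 \<le> la (Suc k0)"
    by (auto dest: frequently_ex)
  define u where "u = la (Suc k0)"
  have u: "1 \<le> u" "4 * D / \<kappa> \<le> u" "8 * K / \<rho>\<^sup>2 < u" using k0(2) by (auto simp: U1_def u_def)
  define m where "m = nat \<lfloor>u\<rfloor>"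
  have "(1 - \<sigma>0 + \<epsilon>) * u \<le> (1 - \<sigma>0 / 2) * u" using \<epsilon> u by (intro mult_right_mono) auto
  then have gap: "la k0 \<le> (1 - \<sigma>0 / 2) * u" using k0(1) by (simp add: u_def)
  have pu: "0 < poisson m u" using u by (simp add: poisson_def)
  define f where "f = (\<lambda>k. if k = k0 then 0 else trm m k s1)"
  have sn: "summable (\<lambda>k. norm (trm m k s1))" using term_summable[of s1 m] Re1 by simp
  have sf: "summable (\<lambda>k. norm (f k))" by (rule summable_comparison_test'[OF sn]) (simp add: f_def)
  have "(\<Sum>k. trm m k s1) = (\<Sum>k. f k) + trm m k0 s1"
  proof -
    have "(\<lambda>k. f k + (if k = k0 then trm m k s1 else 0)) sums ((\<Sum>k. f k) + trm m k0 s1)"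
      using summable_sums[OF summable_norm_cancel[OF sf]] sums_single[of k0 "\<lambda>k. trm m k s1"]
      by (intro sums_add)
    moreover have "(\<lambda>k. f k + (if k = k0 then trm m k s1 else 0)) = (\<lambda>k. trm m k s1)" by (auto simp: f_def)
    ultimately show ?thesis by (simp only: sums_iff)
  qed
  then have "norm (trm m k0 s1) \<le> norm (\<Sum>k. trm m k s1) + norm (\<Sum>k. f k)"
    by (metis add_diff_cancel_left' norm_triangle_ineq4)
  also have "norm (\<Sum>k. f k) \<le> (\<Sum>k. norm (f k))" by (rule summable_norm[OF sf])
  finally have "norm (trm m k0 s1) / fact m \<le> norm (\<Sum>k. trm m k s1) / fact m + (\<Sum>k. norm (f k)) / fact m"
    by (simp add: add_divide_distrib[symmetric] divide_right_mono)
  also have "(\<Sum>k. norm (f k)) / fact m = (\<Sum>k. if k = k0 then 0 else w k * poisson m (la (Suc k)))"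
  proof -
    have "(\<Sum>k. norm (f k)) / fact m = (\<Sum>k. norm (f k) / fact m)" using sf by (rule suminf_divide[symmetric])
    also have "\<dots> = (\<Sum>k. if k = k0 then 0 else w k * poisson m (la (Suc k)))"
      using term_ratio[OF Re1] by (intro suminf_cong) (simp add: f_def)
    finally show ?thesis .
  qed
  finally have "w k0 * poisson m u \<le> B / (1 + r) ^ m + D * exp (- (\<kappa> * u)) * poisson m u"
    using cauchy[of m] D(3)[OF u_def gap u(1) m_def] term_ratio[OF Re1, of m k0] by (simp add: u_def[symmetric])
  moreover have "exp (- (\<epsilon> * u)) * poisson m u \<le> w k0 * poisson m u"
    using k0(1) pu by (intro mult_right_mono) (auto simp: w_def u_def[symmetric] algebra_simps)
  moreover have "D * exp (- (\<kappa> * u)) * poisson m u \<le> 1 / 2 * exp (- (\<epsilon> * u)) * poisson m u"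
  proof (intro mult_right_mono)
    have "2 * D \<le> \<kappa> / 2 * u" using u D by (simp add: field_simps)
    also have "\<dots> \<le> exp (\<kappa> / 2 * u)" using exp_ge_add_one_self[of "\<kappa> / 2 * u"] by linarith
    also have "\<dots> \<le> exp ((\<kappa> - \<epsilon>) * u)" using \<epsilon> u by (simp add: mult_right_mono)
    finally have "2 * D * exp (- (\<kappa> * u)) \<le> exp ((\<kappa> - \<epsilon>) * u) * exp (- (\<kappa> * u))" by (intro mult_right_mono) auto
    then show "D * exp (- (\<kappa> * u)) \<le> 1 / 2 * exp (- (\<epsilon> * u))" by (simp add: exp_add[symmetric] algebra_simps)
  qed (use pu in auto)
  ultimately have "1 / 2 * exp (- (\<epsilon> * u)) * poisson m u \<le> B / (1 + r) ^ m" by linarith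
  moreover have "1 / 2 * exp (- (\<rho> / 2 * u)) * (1 / (exp 2 * u)) \<le> 1 / 2 * exp (- (\<epsilon> * u)) * poisson m u"
    using poisson_ge[OF u(1) m_def] \<epsilon> u by (intro mult_mono) auto
  moreover have "B / (1 + r) ^ m \<le> B * (1 + r) * exp (- (\<rho> * u))"
  proof -
    have "u \<le> real (Suc m)" using u by (simp add: m_def) linarith
    then have "exp (\<rho> * u) \<le> exp (\<rho> * real (Suc m))" using \<rho> by simp
    also have "\<dots> = (1 + r) ^ Suc m" using r by (simp only: \<rho>_def mult.commute[of "ln (1 + r)"] exp_of_nat_mult) simp
    finally have "B * exp (\<rho> * u) \<le> B * (1 + r) ^ Suc m" using B by (intro mult_left_mono) auto
    then show ?thesis using r B by (simp add: field_simps exp_minus)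
  qed
  ultimately have "1 / 2 * exp (- (\<rho> / 2 * u)) * (1 / (exp 2 * u)) \<le> B * (1 + r) * exp (- (\<rho> * u))" by linarith
  then have "1 / 2 * exp (- (\<rho> / 2 * u)) * (1 / (exp 2 * u)) * (2 * exp 2 * u * exp (\<rho> * u)) \<le> B * (1 + r) * exp (- (\<rho> * u)) * (2 * exp 2 * u * exp (\<rho> * u))"
    using u by (intro mult_right_mono) auto
  moreover have "1 / 2 * exp (- (\<rho> / 2 * u)) * (1 / (exp 2 * u)) * (2 * exp 2 * u * exp (\<rho> * u)) = exp (\<rho> / 2 * u)"
    using u by (simp add: exp_add[symmetric])
  moreover have "B * (1 + r) * exp (- (\<rho> * u)) * (2 * exp 2 * u * exp (\<rho> * u)) = K * u"
    by (simp add: K_def exp_minus)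
  ultimately have "exp (\<rho> / 2 * u) \<le> K * u" by simp
  moreover have "0 \<le> \<rho> / 2 * u" using u \<rho> by simp
  then have "(\<rho> / 2 * u)\<^sup>2 / 2 \<le> exp (\<rho> / 2 * u)"
    using exp_lower_Taylor_quadratic[of "\<rho> / 2 * u"] by linarith
  moreover have "(\<rho> / 2 * u)\<^sup>2 / 2 = \<rho>\<^sup>2 / 8 * u * u" by (simp add: power2_eq_square)
  ultimately have "\<rho>\<^sup>2 / 8 * u * u \<le> K * u" by linarith
  then have "\<rho>\<^sup>2 / 8 * u \<le> K" using u by simp
  then show False using u(3) \<rho> by (simp add: field_simps)
qed

end

section \<open>Continuation up to the line of abscissa minus iota\<close>

lemma holomorphic_taylor_split:
  assumes "f holomorphic_on ball 0 R" "0 < R"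
  obtains g where "g holomorphic_on ball 0 R" "\<And>z. f z = f 0 + z * g z"
proof -
  define g where "g = (\<lambda>z. if z = 0 then deriv f 0 else (f z - f 0) / (z - 0))"
  have "g holomorphic_on ball 0 R" unfolding g_def by (rule pole_lemma_open[OF assms(1)]) simp
  moreover have "f z = f 0 + z * g z" for z by (simp add: g_def)
  ultimately show ?thesis using that by blast
qed

lemma holomorphic_bounded_unit:
  assumes "f holomorphic_on ball 0 R" "1 < R"
  obtains B where "0 < B" "\<And>t. 0 \<le> t \<Longrightarrow> t \<le> 1 \<Longrightarrow> norm (f (complex_of_real t)) \<le> B"
proof -
  have "cball 0 1 \<subseteq> ball (0::complex) R" using assms by auto
  then have "continuous_on (cball 0 1) f" using assms holomorphic_on_imp_continuous_on holomorphic_on_subset by blast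
  then have "compact (f ` cball 0 1)" by (rule compact_continuous_image) simp
  then obtain B where B: "0 < B" "\<And>z. z \<in> cball 0 1 \<Longrightarrow> norm (f z) \<le> B"
    by (auto dest!: compact_imp_bounded simp: bounded_pos)
  show ?thesis by (rule that[OF B(1)]) (use B(2) in auto)
qed

lemma mellin_const:
  assumes "0 < Re s"
  shows "mellin {0<..1} (\<lambda>t. c) s = c / s" and "mellin_conv {0<..1} (\<lambda>t. c) s"
  using mellin_cmult[of "{0<..1}" c "\<lambda>_. 1" s] mellin_conv_cmult[of "{0<..1}" "\<lambda>_. 1" s c] mellin_one[of s 1] assms by auto

lemma mellin_inverse_t:
  assumes "1 < Re s"
  shows "mellin {0<..1} (\<lambda>t. c / of_real t) s = c / (s - 1)" and "mellin_conv {0<..1} (\<lambda>t. c / of_real t) s"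
proof -
  have "{0<..1::real} \<subseteq> {0<..}" by auto
  then show "mellin {0<..1} (\<lambda>t. c / of_real t) s = c / (s - 1)" "mellin_conv {0<..1} (\<lambda>t. c / of_real t) s"
    using mellin_const[of "s - 1" c] mellin_divide_t[of "{0<..1}" "\<lambda>t. c" s] assms by auto
qed

lemma Gamma_rGamma: "0 < Re s \<Longrightarrow> rGamma s * Gamma s = 1" for s :: complex
proof -
  assume "0 < Re s"
  then have "s \<notin> \<int>\<^sub>\<le>\<^sub>0" by (auto elim!: nonpos_Ints_cases)
  then show ?thesis by (simp add: rGamma_inverse_Gamma Gamma_eq_zero_iff)
qed

context irrational_number
begin

section \<open>The exponent 1 / tau and the growth of consecutive denominators\<close>

definition iota :: real where "iota = real_of_ereal (1 / cf_tau \<alpha>)"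

lemma cf_tau_eq: "cf_tau \<alpha> = limsup (\<lambda>n. ereal (ln (Q (Suc n)) / ln (Q n)))"
  by (simp add: cf_tau_def cf_denom_def)

lemma ln_Q_pos: "2 \<le> n \<Longrightarrow> 0 < ln (Q n)"
proof -
  assume "2 \<le> n"
  then obtain m where "n = Suc (Suc m)" by (metis Suc_le_D numeral_2_eq_2 le_Suc_ex add_2_eq_Suc)
  then have "2 \<le> Q n" using Q_double[of m] Q_ge_1[of m] by simp
  then show ?thesis by simp
qed

lemma ln_Q_le: "ln (Q n) \<le> ln (Q (Suc n))"
  using Q_le_Suc[of n] Q_pos[of n] by simp

lemma ln_Q_nonneg: "0 \<le> ln (Q n)"
  using Q_ge_1[of n] by simp

lemma cf_tau_ge_1: "1 \<le> cf_tau \<alpha>"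
  unfolding cf_tau_eq
proof (rule le_Limsup)
  show "\<forall>\<^sub>F n in sequentially. 1 \<le> ereal (ln (Q (Suc n)) / ln (Q n))"
    using eventually_ge_at_top[of 2]
  proof eventually_elim
    case (elim n)
    then show ?case using ln_Q_pos[OF elim] ln_Q_le[of n] by (simp add: one_ereal_def)
  qed
qed simp

lemma iota_eq: "1 / cf_tau \<alpha> = ereal iota" and iota_nonneg: "0 \<le> iota" and iota_le_1: "iota \<le> 1"
proof -
  have "1 / cf_tau \<alpha> = ereal iota \<and> 0 \<le> iota \<and> iota \<le> 1"
  proof (cases "cf_tau \<alpha>")
    case (real r)
    then have "1 \<le> r" using cf_tau_ge_1 by simp
    then have "1 / cf_tau \<alpha> = ereal (1 / r)" using real by (simp add: one_ereal_def)
    then show ?thesis using \<open>1 \<le> r\<close> by (simp add: iota_def)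
  qed (use cf_tau_ge_1 in \<open>auto simp: iota_def zero_ereal_def\<close>)
  then show "1 / cf_tau \<alpha> = ereal iota" "0 \<le> iota" "iota \<le> 1" by auto
qed

lemma cf_tau_cases:
  obtains "cf_tau \<alpha> = \<infinity>" "iota = 0" | r where "cf_tau \<alpha> = ereal r" "1 \<le> r" "iota = 1 / r"
proof (cases "cf_tau \<alpha>")
  case (real r)
  then have "1 \<le> r" using cf_tau_ge_1 by simp
  moreover have "iota = 1 / r" using real \<open>1 \<le> r\<close> by (simp add: iota_def one_ereal_def)
  ultimately show ?thesis using that(2) real by blast
next
  case PInf
  then show ?thesis using that(1) by (simp add: iota_def)
qed (use cf_tau_ge_1 in auto)

text \<open>The upper half of the limsup: eventually ln(q_(n+1)) / ln(q_n) < 1 /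
  \<open>\<kappa>\<close>. The constant absorbs the finitely many earlier indices.\<close>

lemma Q_powr_le:
  assumes "0 < \<kappa>" "\<kappa> < iota"
  obtains C where "0 < C" "\<And>k. Q (Suc k) powr \<kappa> \<le> C * Q k"
proof -
  have "cf_tau \<alpha> < ereal (1 / \<kappa>)"
  proof (cases rule: cf_tau_cases)
    case (2 r)
    have "\<kappa> * r < iota * r" using assms 2(2) by (intro mult_strict_right_mono) auto
    then have "r < 1 / \<kappa>" using assms 2(2,3) by (simp add: field_simps)
    then show ?thesis using 2 by simp
  qed (use assms in auto)
  then have "eventually (\<lambda>n. ereal (ln (Q (Suc n)) / ln (Q n)) < ereal (1 / \<kappa>)) sequentially"
    unfolding cf_tau_eq by (rule Limsup_lessD)
  then have "eventually (\<lambda>n. Q (Suc n) powr \<kappa> \<le> Q n) sequentially"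
    using eventually_ge_at_top[of 2]
  proof eventually_elim
    case (elim n)
    then have "\<kappa> * ln (Q (Suc n)) \<le> ln (Q n)" using ln_Q_pos[OF elim(2)] assms by (simp add: field_simps)
    then have "exp (\<kappa> * ln (Q (Suc n))) \<le> exp (ln (Q n))" by simp
    then show ?case using Q_pos[of n] Q_pos[of "Suc n"] by (simp add: powr_def)
  qed
  then obtain N where N: "\<And>n. N \<le> n \<Longrightarrow> Q (Suc n) powr \<kappa> \<le> Q n" by (auto simp: eventually_at_top_linorder)
  define C where "C = 1 + (\<Sum>k<N. Q (Suc k) powr \<kappa>)"
  have C: "1 \<le> C" unfolding C_def by (simp add: sum_nonneg)
  have "Q (Suc k) powr \<kappa> \<le> C * Q k" for k
  proof (cases "N \<le> k")
    case True
    have "1 * Q k \<le> C * Q k" using C Q_pos[of k] by (intro mult_right_mono) auto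
    then show ?thesis using N[OF True] by simp
  next
    case False
    then have "Q (Suc k) powr \<kappa> \<le> (\<Sum>k<N. Q (Suc k) powr \<kappa>)" by (intro member_le_sum) auto
    also have "\<dots> \<le> C * 1" by (simp add: C_def)
    also have "\<dots> \<le> C * Q k" using C Q_ge_1[of k] by (intro mult_left_mono) auto
    finally show ?thesis .
  qed
  then show ?thesis using that[of C] C by simp
qed

text \<open>The lower half of the limsup: if the inequality failed from some index on, the limsup
  would be at most 1 / \<open>\<kappa>\<close>, less than tau.\<close>

lemma ln_Q_gaps:
  assumes "iota < \<kappa>"
  shows "\<exists>\<^sub>F k in sequentially. ln (Q k) \<le> \<kappa> * ln (Q (Suc k))"
proof (rule ccontr)
  assume "\<not> ?thesis"
  then have "\<forall>\<^sub>F k in sequentially. \<kappa> * ln (Q (Suc k)) < ln (Q k)" by (simp add: not_frequently not_le)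
  then have "\<forall>\<^sub>F n in sequentially. ereal (ln (Q (Suc n)) / ln (Q n)) \<le> ereal (1 / \<kappa>)"
    using eventually_ge_at_top[of 2]
  proof eventually_elim
    case (elim n)
    have "0 < \<kappa>" using assms iota_nonneg by simp
    then show ?case using ln_Q_pos[OF elim(2)] elim by (simp add: field_simps)
  qed
  then have le: "cf_tau \<alpha> \<le> ereal (1 / \<kappa>)" unfolding cf_tau_eq by (rule Limsup_bounded)
  have k: "0 < \<kappa>" using assms iota_nonneg by simp
  show False
  proof (cases rule: cf_tau_cases)
    case (2 r)
    then have "r \<le> 1 / \<kappa>" using le by simp
    moreover have "iota * r < \<kappa> * r" using assms 2(2) by (intro mult_strict_right_mono) auto
    ultimately show ?thesis using 2(2,3) k by (simp add: field_simps)
  qed (use le in auto)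
qed

lemma summable_Q_ratio:
  assumes "0 \<le> \<mu>" "\<mu> = 0 \<or> \<mu> < iota"
  shows "summable (\<lambda>k. Q (Suc k) powr \<mu> / Q k)"
proof (cases "\<mu> = 0")
  case True
  have "Q k powr 0 = 1" for k using Q_pos[of k] by simp
  then show ?thesis using True summable_inverse_Q by simp
next
  case False
  define \<kappa> where "\<kappa> = (\<mu> + iota) / 2"
  have k: "0 < \<mu>" "\<mu> < \<kappa>" "\<kappa> < iota" using False assms by (auto simp: \<kappa>_def)
  then have k0: "0 < \<kappa>" by simp
  obtain C where C: "0 < C" "\<And>k. Q (Suc k) powr \<kappa> \<le> C * Q k" using Q_powr_le[OF k0 k(3)] by blast
  have pos: "0 < 1 - \<mu> / \<kappa>" using k k0 by simp
  show ?thesis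
  proof (rule summable_comparison_test'[OF summable_mult[OF summable_Q_powr[OF pos], of "C powr (\<mu> / \<kappa>)"]])
    fix n
    have "Q (Suc n) powr \<mu> = (Q (Suc n) powr \<kappa>) powr (\<mu> / \<kappa>)" using k0 by (simp add: powr_powr)
    also have "\<dots> \<le> (C * Q n) powr (\<mu> / \<kappa>)" using C(2)[of n] k k0 by (intro powr_mono2) auto
    also have "\<dots> = C powr (\<mu> / \<kappa>) * Q n powr (\<mu> / \<kappa>)" using C Q_pos[of n] by (simp add: powr_mult)
    finally have "Q (Suc n) powr \<mu> / Q n \<le> C powr (\<mu> / \<kappa>) * Q n powr (\<mu> / \<kappa>) / Q n"
      using Q_pos[of n] by (intro divide_right_mono) auto
    also have "\<dots> = C powr (\<mu> / \<kappa>) * Q n powr (- (1 - \<mu> / \<kappa>))"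
      using Q_pos[of n] by (simp add: powr_diff)
    finally show "norm (Q (Suc n) powr \<mu> / Q n) \<le> C powr (\<mu> / \<kappa>) * Q n powr (- (1 - \<mu> / \<kappa>))"
      using Q_pos[of n] by simp
  qed
qed

lemma A_lambert_decay: "1 < t \<Longrightarrow> norm (complex_of_real (A_lambert q t)) \<le> 2 * exp (- (1 * t))"
  using A_lambert_bounds[of t q] bose_le_exp[of t] by simp

lemma mellin_A_lambert_tail: "mellin {1<..} (\<lambda>t. of_real (A_lambert q t)) holomorphic_on S"
  by (rule mellin_at_infinity_holomorphic[OF _ A_lambert_decay]) auto

text \<open>After removal of its terms g0 / t and c0 the Lambert series is O(t^\<open>\<mu>\<close>)
  for every \<open>\<mu>\<close> < \<open>iota\<close>, so its transform over (0, 1] continues to Re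
  s > -\<open>\<mu>\<close>. The removed terms give g0 / (s - 1) and c0 / s, and the zero of 1 /
  Gamma cancels the second pole.\<close>

lemma continuation:
  obtains g where "g holomorphic_on {s. - iota < Re s}" "g 1 = of_real (frac (\<alpha> * of_int q))"
    "\<And>s. 1 < Re s \<Longrightarrow> g_series \<alpha> q s = g s / (s - 1)"
proof -
  let ?G = "\<lambda>t. complex_of_real (A_lambert q t)"
  define g0 where "g0 = complex_of_real (frac (\<alpha> * of_int q))"
  obtain Gh where Gh: "Gh holomorphic_on ball 0 6" "Gh 0 = g0"
    "\<And>t. 0 < t \<Longrightarrow> t < 6 \<Longrightarrow> ?G t = Gh (of_real t) / of_real t + (1 - exp (- (of_int q * of_real t))) * of_real (rem_lambert t)"
    using A_lambert_near_0[of q] unfolding g0_def by blast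
  obtain k1 where k1: "k1 holomorphic_on ball 0 6" "\<And>z. Gh z = Gh 0 + z * k1 z"
    using holomorphic_taylor_split[OF Gh(1)] by auto
  obtain k2 where k2: "k2 holomorphic_on ball 0 6" "\<And>z. k1 z = k1 0 + z * k2 z"
    using holomorphic_taylor_split[OF k1(1)] by auto
  obtain B2 where B2: "0 < B2" "\<And>t. 0 \<le> t \<Longrightarrow> t \<le> 1 \<Longrightarrow> norm (k2 (complex_of_real t)) \<le> B2"
    using holomorphic_bounded_unit[OF k2(1)] by auto
  obtain B1 where B1: "0 < B1" "\<And>t. 0 \<le> t \<Longrightarrow> t \<le> 1 \<Longrightarrow> norm (expm1_div (- of_int q) (complex_of_real t)) \<le> B1"
    using holomorphic_bounded_unit[OF expm1_div_holomorphic, of 6] by auto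
  define c0 where "c0 = k1 0"
  define R where "R = (\<lambda>t. ?G t - g0 / of_real t - c0)"
  have Rm: "R \<in> borel_measurable borel" unfolding R_def by measurable
  have R: "\<exists>C. \<forall>t. 0 < t \<longrightarrow> t \<le> 1 \<longrightarrow> norm (R t) \<le> C * t powr \<mu>" if mu: "0 \<le> \<mu>" "\<mu> = 0 \<or> \<mu> < iota" for \<mu>
  proof -
    have mu1: "\<mu> \<le> 1" using mu iota_le_1 by auto
    obtain C where C: "0 < C" "\<And>t. 0 < t \<Longrightarrow> \<bar>rem_lambert t\<bar> \<le> C * t powr (\<mu> - 1)"
      using rem_lambert_bound[OF mu(1) mu1 summable_Q_ratio[OF mu]] by blast
    have "norm (R t) \<le> (B2 + B1 * C) * t powr \<mu>" if t: "0 < t" "t \<le> 1" for t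
    proof -
      define z where "z = complex_of_real t"
      have z: "z \<noteq> 0" using t by (simp add: z_def)
      have e: "1 - exp (- (of_int q * z)) = - (z * expm1_div (- of_int q) z)" using z by (simp add: expm1_div_def)
      have "?G t = Gh z / z - z * expm1_div (- of_int q) z * of_real (rem_lambert t)"
        using Gh(3)[of t] t unfolding z_def[symmetric] e by simp
      also have "Gh z / z = g0 / z + c0 + z * k2 z"
        using z k1(2)[of z] k2(2)[of z] Gh(2) by (simp add: c0_def field_simps)
      finally have "R t = z * k2 z - z * expm1_div (- of_int q) z * of_real (rem_lambert t)"
        by (simp add: R_def z_def)
      then have "norm (R t) \<le> norm (z * k2 z) + norm (z * expm1_div (- of_int q) z * of_real (rem_lambert t))"
        using norm_triangle_ineq4 by metis
      also have "\<dots> = t * norm (k2 z) + t * norm (expm1_div (- of_int q) z) * \<bar>rem_lambert t\<bar>"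
        using t by (simp add: norm_mult z_def)
      also have "\<dots> \<le> t powr \<mu> * B2 + t * B1 * (C * t powr (\<mu> - 1))"
      proof (intro add_mono mult_mono)
        have "t powr 1 \<le> t powr \<mu>" using t mu1 by (intro powr_mono') auto
        then show "t \<le> t powr \<mu>" using t by simp
      qed (use t B1 B2 C in \<open>auto simp: z_def\<close>)
      also have "\<dots> = (B2 + B1 * C) * t powr \<mu>" using t by (simp add: powr_diff algebra_simps)
      finally show ?thesis .
    qed
    then show ?thesis by blast
  qed
  define H0 where "H0 = (\<lambda>s. mellin {1<..} ?G s + mellin {0<..1} R s)"
  \<comment> \<open>No single \<open>\<mu>\<close> reaches the line: the half-plane is exhausted by
    those belonging to all \<open>\<mu>\<close> below \<open>iota\<close>. Including 0 covers Re s >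
    0 even if \<open>iota\<close> is 0.\<close>
  define M where "M = {\<mu>. 0 \<le> \<mu> \<and> (\<mu> = 0 \<or> \<mu> < iota)}"
  have "mellin {0<..1} R holomorphic_on (\<Union>\<mu>\<in>M. {s. - \<mu> < Re s})"
  proof (rule holomorphic_on_UN_open)
    fix \<mu> assume "\<mu> \<in> M"
    then obtain C where "\<forall>t. 0 < t \<longrightarrow> t \<le> 1 \<longrightarrow> norm (R t) \<le> C * t powr \<mu>" using R by (auto simp: M_def)
    then show "mellin {0<..1} R holomorphic_on {s. - \<mu> < Re s}"
      by (intro mellin_near_0_holomorphic[OF Rm]) auto
  qed (simp add: open_halfspace_Re_gt)
  moreover have "{s. - iota < Re s} \<subseteq> (\<Union>\<mu>\<in>M. {s. - \<mu> < Re s})"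
  proof
    fix s :: complex assume "s \<in> {s. - iota < Re s}"
    then have s: "- iota < Re s" by simp
    define \<mu> where "\<mu> = (if 0 < Re s then 0 else (iota - Re s) / 2)"
    have "\<mu> \<in> M" "- \<mu> < Re s" using s by (auto simp: \<mu>_def M_def field_simps split: if_splits)
    then show "s \<in> (\<Union>\<mu>\<in>M. {s. - \<mu> < Re s})" by auto
  qed
  ultimately have Rh: "mellin {0<..1} R holomorphic_on {s. - iota < Re s}" using holomorphic_on_subset by blast
  \<comment> \<open>The product of s - 1 with the continuation; rGamma s / s is written as rGamma (s
    + 1), so that nothing singular is left at 0.\<close>
  define g where "g = (\<lambda>s. (s - 1) * (rGamma s * H0 s + c0 * rGamma (s + 1)) + rGamma s * g0)"
  show ?thesis
  proof (rule that[of g])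
    show "g holomorphic_on {s. - iota < Re s}" unfolding g_def H0_def
      by (intro holomorphic_intros Rh mellin_A_lambert_tail)
    show "g 1 = complex_of_real (frac (\<alpha> * real_of_int q))" by (simp add: g_def g0_def)
    fix s :: complex assume s: "1 < Re s"
    have s0: "s \<noteq> 0" "s \<noteq> 1" using s by auto
    obtain C where C: "\<forall>t. 0 < t \<longrightarrow> t \<le> 1 \<longrightarrow> norm (R t) \<le> C * t powr 0" using R[of 0] by auto
    have convR: "mellin_conv {0<..1} R s" by (rule mellin_conv_near_0[OF Rm, of _ C 0]) (use C s in auto)
    have "Gamma s * g_series \<alpha> q s = mellin {0<..} ?G s" using mellin_A_lambert(1)[OF s] by simp
    also have "\<dots> = mellin {0<..1} ?G s + mellin {1<..} ?G s"
      by (rule mellin_split[OF mellin_A_lambert(2)[OF s]]) simp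
    also have "mellin {0<..1} ?G s = mellin {0<..1} (\<lambda>t. (R t + g0 / of_real t) + c0) s"
      by (simp add: R_def)
    also have "\<dots> = mellin {0<..1} R s + g0 / (s - 1) + c0 / s"
      using s by (simp add: mellin_add mellin_conv_add convR mellin_inverse_t mellin_const)
    finally have "rGamma s * (Gamma s * g_series \<alpha> q s) = rGamma s * (H0 s + g0 / (s - 1) + c0 / s)"
      by (simp add: H0_def)
    moreover have "rGamma s * (Gamma s * g_series \<alpha> q s) = g_series \<alpha> q s"
      using Gamma_rGamma[of s] s by (simp add: mult.assoc[symmetric])
    moreover have "rGamma s * (H0 s + g0 / (s - 1) + c0 / s) = g s / (s - 1)"
    proof -
      have "rGamma s = s * rGamma (s + 1)" using rGamma_plus1[of s] by simp
      then have "rGamma s * (c0 / s) = c0 * rGamma (s + 1)" using s0 by simp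
      then show ?thesis using s0 by (simp add: g_def distrib_left add_divide_distrib)
    qed
    ultimately show "g_series \<alpha> q s = g s / (s - 1)" by simp
  qed
qed

lemma frac_nonzero: "q \<noteq> 0 \<Longrightarrow> frac (\<alpha> * of_int q) \<noteq> 0"
proof
  assume "q \<noteq> 0" "frac (\<alpha> * of_int q) = 0"
  then have "\<alpha> * of_int q \<in> \<int>" by simp
  then obtain m where "\<alpha> * of_int q = of_int m" by (auto elim: Ints_cases)
  then have "\<alpha> = of_int m / of_int q" using \<open>q \<noteq> 0\<close> by (simp add: field_simps)
  then show False using irr by simp
qed

lemma simple_pole_quotient:
  assumes "open S" "z \<in> S" "g holomorphic_on S" "g z \<noteq> 0"
  shows "has_simple_pole (\<lambda>s. g s / (s - z)) z" "residue (\<lambda>s. g s / (s - z)) z = g z"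
proof -
  have "is_pole (\<lambda>s. g s / (s - z)) z" using is_pole_basic[OF assms(3,1,2,4), of 1] by simp
  moreover have "zorder (\<lambda>s. g s / (s - z)) z = -1"
    by (rule zorder_eqI[OF assms(1,2,3,4)]) (simp add: power_int_minus divide_inverse)
  ultimately show "has_simple_pole (\<lambda>s. g s / (s - z)) z" by (simp add: has_simple_pole_def)
  show "residue (\<lambda>s. g s / (s - z)) z = g z" by (rule residue_simple[OF assms(1,2,3)])
qed

section \<open>The part of the remainder whose Mellin transform is lacunary\<close>

definition D_lambert :: "real \<Rightarrow> real" where
  "D_lambert t = (\<Sum>k. (-1) ^ k * (bose (Q (Suc k) * t) / (Q k * t)))"

text \<open>The error when bose x bose y is replaced by bose y / x - 1 / (2 y). In
  \<open>D_lambert\<close> the smaller denominator therefore enters only as a factor 1 / q_k, and t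
  occurs only in the combination q_(k+1) t, apart from the 1 / t; hence scaling can separate the
  variables.\<close>

definition bose_bracket :: "real \<Rightarrow> real \<Rightarrow> real" where
  "bose_bracket x y = bose y * bose_reg x + (1 / y - bose y) / 2"

definition omega_lambert :: "real \<Rightarrow> real" where
  "omega_lambert t = (\<Sum>k. (-1) ^ k * bose_bracket (Q k * t) (Q (Suc k) * t))"

lemma measurable_D_lambert [measurable]: "D_lambert \<in> borel_measurable borel"
  unfolding D_lambert_def[abs_def] bose_def by (intro borel_measurable_suminf) measurable

text \<open>The bound involves the larger argument only, so it sums over all denominators for any d
  > 0 whatever tau is. The corrections are thus O(t^(-d)) and, after the extra factor t, continue to
  Re s > -1 + d.\<close>

lemma bose_bracket_bound:
  assumes "0 < x" "x \<le> y" "0 < d" "d \<le> 1"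
  shows "\<bar>bose_bracket x y\<bar> \<le> 2 * y powr (- d)"
proof -
  have y: "0 < y" using assms by simp
  have bsy: "0 < bose y" "bose y \<le> 1 / y" using y by (auto intro: bose_pos bose_le)
  have "1 / y - bose y \<le> 1 / 2" using bose_reg_nonneg[OF y] by (simp add: bose_reg_def)
  have cx: "0 \<le> bose_reg x" "bose_reg x \<le> 1 / 2" "bose_reg x \<le> x / 4"
    using assms bose_reg_nonneg bose_reg_le_half bose_reg_le by auto
  have nn: "0 \<le> bose_bracket x y" using bsy cx by (simp add: bose_bracket_def)
  show ?thesis
  proof (cases "1 \<le> y")
    case True
    have "bose_bracket x y \<le> 1 / y * (1 / 2) + (1 / y - 0) / 2"
      unfolding bose_bracket_def using bsy cx y by (intro add_mono mult_mono divide_right_mono) auto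
    also have "\<dots> = y powr (- 1)" using y by (simp add: powr_minus_divide)
    also have "\<dots> \<le> y powr (- d)" using True assms by (intro powr_mono) auto
    also have "\<dots> \<le> 2 * y powr (- d)" by simp
    finally show ?thesis using nn by simp
  next
    case False
    have "bose y * bose_reg x \<le> 1 / y * (y / 4)" using bsy cx y assms by (intro mult_mono) auto
    moreover have "1 / y * (y / 4) = 1 / 4" using y by simp
    ultimately have "bose y * bose_reg x \<le> 1 / 4" by (simp only:)
    then have "bose y * bose_reg x + (1 / y - bose y) / 2 \<le> 1 / 4 + (1 / 2) / 2"
      using \<open>1 / y - bose y \<le> 1 / 2\<close> by (intro add_mono divide_right_mono) auto
    then have "bose_bracket x y \<le> 1 / 4 + 1 / 4" unfolding bose_bracket_def by (rule order_trans) simp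
    also have "\<dots> \<le> y powr 0" using y by simp
    also have "\<dots> \<le> y powr (- d)" using False y assms by (intro powr_mono') auto
    also have "\<dots> \<le> 2 * y powr (- d)" by simp
    finally show ?thesis using nn by simp
  qed
qed

lemma summable_Q_powr_Suc: "0 < d \<Longrightarrow> summable (\<lambda>k. Q (Suc k) powr (- d))"
  using summable_Q_powr[of d] by (subst summable_Suc_iff)

lemma bose_bracket_Q_bound:
  assumes "0 < t" "0 < d" "d \<le> 1"
  shows "\<bar>bose_bracket (Q k * t) (Q (Suc k) * t)\<bar> \<le> 2 * Q (Suc k) powr (- d) * t powr (- d)"
proof -
  have "\<bar>bose_bracket (Q k * t) (Q (Suc k) * t)\<bar> \<le> 2 * (Q (Suc k) * t) powr (- d)"
    using assms Q_pos[of k] Q_le_Suc[of k] by (intro bose_bracket_bound mult_right_mono) auto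
  then show ?thesis using assms Q_pos[of "Suc k"] by (simp add: powr_mult mult.assoc)
qed

lemma omega_lambert_summable: "0 < t \<Longrightarrow> summable (\<lambda>k. \<bar>bose_bracket (Q k * t) (Q (Suc k) * t)\<bar>)"
proof -
  assume t: "0 < t"
  have sm: "summable (\<lambda>k. 2 * Q (Suc k) powr (- 1) * t powr (- 1))" by (intro summable_mult summable_mult2 summable_Q_powr_Suc) simp
  show ?thesis
    by (rule summable_comparison_test'[OF sm]) (use bose_bracket_Q_bound[OF t, of 1] in simp)
qed

lemma omega_lambert_bound:
  assumes "0 < d" "d \<le> 1"
  obtains C where "0 < C" "\<And>t. 0 < t \<Longrightarrow> \<bar>omega_lambert t\<bar> \<le> C * t powr (- d)"
proof -
  define S where "S = (\<Sum>k. Q (Suc k) powr (- d))"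
  have S: "0 \<le> S" unfolding S_def by (intro suminf_nonneg summable_Q_powr_Suc assms) auto
  have "\<bar>omega_lambert t\<bar> \<le> (2 * S + 1) * t powr (- d)" if t: "0 < t" for t
  proof -
    have sm: "summable (\<lambda>k. 2 * Q (Suc k) powr (- d) * t powr (- d))" by (intro summable_mult summable_mult2 summable_Q_powr_Suc assms)
    have "\<bar>omega_lambert t\<bar> \<le> (\<Sum>k. \<bar>(-1) ^ k * bose_bracket (Q k * t) (Q (Suc k) * t)\<bar>)"
      unfolding omega_lambert_def using omega_lambert_summable[OF t] by (intro summable_rabs) (simp add: abs_mult)
    also have "\<dots> \<le> (\<Sum>k. 2 * Q (Suc k) powr (- d) * t powr (- d))"
      using omega_lambert_summable[OF t] bose_bracket_Q_bound[OF t assms] sm by (intro suminf_le) (simp_all add: abs_mult)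
    also have "\<dots> = 2 * S * t powr (- d)"
      unfolding S_def by (intro sums_unique[symmetric] sums_mult sums_mult2 summable_sums summable_Q_powr_Suc assms)
    also have "\<dots> \<le> (2 * S + 1) * t powr (- d)" by (intro mult_right_mono) auto
    finally show ?thesis .
  qed
  then show ?thesis using that[of "2 * S + 1"] S by simp
qed

definition e0 :: real where "e0 = (\<Sum>k. (-1) ^ k / Q (Suc k))"

lemma e0_sums: "(\<lambda>k. (-1) ^ k / Q (Suc k)) sums e0"
proof -
  have "summable (\<lambda>k. 1 / Q (Suc k))" using summable_inverse_Q by (subst summable_Suc_iff)
  then have "summable (\<lambda>k. \<bar>(-1) ^ k / Q (Suc k)\<bar>)" using Q_pos by (simp add: abs_mult less_imp_le abs_of_pos)
  then show ?thesis unfolding e0_def by (rule summable_sums[OF summable_rabs_cancel])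
qed

lemma D_lambert_term_le:
  assumes "1 \<le> t"
  shows "\<bar>bose (Q (Suc k) * t) / (Q k * t)\<bar> \<le> 1 / Q k * (2 * exp (- t))"
proof -
  have "1 * t \<le> Q (Suc k) * t" using assms Q_ge_1[of "Suc k"] by (intro mult_right_mono) auto
  then have Qt: "t \<le> Q (Suc k) * t" by simp
  then have "bose (Q (Suc k) * t) \<le> 2 * exp (- (Q (Suc k) * t))" using assms Qt by (intro bose_le_exp) linarith
  also have "\<dots> \<le> 2 * exp (- t)" using Qt by simp
  finally have 1: "bose (Q (Suc k) * t) \<le> 2 * exp (- t)" .
  have "Q k * 1 \<le> Q k * t" using assms Q_pos[of k] by (intro mult_left_mono) auto
  then have "1 / (Q k * t) \<le> 1 / Q k" using assms Q_pos[of k] by (intro divide_left_mono) auto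
  then have "1 / (Q k * t) * bose (Q (Suc k) * t) \<le> 1 / Q k * (2 * exp (- t))"
    using 1 Q_pos[of k] assms Q_pos[of "Suc k"] by (intro mult_mono less_imp_le[OF bose_pos]) auto
  moreover have "0 \<le> bose (Q (Suc k) * t) / (Q k * t)"
    using assms Q_pos[of k] Q_pos[of "Suc k"] less_imp_le[OF bose_pos[of "Q (Suc k) * t"]] by simp
  ultimately show ?thesis by simp
qed

lemma D_lambert_summable:
  assumes "0 < t"
  shows "summable (\<lambda>k. \<bar>bose (Q (Suc k) * t) / (Q k * t)\<bar>)"
proof (rule summable_comparison_test'[OF summable_mult2[OF summable_inverse_Q, of "1 / t * (1 / t)"]])
  fix k
  have p: "0 < Q k" "0 < Q (Suc k)" "1 \<le> Q (Suc k)" by (rule Q_pos Q_ge_1)+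
  have "bose (Q (Suc k) * t) \<le> 1 / (Q (Suc k) * t)" using assms p by (intro bose_le) auto
  also have "\<dots> \<le> 1 / (1 * t)" using assms p by (intro divide_left_mono mult_right_mono) auto
  finally have "bose (Q (Suc k) * t) / (Q k * t) \<le> 1 / t / (Q k * t)" using assms p by (intro divide_right_mono) auto
  moreover have "0 \<le> bose (Q (Suc k) * t) / (Q k * t)" using assms p less_imp_le[OF bose_pos[of "Q (Suc k) * t"]] by simp
  moreover have "1 / t / (Q k * t) = 1 / Q k * (1 / t * (1 / t))" by simp
  ultimately show "norm \<bar>bose (Q (Suc k) * t) / (Q k * t)\<bar> \<le> 1 / Q k * (1 / t * (1 / t))"
    by (simp only: real_norm_def abs_idempotent abs_of_nonneg)
qed

lemma D_lambert_decay:
  obtains C where "\<And>t. 1 < t \<Longrightarrow> norm (complex_of_real (D_lambert t)) \<le> C * exp (- (1 * t))"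
proof -
  have "norm (complex_of_real (D_lambert t)) \<le> (2 * (\<Sum>k. 1 / Q k)) * exp (- (1 * t))" if t: "1 < t" for t
  proof -
    have sm: "summable (\<lambda>k. 1 / Q k * (2 * exp (- t)))" by (intro summable_mult2 summable_inverse_Q)
    have "\<bar>D_lambert t\<bar> \<le> (\<Sum>k. \<bar>(-1) ^ k * (bose (Q (Suc k) * t) / (Q k * t))\<bar>)"
      unfolding D_lambert_def using D_lambert_summable[of t] t by (intro summable_rabs) (simp add: abs_mult)
    also have "\<dots> \<le> (\<Sum>k. 1 / Q k * (2 * exp (- t)))"
      using D_lambert_summable[of t] D_lambert_term_le[of t] t sm by (intro suminf_le) (simp_all add: abs_mult)
    also have "\<dots> = (\<Sum>k. 1 / Q k) * (2 * exp (- t))" by (rule suminf_mult2[symmetric, OF summable_inverse_Q])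
    finally show ?thesis by simp
  qed
  then show ?thesis using that by blast
qed

lemma rem_lambert_eq_D:
  assumes "0 < t"
  shows "rem_lambert t = D_lambert t + omega_lambert t - \<beta> / t\<^sup>2 + (1 - e0) / (2 * t)"
proof -
  have "summable (\<lambda>k. (-1) ^ k * (bose (Q (Suc k) * t) / (Q k * t)))"
    by (rule summable_rabs_cancel) (use D_lambert_summable[OF assms] in \<open>simp add: abs_mult\<close>)
  then have 1: "(\<lambda>k. (-1) ^ k * (bose (Q (Suc k) * t) / (Q k * t))) sums D_lambert t"
    unfolding D_lambert_def by (rule summable_sums)
  have "summable (\<lambda>k. (-1) ^ k * bose_bracket (Q k * t) (Q (Suc k) * t))"
    by (rule summable_rabs_cancel) (use omega_lambert_summable[OF assms] in \<open>simp add: abs_mult\<close>)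
  then have 2: "(\<lambda>k. (-1) ^ k * bose_bracket (Q k * t) (Q (Suc k) * t)) sums omega_lambert t"
    unfolding omega_lambert_def by (rule summable_sums)
  have "(\<lambda>k. (-1) ^ k * (bose (Q (Suc k) * t) / (Q k * t)) + (-1) ^ k * bose_bracket (Q k * t) (Q (Suc k) * t)
      - (-1) ^ k / Q (Suc k) * (1 / (2 * t))) sums (D_lambert t + omega_lambert t - e0 * (1 / (2 * t)))"
    by (intro sums_add sums_diff sums_mult2 1 2 e0_sums)
  also have "(\<lambda>k. (-1) ^ k * (bose (Q (Suc k) * t) / (Q k * t)) + (-1) ^ k * bose_bracket (Q k * t) (Q (Suc k) * t)
      - (-1) ^ k / Q (Suc k) * (1 / (2 * t))) = (\<lambda>k. (-1) ^ k * (bose (Q k * t) * bose (Q (Suc k) * t)))"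
  proof
    fix k
    define m where "m = (-1 :: real) ^ k"
    define x y where "x = Q k * t" and "y = Q (Suc k) * t"
    have "bose y / x + bose_bracket x y - 1 / (2 * y) = bose x * bose y"
      by (simp add: bose_bracket_def bose_reg_def algebra_simps diff_divide_distrib)
    then have "m * (bose y / x) + m * bose_bracket x y - m * (1 / (2 * y)) = m * (bose x * bose y)"
      by (metis distrib_left right_diff_distrib)
    moreover have "m * (1 / (2 * y)) = m / Q (Suc k) * (1 / (2 * t))" by (simp add: y_def)
    ultimately show "(-1) ^ k * (bose (Q (Suc k) * t) / (Q k * t)) + (-1) ^ k * bose_bracket (Q k * t) (Q (Suc k) * t)
      - (-1) ^ k / Q (Suc k) * (1 / (2 * t)) = (-1) ^ k * (bose (Q k * t) * bose (Q (Suc k) * t))"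
      by (simp add: m_def x_def y_def)
  qed
  finally have "floor_lambert t = D_lambert t + omega_lambert t - e0 * (1 / (2 * t))"
    by (simp add: floor_lambert_def sums_iff)
  then show ?thesis using floor_lambert_eq[OF assms] by (simp add: diff_divide_distrib)
qed

text \<open>Here the abscissa is 1 - \<open>iota\<close>: \<open>abscissa\<close> is the upper and
  \<open>gaps\<close> the lower half of the limsup defining tau. The condition tau > 1 is what makes
  the abscissa positive and hence the gaps proportional.\<close>

lemma lacunary:
  assumes iota1: "iota < 1"
  shows "lacunary_series (\<lambda>k. ln (Q k)) (1 - iota) (\<lambda>k. (-1) ^ k)"
proof
  show "ln (Q k) \<le> ln (Q (Suc k))" for k by (rule ln_Q_le)
  show "0 \<le> ln (Q 0)" by (rule ln_Q_nonneg)
  show "summable (\<lambda>k. exp (- (d * ln (Q k))))" if "0 < d" for d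
  proof -
    have "exp (- (d * ln (Q k))) = Q k powr (- d)" for k using Q_pos[of k] by (simp add: powr_def)
    then show ?thesis using summable_Q_powr[OF that] by simp
  qed
  show "0 < 1 - iota" "1 - iota \<le> 1" using iota1 iota_nonneg by auto
  show "norm ((- 1 :: complex) ^ k) = 1" for k by (simp add: norm_power)
  show "\<exists>C. \<forall>k. (1 - (1 - iota)) * ln (Q (Suc k)) - ln (Q k) \<le> C + \<epsilon> * ln (Q (Suc k))" if e: "0 < \<epsilon>" for \<epsilon>
  proof (cases "iota = 0")
    case True
    have "- ln (Q k) \<le> 0 + \<epsilon> * ln (Q (Suc k))" for k
      using ln_Q_nonneg[of k] ln_Q_nonneg[of "Suc k"] e mult_nonneg_nonneg[of \<epsilon> "ln (Q (Suc k))"] by linarith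
    then show ?thesis using True by (intro exI[of _ 0]) simp
  next
    case False
    \<comment> \<open>Within \<open>\<epsilon>\<close> of \<open>iota\<close>, but kept positive so
      that \<open>Q_powr_le\<close> applies.\<close>
    define \<kappa> where "\<kappa> = max (iota - \<epsilon>) (iota / 2)"
    have k: "0 < \<kappa>" "\<kappa> < iota" "iota - \<epsilon> \<le> \<kappa>" using False iota_nonneg e by (auto simp: \<kappa>_def)
    obtain C where C: "0 < C" "\<And>k. Q (Suc k) powr \<kappa> \<le> C * Q k" using Q_powr_le[OF k(1,2)] by blast
    have "iota * ln (Q (Suc k)) - ln (Q k) \<le> ln C + \<epsilon> * ln (Q (Suc k))" for k
    proof -
      have "ln (Q (Suc k) powr \<kappa>) \<le> ln (C * Q k)" using C(2)[of k] Q_pos[of "Suc k"] Q_pos[of k] C(1) by (subst ln_le_cancel_iff) auto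
      then have "\<kappa> * ln (Q (Suc k)) \<le> ln C + ln (Q k)" using C(1) Q_pos[of k] Q_pos[of "Suc k"] by (simp add: ln_mult ln_powr)
      moreover have "(iota - \<epsilon>) * ln (Q (Suc k)) \<le> \<kappa> * ln (Q (Suc k))" using k ln_Q_nonneg by (intro mult_right_mono) auto
      ultimately show ?thesis by (simp add: algebra_simps)
    qed
    then show ?thesis by auto
  qed
  show "\<exists>\<^sub>F k in sequentially. ln (Q k) \<le> (1 - (1 - iota) + \<epsilon>) * ln (Q (Suc k))" if "0 < \<epsilon>" for \<epsilon>
    using ln_Q_gaps[of "iota + \<epsilon>"] that by simp
qed

end

section \<open>The natural boundary\<close>

definition bose_div :: "real \<Rightarrow> complex" where
  "bose_div t = of_real (bose t / t)"

lemma measurable_bose_div [measurable]: "bose_div \<in> borel_measurable borel"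
  unfolding bose_div_def[abs_def] bose_def by measurable

lemma measurable_bose_reg [measurable]: "bose_reg \<in> borel_measurable borel"
  unfolding bose_reg_def[abs_def] bose_def by measurable

lemma bose_div_bounds:
  shows "0 < t \<Longrightarrow> norm (bose_div t) \<le> 1 * t powr (- 2)"
    and "1 < t \<Longrightarrow> norm (bose_div t) \<le> 2 * exp (- (1 * t))"
proof -
  assume t: "0 < t"
  have "bose t / t \<le> 1 / t / t" using t by (intro divide_right_mono bose_le) auto
  also have "\<dots> = t powr (- 2)" using t by (simp add: powr_minus_divide power2_eq_square)
  finally show "norm (bose_div t) \<le> 1 * t powr (- 2)"
    using t less_imp_le[OF bose_pos[OF t]] by (simp add: bose_div_def norm_divide)
next
  assume t: "1 < t"
  have b: "0 < bose t" using t by (intro bose_pos) auto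
  have "bose t / t \<le> bose t / 1" using t b by (intro divide_left_mono) auto
  also have "\<dots> \<le> 2 * exp (- t)" using bose_le_exp[of t] t by simp
  finally show "norm (bose_div t) \<le> 2 * exp (- (1 * t))" using t b by (simp add: bose_div_def norm_divide)
qed

lemma mellin_bose_div_conv: "2 < Re s \<Longrightarrow> mellin_conv {0<..} bose_div s"
proof (rule mellin_conv_split[where r = 1])
  assume s: "2 < Re s"
  show "mellin_conv {0<..1} bose_div s"
    by (rule mellin_conv_near_0[OF _ bose_div_bounds(1)]) (use s in auto)
  show "mellin_conv {1<..} bose_div s"
    by (rule mellin_conv_at_infinity[OF _ bose_div_bounds(2)]) auto
qed simp

text \<open>The continuation of Gamma(s - 1) zeta(s - 1) to Re s > 0: the terms 1 / t^2 - 1 / (2 t)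
  of the integrand are integrated explicitly over (0, 1].\<close>

definition bose_mellin :: "complex \<Rightarrow> complex" where
  "bose_mellin s = 1 / (s - 2) - 1 / (2 * (s - 1)) + (mellin {0<..1} (\<lambda>t. of_real (bose_reg t / t)) s + mellin {1<..} bose_div s)"

lemma bose_mellin_parts:
  "mellin {0<..1} (\<lambda>t. of_real (bose_reg t / t)) holomorphic_on {s. 0 < Re s}"
  "mellin {1<..} bose_div holomorphic_on S"
proof -
  have "mellin {0<..1} (\<lambda>t. of_real (bose_reg t / t)) holomorphic_on {s. - 0 < Re s}"
  proof (rule mellin_near_0_holomorphic)
    fix t :: real assume t: "0 < t" "t \<le> 1"
    have "bose_reg t / t \<le> t / 4 / t" using t by (intro divide_right_mono bose_reg_le) auto
    then show "norm (complex_of_real (bose_reg t / t)) \<le> 1 * t powr 0" using t bose_reg_nonneg[OF t(1)] by (simp add: norm_divide)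
  qed auto
  then show "mellin {0<..1} (\<lambda>t. of_real (bose_reg t / t)) holomorphic_on {s. 0 < Re s}" by simp
  show "mellin {1<..} bose_div holomorphic_on S"
    by (rule mellin_at_infinity_holomorphic[OF _ bose_div_bounds(2)]) auto
qed

lemma bose_mellin_meromorphic: "bose_mellin meromorphic_on {s. 0 < Re s}"
proof -
  have "(\<lambda>s. mellin {0<..1} (\<lambda>t. of_real (bose_reg t / t)) s + mellin {1<..} bose_div s) analytic_on {s. 0 < Re s}"
    unfolding analytic_on_open[OF open_halfspace_Re_gt] by (intro holomorphic_intros bose_mellin_parts)
  then show ?thesis unfolding bose_mellin_def[abs_def]
    by (intro meromorphic_intros analytic_on_imp_meromorphic_on[of "\<lambda>s. mellin _ _ s + mellin _ _ s"])
qed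

lemma bose_mellin_eq:
  assumes s: "2 < Re s"
  shows "mellin {0<..} bose_div s = bose_mellin s"
proof -
  have "mellin {0<..1} bose_div s = mellin {0<..1} (\<lambda>t. ((1 / of_real t) / of_real t - (1/2) / of_real t) + of_real (bose_reg t / t)) s"
    by (rule mellin_cong) (auto simp: bose_div_def bose_reg_def add_divide_distrib diff_divide_distrib)
  also have "\<dots> = 1 / (s - 1 - 1) - (1/2) / (s - 1) + mellin {0<..1} (\<lambda>t. of_real (bose_reg t / t)) s"
  proof -
    have sub: "{0<..1::real} \<subseteq> {0<..}" by auto
    have 1: "mellin_conv {0<..1} (\<lambda>t. (1 / complex_of_real t) / of_real t) s"
      "mellin {0<..1} (\<lambda>t. (1 / complex_of_real t) / of_real t) s = 1 / (s - 1 - 1)"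
      using mellin_divide_t[OF sub, of "\<lambda>t. 1 / complex_of_real t" s] mellin_inverse_t[of "s - 1" 1] s by auto
    have 2: "mellin_conv {0<..1} (\<lambda>t. (1/2) / complex_of_real t) s"
      "mellin {0<..1} (\<lambda>t. (1/2) / complex_of_real t) s = (1/2) / (s - 1)"
      using mellin_inverse_t[of s "1/2"] s by auto
    have 3: "mellin_conv {0<..1} (\<lambda>t. complex_of_real (bose_reg t / t)) s"
    proof (rule mellin_conv_near_0[where a = 0 and C = 1])
      fix t :: real assume t: "0 < t" "t \<le> 1"
      have "bose_reg t / t \<le> t / 4 / t" using t by (intro divide_right_mono bose_reg_le) auto
      then show "norm (complex_of_real (bose_reg t / t)) \<le> 1 * t powr 0" using t bose_reg_nonneg[OF t(1)] by (simp add: norm_divide)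
    qed (use s in auto)
    show ?thesis
      by (subst mellin_add[OF mellin_conv_diff[OF 1(1) 2(1)] 3], subst mellin_diff[OF 1(1) 2(1)], subst 1(2), subst 2(2)) simp
  qed
  finally show ?thesis
    unfolding mellin_split[OF mellin_bose_div_conv[OF s] zero_less_one] bose_mellin_def by simp
qed

text \<open>Permits dividing by \<open>bose_mellin\<close>. If it vanished identically,
  multiplication by s - 2 would give the limit 0 at s = 2, whereas the explicit pole gives 1; hence
  its zeros are isolated.\<close>

lemma bose_mellin_nonzero:
  assumes "0 < c"
  obtains U where "open U" "U \<noteq> {}" "U \<subseteq> {s. c < Re s}" "\<And>s. s \<in> U \<Longrightarrow> bose_mellin s \<noteq> 0"
proof -
  define Hp where "Hp = {s::complex. 0 < Re s}"
  have Hp: "open Hp" "connected Hp" by (auto simp: Hp_def open_halfspace_Re_gt convex_halfspace_Re_gt convex_connected)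
  have "bose_mellin meromorphic_on Hp" using bose_mellin_meromorphic by (simp add: Hp_def)
  from meromorphic_imp_constant_or_avoid[OF this Hp, of 0]
  have "eventually (\<lambda>s. bose_mellin s \<noteq> 0) (cosparse Hp)"
  proof
    assume z: "eventually (\<lambda>s. bose_mellin s = 0) (cosparse Hp)"
    have "(2::complex) \<in> Hp" by (simp add: Hp_def)
    then have ev: "eventually (\<lambda>s. bose_mellin s = 0) (at 2)"
      using z[unfolded eventually_cosparse_open_eq[OF Hp(1)]] by (rule bspec[rotated])
    define r where "r = (\<lambda>s. - 1 / (2 * (s - 1)) + (mellin {0<..1} (\<lambda>t. of_real (bose_reg t / t)) s + mellin {1<..} bose_div s))"
    have "r holomorphic_on Hp - {1}" unfolding r_def
      by (intro holomorphic_intros bose_mellin_parts holomorphic_on_subset[OF bose_mellin_parts(1)]) (auto simp: Hp_def)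
    then have "continuous_on (Hp - {1}) r" by (rule holomorphic_on_imp_continuous_on)
    then have "isCont r 2" using Hp by (auto simp: continuous_on_eq_continuous_at open_delete Hp_def)
    then have "((\<lambda>s. 1 + (s - 2) * r s) \<longlongrightarrow> 1 + (2 - 2) * r 2) (at 2)"
      by (intro tendsto_intros) (auto simp: isCont_def)
    moreover have "eventually (\<lambda>s. 1 + (s - 2) * r s = 0) (at 2)"
      using ev eventually_neq_at_within[of 2 2 UNIV]
    proof eventually_elim
      case (elim s)
      have "bose_mellin s = 1 / (s - 2) + r s" by (simp add: bose_mellin_def r_def)
      then have "(s - 2) * (1 / (s - 2) + r s) = 0" using elim by simp
      then show ?case using elim by (simp add: distrib_left)
    qed
    ultimately have "((\<lambda>s::complex. 0::complex) \<longlongrightarrow> 1 + (2 - 2) * r 2) (at 2)" by (rule Lim_transform_eventually)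
    then have "1 + (2 - 2) * r 2 = 0" by (simp add: tendsto_const_iff)
    then show ?thesis by simp
  qed
  moreover define w where "w = complex_of_real (c + 3)"
  have wH: "w \<in> Hp" using assms by (simp add: w_def Hp_def)
  ultimately have "eventually (\<lambda>s. bose_mellin s \<noteq> 0) (at w)"
    unfolding eventually_cosparse_open_eq[OF Hp(1)] by (rule bspec)
  then obtain d where d: "0 < d" "\<And>s. s \<noteq> w \<Longrightarrow> dist s w < d \<Longrightarrow> bose_mellin s \<noteq> 0"
    by (auto simp: eventually_at)
  define e where "e = min d 1"
  have e: "0 < e" "e \<le> d" "e \<le> 1" using d by (auto simp: e_def)
  show ?thesis
  proof (rule that[of "ball w e - {w}"])
    show "open (ball w e - {w})" by (intro open_delete open_ball)
    have "w + of_real (e / 2) \<in> ball w e - {w}" using e by (auto simp: dist_norm)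
    then show "ball w e - {w} \<noteq> {}" by blast
    show "ball w e - {w} \<subseteq> {s. c < Re s}"
    proof
      fix s assume "s \<in> ball w e - {w}"
      then have "norm (w - s) < 1" using e by (auto simp: dist_norm)
      then have "Re w - Re s < 1" using complex_Re_le_cmod[of "w - s"] by simp
      then show "s \<in> {s. c < Re s}" by (simp add: w_def)
    qed
    show "bose_mellin s \<noteq> 0" if "s \<in> ball w e - {w}" for s
      using that e by (intro d(2)) (auto simp: dist_commute)
  qed
qed

context irrational_number
begin

text \<open>The k-th summand is a multiple of \<open>bose_div\<close> at q_(k+1) t, so scaling turns
  it into a constant times one fixed transform, and the sum factors into a Dirichlet series and
  \<open>bose_mellin\<close>.\<close>

lemma mellin_D_lambert:
  assumes s: "2 < Re s"
  shows "mellin {0<..} (\<lambda>t. of_real (D_lambert t)) s = (\<Sum>k. (-1) ^ k * (of_real (Q (Suc k) / Q k) * of_real (Q (Suc k)) powr (- s))) * bose_mellin s"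
    and "mellin_conv {0<..} (\<lambda>t. of_real (D_lambert t)) s"
proof -
  define f where "f = (\<lambda>k t. ((-1) ^ k * of_real (Q (Suc k) / Q k)) * bose_div (Q (Suc k) * t))"
  have f: "f k t = of_real ((-1) ^ k * (bose (Q (Suc k) * t) / (Q k * t)))" if "0 < t" for k t
    using that Q_pos[of k] Q_pos[of "Suc k"] by (simp add: f_def bose_div_def)
  have conv: "mellin_conv {0<..} (f k) s" for k
    unfolding f_def using mellin_bose_div_conv[OF s] mellin_scale(2)[OF Q_pos] by (intro mellin_conv_cmult) auto
  have m: "mellin {0<..} (f k) s = ((-1) ^ k * (of_real (Q (Suc k) / Q k) * of_real (Q (Suc k)) powr (- s))) * bose_mellin s" for k
    unfolding f_def mellin_cmult mellin_scale(1)[OF Q_pos] bose_mellin_eq[OF s] by simp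
  have pw: "summable (\<lambda>k. norm (f k t))" if "t \<in> {0<..}" for t
  proof -
    have "norm (f k t) = \<bar>bose (Q (Suc k) * t) / (Q k * t)\<bar>" for k
      using f[of t k] that by (simp only: greaterThan_iff norm_of_real) (simp add: abs_mult)
    then show ?thesis using D_lambert_summable[of t] that by (simp only: greaterThan_iff)
  qed
  define J where "J = (LINT t:{0<..}|lborel. t powr (Re s - 1) * norm (bose_div t))"
  have J0: "0 \<le> J" unfolding J_def set_lebesgue_integral_def by (intro integral_nonneg_AE) auto
  have intk: "(LINT t:{0<..}|lborel. t powr (Re s - 1) * norm (f k t)) = Q (Suc k) / Q k * Q (Suc k) powr (- Re s) * J" for k
  proof -
    let ?c = "Q (Suc k)"
    have c: "0 < ?c" "0 < Q k" by (rule Q_pos)+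
    have "(LINT t:{0<..}|lborel. t powr (Re s - 1) * norm (f k t)) =
      (LINT t:{0<..}|lborel. (?c / Q k * ?c powr (1 - Re s)) * ((?c * t) powr (Re s - 1) * norm (bose_div (?c * t))))"
    proof (intro set_lebesgue_integral_cong allI impI)
      fix t :: real assume "t \<in> {0<..}"
      then have "t powr (Re s - 1) = ?c powr (1 - Re s) * (?c * t) powr (Re s - 1)"
        using c by (simp add: powr_mult mult.assoc[symmetric] powr_add[symmetric])
      then show "t powr (Re s - 1) * norm (f k t) = (?c / Q k * ?c powr (1 - Re s)) * ((?c * t) powr (Re s - 1) * norm (bose_div (?c * t)))"
        using c by (simp add: f_def norm_mult norm_power norm_divide)
    qed auto
    also have "\<dots> = (?c / Q k * ?c powr (1 - Re s)) * (LINT t:{0<..}|lborel. (?c * t) powr (Re s - 1) * norm (bose_div (?c * t)))"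
      by simp
    also have "(LINT t:{0<..}|lborel. (?c * t) powr (Re s - 1) * norm (bose_div (?c * t))) = J / ?c"
      using set_integral_scale(1)[OF c(1), of "\<lambda>t. t powr (Re s - 1) * norm (bose_div t)"] c by (simp add: J_def field_simps)
    also have "(?c / Q k * ?c powr (1 - Re s)) * (J / ?c) = ?c / Q k * ?c powr (- Re s) * J"
      using c by (simp add: powr_diff powr_minus_divide)
    finally show ?thesis .
  qed
  have sm: "summable (\<lambda>k. LINT t:{0<..}|lborel. t powr (Re s - 1) * norm (f k t))"
  proof (rule summable_comparison_test'[OF summable_mult2[OF summable_inverse_Q, of J]])
    fix k
    have c: "0 < Q (Suc k)" "0 < Q k" "1 \<le> Q (Suc k)" by (rule Q_pos Q_ge_1)+
    have "Q (Suc k) / Q k * Q (Suc k) powr (- Re s) = Q (Suc k) powr (1 - Re s) / Q k"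
      using c by (simp add: powr_diff powr_minus_divide)
    also have "\<dots> \<le> Q (Suc k) powr 0 / Q k" using c s by (intro divide_right_mono powr_mono) auto
    finally have "Q (Suc k) / Q k * Q (Suc k) powr (- Re s) * J \<le> 1 / Q k * J" using J0 c by (intro mult_right_mono) auto
    moreover have "0 \<le> Q (Suc k) / Q k * Q (Suc k) powr (- Re s) * J" using J0 c by simp
    ultimately show "norm (LINT t:{0<..}|lborel. t powr (Re s - 1) * norm (f k t)) \<le> 1 / Q k * J"
      unfolding intk by simp
  qed
  have eq: "(\<Sum>k. f k t) = of_real (D_lambert t)" if "t \<in> {0<..}" for t
  proof -
    have "summable (\<lambda>k. (-1) ^ k * (bose (Q (Suc k) * t) / (Q k * t)))"
      by (rule summable_rabs_cancel) (use D_lambert_summable[of t] that in \<open>simp add: abs_mult\<close>)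
    from suminf_of_real[OF this, where 'a = complex] show ?thesis
      using that by (simp only: D_lambert_def f greaterThan_iff)
  qed
  have sums: "(\<lambda>k. mellin {0<..} (f k) s) sums mellin {0<..} (\<lambda>t. \<Sum>k. f k t) s"
    and conv': "mellin_conv {0<..} (\<lambda>t. \<Sum>k. f k t) s"
    using mellin_sums[of "{0<..}" f s] conv pw sm by auto
  show "mellin_conv {0<..} (\<lambda>t. of_real (D_lambert t)) s"
    using conv' by (subst mellin_conv_cong[of _ _ "\<lambda>t. \<Sum>k. f k t"]) (auto simp: eq)
  have "mellin {0<..} (\<lambda>t. of_real (D_lambert t)) s = mellin {0<..} (\<lambda>t. \<Sum>k. f k t) s"
    by (rule mellin_cong) (auto simp: eq)
  also have "\<dots> = (\<Sum>k. mellin {0<..} (f k) s)" using sums by (simp add: sums_iff)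
  also have "\<dots> = (\<Sum>k. ((-1) ^ k * (of_real (Q (Suc k) / Q k) * of_real (Q (Suc k)) powr (- s))) * bose_mellin s)"
    by (simp only: m)
  also have "\<dots> = (\<Sum>k. (-1) ^ k * (of_real (Q (Suc k) / Q k) * of_real (Q (Suc k)) powr (- s))) * bose_mellin s"
  proof (rule suminf_mult2[symmetric])
    show "summable (\<lambda>k. (-1) ^ k * (complex_of_real (Q (Suc k) / Q k) * of_real (Q (Suc k)) powr (- s)))"
    proof (rule summable_comparison_test'[OF summable_inverse_Q])
      fix k
      have c: "0 < Q (Suc k)" "0 < Q k" "1 \<le> Q (Suc k)" by (rule Q_pos Q_ge_1)+
      have "Q (Suc k) / Q k * Q (Suc k) powr (- Re s) = Q (Suc k) powr (1 - Re s) / Q k"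
        using c by (simp add: powr_diff powr_minus_divide)
      also have "\<dots> \<le> Q (Suc k) powr 0 / Q k" using c s by (intro divide_right_mono powr_mono) auto
      finally show "norm ((-1) ^ k * (complex_of_real (Q (Suc k) / Q k) * of_real (Q (Suc k)) powr (- s))) \<le> 1 / Q k"
        using c by (simp add: norm_mult norm_power norm_divide norm_of_real_powr)
    qed
  qed
  finally show "mellin {0<..} (\<lambda>t. of_real (D_lambert t)) s = (\<Sum>k. (-1) ^ k * (of_real (Q (Suc k) / Q k) * of_real (Q (Suc k)) powr (- s))) * bose_mellin s" .
qed

lemma lacunary_L_eq:
  "lacunary_series.L (\<lambda>k. ln (Q k)) (\<lambda>k. (-1) ^ k) s = (\<Sum>k. (-1) ^ k * (of_real (Q (Suc k) / Q k) * of_real (Q (Suc k)) powr (- s)))"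
  if "iota < 1"
proof -
  interpret lacunary_series "\<lambda>k. ln (Q k)" "1 - iota" "\<lambda>k. (-1) ^ k" by (rule lacunary[OF that])
  have "trm 0 k s = (-1) ^ k * (of_real (Q (Suc k) / Q k) * of_real (Q (Suc k)) powr (- s))" for k
  proof -
    have c: "0 < Q (Suc k)" "0 < Q k" by (rule Q_pos)+
    have "exp (complex_of_real (ln (Q (Suc k)) - ln (Q k)) - s * of_real (ln (Q (Suc k)))) =
        exp (of_real (ln (Q (Suc k)) - ln (Q k))) * exp (- s * of_real (ln (Q (Suc k))))"
      by (simp add: exp_add[symmetric])
    also have "exp (complex_of_real (ln (Q (Suc k)) - ln (Q k))) = of_real (Q (Suc k) / Q k)"
      using c by (subst exp_of_real) (simp add: exp_diff)
    also have "exp (- s * of_real (ln (Q (Suc k)))) = of_real (Q (Suc k)) powr (- s)"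
      using c by (simp add: powr_def Ln_of_real)
    finally show ?thesis by (simp add: trm_def)
  qed
  then show ?thesis by (simp add: L_def)
qed

text \<open>Only the linear term q t of 1 - exp(-q t) has to meet \<open>D_lambert\<close>: the
  quadratic part times \<open>rem_lambert\<close> = O(1 / t) is O(t). The explicit poles of
  \<open>rem_lambert_eq_D\<close> go into g1 and c1.\<close>

lemma A_lambert_minus_D_lambert:
  assumes d: "0 < d" "d \<le> 1"
  obtains g1 c1 R1 C where "R1 \<in> borel_measurable borel" "\<And>t. 0 < t \<Longrightarrow> t \<le> 1 \<Longrightarrow> norm (R1 t) \<le> C * t powr (1 - d)"
    "\<And>t. 0 < t \<Longrightarrow> t \<le> 1 \<Longrightarrow> of_real (A_lambert q t) = of_int q * (of_real t * complex_of_real (D_lambert t)) + g1 / of_real t + c1 + R1 t"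
proof -
  let ?G = "\<lambda>t. complex_of_real (A_lambert q t)"
  obtain Gh where Gh: "Gh holomorphic_on ball 0 6"
    "\<And>t. 0 < t \<Longrightarrow> t < 6 \<Longrightarrow> ?G t = Gh (of_real t) / of_real t + (1 - exp (- (of_int q * of_real t))) * of_real (rem_lambert t)"
    using A_lambert_near_0[of q] by blast
  obtain k1 where k1: "k1 holomorphic_on ball 0 6" "\<And>z. Gh z = Gh 0 + z * k1 z"
    using holomorphic_taylor_split[OF Gh(1)] by auto
  obtain k2 where k2: "k2 holomorphic_on ball 0 6" "\<And>z. k1 z = k1 0 + z * k2 z"
    using holomorphic_taylor_split[OF k1(1)] by auto
  obtain e2 where e2: "e2 holomorphic_on ball 0 6" "\<And>z. expm1_div (- of_int q) z = expm1_div (- of_int q) 0 + z * e2 z"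
    using holomorphic_taylor_split[OF expm1_div_holomorphic, of 6 "- of_int q"] by auto
  obtain B2 where B2: "0 < B2" "\<And>t. 0 \<le> t \<Longrightarrow> t \<le> 1 \<Longrightarrow> norm (k2 (complex_of_real t)) \<le> B2"
    using holomorphic_bounded_unit[OF k2(1)] by auto
  obtain B1 where B1: "0 < B1" "\<And>t. 0 \<le> t \<Longrightarrow> t \<le> 1 \<Longrightarrow> norm (e2 (complex_of_real t)) \<le> B1"
    using holomorphic_bounded_unit[OF e2(1)] by auto
  obtain C0 where C0: "0 < C0" "\<And>t. 0 < t \<Longrightarrow> \<bar>rem_lambert t\<bar> \<le> C0 * t powr (0 - 1)"
    using rem_lambert_bound[of 0] summable_Q_ratio[of 0] by auto
  obtain C1 where C1: "0 < C1" "\<And>t. 0 < t \<Longrightarrow> \<bar>omega_lambert t\<bar> \<le> C1 * t powr (- d)"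
    using omega_lambert_bound[OF d] by blast
  define g1 where "g1 = Gh 0 - of_int q * of_real \<beta>"
  define c1 where "c1 = k1 0 + of_int q * of_real ((1 - e0) / 2)"
  define R1 where "R1 = (\<lambda>t. ?G t - of_int q * (of_real t * complex_of_real (D_lambert t)) - g1 / of_real t - c1)"
  have Rm: "R1 \<in> borel_measurable borel" unfolding R1_def by measurable
  have Rb: "norm (R1 t) \<le> (B2 + B1 * C0 + \<bar>of_int q\<bar> * C1) * t powr (1 - d)" if t: "0 < t" "t \<le> 1" for t
  proof -
    define z where "z = complex_of_real t"
    define r D w where "r = complex_of_real (rem_lambert t)" and "D = complex_of_real (D_lambert t)" and "w = complex_of_real (omega_lambert t)"
    have z: "z \<noteq> 0" using t by (simp add: z_def)
    have "expm1_div (- of_int q) 0 = - of_int q" by (simp add: expm1_div_def)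
    then have "exp (- (of_int q * z)) - 1 = z * (- of_int q + z * e2 z)"
      using e2(2)[of z] z by (simp add: expm1_div_def divide_eq_eq mult.commute)
    then have "1 - exp (- (of_int q * z)) = - (z * (- of_int q + z * e2 z))" by (metis minus_diff_eq)
    also have "\<dots> = of_int q * z - z * z * e2 z" by (simp add: algebra_simps)
    finally have eq1: "1 - exp (- (of_int q * z)) = of_int q * z - z * z * e2 z" .
    have "?G t = Gh z / z + (of_int q * z - z * z * e2 z) * r"
      using Gh(2)[of t] t unfolding z_def[symmetric] r_def[symmetric] eq1 by simp
    also have "Gh z / z = Gh 0 / z + k1 0 + z * k2 z"
      using z k1(2)[of z] k2(2)[of z] by (simp add: field_simps)
    finally have G: "?G t = Gh 0 / z + k1 0 + z * k2 z - z * z * e2 z * r + of_int q * z * r"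
      by (simp add: algebra_simps)
    have rq: "r = D + w - of_real \<beta> / z\<^sup>2 + of_real (1 - e0) / (2 * z)"
      unfolding r_def rem_lambert_eq_D[OF t(1)] by (simp add: D_def w_def z_def)
    have "of_int q * z * r = of_int q * (z * D) + of_int q * z * w - of_int q * of_real \<beta> / z + of_int q * of_real ((1 - e0) / 2)"
      unfolding rq using z by (simp add: field_simps power2_eq_square)
    then have "R1 t = z * k2 z - z * z * e2 z * r + of_int q * z * w"
      using G by (simp add: R1_def g1_def c1_def z_def[symmetric] D_def[symmetric] diff_divide_distrib)
    then have "norm (R1 t) \<le> norm (z * k2 z - z * z * e2 z * r) + norm (of_int q * z * w)"
      using norm_triangle_ineq by metis
    also have "\<dots> \<le> (norm (z * k2 z) + norm (z * z * e2 z * r)) + norm (of_int q * z * w)"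
      by (intro add_mono norm_triangle_ineq4) auto
    also have "\<dots> = t * norm (k2 z) + t * norm (e2 z) * (t * \<bar>rem_lambert t\<bar>) + \<bar>of_int q\<bar> * (t * \<bar>omega_lambert t\<bar>)"
      using t by (simp add: norm_mult z_def r_def w_def)
    also have "\<dots> \<le> t powr (1 - d) * B2 + t powr (1 - d) * B1 * C0 + \<bar>of_int q\<bar> * (t powr (1 - d) * C1)"
    proof -
      have "t powr 1 \<le> t powr (1 - d)" using t d by (intro powr_mono') auto
      then have tt: "t \<le> t powr (1 - d)" using t by simp
      have "t * \<bar>rem_lambert t\<bar> \<le> t * (C0 * t powr (0 - 1))" using C0(2)[OF t(1)] t by (intro mult_left_mono) auto
      also have "\<dots> = C0" using t by (simp add: powr_minus_divide)
      finally have tr: "t * \<bar>rem_lambert t\<bar> \<le> C0" .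
      have "t * \<bar>omega_lambert t\<bar> \<le> t * (C1 * t powr (- d))" using C1(2)[OF t(1)] t by (intro mult_left_mono) auto
      also have "\<dots> = t powr (1 - d) * C1" using t by (simp add: powr_diff powr_minus_divide)
      finally have to: "t * \<bar>omega_lambert t\<bar> \<le> t powr (1 - d) * C1" .
      have kk: "norm (k2 z) \<le> B2" "norm (e2 z) \<le> B1" using B1(2)[of t] B2(2)[of t] t by (auto simp: z_def)
      have 1: "t * norm (k2 z) \<le> t powr (1 - d) * B2" using tt kk t by (intro mult_mono) auto
      have 20: "t * norm (e2 z) \<le> t powr (1 - d) * B1" using tt kk t by (intro mult_mono) auto
      have 2: "t * norm (e2 z) * (t * \<bar>rem_lambert t\<bar>) \<le> t powr (1 - d) * B1 * C0"
        by (rule mult_mono[OF 20 tr]) (use t B1 in auto)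
      have 3: "\<bar>of_int q\<bar> * (t * \<bar>omega_lambert t\<bar>) \<le> \<bar>of_int q\<bar> * (t powr (1 - d) * C1)"
        by (intro mult_left_mono to) auto
      show ?thesis by (rule add_mono[OF add_mono[OF 1 2] 3])
    qed
    also have "\<dots> = (B2 + B1 * C0 + \<bar>of_int q\<bar> * C1) * t powr (1 - d)" by (simp add: algebra_simps)
    finally show ?thesis .
  qed
  show ?thesis by (rule that[OF Rm Rb, of g1 c1]) (simp_all add: R1_def)
qed

text \<open>Solving the Mellin identity for the lacunary series expresses it through g and through
  functions known to be meromorphic up to Re s > -1. A continuation of g past -\<open>iota\<close>
  would thus continue the series past its abscissa.\<close>

lemma no_continuation:
  assumes iota1: "iota < 1" and q: "q \<noteq> 0"
    and mero: "h meromorphic_on {s. x < Re s}" and x: "x < - iota"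
    and eq: "\<And>s. c < Re s \<Longrightarrow> h s = g_series \<alpha> q s"
  shows False
proof -
  \<comment> \<open>x may be far to the left, but the correction terms are controlled only to the
    right of -1. The midpoint of -1 and -\<open>iota\<close> serves as a lower bound.\<close>
  define x' where "x' = max x (- (1 + iota) / 2)"
  have x': "x \<le> x'" "- 1 < x'" "x' < - iota" proof -
    have "- 1 < - (1 + iota) / 2" "- (1 + iota) / 2 < - iota" using iota1 by (simp_all add: field_simps)
    then show "x \<le> x'" "- 1 < x'" "x' < - iota" using x unfolding x'_def by linarith+
  qed
  define d where "d = x' + 1"
  have d: "0 < d" "d \<le> 1" "d < 1 - iota" using x' iota_nonneg by (auto simp: d_def)
  let ?G = "\<lambda>t. complex_of_real (A_lambert q t)"
  let ?D = "\<lambda>t. complex_of_real (D_lambert t)"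
  obtain R1 C g1 c1 where R1: "R1 \<in> borel_measurable borel" "\<And>t. 0 < t \<Longrightarrow> t \<le> 1 \<Longrightarrow> norm (R1 t) \<le> C * t powr (1 - d)"
    "\<And>t. 0 < t \<Longrightarrow> t \<le> 1 \<Longrightarrow> ?G t = of_int q * (of_real t * ?D t) + g1 / of_real t + c1 + R1 t"
    by (rule A_lambert_minus_D_lambert[OF d(1,2), of q]) (rule that, assumption+)
  obtain CD where CD: "\<And>t. 1 < t \<Longrightarrow> norm (?D t) \<le> CD * exp (- (1 * t))" using D_lambert_decay by blast
  have Dh: "mellin {1<..} ?D holomorphic_on S" for S
    by (rule mellin_at_infinity_holomorphic[OF _ CD]) auto
  have R1h: "mellin {0<..1} R1 holomorphic_on {s. - (1 - d) < Re s}"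
    by (rule mellin_near_0_holomorphic[OF R1(1,2)]) auto
  define rest where "rest = (\<lambda>s. (mellin {1<..} ?G s + mellin {0<..1} R1 s) + g1 / (s - 1) + c1 / s)"
  \<comment> \<open>The argument is shifted, z = s + 1, because \<open>D_lambert\<close> occurs
    multiplied by t.\<close>
  define Lm where "Lm = (\<lambda>z. (h (z - 1) / rGamma (z - 1) - rest (z - 1) + of_int q * mellin {1<..} ?D z) / (of_int q * bose_mellin z))"
  have rest_mero: "rest meromorphic_on {s. x' < Re s}"
  proof -
    have "(\<lambda>s. mellin {1<..} ?G s + mellin {0<..1} R1 s) holomorphic_on {s. x' < Re s}"
      by (intro holomorphic_intros mellin_A_lambert_tail holomorphic_on_subset[OF R1h]) (auto simp: d_def)
    then have "(\<lambda>s. mellin {1<..} ?G s + mellin {0<..1} R1 s) analytic_on {s. x' < Re s}"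
      by (simp add: analytic_on_open open_halfspace_Re_gt)
    then show ?thesis unfolding rest_def
      by (intro meromorphic_intros analytic_on_imp_meromorphic_on[of "\<lambda>s. mellin {1<..} ?G s + mellin {0<..1} R1 s"])
  qed
  have Lm_mero: "Lm meromorphic_on {z. d < Re z}"
  proof -
    have sub: "(\<lambda>z. z - 1) ` {z. d < Re z} \<subseteq> {s. x' < Re s}" by (auto simp: d_def)
    have "h meromorphic_on {s. x' < Re s}" by (rule meromorphic_on_subset[OF mero]) (use x' in auto)
    then have 1: "(\<lambda>z. h (z - 1)) meromorphic_on {z. d < Re z}"
      by (rule meromorphic_on_compose[OF _ _ sub]) (auto intro!: analytic_intros)
    have 2: "(\<lambda>z. rest (z - 1)) meromorphic_on {z. d < Re z}"
      by (rule meromorphic_on_compose[OF rest_mero _ sub]) (auto intro!: analytic_intros)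
    have 3: "(\<lambda>z. rGamma (z - 1)) meromorphic_on {z. d < Re z}"
      by (intro analytic_on_imp_meromorphic_on) (auto simp: analytic_on_open open_halfspace_Re_gt intro!: holomorphic_intros)
    have 4: "mellin {1<..} ?D meromorphic_on {z. d < Re z}"
      by (intro analytic_on_imp_meromorphic_on) (auto simp: analytic_on_open open_halfspace_Re_gt intro!: Dh)
    have 5: "bose_mellin meromorphic_on {z. d < Re z}"
      by (rule meromorphic_on_subset[OF bose_mellin_meromorphic]) (use d in auto)
    show ?thesis unfolding Lm_def by (intro meromorphic_intros 1 2 3 4 5)
  qed
  define c' where "c' = max 3 (c + 2)"
  have c': "0 < c'" "3 \<le> c'" "c + 1 < c'" by (auto simp: c'_def)
  obtain U where U: "open U" "U \<noteq> {}" "U \<subseteq> {s. c' < Re s}" "\<And>s. s \<in> U \<Longrightarrow> bose_mellin s \<noteq> 0"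
    using bose_mellin_nonzero[OF c'(1)] by blast
  interpret lacunary_series "\<lambda>k. ln (Q k)" "1 - iota" "\<lambda>k. (-1) ^ k" by (rule lacunary[OF iota1])
  have "Lm z = L z" if z: "z \<in> U" for z
  proof -
    define s where "s = z - 1"
    have "c' < Re z" using U(3) z by auto
    then have s: "2 < Re s" "c < Re s" "2 < Re z" using c' by (auto simp: s_def)
    have zs: "z = s + 1" by (simp add: s_def)
    have sub: "{0<..1::real} \<subseteq> {0<..}" by auto
    have convD: "mellin_conv {0<..} ?D z" by (rule mellin_D_lambert(2)[OF s(3)])
    then have convD1: "mellin_conv {0<..1} ?D z" by (rule mellin_conv_subset) auto
    have Dt: "mellin_conv {0<..1} (\<lambda>t. of_real t * ?D t) s" "mellin {0<..1} (\<lambda>t. of_real t * ?D t) s = mellin {0<..1} ?D z"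
      using mellin_mult_t[OF sub, of ?D s] convD1 zs by auto
    have convR: "mellin_conv {0<..1} R1 s"
      by (rule mellin_conv_near_0[OF R1(1,2)]) (use s d in auto)
    have Ds: "mellin {0<..1} ?D z = L z * bose_mellin z - mellin {1<..} ?D z"
      using mellin_split[OF convD zero_less_one] mellin_D_lambert(1)[OF s(3)] lacunary_L_eq[OF iota1, of z] by simp
    have "mellin {0<..1} ?G s = mellin {0<..1} (\<lambda>t. ((of_int q * (of_real t * ?D t) + g1 / of_real t) + c1) + R1 t) s"
      by (rule mellin_cong) (auto simp: R1(3))
    also have "\<dots> = of_int q * mellin {0<..1} ?D z + g1 / (s - 1) + c1 / s + mellin {0<..1} R1 s"
      using s by (simp add: mellin_add mellin_conv_add mellin_conv_cmult mellin_cmult convR mellin_inverse_t mellin_const Dt)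
    finally have G1: "mellin {0<..1} ?G s = of_int q * mellin {0<..1} ?D z + g1 / (s - 1) + c1 / s + mellin {0<..1} R1 s" .
    have "Gamma s * g_series \<alpha> q s = mellin {0<..1} ?G s + mellin {1<..} ?G s"
      using mellin_A_lambert(1)[of s q] mellin_split[OF mellin_A_lambert(2)[of s q] zero_less_one] s by simp
    then have "Gamma s * g_series \<alpha> q s = of_int q * mellin {0<..1} ?D z + rest s"
      by (simp add: G1 rest_def)
    moreover have "h s / rGamma s = Gamma s * g_series \<alpha> q s"
      using eq[OF s(2)] Gamma_rGamma[of s] s by (simp add: rGamma_inverse_Gamma field_simps)
    ultimately have "h s / rGamma s - rest s + of_int q * mellin {1<..} ?D z = of_int q * (L z * bose_mellin z)"
      by (simp add: Ds algebra_simps)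
    then have "Lm z = of_int q * (L z * bose_mellin z) / (of_int q * bose_mellin z)" by (simp add: Lm_def s_def[symmetric])
    then show ?thesis using U(4)[OF z] q by simp
  qed
  moreover have "U \<subseteq> {s. 1 - iota < Re s}" using U(3) c' iota_nonneg by auto
  ultimately show False using no_meromorphic_continuation[OF Lm_mero d(3) U(1,2)] by blast
qed

end

section \<open>Quadratic irrationals\<close>

text \<open>Each step multiplies the distance of the two sequences by the product of the new
  members, and over two steps this factor is at least 4. The distance stays below 1, both members
  lying in the same unit interval, so it must be 0. One sequence may be one of conjugates, hence the
  formulation for arbitrary sequences.\<close>

lemma cf_expansion_unique:
  fixes u v a :: "nat \<Rightarrow> real"
  assumes u: "\<And>n. a n < u n" "\<And>n. u n < a n + 1" "\<And>n. u (Suc n) = 1 / (u n - a n)"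
    and v: "\<And>n. a n < v n" "\<And>n. v n < a n + 1" "\<And>n. v (Suc n) = 1 / (v n - a n)"
    and a: "\<And>n. 1 \<le> a (Suc n)"
  shows "u 0 = v 0"
proof (rule ccontr)
  assume ne: "u 0 \<noteq> v 0"
  have two: "2 \<le> w (Suc n) * w (Suc (Suc n))" if w: "\<And>n. a n < w n" "\<And>n. w (Suc n) = 1 / (w n - a n)" for w n
  proof -
    have gt: "1 < w (Suc (Suc n))" using w(1)[of "Suc (Suc n)"] a[of "Suc n"] by simp
    have d: "0 < w (Suc n) - a (Suc n)" using w(1)[of "Suc n"] by simp
    have "w (Suc (Suc n)) * (w (Suc n) - a (Suc n)) = 1" using w(2)[of "Suc n"] d by simp
    then have "w (Suc n) * w (Suc (Suc n)) = a (Suc n) * w (Suc (Suc n)) + 1" by (simp add: algebra_simps)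
    moreover have "1 * 1 \<le> a (Suc n) * w (Suc (Suc n))" using a[of n] gt by (intro mult_mono) auto
    ultimately show ?thesis by simp
  qed
  have step: "\<bar>u (Suc n) - v (Suc n)\<bar> = \<bar>u n - v n\<bar> * (u (Suc n) * v (Suc n))" for n
  proof -
    have d: "0 < u n - a n" "0 < v n - a n" using u(1)[of n] v(1)[of n] by auto
    have "u (Suc n) - v (Suc n) = (v n - u n) * (u (Suc n) * v (Suc n))"
      unfolding u(3)[of n] v(3)[of n] using d by (simp add: field_simps)
    moreover have "0 < u (Suc n) * v (Suc n)" unfolding u(3)[of n] v(3)[of n] using d by simp
    ultimately have "\<bar>u (Suc n) - v (Suc n)\<bar> = \<bar>v n - u n\<bar> * (u (Suc n) * v (Suc n))"
      by (metis abs_mult abs_of_pos)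
    then show ?thesis by (simp only: abs_minus_commute)
  qed
  have grow: "4 * \<bar>u n - v n\<bar> \<le> \<bar>u (Suc (Suc n)) - v (Suc (Suc n))\<bar>" for n
  proof -
    have "2 * 2 \<le> (u (Suc n) * u (Suc (Suc n))) * (v (Suc n) * v (Suc (Suc n)))"
      using two[OF u(1,3), of n] two[OF v(1,3), of n] by (intro mult_mono) auto
    then have "\<bar>u n - v n\<bar> * 4 \<le> \<bar>u n - v n\<bar> * ((u (Suc n) * u (Suc (Suc n))) * (v (Suc n) * v (Suc (Suc n))))"
      by (intro mult_left_mono) auto
    then show ?thesis unfolding step[of "Suc n"] step[of n] by (simp add: mult_ac)
  qed
  have pow: "4 ^ k * \<bar>u 0 - v 0\<bar> \<le> \<bar>u (2 * k) - v (2 * k)\<bar>" for k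
  proof (induction k)
    case (Suc k)
    have "4 ^ Suc k * \<bar>u 0 - v 0\<bar> \<le> 4 * \<bar>u (2 * k) - v (2 * k)\<bar>" using Suc by simp
    also have "\<dots> \<le> \<bar>u (2 * Suc k) - v (2 * Suc k)\<bar>" using grow[of "2 * k"] by simp
    finally show ?case .
  qed simp
  obtain k where k: "1 / \<bar>u 0 - v 0\<bar> < 4 ^ k" using real_arch_pow[of 4 "1 / \<bar>u 0 - v 0\<bar>"] by auto
  have "1 < 4 ^ k * \<bar>u 0 - v 0\<bar>" using k ne by (simp add: field_simps)
  moreover have "\<bar>u (2 * k) - v (2 * k)\<bar> < 1" using u(1,2)[of "2 * k"] v(1,2)[of "2 * k"] by linarith
  ultimately show False using pow[of k] by linarith
qed

context irrational_number
begin

lemma theta_bounds: "real_of_int (a n) < \<theta> n" "\<theta> n < real_of_int (a n) + 1"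
  using theta_diff_pos[of n] unfolding partial_quotient_def by linarith+

lemma theta_eq_if_same_quotients:
  assumes "\<And>i. a (m + i) = a (n + i)"
  shows "\<theta> m = \<theta> n"
proof (cases "\<theta> m = \<theta> n")
  case False
  have "\<theta> (m + 0) = \<theta> (n + 0)"
  proof (rule cf_expansion_unique[of "\<lambda>i. real_of_int (a (m + i))" "\<lambda>i. \<theta> (m + i)" "\<lambda>i. \<theta> (n + i)"])
    show "1 \<le> real_of_int (a (m + Suc i))" for i using a_ge_1[of "m + i"] by simp
    show "\<theta> (n + Suc i) = 1 / (\<theta> (n + i) - real_of_int (a (m + i)))" for i
      using theta_Suc[of "n + i"] assms[of i] by simp
    show "real_of_int (a (m + i)) < \<theta> (n + i)" "\<theta> (n + i) < real_of_int (a (m + i)) + 1" for i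
      using theta_bounds[of "n + i"] assms[of i] by auto
    show "\<theta> (m + Suc i) = 1 / (\<theta> (m + i) - real_of_int (a (m + i)))" for i using theta_Suc[of "m + i"] by simp
  qed (rule theta_bounds)+
  then show ?thesis by simp
qed

text \<open>Lagrange's theorem. Once the conjugates \<open>\<phi> n\<close> of the complete quotients are negative, the
  integral quadratic equations of the \<open>\<theta> n\<close> have fixed discriminant and outer coefficients of
  opposite sign, so there are only finitely many of them.\<close>

lemma quadratic_theta_repeats:
  assumes quad: "quadratic_irrational \<alpha>"
  obtains m n where "m < n" "\<theta> m = \<theta> n"
proof -
  obtain qa qb qc :: int where q: "qa \<noteq> 0" "of_int qa * \<alpha>\<^sup>2 + of_int qb * \<alpha> + of_int qc = 0"
    using quad by (auto simp: quadratic_irrational_def)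
  \<comment> \<open>The conjugate root, read off from the sum of the roots. Running it through the
    partial quotients of \<alpha> makes \<open>\<phi> n\<close> the conjugate of
    \<open>\<theta> n\<close>.\<close>
  define \<alpha>' where "\<alpha>' = - of_int qb / of_int qa - \<alpha>"
  define \<phi> where "\<phi> = rec_nat \<alpha>' (\<lambda>n x. 1 / (x - real_of_int (a n)))"
  have phi0: "\<phi> 0 = \<alpha>'" and phiS: "\<phi> (Suc n) = 1 / (\<phi> n - real_of_int (a n))" for n
    by (simp_all add: \<phi>_def)
  have irr': "\<alpha>' \<notin> \<rat>"
  proof
    assume "\<alpha>' \<in> \<rat>"
    moreover have "\<alpha> = - of_int qb / of_int qa - \<alpha>'" by (simp add: \<alpha>'_def)
    ultimately show False using irr by (metis Rats_diff Rats_divide Rats_minus_iff Rats_of_int)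
  qed
  have ne0: "\<alpha>' \<noteq> \<alpha>"
  proof
    assume "\<alpha>' = \<alpha>"
    then have "\<alpha> = - of_int qb / of_int qa / 2" by (simp add: \<alpha>'_def)
    then show False using irr by (metis Rats_divide Rats_minus_iff Rats_number_of Rats_of_int)
  qed
  have phi_irr: "\<phi> n \<notin> \<rat>" for n
  proof (induction n)
    case 0
    then show ?case using irr' by (simp add: phi0)
  next
    case (Suc n)
    show ?case
    proof
      assume "\<phi> (Suc n) \<in> \<rat>"
      then have "1 / \<phi> (Suc n) + real_of_int (a n) \<in> \<rat>" by simp
      moreover have "1 / \<phi> (Suc n) + real_of_int (a n) = \<phi> n" by (simp add: phiS)
      ultimately show False using Suc by simp
    qed
  qed
  define disc where "disc = (real_of_int qa)\<^sup>2 * (\<alpha> - \<alpha>')\<^sup>2"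
  have inv: "\<exists>A B C :: int. A \<noteq> 0 \<and> real_of_int B = - A * (\<theta> n + \<phi> n) \<and> real_of_int C = A * (\<theta> n * \<phi> n) \<and>
      (real_of_int A)\<^sup>2 * (\<theta> n - \<phi> n)\<^sup>2 = disc" for n
  proof (induction n)
    case 0
    have qa: "real_of_int qa \<noteq> 0" using q by simp
    have "real_of_int qb = - qa * (\<alpha> + \<alpha>')" using qa by (simp add: \<alpha>'_def)
    moreover have "real_of_int qc = qa * (\<alpha> * \<alpha>')"
    proof -
      have "qa * (\<alpha> * \<alpha>') = - (qa * \<alpha>\<^sup>2 + qb * \<alpha>)" using qa by (simp add: \<alpha>'_def field_simps power2_eq_square)
      then show ?thesis using q(2) by linarith
    qed
    ultimately show ?case using q(1) by (intro exI[of _ qa] exI[of _ qb] exI[of _ qc]) (simp add: phi0 disc_def)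
  next
    case (Suc n)
    then obtain A B C :: int where ABC: "A \<noteq> 0" "real_of_int B = - real_of_int A * (\<theta> n + \<phi> n)" "real_of_int C = A * (\<theta> n * \<phi> n)"
      "(real_of_int A)\<^sup>2 * (\<theta> n - \<phi> n)\<^sup>2 = disc"
      by (elim exE conjE) (rule that, assumption+)
    define k where "k = a n"
    define x y where "x = \<theta> n - real_of_int k" and "y = \<phi> n - real_of_int k"
    have x: "x \<noteq> 0" using theta_diff_pos[of n] by (simp add: x_def k_def)
    have y: "y \<noteq> 0" 
    proof
      assume "y = 0"
      then have "\<phi> n = real_of_int k" by (simp add: y_def)
      then show False using phi_irr[of n] by simp
    qed
    have tx: "\<theta> n = x + k" "\<phi> n = y + k" by (simp_all add: x_def y_def)
    have t1: "\<theta> (Suc n) = 1 / x" "\<phi> (Suc n) = 1 / y" by (simp_all add: theta_Suc phiS x_def y_def k_def)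
    \<comment> \<open>With p(X) = A X^2 + B X + C, substituting k + 1 / X and multiplying by X^2
      gives the coefficients p(k), p'(k) and A.\<close>
    define A1 B1 :: int where "A1 = A * k\<^sup>2 + B * k + C" and "B1 = 2 * A * k + B"
    have A1: "real_of_int A1 = A * (x * y)" unfolding A1_def of_int_add of_int_mult ABC(2,3) tx
      by (simp add: algebra_simps power2_eq_square)
    have B1: "real_of_int B1 = - A * (x + y)" unfolding B1_def of_int_add of_int_mult ABC(2) tx
      by (simp add: algebra_simps)
    have "A1 \<noteq> 0" using A1 ABC(1) x y by auto
    moreover have "real_of_int B1 = - A1 * (\<theta> (Suc n) + \<phi> (Suc n))" using x y by (simp add: A1 B1 t1 field_simps)
    moreover have "real_of_int A = A1 * (\<theta> (Suc n) * \<phi> (Suc n))" using x y by (simp add: A1 t1)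
    moreover have "(real_of_int A1)\<^sup>2 * (\<theta> (Suc n) - \<phi> (Suc n))\<^sup>2 = disc"
    proof -
      have "real_of_int A1 * (\<theta> (Suc n) - \<phi> (Suc n)) = - (A * (\<theta> n - \<phi> n))" using x y by (simp add: A1 t1 tx field_simps)
      then have "(real_of_int A1 * (\<theta> (Suc n) - \<phi> (Suc n)))\<^sup>2 = (A * (\<theta> n - \<phi> n))\<^sup>2" by simp
      then show ?thesis using ABC(4) by (simp add: power_mult_distrib)
    qed
    ultimately show ?case by (intro exI[of _ A1] exI[of _ B1] exI[of _ A]) (simp)
  qed
  \<comment> \<open>If all conjugates stayed positive, they would obey the same expansion as the
    complete quotients, and uniqueness would identify \<alpha> with its conjugate.\<close>
  have "\<exists>N. \<phi> (Suc N) < 0"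
  proof (rule ccontr)
    assume "\<nexists>N. \<phi> (Suc N) < 0"
    moreover have "\<phi> (Suc n) \<noteq> 0" for n using phi_irr[of "Suc n"] by auto
    ultimately have pos: "0 < \<phi> (Suc n)" for n by (meson linorder_neqE_linordered_idom)
    have gt: "real_of_int (a n) < \<phi> n" for n using pos[of n] by (simp add: phiS)
    have lt: "\<phi> n < real_of_int (a n) + 1" for n
    proof -
      have "1 < \<phi> (Suc n)" using gt[of "Suc n"] a_ge_1[of n] by linarith
      then have "1 < 1 / (\<phi> n - real_of_int (a n))" by (simp add: phiS)
      then show ?thesis using gt[of n] by (simp add: field_simps)
    qed
    have "\<theta> 0 = \<phi> 0"
    proof (rule cf_expansion_unique[of "\<lambda>i. real_of_int (a i)" \<theta> \<phi>])
      show "1 \<le> real_of_int (a (Suc i))" for i using a_ge_1[of i] by simp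
    qed (rule theta_bounds theta_Suc gt lt phiS)+
    then show False using ne0 by (simp add: phi0)
  qed
  then obtain N where N: "\<phi> (Suc N) < 0" by blast
  have neg: "\<phi> (Suc n) < 0" if "N \<le> n" for n
    using that
  proof (induction n rule: dec_induct)
    case (step n)
    then have "\<phi> (Suc n) - real_of_int (a (Suc n)) < 0" using a_ge_1[of n] by linarith
    then show ?case by (simp add: phiS[of "Suc n"])
  qed (rule N)
  from choice[OF allI[OF inv]] obtain A where "\<forall>n. \<exists>B C :: int. A n \<noteq> (0::int) \<and> real_of_int B = - real_of_int (A n) * (\<theta> n + \<phi> n) \<and> real_of_int C = A n * (\<theta> n * \<phi> n) \<and>
      (real_of_int (A n))\<^sup>2 * (\<theta> n - \<phi> n)\<^sup>2 = disc" by (rule exE) (rule that, assumption)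
  from choice[OF this] obtain B where "\<forall>n. \<exists>C :: int. A n \<noteq> (0::int) \<and> real_of_int (B n) = - real_of_int (A n) * (\<theta> n + \<phi> n) \<and> real_of_int C = A n * (\<theta> n * \<phi> n) \<and>
      (real_of_int (A n))\<^sup>2 * (\<theta> n - \<phi> n)\<^sup>2 = disc" by (rule exE) (rule that, assumption)
  from choice[OF this] obtain C where ABC': "\<forall>n. A n \<noteq> (0::int) \<and> real_of_int (B n) = - real_of_int (A n) * (\<theta> n + \<phi> n) \<and> real_of_int (C n) = A n * (\<theta> n * \<phi> n) \<and>
      (real_of_int (A n))\<^sup>2 * (\<theta> n - \<phi> n)\<^sup>2 = disc" by (rule exE) (rule that, assumption)
  have ABC: "A n \<noteq> 0" "real_of_int (B n) = - real_of_int (A n) * (\<theta> n + \<phi> n)"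
     "real_of_int (C n) = A n * (\<theta> n * \<phi> n)" "(real_of_int (A n))\<^sup>2 * (\<theta> n - \<phi> n)\<^sup>2 = disc" for n
    using spec[OF ABC', of n] by auto
  define M where "M = \<lfloor>disc\<rfloor>"
  define f where "f = (\<lambda>n. (A n, B n, C n))"
  have box: "f (Suc n) \<in> {-M..M} \<times> {-M..M} \<times> {-M..M}" if n: "N \<le> n" for n
  proof -
    let ?m = "Suc n"
    have th: "0 < \<theta> ?m" "\<phi> ?m < 0" using theta_gt_1[of n] neg[OF n] by auto
    have "real_of_int (A ?m * C ?m) = (real_of_int (A ?m))\<^sup>2 * (\<theta> ?m * \<phi> ?m)" by (simp add: ABC(3) power2_eq_square)
    also have "\<dots> < 0" using th ABC(1)[of ?m] by (intro mult_pos_neg) (auto simp: mult_pos_neg)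
    finally have "A ?m * C ?m < 0" by (simp only: of_int_less_0_iff)
    then have AC: "A ?m * C ?m \<le> - 1" by linarith
    \<comment> \<open>As A C is negative, the fixed discriminant is a sum of nonnegative terms B^2 +
      4 |A C|, each of which is therefore bounded.\<close>
    have "real_of_int ((B ?m)\<^sup>2 - 4 * (A ?m * C ?m)) = disc"
      unfolding ABC(4)[of ?m, symmetric] of_int_diff of_int_mult of_int_power ABC(2,3)
      by (simp add: algebra_simps power2_eq_square)
    then have M: "(B ?m)\<^sup>2 - 4 * (A ?m * C ?m) = M" unfolding M_def by (metis floor_of_int)
    have "\<bar>A ?m\<bar> * \<bar>C ?m\<bar> = - (A ?m * C ?m)" using AC by (simp add: abs_mult[symmetric])
    then have prod: "\<bar>A ?m\<bar> * \<bar>C ?m\<bar> \<le> M" using M AC zero_le_power2[of "B ?m"] by linarith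
    have C0: "C ?m \<noteq> 0" using AC by auto
    have "\<bar>A ?m\<bar> * 1 \<le> \<bar>A ?m\<bar> * \<bar>C ?m\<bar>" using C0 by (intro mult_left_mono) auto
    moreover have "1 * \<bar>C ?m\<bar> \<le> \<bar>A ?m\<bar> * \<bar>C ?m\<bar>" using ABC(1)[of ?m] by (intro mult_right_mono) auto
    moreover have "\<bar>B ?m\<bar> \<le> (B ?m)\<^sup>2"
    proof (cases "B ?m = 0")
      case False
      then have "\<bar>B ?m\<bar> * 1 \<le> \<bar>B ?m\<bar> * \<bar>B ?m\<bar>" by (intro mult_left_mono) auto
      then show ?thesis by (simp add: power2_eq_square)
    qed simp
    ultimately have "\<bar>A ?m\<bar> \<le> M" "\<bar>C ?m\<bar> \<le> M" "\<bar>B ?m\<bar> \<le> M" using prod M AC by linarith+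
    then show ?thesis unfolding f_def by (auto simp: abs_le_iff)
  qed
  have "\<not> inj_on (\<lambda>n. f (Suc n)) {N..}"
  proof
    assume inj: "inj_on (\<lambda>n. f (Suc n)) {N..}"
    have "finite ((\<lambda>n. f (Suc n)) ` {N..})"
    proof (rule finite_subset)
      show "(\<lambda>n. f (Suc n)) ` {N..} \<subseteq> {-M..M} \<times> {-M..M} \<times> {-M..M}" by (intro image_subsetI box) simp
    qed simp
    then have "finite {N..}" using inj by (rule finite_imageD)
    then show False using infinite_Ici by blast
  qed
  then obtain m n where mn: "N \<le> m" "N \<le> n" "m \<noteq> n" "f (Suc m) = f (Suc n)" unfolding inj_on_def atLeast_iff by blast
  have "\<theta> (Suc m) = \<theta> (Suc n)"
  proof -
    have e: "A (Suc m) = A (Suc n)" "B (Suc m) = B (Suc n)" "C (Suc m) = C (Suc n)" using mn(4) by (auto simp: f_def)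
    have An: "real_of_int (A (Suc n)) \<noteq> 0" using ABC(1) by simp
    have s: "\<theta> (Suc m) + \<phi> (Suc m) = \<theta> (Suc n) + \<phi> (Suc n)"
      using ABC(2)[of "Suc m"] ABC(2)[of "Suc n"] An e by simp
    have p: "\<theta> (Suc m) * \<phi> (Suc m) = \<theta> (Suc n) * \<phi> (Suc n)"
      using ABC(3)[of "Suc m"] ABC(3)[of "Suc n"] An e by simp
    \<comment> \<open>Equal coefficients mean equal sums and products of the roots. Which of the two
      roots is the complete quotient is then decided by the sign.\<close>
    have "(\<theta> (Suc m) - \<theta> (Suc n)) * (\<theta> (Suc m) - \<phi> (Suc n)) = \<theta> (Suc m) * \<theta> (Suc m) - \<theta> (Suc m) * (\<theta> (Suc n) + \<phi> (Suc n)) + \<theta> (Suc n) * \<phi> (Suc n)"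
      by (simp add: algebra_simps)
    also have "\<dots> = 0" unfolding s[symmetric] p[symmetric] by (simp add: algebra_simps)
    finally have "\<theta> (Suc m) - \<theta> (Suc n) = 0 \<or> \<theta> (Suc m) - \<phi> (Suc n) = 0" by simp
    moreover have "0 < \<theta> (Suc m) - \<phi> (Suc n)" using theta_gt_1[of m] neg[OF mn(2)] by linarith
    ultimately show ?thesis by simp
  qed
  then show ?thesis using mn(3) that[of "Suc m" "Suc n"] that[of "Suc n" "Suc m"] by (cases "m < n") auto
qed

section \<open>Denominators along a period\<close>

definition theta_prod :: "nat \<Rightarrow> real" where "theta_prod k = (\<Prod>j=1..k. \<theta> j)"

lemma theta_prod_Suc: "theta_prod (Suc k) = theta_prod k * \<theta> (Suc k)"
  by (simp add: theta_prod_def)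

lemma theta_prod_pos: "0 < theta_prod k"
proof -
  have "0 < \<theta> j" if "j \<in> {1..k}" for j using theta_gt_1[of "j - 1"] that by simp
  then show ?thesis unfolding theta_prod_def by (rule prod_pos)
qed

text \<open>By induction from \<open>\<theta> n\<close> = \<open>a n\<close> + 1 /
  \<open>\<theta> (Suc n)\<close>. This is the link between the denominators and the products of
  complete quotients that make up \<open>cf_eta\<close>.\<close>

lemma theta_Q: "\<theta> (Suc (Suc k)) * Q (Suc k) + Q k = theta_prod (Suc (Suc k))"
proof (induction k)
  case 0
  have "0 < \<theta> 2" using theta_gt_1[of 1] by (simp add: numeral_2_eq_2)
  then show ?case using theta_eq[of 1] by (simp add: theta_prod_def Q_0 Q_1 numeral_2_eq_2 field_simps)
next
  case (Suc k)
  have t: "0 < \<theta> (Suc (Suc (Suc k)))" using theta_gt_1[of "Suc (Suc k)"] by simp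
  have e: "\<theta> (Suc (Suc k)) = a (Suc (Suc k)) + 1 / \<theta> (Suc (Suc (Suc k)))" by (rule theta_eq)
  have "\<theta> (Suc (Suc (Suc k))) * Q (Suc (Suc k)) + Q (Suc k)
      = \<theta> (Suc (Suc (Suc k))) * ((a (Suc (Suc k)) + 1 / \<theta> (Suc (Suc (Suc k)))) * Q (Suc k) + Q k)"
    using t by (simp add: Q_rec[of k] field_simps)
  also have "\<dots> = \<theta> (Suc (Suc (Suc k))) * theta_prod (Suc (Suc k))" unfolding e[symmetric] Suc.IH ..
  finally show ?case by (simp add: theta_prod_Suc mult.commute)
qed

text \<open>By \<open>theta_Q\<close>, the defect \<open>Q (k + l) - \<epsilon> * Q k\<close>
  satisfies a homogeneous first-order recursion, so it is a multiple of z_k = (-1)^k / (theta_1 ...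
  theta_(k+1)). This z_k is divided by \<open>\<epsilon>\<close> over a period; the sign returns
  because the period is even. A suitable multiple of z_k is \<open>Y\<close>, and \<open>X\<close>
  is the rest.\<close>

lemma quadratic_structure:
  assumes quad: "quadratic_irrational \<alpha>"
  obtains \<epsilon> p l X Y where "1 < \<epsilon>" "cf_eta \<alpha> = 1 / \<epsilon>" "0 < l" "even l"
    "\<And>k. p \<le> k \<Longrightarrow> Q k = X k + Y k" "\<And>k. p \<le> k \<Longrightarrow> X (k + l) = \<epsilon> * X k"
    "\<And>k. p \<le> k \<Longrightarrow> Y (k + l) = Y k / \<epsilon>" "\<And>k. p \<le> k \<Longrightarrow> 0 < (X k :: real)"
proof -
  define per where "per = (\<lambda>l. 0 < l \<and> even l \<and> (\<exists>p. \<forall>n\<ge>p. a (n + l) = a n))"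
  obtain m n where mn: "m < n" "\<theta> m = \<theta> n" using quadratic_theta_repeats[OF quad] by blast
  define d where "d = n - m"
  have d: "0 < d" "n = m + d" using mn by (auto simp: d_def)
  have shift: "\<theta> (m + i) = \<theta> (m + i + d)" for i
  proof (induction i)
    case 0
    then show ?case using mn d by simp
  next
    case (Suc i)
    then show ?case by (simp add: complete_quotient.simps)
  qed
  have one: "a (k + d) = a k" if "m \<le> k" for k
    using shift[of "k - m"] that by (simp add: partial_quotient_def)
  \<comment> \<open>The repetition gives a period d of unknown parity; doubled, it is of the even
    kind that \<open>cf_period\<close> asks for.\<close>
  have "per (2 * d)" unfolding per_def
  proof (intro conjI exI[of _ m] allI impI)
    fix k assume "m \<le> k"
    then have "a (k + d + d) = a (k + d)" "a (k + d) = a k" using one[of "k + d"] one[of k] by auto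
    then show "a (k + 2 * d) = a k" by (simp add: mult_2 add.assoc)
  qed (use d in auto)
  then have "per (LEAST l. per l)" by (rule LeastI)
  moreover define l where "l = cf_period \<alpha>"
  moreover have "l = (LEAST l. per l)" unfolding l_def cf_period_def per_def ..
  ultimately have l: "0 < l" "even l" "\<exists>p. \<forall>n\<ge>p. a (n + l) = a n" by (auto simp: per_def)
  define p where "p = cf_preperiod \<alpha>"
  have p: "a (n + l) = a n" if "p \<le> n" for n
    using LeastI_ex[OF l(3)] that unfolding p_def cf_preperiod_def l_def by blast
  have thp: "\<theta> (n + l) = \<theta> n" if "p \<le> n" for n
  proof (rule theta_eq_if_same_quotients)
    show "a (n + l + i) = a (n + i)" for i using p[of "n + i"] that by (simp add: add_ac)
  qed
  define \<epsilon> where "\<epsilon> = (\<Prod>i=1..l. \<theta> (p + i))"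
  have gt: "1 < \<theta> (p + i)" if "i \<in> {1..l}" for i using theta_gt_1[of "p + i - 1"] that by simp
  have e1: "1 < \<epsilon>" unfolding \<epsilon>_def
  proof (rule less_1_prod)
    show "{1..l} \<noteq> {}" using l by simp
  qed (use gt in auto)
  have eta: "cf_eta \<alpha> = 1 / \<epsilon>" by (simp add: cf_eta_def \<epsilon>_def l_def p_def inverse_eq_divide)
  have E: "theta_prod (k + l) = \<epsilon> * theta_prod k" if "p \<le> k" for k
    using that
  proof (induction k rule: dec_induct)
    case base
    have "theta_prod (p + i) = (\<Prod>i=1..i. \<theta> (p + i)) * theta_prod p" for i
      by (induction i) (simp_all add: theta_prod_Suc)
    then show ?case by (simp add: \<epsilon>_def)
  next
    case (step k)
    have "theta_prod (Suc k + l) = theta_prod (k + l) * \<theta> (Suc k + l)" using theta_prod_Suc[of "k + l"] by simp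
    then show ?case using step thp[of "Suc k"] by (simp add: theta_prod_Suc)
  qed
  define z where "z = (\<lambda>k. (-1) ^ k / theta_prod (Suc k))"
  define y where "y = (\<lambda>k. Q (k + l) - \<epsilon> * Q k)"
  have z0: "z k \<noteq> 0" for k using theta_prod_pos[of "Suc k"] by (simp add: z_def)
  have zS: "z (Suc k) = - z k / \<theta> (Suc (Suc k))" for k by (simp add: z_def theta_prod_Suc)
  have yS: "y (Suc k) = - y k / \<theta> (Suc (Suc k))" if k: "p \<le> k" for k
  proof -
    have th: "0 < \<theta> (Suc (Suc k))" using theta_gt_1[of "Suc k"] by simp
    have "\<theta> (Suc (Suc k)) * Q (Suc k + l) + Q (k + l) = \<epsilon> * theta_prod (Suc (Suc k))"
      using theta_Q[of "k + l"] thp[of "Suc (Suc k)"] E[of "Suc (Suc k)"] k by simp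
    then have "\<theta> (Suc (Suc k)) * y (Suc k) + y k = 0"
      unfolding theta_Q[of k, symmetric] y_def by (simp add: algebra_simps)
    then show ?thesis using th by (simp add: field_simps)
  qed
  define c where "c = y p / z p"
  have yz: "y k = c * z k" if "p \<le> k" for k
    using that
  proof (induction k rule: dec_induct)
    case base
    then show ?case using z0 by (simp add: c_def)
  next
    case (step k)
    then show ?case by (simp add: yS zS)
  qed
  have zl: "z (k + l) = z k / \<epsilon>" if "p \<le> k" for k
    using E[of "Suc k"] that l by (simp add: z_def power_add)
  \<comment> \<open>Chosen so that \<open>Y = d' * z\<close> has the same defect, Y_(k+l) -
    \<open>\<epsilon>\<close> Y_k = c z_k, as the denominators themselves.\<close>
  define d' where "d' = c / (1 / \<epsilon> - \<epsilon>)"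
  have "1 / \<epsilon> < 1" using e1 by simp
  then have "1 / \<epsilon> - \<epsilon> \<noteq> 0" using e1 by linarith
  then have c: "c = d' * (1 / \<epsilon> - \<epsilon>)" by (simp add: d'_def)
  define Y where "Y = (\<lambda>k. d' * z k)"
  define X where "X = (\<lambda>k. Q k - Y k)"
  have QXY: "Q k = X k + Y k" for k by (simp add: X_def)
  have Yl: "Y (k + l) = Y k / \<epsilon>" if "p \<le> k" for k using zl[OF that] by (simp add: Y_def)
  have Xl: "X (k + l) = \<epsilon> * X k" if "p \<le> k" for k
  proof -
    have "Q (k + l) = \<epsilon> * Q k + c * z k" using yz[OF that] by (simp add: y_def)
    then have "X (k + l) = \<epsilon> * Q k + c * z k - d' * z k / \<epsilon>" using Yl[OF that] by (simp add: X_def Y_def)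
    also have "\<dots> = \<epsilon> * Q k - \<epsilon> * (d' * z k)" using e1 by (simp add: c field_simps)
    finally show ?thesis by (simp add: X_def Y_def algebra_simps)
  qed
  \<comment> \<open>A nonpositive X would stay so along the whole progression, and the denominators
    would be bounded by |Y|.\<close>
  have Xpos: "0 < X k" if k: "p \<le> k" for k
  proof (rule ccontr)
    assume "\<not> 0 < X k"
    then have X: "X k \<le> 0" by simp
    have it: "X (k + j * l) \<le> 0 \<and> \<bar>Y (k + j * l)\<bar> \<le> \<bar>Y k\<bar>" for j
    proof (induction j)
      case (Suc j)
      have "p \<le> k + j * l" using k by simp
      then have "X (k + j * l + l) = \<epsilon> * X (k + j * l)" "Y (k + j * l + l) = Y (k + j * l) / \<epsilon>" using Xl Yl by auto
      moreover have "\<epsilon> * X (k + j * l) \<le> 0" using Suc e1 by (intro mult_nonneg_nonpos) auto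
      moreover have "\<bar>Y (k + j * l) / \<epsilon>\<bar> \<le> \<bar>Y (k + j * l)\<bar> / 1" unfolding abs_divide using e1 by (intro divide_left_mono) auto
      ultimately show ?case using Suc by (simp add: add_ac)
    qed (simp add: X)
    have Qb: "Q (k + j * l) \<le> \<bar>Y k\<bar>" for j using it[of j] QXY[of "k + j * l"] by linarith
    have "eventually (\<lambda>n. \<bar>Y k\<bar> < Q n) sequentially" using Q_filterlim by (simp add: filterlim_at_top_dense)
    then obtain M where M: "\<And>n. M \<le> n \<Longrightarrow> \<bar>Y k\<bar> < Q n" by (auto simp: eventually_at_top_linorder)
    have "M \<le> k + M * l" using l(1) by (cases l) auto
    then show False using M[of "k + M * l"] Qb[of M] by simp
  qed
  show ?thesis by (rule that[OF e1 eta l(1,2) QXY Xl Yl Xpos])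
qed

end

section \<open>Hankel integrals\<close>

definition circle_point :: "real \<Rightarrow> real \<Rightarrow> complex" where
  "circle_point r y = exp (of_real (ln r) + \<i> * of_real y)"

text \<open>The loop integral of u^(s-1) f(u) along a circle of radius r with argument running from
  0 to 2 pi, and along the ray beyond r in both directions, where the two branches of u^s differ by
  exp(2 pi i s). The kernel is given twice: on the circle as F(u) / u, on the ray as f.\<close>

definition hankel :: "real \<Rightarrow> (complex \<Rightarrow> complex) \<Rightarrow> (real \<Rightarrow> complex) \<Rightarrow> complex \<Rightarrow> complex" where
  "hankel r F f s =
     (LINT y:{0..2*pi}|lborel. \<i> * exp (s * (of_real (ln r) + \<i> * of_real y)) * (F (circle_point r y) / circle_point r y))
     + (exp (2 * pi * \<i> * s) - 1) * mellin {r<..} f s"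

lemma norm_circle_point: "0 < r \<Longrightarrow> norm (circle_point r y) = r"
  by (simp add: circle_point_def norm_exp_eq_Re)

lemma hankel_circle_le:
  assumes "0 < r" "y \<in> {0..2*pi}" "norm s \<le> S" "norm (F (circle_point r y)) \<le> C"
  shows "norm (\<i> * exp (s * (of_real (ln r) + \<i> * of_real y)) * (F (circle_point r y) / circle_point r y))
    \<le> exp (S * (\<bar>ln r\<bar> + 2 * pi)) * (C / r)"
proof -
  have "norm (of_real (ln r) + \<i> * of_real y) \<le> \<bar>ln r\<bar> + \<bar>y\<bar>"
    using norm_triangle_ineq[of "of_real (ln r)" "\<i> * complex_of_real y"] by (simp add: norm_mult)
  also have "\<dots> \<le> \<bar>ln r\<bar> + 2 * pi" using assms by simp
  finally have L: "norm (of_real (ln r) + \<i> * of_real y) \<le> \<bar>ln r\<bar> + 2 * pi" .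
  have "norm (s * (of_real (ln r) + \<i> * of_real y)) \<le> S * (\<bar>ln r\<bar> + 2 * pi)"
    unfolding norm_mult using assms(3) L norm_ge_zero[of s] by (intro mult_mono norm_ge_zero) linarith+
  then have "norm (exp (s * (of_real (ln r) + \<i> * of_real y))) \<le> exp (S * (\<bar>ln r\<bar> + 2 * pi))"
    using norm_exp[of "s * (of_real (ln r) + \<i> * of_real y)"] by (meson exp_le_cancel_iff order_trans)
  moreover have "norm (F (circle_point r y)) / r \<le> C / r" using assms by (simp add: divide_right_mono)
  ultimately show ?thesis
    unfolding norm_mult norm_divide norm_circle_point[OF assms(1)] norm_ii mult_1
    by (intro mult_mono) (use assms in auto)
qed

lemma norm_exp_2pi_le: "norm s \<le> S \<Longrightarrow> norm (exp (2 * pi * \<i> * s) - 1) \<le> exp (2 * pi * S) + 1"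
proof -
  assume s: "norm s \<le> S"
  have "norm (2 * pi * \<i> * s) = 2 * pi * norm s" by (simp add: norm_mult)
  then have "norm (exp (2 * pi * \<i> * s)) \<le> exp (2 * pi * norm s)" using norm_exp[of "2 * pi * \<i> * s"] by simp
  also have "\<dots> \<le> exp (2 * pi * S)" using s by simp
  finally have "norm (exp (2 * pi * \<i> * s)) \<le> exp (2 * pi * S)" .
  then show ?thesis using norm_triangle_ineq4[of "exp (2 * pi * \<i> * s)" 1] by (simp only: norm_one)
qed

lemma hankel_circle_measurable:
  assumes "0 < r" "continuous_on (sphere 0 r) F"
  shows "(\<lambda>y. indicator {0..2*pi} y *\<^sub>R (\<i> * exp (s * (of_real (ln r) + \<i> * of_real y)) * (F (circle_point r y) / circle_point r y)))
    \<in> borel_measurable borel"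
proof (rule borel_measurable_continuous_on_indicator)
  have c: "continuous_on {0..2*pi} (circle_point r)" unfolding circle_point_def [abs_def] by (intro continuous_intros)
  have "continuous_on {0..2*pi} (\<lambda>y. F (circle_point r y))"
    by (rule continuous_on_compose2[OF assms(2) c]) (use assms norm_circle_point in auto)
  then show "continuous_on {0..2*pi} (\<lambda>y. \<i> * exp (s * (of_real (ln r) + \<i> * of_real y)) * (F (circle_point r y) / circle_point r y))"
    by (intro continuous_intros c) (auto simp: circle_point_def)
qed simp

text \<open>\<open>B\<close> depends on r and S only, not on the kernel; this gives bounds uniform
  in the parameter v of a family of kernels.\<close>

lemma hankel_bound:
  assumes r: "0 < r"
  obtains B where "0 \<le> B" "\<And>F f C s. 0 \<le> C \<Longrightarrow> (\<And>u. norm u = r \<Longrightarrow> norm (F u) \<le> C) \<Longrightarrow> f \<in> borel_measurable borel \<Longrightarrow>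
     (\<And>t. r < t \<Longrightarrow> norm (f t) \<le> C * exp (- t)) \<Longrightarrow> norm s \<le> S \<Longrightarrow> norm (hankel r F f s) \<le> C * B"
proof (cases "0 \<le> S")
  case False
  then have "\<not> norm (s::complex) \<le> S" for s using norm_ge_zero[of s] by linarith
  then show ?thesis using that[of 0] by simp
next
  case S: True
  define W where "W = exp (S * (\<bar>ln r\<bar> + 2 * pi)) / r"
  define L where "L = (\<lambda>\<sigma>. LINT t:{r<..}|lborel. t powr (\<sigma> - 1) * exp (- t))"
  define B where "B = 2 * pi * W + (exp (2 * pi * S) + 1) * (L (-S) + L S)"
  have W0: "0 \<le> W" using r by (simp add: W_def)
  have L0: "0 \<le> L \<sigma>" for \<sigma> unfolding L_def set_lebesgue_integral_def by (rule Bochner_Integration.integral_nonneg) auto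
  have "norm (hankel r F f s) \<le> C * B"
    if C: "0 \<le> C" and F: "\<And>u. norm u = r \<Longrightarrow> norm (F u) \<le> C" and f: "f \<in> borel_measurable borel"
      and le: "\<And>t. r < t \<Longrightarrow> norm (f t) \<le> C * exp (- t)" and s: "norm s \<le> S" for F f C s
  proof -
    have "norm (LINT y:{0..2*pi}|lborel. \<i> * exp (s * (of_real (ln r) + \<i> * of_real y)) * (F (circle_point r y) / circle_point r y))
      \<le> (LINT y|lborel. norm (indicator {0..2*pi} y *\<^sub>R (\<i> * exp (s * (of_real (ln r) + \<i> * of_real y)) * (F (circle_point r y) / circle_point r y))))"
      unfolding set_lebesgue_integral_def by (rule integral_norm_bound)
    also have "\<dots> \<le> (LINT y|lborel. indicator {0..2*pi} y *\<^sub>R (C * W))"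
    proof (rule integral_mono')
      show "integrable lborel (\<lambda>y. indicator {0..2*pi} y *\<^sub>R (C * W))" by simp
      show "0 \<le> indicator {0..2*pi} y *\<^sub>R (C * W)" for y :: real using C W0 by simp
      show "norm (indicator {0..2*pi} y *\<^sub>R (\<i> * exp (s * (of_real (ln r) + \<i> * of_real y)) * (F (circle_point r y) / circle_point r y)))
         \<le> indicator {0..2*pi} y *\<^sub>R (C * W)" for y
      proof (cases "y \<in> {0..2*pi}")
        case True
        then show ?thesis using hankel_circle_le[where F = F, OF r True s F[OF norm_circle_point[OF r]]] by (simp add: W_def mult.commute)
      qed simp
    qed
    also have "\<dots> = C * (2 * pi * W)" by simp
    finally have 1: "norm (LINT y:{0..2*pi}|lborel. \<i> * exp (s * (of_real (ln r) + \<i> * of_real y)) * (F (circle_point r y) / circle_point r y))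
      \<le> C * (2 * pi * W)" .
    have g: "set_integrable lborel {r<..} (\<lambda>t. t powr (\<sigma> - 1) * (C * exp (- t)))" for \<sigma>
      using set_integrable_at_infinity[of 1 r \<sigma> C] r by simp
    have gL: "(LINT t:{r<..}|lborel. t powr (\<sigma> - 1) * (C * exp (- t))) = C * L \<sigma>" for \<sigma>
      unfolding L_def by (subst set_integral_mult_right[symmetric]) (simp add: mult_ac)
    have "- S \<le> Re s" "Re s \<le> S" using s abs_Re_le_cmod[of s] by linarith+
    then have 2: "norm (mellin {r<..} f s) \<le> C * L (-S) + C * L S"
      using mellin_norm_le[where S = "{r<..}" and f = f and g = "\<lambda>t. C * exp (- t)" and lo = "-S" and hi = S and s = s, OF _ _ f _ g g] le r
      unfolding gL by auto
    have "norm ((exp (2 * pi * \<i> * s) - 1) * mellin {r<..} f s) \<le> (exp (2 * pi * S) + 1) * (C * L (-S) + C * L S)"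
      unfolding norm_mult using norm_exp_2pi_le[OF s] 2 by (intro mult_mono) (auto intro: add_nonneg_nonneg)
    also have "\<dots> = C * ((exp (2 * pi * S) + 1) * (L (-S) + L S))" by (simp add: algebra_simps)
    finally have "norm (hankel r F f s) \<le> C * (2 * pi * W) + C * ((exp (2 * pi * S) + 1) * (L (-S) + L S))"
      unfolding hankel_def using 1 by (intro norm_triangle_mono)
    then show ?thesis by (simp add: B_def distrib_left)
  qed
  moreover have "0 \<le> B" unfolding B_def using W0 L0 by (intro add_nonneg_nonneg mult_nonneg_nonneg) auto
  ultimately show ?thesis by (intro that[of B]) auto
qed

lemma hankel_holomorphic:
  assumes r: "0 < r" and F: "continuous_on (sphere 0 r) F" and f: "f \<in> borel_measurable borel"
    and le: "\<And>t. r < t \<Longrightarrow> norm (f t) \<le> C * exp (- t)"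
  shows "hankel r F f holomorphic_on A"
proof -
  have "compact (F ` sphere 0 r)" using F by (rule compact_continuous_image) simp
  then obtain K where "\<And>u. u \<in> sphere 0 r \<Longrightarrow> norm (F u) \<le> K" by (meson bounded_iff compact_imp_bounded imageI)
  then have K: "norm (F u) \<le> K" if "norm u = r" for u using that by simp
  have "(\<lambda>s. LINT y|lborel. indicator {0..2*pi} y *\<^sub>R (\<i> * exp (s * (of_real (ln r) + \<i> * of_real y)) * (F (circle_point r y) / circle_point r y)))
    holomorphic_on UNIV"
  proof (rule holomorphic_on_integral)
    fix s0 :: complex
    define w where "w = (\<lambda>y. indicator {0..2*pi} y *\<^sub>R (exp ((norm s0 + 1) * (\<bar>ln r\<bar> + 2 * pi)) * (K / r)))"
    have "integrable lborel w" unfolding w_def by simp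
    moreover have "norm (indicator {0..2*pi} y *\<^sub>R (\<i> * exp (s * (of_real (ln r) + \<i> * of_real y)) * (F (circle_point r y) / circle_point r y))) \<le> w y"
      if s: "s \<in> ball s0 1" for s y
    proof (cases "y \<in> {0..2*pi}")
      case True
      have "norm s \<le> norm s0 + 1" using s norm_triangle_ineq2[of s s0] by (simp add: dist_norm norm_minus_commute)
      then show ?thesis using hankel_circle_le[where F = F, OF r True _ K[OF norm_circle_point[OF r]]] True by (simp add: w_def)
    qed (simp add: w_def)
    ultimately show "\<exists>r'>0. \<exists>w. integrable lborel w \<and> (\<forall>s\<in>ball s0 r' \<inter> UNIV. \<forall>y\<in>space lborel.
      norm (indicator {0..2*pi} y *\<^sub>R (\<i> * exp (s * (of_real (ln r) + \<i> * of_real y)) * (F (circle_point r y) / circle_point r y))) \<le> w y)"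
      by (intro exI[of _ 1] conjI exI[of _ w]) auto
  qed (use hankel_circle_measurable[OF r F] in \<open>auto intro!: holomorphic_intros\<close>)
  moreover have "mellin {r<..} f holomorphic_on UNIV"
    by (rule mellin_at_infinity_holomorphic[where C = C and c = 1]) (use assms in auto)
  ultimately have "hankel r F f holomorphic_on UNIV"
    unfolding hankel_def [abs_def] set_lebesgue_integral_def by (intro holomorphic_intros)
  then show ?thesis by (rule holomorphic_on_subset) simp
qed

text \<open>Holomorphy in the parameter of the kernel, at fixed s. It is what permits expanding one
  period of the series in powers of its scale.\<close>

lemma hankel_holomorphic_parameter:
  assumes r: "0 < r" and V: "open V"
    and F: "\<And>v. v \<in> V \<Longrightarrow> continuous_on (sphere 0 r) (F v)" "\<And>u. norm u = r \<Longrightarrow> (\<lambda>v. F v u) holomorphic_on V"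
      "\<And>v u. v \<in> V \<Longrightarrow> norm u = r \<Longrightarrow> norm (F v u) \<le> C"
    and f: "\<And>v. v \<in> V \<Longrightarrow> f v \<in> borel_measurable borel" "\<And>t. r < t \<Longrightarrow> (\<lambda>v. f v t) holomorphic_on V"
      "\<And>v t. v \<in> V \<Longrightarrow> r < t \<Longrightarrow> norm (f v t) \<le> C * exp (- t)"
  shows "(\<lambda>v. hankel r (F v) (f v) s) holomorphic_on V"
proof -
  have "(\<lambda>v. LINT y|lborel. indicator {0..2*pi} y *\<^sub>R (\<i> * exp (s * (of_real (ln r) + \<i> * of_real y)) * (F v (circle_point r y) / circle_point r y)))
    holomorphic_on V"
  proof (rule holomorphic_on_integral[OF V])
    fix v0 assume "v0 \<in> V"
    define w where "w = (\<lambda>y. indicator {0..2*pi} y *\<^sub>R (exp (norm s * (\<bar>ln r\<bar> + 2 * pi)) * (C / r)))"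
    have "integrable lborel w" unfolding w_def by simp
    moreover have "norm (indicator {0..2*pi} y *\<^sub>R (\<i> * exp (s * (of_real (ln r) + \<i> * of_real y)) * (F v (circle_point r y) / circle_point r y))) \<le> w y"
      if v: "v \<in> V" for v y
    proof (cases "y \<in> {0..2*pi}")
      case True
      then show ?thesis using hankel_circle_le[where F = "F v", OF r True order_refl F(3)[OF v norm_circle_point[OF r]]] by (simp add: w_def)
    qed (simp add: w_def)
    ultimately show "\<exists>r'>0. \<exists>w. integrable lborel w \<and> (\<forall>v\<in>ball v0 r' \<inter> V. \<forall>y\<in>space lborel.
      norm (indicator {0..2*pi} y *\<^sub>R (\<i> * exp (s * (of_real (ln r) + \<i> * of_real y)) * (F v (circle_point r y) / circle_point r y))) \<le> w y)"
      by (intro exI[of _ 1] conjI exI[of _ w]) auto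
  next
    fix y :: real
    have "circle_point r y \<noteq> 0" by (simp add: circle_point_def)
    then show "(\<lambda>v. indicator {0..2*pi} y *\<^sub>R (\<i> * exp (s * (of_real (ln r) + \<i> * of_real y)) * (F v (circle_point r y) / circle_point r y)))
      holomorphic_on V"
      by (intro holomorphic_intros F(2) norm_circle_point r) auto
  qed (use hankel_circle_measurable[OF r F(1)] in auto)
  moreover have "(\<lambda>v. LINT t|lborel. indicator {r<..} t *\<^sub>R (of_real t powr (s - 1) * f v t)) holomorphic_on V"
  proof (rule holomorphic_on_integral[OF V])
    show "(\<lambda>t. indicator {r<..} t *\<^sub>R (of_real t powr (s - 1) * f v t)) \<in> borel_measurable lborel" if "v \<in> V" for v
      using f(1)[OF that] by measurable
    show "(\<lambda>v. indicator {r<..} t *\<^sub>R (of_real t powr (s - 1) * f v t)) holomorphic_on V" for t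
    proof (cases "r < t")
      case True
      then show ?thesis by (intro holomorphic_intros f(2))
    qed simp
    fix v0 assume "v0 \<in> V"
    define w where "w = (\<lambda>t. indicator {r<..} t *\<^sub>R (t powr (Re s - 1) * (C * exp (- (1 * t)))))"
    have "integrable lborel w" using set_integrable_at_infinity[of 1 r "Re s" C] r by (simp add: w_def set_integrable_def)
    moreover have "norm (indicator {r<..} t *\<^sub>R (of_real t powr (s - 1) * f v t)) \<le> w t" if v: "v \<in> V" for v t
    proof (cases "r < t")
      case True
      then have "t powr (Re s - 1) * norm (f v t) \<le> t powr (Re s - 1) * (C * exp (- t))"
        using f(3)[OF v] by (intro mult_left_mono) auto
      then show ?thesis using True r by (simp add: w_def norm_mult norm_of_real_powr)
    qed (simp add: w_def)
    ultimately show "\<exists>r'>0. \<exists>w. integrable lborel w \<and> (\<forall>v\<in>ball v0 r' \<inter> V. \<forall>t\<in>space lborel.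
      norm (indicator {r<..} t *\<^sub>R (of_real t powr (s - 1) * f v t)) \<le> w t)"
      by (intro exI[of _ 1] conjI exI[of _ w]) auto
  qed
  ultimately show ?thesis unfolding hankel_def mellin_def set_lebesgue_integral_def by (intro holomorphic_intros)
qed

lemma mellin_power:
  assumes "0 < Re s" "0 < r"
  shows "mellin {0<..r} (\<lambda>t. of_real t ^ k) s = of_real r powr (s + of_nat k) / (s + of_nat k)"
    and "mellin_conv {0<..r} (\<lambda>t. of_real t ^ k) s"
proof -
  have "\<forall>s. 0 < Re s \<longrightarrow> mellin {0<..r} (\<lambda>t. of_real t ^ k) s = of_real r powr (s + of_nat k) / (s + of_nat k)
      \<and> mellin_conv {0<..r} (\<lambda>t. of_real t ^ k) s"
  proof (induction k)
    case 0
    then show ?case using mellin_one assms(2) by simp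
  next
    case (Suc k)
    have S: "{0<..r} \<subseteq> {0<..}" "{0<..r} \<in> sets borel" by auto
    show ?case
      using mellin_mult_t[OF S, of "\<lambda>t. of_real t ^ k"] Suc by (simp add: add_ac)
  qed
  then show "mellin {0<..r} (\<lambda>t. of_real t ^ k) s = of_real r powr (s + of_nat k) / (s + of_nat k)"
    "mellin_conv {0<..r} (\<lambda>t. of_real t ^ k) s" using assms by auto
qed

lemma circle_integral_exp:
  assumes "w \<noteq> 0"
  shows "has_bochner_integral lborel (\<lambda>y. indicator {0..2*pi} y *\<^sub>R (\<i> * exp (w * (of_real L + \<i> * of_real y))))
    ((exp (2 * pi * \<i> * w) - 1) * (exp (w * of_real L) / w))"
proof -
  let ?G = "\<lambda>y. exp (w * (of_real L + \<i> * of_real y)) / w"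
  have "has_bochner_integral lborel (\<lambda>y. indicator {0..2*pi} y *\<^sub>R (\<i> * exp (w * (of_real L + \<i> * of_real y)))) (?G (2*pi) - ?G 0)"
  proof (rule has_bochner_integral_FTC_Icc)
    show "(?G has_vector_derivative \<i> * exp (w * (of_real L + \<i> * of_real y))) (at y within {0..2*pi})" for y
    proof -
      have "((\<lambda>z. exp (w * (of_real L + \<i> * z)) / w) has_field_derivative \<i> * exp (w * (of_real L + \<i> * of_real y))) (at (of_real y))"
        using assms by (auto intro!: derivative_eq_intros)
      then have "((\<lambda>z. exp (w * (of_real L + \<i> * z)) / w) \<circ> of_real has_vector_derivative \<i> * exp (w * (of_real L + \<i> * of_real y))) (at y)"
        unfolding o_def by (rule has_vector_derivative_real_field)
      then show ?thesis by (simp add: o_def has_vector_derivative_at_within)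
    qed
  qed (auto intro!: continuous_intros)
  moreover have "?G (2*pi) - ?G 0 = (exp (2 * pi * \<i> * w) - 1) * (exp (w * of_real L) / w)"
    by (simp add: distrib_left exp_add algebra_simps diff_divide_distrib)
  ultimately show ?thesis by simp
qed

text \<open>No contour is deformed: F is expanded in its power series. With w = s - 1 + k, the k-th
  term contributes r^w / w over (0, r] and (exp(2 pi i w) - 1) r^w / w over the circle, and exp(2 pi
  i w) does not depend on k.\<close>

lemma hankel_eq:
  assumes r: "0 < r" "r < R" and F: "F holomorphic_on ball 0 R" and f: "f \<in> borel_measurable borel"
    and near: "\<And>t. 0 < t \<Longrightarrow> t \<le> r \<Longrightarrow> f t = F (of_real t) / of_real t"
    and le: "\<And>t. r < t \<Longrightarrow> norm (f t) \<le> C * exp (- t)" and s: "1 < Re s"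
  shows "hankel r F f s = (exp (2 * pi * \<i> * s) - 1) * mellin {0<..} f s" and "mellin_conv {0<..} f s"
proof -
  define c where "c = (\<lambda>j. (deriv ^^ j) F 0 / fact j)"
  have c: "(\<lambda>j. c j * z ^ j) sums F z" if "norm z < R" for z
    using holomorphic_power_series[OF F, of z] that by (simp add: c_def)
  have csum: "summable (\<lambda>j. norm (c j) * r ^ j)"
  proof -
    have "summable (\<lambda>j. c j * of_real ((r + R) / 2) ^ j)" using c[of "of_real ((r + R) / 2)"] r by (auto simp: sums_iff norm_divide simp flip: of_real_add)
    from powser_insidea[OF this, of "of_real r"] r show ?thesis by (simp add: norm_mult norm_power norm_divide flip: of_real_add)
  qed
  have S: "{0<..r} \<subseteq> {0<..}" "{0<..r} \<in> sets borel" by auto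
  define E where "E = exp (2 * pi * \<i> * s) - 1"
  define J where "J = (LINT t:{0<..r}|lborel. t powr ((Re s - 1) - 1))"
  have Jint: "set_integrable lborel {0<..r} (\<lambda>t. t powr ((Re s - 1) - 1))" by (rule set_integrable_powr_0) (use s r in auto)
  define T where "T = (\<lambda>k t. c k * (complex_of_real t ^ k / of_real t))"
  have T: "mellin {0<..r} (T k) s = c k * (of_real r powr (s - 1 + of_nat k) / (s - 1 + of_nat k))"
     "mellin_conv {0<..r} (T k) s" for k
    unfolding T_def using mellin_power[of "s - 1" r k] s r
    by (auto simp: mellin_cmult mellin_divide_t[OF S] intro!: mellin_conv_cmult)
  have normT: "norm (T k t) \<le> norm (c k) * r ^ k * (1 / t)" if "0 < t" "t \<le> r" for k t
  proof -
    have "t ^ k \<le> r ^ k" using that by (intro power_mono) auto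
    then have "norm (c k) * t ^ k * (1 / t) \<le> norm (c k) * r ^ k * (1 / t)" using that by (intro mult_right_mono mult_left_mono) auto
    then show ?thesis using that by (simp add: T_def norm_mult norm_divide norm_power)
  qed
  have Tsum: "(\<lambda>k. T k t) sums f t" if "0 < t" "t \<le> r" for t
    using sums_divide[OF c[of "of_real t"], of "of_real t"] that r by (simp add: T_def near)
  have pw: "summable (\<lambda>k. norm (T k t))" if "t \<in> {0<..r}" for t
    by (rule summable_comparison_test'[where N = 0, OF summable_mult2[OF csum, of "1 / t"]]) (use that normT in auto)
  have sm: "summable (\<lambda>k. LINT t:{0<..r}|lborel. t powr (Re s - 1) * norm (T k t))"
  proof (rule summable_comparison_test'[where N = 0, OF summable_mult2[OF csum, of J]])
    fix k
    have "(LINT t:{0<..r}|lborel. t powr (Re s - 1) * norm (T k t)) \<le> (LINT t:{0<..r}|lborel. norm (c k) * r ^ k * (t powr ((Re s - 1) - 1)))"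
      unfolding set_lebesgue_integral_def
    proof (rule integral_mono')
      show "integrable lborel (\<lambda>t. indicator {0<..r} t *\<^sub>R (norm (c k) * r ^ k * (t powr ((Re s - 1) - 1))))"
        using set_integrable_mult_right[OF Jint, of "norm (c k) * r ^ k"] by (simp add: set_integrable_def)
      show "0 \<le> indicator {0<..r} t *\<^sub>R (norm (c k) * r ^ k * (t powr ((Re s - 1) - 1)))" for t using r by simp
      show "indicator {0<..r} t *\<^sub>R (t powr (Re s - 1) * norm (T k t)) \<le> indicator {0<..r} t *\<^sub>R (norm (c k) * r ^ k * (t powr ((Re s - 1) - 1)))" for t
      proof (cases "t \<in> {0<..r}")
        case True
        then have "t powr (Re s - 1) * norm (T k t) \<le> t powr (Re s - 1) * (norm (c k) * r ^ k * (1 / t))"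
          using normT by (intro mult_left_mono) auto
        also have "\<dots> = norm (c k) * r ^ k * (t powr ((Re s - 1) - 1))" using True by (simp add: powr_diff power2_eq_square)
        finally show ?thesis using True by simp
      qed simp
    qed
    also have "\<dots> = norm (c k) * r ^ k * J" unfolding J_def by simp
    finally have "(LINT t:{0<..r}|lborel. t powr (Re s - 1) * norm (T k t)) \<le> norm (c k) * r ^ k * J" .
    moreover have "0 \<le> (LINT t:{0<..r}|lborel. t powr (Re s - 1) * norm (T k t))"
      unfolding set_lebesgue_integral_def by (rule Bochner_Integration.integral_nonneg) simp
    ultimately show "norm (LINT t:{0<..r}|lborel. t powr (Re s - 1) * norm (T k t)) \<le> norm (c k) * r ^ k * J" by simp
  qed
  have sumeq: "mellin {0<..r} (\<lambda>t. \<Sum>k. T k t) s = mellin {0<..r} f s" "mellin_conv {0<..r} (\<lambda>t. \<Sum>k. T k t) s = mellin_conv {0<..r} f s"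
    by (rule mellin_cong mellin_conv_cong; use Tsum in \<open>auto simp: sums_iff\<close>)+
  have nearsum: "(\<lambda>k. c k * (of_real r powr (s - 1 + of_nat k) / (s - 1 + of_nat k))) sums mellin {0<..r} f s"
    using mellin_sums(1)[OF S T(2) pw sm] unfolding T(1) sumeq .
  have convnear: "mellin_conv {0<..r} f s" using mellin_sums(2)[OF S T(2) pw sm] unfolding sumeq .
  have convfar: "mellin_conv {r<..} f s" by (rule mellin_conv_at_infinity[where c = 1 and C = C]) (use assms in auto)
  show conv: "mellin_conv {0<..} f s" by (rule mellin_conv_split[OF convnear convfar r(1)])
  define g where "g = (\<lambda>k y. indicator {0..2*pi} y *\<^sub>R (\<i> * exp (s * (of_real (ln r) + \<i> * of_real y)) * (c k * (circle_point r y ^ k / circle_point r y))))"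
  have g_eq: "g k y = c k * (indicator {0..2*pi} y *\<^sub>R (\<i> * exp ((s - 1 + of_nat k) * (of_real (ln r) + \<i> * of_real y))))" for k y
  proof -
    have eZ: "exp ((s - 1 + of_nat k) * Z) = exp (s * Z) * (exp Z ^ k / exp Z)" for Z
      unfolding exp_of_nat_mult[symmetric] by (simp add: exp_add exp_diff algebra_simps)
    show ?thesis unfolding g_def circle_point_def eZ by (simp add: mult_ac)
  qed
  have ne: "s - 1 + of_nat k \<noteq> 0" for k using s by (auto simp: complex_eq_iff)
  have per: "exp (2 * pi * \<i> * (s - 1 + of_nat k)) = exp (2 * pi * \<i> * s)" for k
  proof -
    have "exp (2 * pi * \<i> * (s - 1 + of_nat k)) = exp (2 * pi * \<i> * s + 2 * pi * \<i> * of_int (int k - 1))"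
      by (simp add: algebra_simps)
    also have "\<dots> = exp (2 * pi * \<i> * s)"
      unfolding exp_add using exp_integer_2pi[OF Ints_of_int[of "int k - 1"]] by (simp only: mult_ac of_real_of_int_eq of_real_mult of_real_numeral mult_1_right mult_1_left)
    finally show ?thesis .
  qed
  have G: "has_bochner_integral lborel (g k) (E * (c k * (of_real r powr (s - 1 + of_nat k) / (s - 1 + of_nat k))))" for k
  proof -
    have "of_real r powr (s - 1 + of_nat k) = exp ((s - 1 + of_nat k) * of_real (ln r))"
      using r by (simp add: powr_def Ln_of_real)
    moreover have "has_bochner_integral lborel (g k) (c k * ((exp (2 * pi * \<i> * (s - 1 + of_nat k)) - 1) *
        (exp ((s - 1 + of_nat k) * of_real (ln r)) / (s - 1 + of_nat k))))"
      unfolding g_eq [abs_def] by (intro has_bochner_integral_mult_right circle_integral_exp ne)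
    ultimately show ?thesis unfolding per by (simp add: E_def mult_ac)
  qed
  have normg: "norm (g k y) \<le> indicator {0..2*pi} y *\<^sub>R (exp (norm s * (\<bar>ln r\<bar> + 2 * pi)) / r * (norm (c k) * r ^ k))" for k y
  proof (cases "y \<in> {0..2*pi}")
    case True
    have "norm (c k * circle_point r y ^ k) \<le> norm (c k) * r ^ k" by (simp add: norm_mult norm_power norm_circle_point r)
    from hankel_circle_le[where F = "\<lambda>u. c k * u ^ k", OF r(1) True order_refl this] True
    show ?thesis by (simp add: g_def)
  qed (simp add: g_def)
  have "(\<lambda>k. LINT y|lborel. g k y) sums (LINT y|lborel. (\<Sum>k. g k y))"
  proof (rule sums_integral)
    show "integrable lborel (g k)" for k using G by (auto simp: has_bochner_integral_iff)
    have "summable (\<lambda>k. norm (g k y))" for y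
      by (rule summable_comparison_test'[where N = 0, OF summable_mult[OF csum, of "indicator {0..2*pi} y * (exp (norm s * (\<bar>ln r\<bar> + 2 * pi)) / r)"]])
        (use normg[of _ y] in \<open>simp add: mult.assoc\<close>)
    then show "AE y in lborel. summable (\<lambda>k. norm (g k y))" by simp
    show "summable (\<lambda>k. LINT y|lborel. norm (g k y))"
    proof (rule summable_comparison_test'[where N = 0, OF summable_mult[OF csum, of "2 * pi * (exp (norm s * (\<bar>ln r\<bar> + 2 * pi)) / r)"]])
      fix k
      have "(LINT y|lborel. norm (g k y)) \<le> (LINT y|lborel. indicator {0..2*pi} y *\<^sub>R (exp (norm s * (\<bar>ln r\<bar> + 2 * pi)) / r * (norm (c k) * r ^ k)))"
        by (rule integral_mono') (use normg r in auto)
      also have "\<dots> = 2 * pi * (exp (norm s * (\<bar>ln r\<bar> + 2 * pi)) / r) * (norm (c k) * r ^ k)" by simp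
      finally show "norm (LINT y|lborel. norm (g k y)) \<le> 2 * pi * (exp (norm s * (\<bar>ln r\<bar> + 2 * pi)) / r) * (norm (c k) * r ^ k)" by simp
    qed
  qed
  moreover have "(LINT y|lborel. g k y) = E * (c k * (of_real r powr (s - 1 + of_nat k) / (s - 1 + of_nat k)))" for k
    using G by (auto simp: has_bochner_integral_iff)
  moreover have "(\<Sum>k. g k y) = indicator {0..2*pi} y *\<^sub>R (\<i> * exp (s * (of_real (ln r) + \<i> * of_real y)) * (F (circle_point r y) / circle_point r y))" for y
  proof -
    have "(\<lambda>k. c k * circle_point r y ^ k) sums F (circle_point r y)" using c norm_circle_point r by simp
    from sums_scaleR_right[OF sums_mult[OF sums_divide[OF this, of "circle_point r y"], of "\<i> * exp (s * (of_real (ln r) + \<i> * of_real y))"], of "indicator {0..2*pi} y"]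
    show ?thesis unfolding g_def by (simp add: sums_iff mult.assoc)
  qed
  ultimately have "(\<lambda>k. E * (c k * (of_real r powr (s - 1 + of_nat k) / (s - 1 + of_nat k)))) sums
    (LINT y:{0..2*pi}|lborel. \<i> * exp (s * (of_real (ln r) + \<i> * of_real y)) * (F (circle_point r y) / circle_point r y))"
    by (simp add: set_lebesgue_integral_def)
  from sums_unique2[OF this sums_mult[OF nearsum, of E]]
  show "hankel r F f s = (exp (2 * pi * \<i> * s) - 1) * mellin {0<..} f s"
    unfolding hankel_def mellin_split[OF conv r(1)] E_def by (simp add: distrib_left)
qed

section \<open>Geometric families of entire functions\<close>

text \<open>At a pole of order 2 or more the product (s - z) h would still have a pole and could not
  converge.\<close>

lemma has_simple_pole_if_tendsto:
  assumes mer: "h meromorphic_on {z}" and lim: "((\<lambda>s. (s - z) * h s) \<longlongrightarrow> L) (at z)" and pole: "is_pole h z"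
  shows "has_simple_pole h z"
proof -
  obtain R where R: "0 < R" "h analytic_on ball z R - {z}"
    using meromorphic_on_isolated_singularity[OF mer] by (auto simp: isolated_singularity_at_def)
  have "zorder h z < 0 \<and> zor_poly h z z \<noteq> 0 \<and> (\<exists>r. r > 0 \<and> cball z r \<subseteq> ball z R \<and> zor_poly h z holomorphic_on cball z r
    \<and> (\<forall>w\<in>cball z r - {z}. h w = zor_poly h z w / (w - z) ^ nat (- zorder h z) \<and> zor_poly h z w \<noteq> 0))"
    by (rule zorder_exist_pole) (use R pole analytic_imp_holomorphic in auto)
  then obtain r where r: "zorder h z < 0" "zor_poly h z z \<noteq> 0" "0 < r" "zor_poly h z holomorphic_on cball z r"
    "\<And>w. w \<in> cball z r - {z} \<Longrightarrow> h w = zor_poly h z w / (w - z) ^ nat (- zorder h z)" by blast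
  have "zorder h z = - 1"
  proof (rule ccontr)
    assume "zorder h z \<noteq> - 1"
    then obtain n where n: "nat (- zorder h z) = Suc (Suc n)" using r(1)
      by (intro that[of "nat (- zorder h z) - 2"]) linarith
    have p: "is_pole (\<lambda>w. zor_poly h z w / (w - z) ^ Suc n) z"
      by (rule is_pole_basic[of _ "ball z r"]) (use r in \<open>auto intro: holomorphic_on_subset\<close>)
    have e: "eventually (\<lambda>w. zor_poly h z w / (w - z) ^ Suc n = (w - z) * h w) (at z)"
    proof -
      have "eventually (\<lambda>w. w \<in> cball z r - {z}) (at z)"
        by (rule eventually_mono[OF eventually_at_in_open[of "ball z r" z]]) (use r(3) in auto)
      then show ?thesis
      proof (rule eventually_mono)
        fix w assume w: "w \<in> cball z r - {z}"
        have "P / d ^ Suc n = d * (P / d ^ Suc (Suc n))" if "d \<noteq> 0" for P d :: complex using that by simp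
        then show "zor_poly h z w / (w - z) ^ Suc n = (w - z) * h w" unfolding r(5)[OF w] n using w by simp
      qed
    qed
    have "is_pole (\<lambda>w. (w - z) * h w) z" using p unfolding is_pole_cong[OF e refl] .
    then show False using not_tendsto_and_filterlim_at_infinity[OF _ lim] by (simp add: is_pole_def)
  qed
  then show ?thesis using pole by (simp add: has_simple_pole_def)
qed

text \<open>\<open>I s v\<close> models the loop integral of one period at scale v, and the scales
  used are v = \<open>\<epsilon>\<close>^(-n) <= 1. The larger radius 2 leaves room for Cauchy's
  estimate on the circle of radius 3/2, hence coefficients of size (2/3)^m. By \<open>at_0\<close>
  the expansion starts with m = 1, so no poles arise on the imaginary axis.\<close>

locale geometric_family =
  fixes I :: "complex \<Rightarrow> complex \<Rightarrow> complex" and \<epsilon> :: real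
  assumes eps: "1 < \<epsilon>"
    and hol_s: "\<And>v. v \<in> ball 0 2 \<Longrightarrow> (\<lambda>s. I s v) holomorphic_on UNIV"
    and hol_v: "\<And>s. I s holomorphic_on ball 0 2"
    and bounded: "\<And>S. \<exists>B. \<forall>s v. norm s \<le> S \<longrightarrow> v \<in> ball 0 2 \<longrightarrow> norm (I s v) \<le> B"
    and at_0: "\<And>s. I s 0 = 0"
begin

definition coef :: "nat \<Rightarrow> complex \<Rightarrow> complex" where
  "coef m s = (deriv ^^ m) (I s) 0 / fact m"

text \<open>1 - \<open>\<epsilon>\<close>^(-(s + m)), the reciprocal of the geometric series that
  arises when the m-th coefficient is summed over all scales. Its zeros -m + 2 pi i n / ln
  \<open>\<epsilon>\<close> are the candidates for poles.\<close>

definition den :: "nat \<Rightarrow> complex \<Rightarrow> complex" where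
  "den m s = 1 - exp (- ((s + of_nat m) * of_real (ln \<epsilon>)))"

definition total :: "complex \<Rightarrow> complex" where
  "total s = (\<Sum>m. coef (Suc m) s / den (Suc m) s)"

lemma ln_eps: "0 < ln \<epsilon>" using eps by simp

lemma coef_0: "coef 0 s = 0" by (simp add: coef_def at_0)

lemma coef_sums: "v \<in> ball 0 2 \<Longrightarrow> (\<lambda>m. coef m s * v ^ m) sums I s v"
  using holomorphic_power_series[OF hol_v, of v s] by (simp add: coef_def)

lemma coef_bound:
  obtains B where "0 \<le> B" "\<And>m s. norm s \<le> S \<Longrightarrow> norm (coef m s) \<le> B * (2 / 3) ^ m"
proof -
  obtain B where B: "\<And>s v. norm s \<le> S \<Longrightarrow> v \<in> ball 0 2 \<Longrightarrow> norm (I s v) \<le> B" using bounded[of S] by blast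
  have "norm (coef m s) \<le> max B 0 * (2 / 3) ^ m" if s: "norm s \<le> S" for m s
  proof -
    have "norm ((deriv ^^ m) (I s) 0) \<le> fact m * max B 0 / (3/2) ^ m"
    proof (rule Cauchy_inequality)
      show "I s holomorphic_on ball 0 (3/2)" by (rule holomorphic_on_subset[OF hol_v]) auto
      show "continuous_on (cball 0 (3/2)) (I s)"
        by (rule continuous_on_subset[OF holomorphic_on_imp_continuous_on[OF hol_v]]) auto
      show "norm (I s x) \<le> max B 0" if "norm (0 - x) = 3/2" for x using B[OF s, of x] that by simp
    qed simp
    then have "norm ((deriv ^^ m) (I s) 0) / fact m \<le> max B 0 / (3/2) ^ m" by (simp add: field_simps)
    then show ?thesis by (simp add: coef_def norm_divide power_divide)
  qed
  then show ?thesis by (intro that[of "max B 0"]) auto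
qed

text \<open>Cauchy's formula on the circle of radius 3/2 represents the coefficient as an integral
  of functions entire in s, to which \<open>holomorphic_on_integral\<close> applies.\<close>

lemma coef_holomorphic: "coef m holomorphic_on UNIV"
proof -
  let ?p = "circlepath 0 (3/2)"
  define G where "G = (\<lambda>s x. I s (?p x) / ?p x ^ Suc m * vector_derivative ?p (at x))"
  have p: "?p x \<in> ball 0 2" "?p x \<noteq> 0" for x by (simp_all add: circlepath norm_mult)
  have cont: "continuous_on {0..1} (G s)" for s
  proof -
    have cp: "continuous_on {0..1} ?p" using path_circlepath[of 0 "3/2"] by (simp add: path_def)
    have "continuous_on {0..1} (\<lambda>x. I s (?p x))"
      by (rule continuous_on_compose2[OF holomorphic_on_imp_continuous_on[OF hol_v] cp]) (use p in blast)
    then show ?thesis unfolding G_def vector_derivative_circlepath using p(2)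
      by (intro continuous_intros cp) auto
  qed
  have eq: "coef m s = 1 / (2 * pi * \<i>) * (LINT x|lborel. indicator {0..1} x *\<^sub>R G s x)" for s
  proof -
    have "(deriv ^^ m) (I s) 0 = fact m / (2 * pi * \<i>) * contour_integral ?p (\<lambda>u. I s u / (u - 0) ^ Suc m)"
      by (rule Cauchy_higher_derivative_integral_circlepath)
        (auto intro!: continuous_on_subset[OF holomorphic_on_imp_continuous_on[OF hol_v]] holomorphic_on_subset[OF hol_v])
    moreover have "contour_integral ?p (\<lambda>u. I s u / (u - 0) ^ Suc m) = integral {0..1} (G s)"
      unfolding contour_integral_integral G_def by simp
    moreover have "integral {0..1} (G s) = (LINT x:{0..1}|lborel. G s x)"
      by (rule set_borel_integral_eq_integral(2)[symmetric]) (rule borel_integrable_atLeastAtMost'[OF cont])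
    ultimately show ?thesis by (simp add: coef_def set_lebesgue_integral_def)
  qed
  have "(\<lambda>s. LINT x|lborel. indicator {0..1} x *\<^sub>R G s x) holomorphic_on UNIV"
  proof (rule holomorphic_on_integral)
    show "(\<lambda>x. indicator {0..1} x *\<^sub>R G s x) \<in> borel_measurable lborel" for s
      using borel_measurable_continuous_on_indicator[OF _ cont, of s] by simp
    show "(\<lambda>s. indicator {0..1} x *\<^sub>R G s x) holomorphic_on UNIV" for x
      unfolding G_def using p by (intro holomorphic_intros hol_s) auto
    fix s0 :: complex
    obtain B where B: "\<And>s v. norm s \<le> norm s0 + 1 \<Longrightarrow> v \<in> ball 0 2 \<Longrightarrow> norm (I s v) \<le> B" using bounded by blast
    define K where "K = B / (3/2) ^ Suc m * (2 * pi * (3/2))"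
    define w where "w = (\<lambda>x::real. indicator {0..1} x *\<^sub>R K)"
    have "norm (indicator {0..1} x *\<^sub>R G s x) \<le> w x" if s: "s \<in> ball s0 1" for s x
    proof (cases "x \<in> {0..1}")
      case True
      have "norm s \<le> norm s0 + 1" using s norm_triangle_ineq2[of s s0] by (simp add: dist_norm norm_minus_commute)
      then have "norm (I s (?p x)) \<le> B" using B p by blast
      then have "norm (I s (?p x)) / (3/2) ^ Suc m * (2 * pi * (3/2)) \<le> K"
        unfolding K_def by (intro mult_right_mono divide_right_mono) auto
      moreover have "norm (?p x) = 3/2" by (simp add: circlepath norm_mult)
      moreover have "norm (vector_derivative ?p (at x)) = 2 * pi * (3/2)"
        unfolding vector_derivative_circlepath by (simp add: norm_mult)
      ultimately have "norm (G s x) \<le> K" unfolding G_def norm_mult norm_divide norm_power by (simp only:)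
      then show ?thesis using True by (simp add: w_def)
    qed (simp add: w_def)
    moreover have "integrable lborel w" unfolding w_def by simp
    ultimately show "\<exists>r>0. \<exists>w. integrable lborel w \<and> (\<forall>s\<in>ball s0 r \<inter> UNIV. \<forall>x\<in>space lborel.
        norm (indicator {0..1} x *\<^sub>R G s x) \<le> w x)"
      by (intro exI[of _ 1] conjI exI[of _ w]) auto
  qed simp
  then have "(\<lambda>s. 1 / (2 * pi * \<i>) * (LINT x|lborel. indicator {0..1} x *\<^sub>R G s x)) holomorphic_on UNIV"
    by (intro holomorphic_intros)
  moreover have "coef m = (\<lambda>s. 1 / (2 * pi * \<i>) * (LINT x|lborel. indicator {0..1} x *\<^sub>R G s x))" using eq by blast
  ultimately show ?thesis by simp
qed

lemma den_lower:
  assumes "0 \<le> Re s + real m - 1"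
  shows "1 - 1 / \<epsilon> \<le> norm (den m s)"
proof -
  have "norm (exp (- ((s + of_nat m) * of_real (ln \<epsilon>)))) = exp (- ((Re s + real m) * ln \<epsilon>))" by (simp add: norm_exp_eq_Re)
  also have "\<dots> \<le> exp (- ln \<epsilon>)" using mult_right_mono[of 1 "Re s + real m" "ln \<epsilon>"] assms ln_eps by simp
  also have "\<dots> = 1 / \<epsilon>" using eps by (simp add: exp_minus inverse_eq_divide)
  finally show ?thesis unfolding den_def using norm_triangle_ineq2[of 1 "exp (- ((s + of_nat m) * of_real (ln \<epsilon>)))"] by simp
qed

lemma den_holomorphic: "den m holomorphic_on A"
  unfolding den_def [abs_def] by (intro holomorphic_intros)

lemma eps_gap: "0 < 1 - 1 / \<epsilon>" using eps by simp

lemma quotient_bound: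
  assumes "norm s \<le> S" "\<And>m s. norm s \<le> S \<Longrightarrow> norm (coef m s) \<le> B * (2 / 3) ^ m" "- real M < Re s"
  shows "norm (coef (Suc (m + M)) s / den (Suc (m + M)) s) \<le> B / (1 - 1 / \<epsilon>) * (2 / 3) ^ m"
proof -
  have B: "0 \<le> B" using order_trans[OF norm_ge_zero assms(2)[OF assms(1), of 0]] by simp
  have "norm (coef (Suc (m + M)) s) \<le> B * (2 / 3) ^ Suc (m + M)" using assms by blast
  also have "\<dots> \<le> B * (2 / 3) ^ m" using B by (intro mult_left_mono power_decreasing) auto
  finally have c: "norm (coef (Suc (m + M)) s) \<le> B * (2 / 3) ^ m" .
  have "1 - 1 / \<epsilon> \<le> norm (den (Suc (m + M)) s)" using assms(3) by (intro den_lower) simp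
  then have "norm (coef (Suc (m + M)) s) / norm (den (Suc (m + M)) s) \<le> B * (2 / 3) ^ m / (1 - 1 / \<epsilon>)"
    using c eps_gap order_trans[OF norm_ge_zero c] by (intro frac_le)
  then show ?thesis unfolding norm_divide by (simp only: times_divide_eq_left)
qed

lemma tail_summable:
  assumes "- real M < Re s"
  shows "summable (\<lambda>m. norm (coef (Suc (m + M)) s / den (Suc (m + M)) s))"
proof -
  obtain B where "0 \<le> B" and B: "\<And>m s'. norm s' \<le> norm s \<Longrightarrow> norm (coef m s') \<le> B * (2 / 3) ^ m"
    by (rule coef_bound[of "norm s"]) (rule that, assumption+)
  have q: "norm (coef (Suc (m + M)) s / den (Suc (m + M)) s) \<le> B / (1 - 1 / \<epsilon>) * (2 / 3) ^ m" for m
    by (rule quotient_bound[OF order_refl _ assms]) (rule B)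
  show ?thesis
  proof (rule summable_comparison_test'[where N = 0])
    show "summable (\<lambda>m. B / (1 - 1 / \<epsilon>) * (2 / 3) ^ m)" by (intro summable_mult summable_geometric) simp
    show "norm (norm (coef (Suc (m + M)) s / den (Suc (m + M)) s)) \<le> B / (1 - 1 / \<epsilon>) * (2 / 3) ^ m" for m
      using q[of m] by (simp only: real_norm_def abs_norm_cancel)
  qed
qed

text \<open>To the right of -M only the first M summands can be singular; the tail is holomorphic
  there. Every local question about \<open>total\<close> is thus reduced to a finite sum.\<close>

lemma total_split:
  assumes "- real M < Re s"
  shows "total s = (\<Sum>m<M. coef (Suc m) s / den (Suc m) s) + (\<Sum>m. coef (Suc (m + M)) s / den (Suc (m + M)) s)"
proof -
  have "summable (\<lambda>m. coef (Suc m) s / den (Suc m) s)"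
    using summable_iff_shift[of "\<lambda>m. coef (Suc m) s / den (Suc m) s" M] summable_norm_cancel[OF tail_summable[OF assms]] by simp
  from suminf_split_initial_segment[OF this, of M] show ?thesis by (simp add: total_def add.commute)
qed

lemma tail_holomorphic: "(\<lambda>s. \<Sum>m. coef (Suc (m + M)) s / den (Suc (m + M)) s) holomorphic_on {s. - real M < Re s}"
proof -
  have "(\<lambda>s. LINT m|count_space UNIV. coef (Suc (m + M)) s / den (Suc (m + M)) s) holomorphic_on {s. - real M < Re s}"
  proof (rule holomorphic_on_integral)
    show "open {s. - real M < Re s}" by (rule open_halfspace_Re_gt)
    show "(\<lambda>s. coef (Suc (m + M)) s / den (Suc (m + M)) s) holomorphic_on {s. - real M < Re s}" for m
    proof (intro holomorphic_on_divide den_holomorphic holomorphic_on_subset[OF coef_holomorphic])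
      show "den (Suc (m + M)) s \<noteq> 0" if "s \<in> {s. - real M < Re s}" for s
        using den_lower[of s "Suc (m + M)"] eps_gap that by auto
    qed simp
    fix s0 assume "s0 \<in> {s. - real M < Re s}"
    obtain B where "0 \<le> B" and B: "\<And>m s. norm s \<le> norm s0 + 1 \<Longrightarrow> norm (coef m s) \<le> B * (2 / 3) ^ m"
      by (rule coef_bound[of "norm s0 + 1"]) (rule that, assumption+)
    have "norm (coef (Suc (m + M)) s / den (Suc (m + M)) s) \<le> B / (1 - 1 / \<epsilon>) * (2 / 3) ^ m"
      if "s \<in> ball s0 1" "- real M < Re s" for s m
    proof (rule quotient_bound[OF _ B that(2)])
      show "norm s \<le> norm s0 + 1" using that norm_triangle_ineq2[of s s0] by (simp add: dist_norm norm_minus_commute)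
    qed
    moreover have "integrable (count_space UNIV) (\<lambda>m::nat. B / (1 - 1 / \<epsilon>) * (2 / 3) ^ m)"
      unfolding integrable_count_space_nat_iff norm_mult norm_power by (intro summable_mult summable_geometric) simp
    ultimately show "\<exists>r>0. \<exists>w. integrable (count_space UNIV) w \<and> (\<forall>s\<in>ball s0 r \<inter> {s. - real M < Re s}.
        \<forall>m\<in>space (count_space UNIV). norm (coef (Suc (m + M)) s / den (Suc (m + M)) s) \<le> w m)"
      by (intro exI[of _ 1] conjI exI[of _ "\<lambda>m. B / (1 - 1 / \<epsilon>) * (2 / 3) ^ m"]) auto
  qed simp
  then show ?thesis
  proof (rule holomorphic_transform)
    fix s assume s: "s \<in> {s. - real M < Re s}"
    show "(LINT m|count_space UNIV. coef (Suc (m + M)) s / den (Suc (m + M)) s) = (\<Sum>m. coef (Suc (m + M)) s / den (Suc (m + M)) s)"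
      by (rule integral_count_space_nat) (use tail_summable[of M s] s in \<open>simp add: integrable_count_space_nat_iff\<close>)
  qed
qed

lemma eventually_total_split:
  assumes "- real M < Re z"
  shows "eventually (\<lambda>s. total s = (\<Sum>m<M. coef (Suc m) s / den (Suc m) s) + (\<Sum>m. coef (Suc (m + M)) s / den (Suc (m + M)) s)) (nhds z)"
proof -
  have "eventually (\<lambda>s. s \<in> {s. - real M < Re s}) (nhds z)" using assms by (intro eventually_nhds_in_open open_halfspace_Re_gt) auto
  then show ?thesis by (rule eventually_mono) (use total_split in auto)
qed

lemma exists_half_plane: obtains M where "- real M < Re z"
proof -
  obtain n where "- Re z < real n" using reals_Archimedean2 by blast
  then show ?thesis by (intro that[of n]) linarith
qed

lemma tail_differentiable:
  assumes "- real M < Re z"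
  shows "(\<lambda>s. \<Sum>m. coef (Suc (m + M)) s / den (Suc (m + M)) s) field_differentiable (at z)"
  by (rule holomorphic_on_imp_differentiable_at[OF tail_holomorphic open_halfspace_Re_gt]) (use assms in simp)

lemma total_differentiable:
  assumes "\<And>m. 1 \<le> m \<Longrightarrow> den m z \<noteq> 0"
  shows "total field_differentiable (at z)"
proof -
  obtain M where M: "- real M < Re z" by (rule exists_half_plane)
  have c: "coef m field_differentiable (at z)" for m by (rule holomorphic_on_imp_differentiable_at[OF coef_holomorphic]) auto
  have d: "den m field_differentiable (at z)" for m by (rule holomorphic_on_imp_differentiable_at[OF den_holomorphic[of _ UNIV]]) auto
  have "(\<lambda>s. (\<Sum>m<M. coef (Suc m) s / den (Suc m) s) + (\<Sum>m. coef (Suc (m + M)) s / den (Suc (m + M)) s)) field_differentiable (at z)"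
    using assms by (intro field_differentiable_add field_differentiable_sum field_differentiable_divide c d tail_differentiable[OF M]) auto
  then obtain D where "((\<lambda>s. (\<Sum>m<M. coef (Suc m) s / den (Suc m) s) + (\<Sum>m. coef (Suc (m + M)) s / den (Suc (m + M)) s)) has_field_derivative D) (at z)"
    by (auto simp: field_differentiable_def)
  then have "(total has_field_derivative D) (at z)"
    using DERIV_cong_ev[OF refl eventually_total_split[OF M] refl, of D] by simp
  then show ?thesis by (auto simp: field_differentiable_def)
qed

lemma total_meromorphic: "total meromorphic_on UNIV"
proof -
  have "total meromorphic_on {z}" for z
  proof -
    obtain M where M: "- real M < Re z" by (rule exists_half_plane)
    define tl where "tl = (\<lambda>s. \<Sum>m. coef (Suc (m + M)) s / den (Suc (m + M)) s)"
    have c: "coef m meromorphic_on {z}" for m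
      by (rule analytic_on_imp_meromorphic_on) (rule holomorphic_on_imp_analytic_at[OF coef_holomorphic], auto)
    have d: "den m meromorphic_on {z}" for m
      by (rule analytic_on_imp_meromorphic_on) (rule holomorphic_on_imp_analytic_at[OF den_holomorphic[of m UNIV]], auto)
    have t: "tl meromorphic_on {z}" unfolding tl_def
      by (rule analytic_on_imp_meromorphic_on)
        (rule holomorphic_on_imp_analytic_at[OF tail_holomorphic open_halfspace_Re_gt], use M in simp)
    have "(\<lambda>s. (\<Sum>m<M. coef (Suc m) s / den (Suc m) s) + tl s) meromorphic_on {z}"
      by (intro meromorphic_on_add meromorphic_on_sum meromorphic_on_divide c d t)
    moreover have "eventually (\<lambda>s. total s = (\<Sum>m<M. coef (Suc m) s / den (Suc m) s) + tl s) (at z)"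
      using eventually_total_split[OF M] unfolding eventually_at_filter tl_def by (rule eventually_mono) simp
    then have "total meromorphic_on {z} \<longleftrightarrow> (\<lambda>s. (\<Sum>m<M. coef (Suc m) s / den (Suc m) s) + tl s) meromorphic_on {z}"
      by (intro meromorphic_on_cong) auto
    ultimately show ?thesis by (simp only:)
  qed
  then show ?thesis by (subst meromorphic_on_meromorphic_at) blast
qed

text \<open>At a zero of \<open>den m\<close> the exponential equals 1, so its derivative there is
  ln \<open>\<epsilon>\<close>, not 0: all zeros are simple.\<close>

lemma total_simple:
  obtains L where "((\<lambda>s. (s - z) * total s) \<longlongrightarrow> L) (at z)"
proof -
  obtain M where M: "- real M < Re z" by (rule exists_half_plane)
  have cont: "(f \<longlongrightarrow> f z) (at z)" if "f field_differentiable (at z)" for f :: "complex \<Rightarrow> complex"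
    using field_differentiable_imp_continuous_at[OF that] by (simp add: continuous_at)
  have c: "(coef m \<longlongrightarrow> coef m z) (at z)" for m
    by (rule cont, rule holomorphic_on_imp_differentiable_at[OF coef_holomorphic]) auto
  have d: "(den m \<longlongrightarrow> den m z) (at z)" for m
    by (rule cont, rule holomorphic_on_imp_differentiable_at[OF den_holomorphic[of _ UNIV]]) auto
  have id: "((\<lambda>s. s - z) \<longlongrightarrow> 0) (at z)" by (intro tendsto_eq_intros) auto
  have "\<exists>L. ((\<lambda>s. (s - z) * (coef m s / den m s)) \<longlongrightarrow> L) (at z)" for m
  proof (cases "den m z = 0")
    case False
    then show ?thesis using tendsto_mult[OF id tendsto_divide[OF c[of m] d[of m]]] by blast
  next
    case True
    then have e: "exp (- ((z + of_nat m) * of_real (ln \<epsilon>))) = 1" by (simp add: den_def)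
    have "(den m has_field_derivative exp (- ((z + of_nat m) * of_real (ln \<epsilon>))) * of_real (ln \<epsilon>)) (at z)"
      unfolding den_def [abs_def] by (auto intro!: derivative_eq_intros)
    then have "((\<lambda>s. den m s / (s - z)) \<longlongrightarrow> of_real (ln \<epsilon>)) (at z)"
      unfolding has_field_derivative_iff e True by simp
    then have "((\<lambda>s. coef m s / (den m s / (s - z))) \<longlongrightarrow> coef m z / of_real (ln \<epsilon>)) (at z)"
      using ln_eps eps by (intro tendsto_divide c) auto
    then show ?thesis by (intro exI) (simp add: mult.commute)
  qed
  then obtain L where L: "\<And>m. ((\<lambda>s. (s - z) * (coef m s / den m s)) \<longlongrightarrow> L m) (at z)" by metis
  have "((\<lambda>s. (\<Sum>m<M. (s - z) * (coef (Suc m) s / den (Suc m) s)) + (s - z) * (\<Sum>m. coef (Suc (m + M)) s / den (Suc (m + M)) s))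
     \<longlongrightarrow> (\<Sum>m<M. L (Suc m)) + 0 * (\<Sum>m. coef (Suc (m + M)) z / den (Suc (m + M)) z)) (at z)"
    by (intro tendsto_add tendsto_sum L tendsto_mult id cont[OF tail_differentiable[OF M]])
  moreover have "eventually (\<lambda>s. (\<Sum>m<M. (s - z) * (coef (Suc m) s / den (Suc m) s)) + (s - z) * (\<Sum>m. coef (Suc (m + M)) s / den (Suc (m + M)) s)
     = (s - z) * total s) (at z)"
  proof -
    have "eventually (\<lambda>s. total s = (\<Sum>m<M. coef (Suc m) s / den (Suc m) s) + (\<Sum>m. coef (Suc (m + M)) s / den (Suc (m + M)) s)) (at z)"
      using eventually_total_split[OF M] unfolding eventually_at_filter by (rule eventually_mono) simp
    then show ?thesis by (rule eventually_mono) (simp add: distrib_left sum_distrib_left)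
  qed
  ultimately have "((\<lambda>s. (s - z) * total s) \<longlongrightarrow> (\<Sum>m<M. L (Suc m)) + 0 * (\<Sum>m. coef (Suc (m + M)) z / den (Suc (m + M)) z)) (at z)"
    by (rule Lim_transform_eventually)
  then show ?thesis by (rule that)
qed

text \<open>With \<open>N(v) = \<Sum>m. coef (m+1) s / den (m+1) s * v ^ (m+1)\<close> one has
  \<open>N(v) - \<epsilon>\<^sup>-\<^sup>s N(v/\<epsilon>) = I s v\<close>, so the sum over \<open>n\<close> telescopes to \<open>N(1)\<close>.\<close>

lemma total_sums:
  assumes s: "0 < Re s"
  shows "(\<lambda>n. exp (- (s * of_real (ln \<epsilon>))) ^ n * I s (of_real ((1 / \<epsilon>) ^ n))) sums total s"
proof -
  define x where "x = exp (- (s * of_real (ln \<epsilon>)))"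
  define e where "e = 1 / \<epsilon>"
  have e: "0 < e" "e < 1" using eps by (auto simp: e_def)
  have x: "norm x < 1" using s ln_eps by (simp add: x_def norm_exp_eq_Re)
  define b where "b = (\<lambda>m. coef (Suc m) s / den (Suc m) s)"
  have bsum: "summable (\<lambda>m. norm (b m))" using tail_summable[of 0 s] s by (simp add: b_def)
  define N where "N = (\<lambda>v. \<Sum>m. b m * of_real v ^ Suc m)"
  have bv: "norm (b m * of_real v ^ Suc m) \<le> norm (b m)" if "0 \<le> v" "v \<le> 1" for m v
  proof -
    have "norm (b m) * v ^ Suc m \<le> norm (b m) * 1" using that power_le_one[of v "Suc m"] by (intro mult_left_mono) auto
    then show ?thesis using that by (simp add: norm_mult norm_power abs_mult)
  qed
  have Nsum: "summable (\<lambda>m. norm (b m * of_real v ^ Suc m))" if "0 \<le> v" "v \<le> 1" for v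
    by (rule summable_comparison_test'[OF bsum, of 0]) (use bv[OF that] in simp)
  have Nb: "norm (N v) \<le> (\<Sum>m. norm (b m))" if "0 \<le> v" "v \<le> 1" for v
    unfolding N_def using summable_norm[OF Nsum[OF that]] suminf_le[OF bv[OF that] Nsum[OF that] bsum] by linarith
  have den: "den (Suc m) s = 1 - x * of_real e ^ Suc m" "den (Suc m) s \<noteq> 0" for m
  proof -
    have "exp (- (of_nat (Suc m) * of_real (ln \<epsilon>))) = exp (complex_of_real (- ln \<epsilon>)) ^ Suc m"
      unfolding exp_of_nat_mult[symmetric] by simp
    also have "exp (complex_of_real (- ln \<epsilon>)) = of_real e"
      unfolding exp_of_real using eps by (simp add: exp_minus e_def inverse_eq_divide)
    finally have "exp (- (of_nat (Suc m) * of_real (ln \<epsilon>))) = complex_of_real e ^ Suc m" .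
    then show "den (Suc m) s = 1 - x * of_real e ^ Suc m"
      unfolding den_def x_def distrib_right minus_add exp_add by simp
    show "den (Suc m) s \<noteq> 0" using den_lower[of s "Suc m"] s eps_gap by auto
  qed
  have rec: "N v - x * N (v * e) = I s (of_real v)" if v: "0 \<le> v" "v \<le> 1" for v
  proof -
    have ve: "0 \<le> v * e" "v * e \<le> 1" using v e mult_le_one[of v e] by auto
    have v2: "complex_of_real v \<in> ball 0 2" using v by simp
    have A: "(\<lambda>m. b m * of_real v ^ Suc m - x * (b m * of_real (v * e) ^ Suc m)) sums (N v - x * N (v * e))"
      unfolding N_def by (intro sums_diff sums_mult summable_sums summable_norm_cancel[OF Nsum] v ve)
    have c: "b m * of_real v ^ Suc m - x * (b m * of_real (v * e) ^ Suc m) = coef (Suc m) s * of_real v ^ Suc m" for m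
    proof -
      have "b m * of_real v ^ Suc m - x * (b m * of_real (v * e) ^ Suc m) = b m * (1 - x * of_real e ^ Suc m) * of_real v ^ Suc m"
        by (simp only: of_real_mult power_mult_distrib left_diff_distrib right_diff_distrib mult_ac mult_1_right mult_1_left)
      also have "b m * (1 - x * of_real e ^ Suc m) = coef (Suc m) s" using den[of m] by (simp add: b_def)
      finally show ?thesis .
    qed
    have "(\<lambda>m. coef (Suc m) s * of_real v ^ Suc m) sums (I s (of_real v) - coef 0 s * of_real v ^ 0)"
      by (rule iffD2[OF sums_Suc_iff]) (use coef_sums[OF v2, of s] in simp)
    then have "(\<lambda>m. coef (Suc m) s * of_real v ^ Suc m) sums I s (of_real v)" by (simp only: coef_0 mult_zero_left diff_zero)
    with A show ?thesis unfolding c by (rule sums_unique2)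
  qed
  have lim: "(\<lambda>n. x ^ n * N (e ^ n)) \<longlonglongrightarrow> 0"
  proof (rule Lim_null_comparison[OF always_eventually])
    show "\<forall>n. norm (x ^ n * N (e ^ n)) \<le> norm x ^ n * (\<Sum>m. norm (b m))"
    proof
      fix n
      have "norm (N (e ^ n)) \<le> (\<Sum>m. norm (b m))" using e by (intro Nb) (auto intro: power_le_one)
      then show "norm (x ^ n * N (e ^ n)) \<le> norm x ^ n * (\<Sum>m. norm (b m))"
        unfolding norm_mult norm_power by (intro mult_left_mono) auto
    qed
    show "(\<lambda>n. norm x ^ n * (\<Sum>m. norm (b m))) \<longlonglongrightarrow> 0"
      by (intro tendsto_mult_left_zero LIMSEQ_realpow_zero x) simp
  qed
  have "(\<lambda>n. x ^ n * N (e ^ n) - x ^ Suc n * N (e ^ Suc n)) sums (x ^ 0 * N (e ^ 0) - 0)"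
    by (rule telescope_sums'[OF lim])
  moreover have "x ^ n * N (e ^ n) - x ^ Suc n * N (e ^ Suc n) = x ^ n * I s (of_real (e ^ n))" for n
  proof -
    have "N (e ^ n) - x * N (e ^ Suc n) = I s (of_real (e ^ n))" using rec[of "e ^ n"] e by (simp add: power_le_one mult.commute)
    moreover have "x ^ n * N (e ^ n) - x ^ Suc n * N (e ^ Suc n) = x ^ n * (N (e ^ n) - x * N (e ^ Suc n))"
      by (simp only: right_diff_distrib power_Suc mult_ac)
    ultimately show ?thesis by (simp only:)
  qed
  moreover have "N 1 = total s" by (simp add: N_def total_def b_def)
  ultimately show ?thesis by (simp add: x_def e_def)
qed

end

section \<open>The self-similar kernels\<close>

text \<open>At scale v = \<open>\<epsilon>\<close>^(-n) and with u = \<open>\<epsilon>\<close>^n t,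
  the denominator \<open>\<epsilon>\<close>^n X + \<open>\<epsilon>\<close>^(-n) Y times t is (X +
  v^2 Y) u. So a shift by n periods becomes a change of v alone.\<close>

definition amp :: "real \<Rightarrow> real \<Rightarrow> complex \<Rightarrow> complex" where
  "amp X Y v = of_real X + v\<^sup>2 * of_real Y"

text \<open>A term of the Lambert series in the rescaled variable: v u is t again, so the first
  factor is 1 - exp(-q t). It vanishes at v = 0.\<close>

definition kern :: "int \<Rightarrow> (complex \<Rightarrow> complex) \<Rightarrow> (complex \<Rightarrow> complex) \<Rightarrow> complex \<Rightarrow> complex \<Rightarrow> complex" where
  "kern q b c v u = (1 - exp (- (of_int q * v * u))) * (bose (b v * u) * bose (c v * u))"

text \<open>u times the kernel, regular at u = 0: the zero of the first factor leaves a simple pole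
  out of the double pole of the two bose factors.\<close>

definition kern_num :: "int \<Rightarrow> (complex \<Rightarrow> complex) \<Rightarrow> (complex \<Rightarrow> complex) \<Rightarrow> complex \<Rightarrow> complex \<Rightarrow> complex" where
  "kern_num q b c v u = - expm1_div (- (of_int q * v)) u / (expm1_div (b v) u * expm1_div (c v) u)"

lemma kern_eq:
  assumes "u \<noteq> 0"
  shows "kern q b c v u = kern_num q b c v u / u"
proof -
  have "(1 - P) * (1 / A * (1 / B)) = - ((P - 1) / u) / ((A / u) * (B / u)) / u" for A B P
    using assms by (cases "A = 0"; cases "B = 0") (simp_all add: field_simps)
  then show ?thesis using assms by (simp only: kern_def kern_num_def expm1_div_def bose_def if_False mult_minus_left)
qed

text \<open>For |v| <= 2 the second summand is at most 4 |Y|, by assumption no more than X /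
  2.\<close>

lemma norm_amp_bounds:
  assumes "8 * \<bar>Y\<bar> \<le> X" "v \<in> cball 0 2"
  shows "X / 2 \<le> Re (amp X Y v)" "norm (amp X Y v) \<le> 3 / 2 * X"
proof -
  have "(norm v)\<^sup>2 \<le> 2\<^sup>2" using assms by (intro power_mono) auto
  then have "norm (v\<^sup>2 * of_real Y) \<le> 4 * \<bar>Y\<bar>" by (simp add: norm_mult norm_power mult_right_mono)
  then have n: "norm (v\<^sup>2 * of_real Y) \<le> X / 2" using assms by linarith
  show "X / 2 \<le> Re (amp X Y v)" using n abs_Re_le_cmod[of "v\<^sup>2 * of_real Y"] unfolding amp_def plus_complex.sel Re_complex_of_real by linarith
  have "norm (amp X Y v) \<le> \<bar>X\<bar> + norm (v\<^sup>2 * of_real Y)" unfolding amp_def using norm_triangle_ineq[of "of_real X" "v\<^sup>2 * complex_of_real Y"] by simp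
  then show "norm (amp X Y v) \<le> 3 / 2 * X" using n assms(1) by linarith
qed

lemma norm_bose_le:
  assumes "0 < r" "r \<le> t" "0 < \<kappa>" "\<kappa> \<le> Re b"
  shows "norm (bose (b * of_real t)) \<le> exp (- (\<kappa> * t)) / (1 - exp (- (\<kappa> * r)))"
proof -
  have kr: "exp (- (\<kappa> * r)) < 1" using assms by simp
  have "exp (- (\<kappa> * t)) \<le> exp (- (\<kappa> * r))" using assms by simp
  then have "exp (\<kappa> * t) * (1 - exp (- (\<kappa> * r))) \<le> exp (\<kappa> * t) * (1 - exp (- (\<kappa> * t)))" by (intro mult_left_mono) auto
  also have "\<dots> = exp (\<kappa> * t) - 1" by (simp add: right_diff_distrib flip: exp_add)
  also have "\<dots> \<le> exp (Re b * t) - 1" using assms by simp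
  also have "\<dots> = norm (exp (b * of_real t)) - norm (1::complex)" by (simp add: norm_exp_eq_Re)
  also have "\<dots> \<le> norm (exp (b * of_real t) - 1)" by (rule norm_triangle_ineq2)
  finally have le: "exp (\<kappa> * t) * (1 - exp (- (\<kappa> * r))) \<le> norm (exp (b * of_real t) - 1)" .
  have "norm (bose (b * of_real t)) = 1 / norm (exp (b * of_real t) - 1)" by (simp add: bose_def norm_divide)
  also have "\<dots> \<le> 1 / (exp (\<kappa> * t) * (1 - exp (- (\<kappa> * r))))" 
  proof (rule frac_le[OF zero_le_one order_refl _ le])
    show "0 < exp (\<kappa> * t) * (1 - exp (- (\<kappa> * r)))" using kr by simp
  qed
  also have "\<dots> = exp (- (\<kappa> * t)) / (1 - exp (- (\<kappa> * r)))" by (simp add: exp_minus divide_simps)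
  finally show ?thesis .
qed

text \<open>X >= 4 |q| + 4 makes the real parts of the amplitudes at least 2 |q| + 2, so the two
  bose factors outweigh the possible growth exp(2 |q| t) of the first factor for |v| <= 2. r X <= 1
  keeps |amp u| at most 3 for |u| < 2 r, away from the nonzero zeros of exp - 1.\<close>

locale kernel_family =
  fixes q :: int and X1 Y1 X2 Y2 r :: real
  assumes X: "4 * \<bar>real_of_int q\<bar> + 4 \<le> X1" "4 * \<bar>real_of_int q\<bar> + 4 \<le> X2"
    and Y: "8 * \<bar>Y1\<bar> \<le> X1" "8 * \<bar>Y2\<bar> \<le> X2"
    and r: "0 < r" "r * X1 \<le> 1" "r * X2 \<le> 1"
begin

abbreviation "k \<equiv> kern q (amp X1 Y1) (amp X2 Y2)"
abbreviation "kn \<equiv> kern_num q (amp X1 Y1) (amp X2 Y2)"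

lemma amp_small:
  assumes "v \<in> cball 0 2" "norm u < 2 * r"
  shows "norm (amp X1 Y1 v * u) < 6" "norm (amp X2 Y2 v * u) < 6" "amp X1 Y1 v \<noteq> 0" "amp X2 Y2 v \<noteq> 0"
proof -
  have gen: "norm (amp X Y v * u) < 6 \<and> amp X Y v \<noteq> 0"
    if h: "4 * \<bar>real_of_int q\<bar> + 4 \<le> X" "8 * \<bar>Y\<bar> \<le> X" "r * X \<le> 1" for X Y
  proof -
    note b = norm_amp_bounds[OF h(2) assms(1)]
    have "norm (amp X Y v * u) \<le> (3 / 2 * X) * (2 * r)" unfolding norm_mult using b(2) assms(2) h(1) by (intro mult_mono) auto
    also have "\<dots> = 3 * (r * X)" by simp
    also have "\<dots> < 6" using h(3) by linarith
    finally have "norm (amp X Y v * u) < 6" .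
    moreover have "0 < Re (amp X Y v)" using b(1) h(1) by linarith
    ultimately show ?thesis by auto
  qed
  show "norm (amp X1 Y1 v * u) < 6" "norm (amp X2 Y2 v * u) < 6" "amp X1 Y1 v \<noteq> 0" "amp X2 Y2 v \<noteq> 0"
    using gen[OF X(1) Y(1) r(2)] gen[OF X(2) Y(2) r(3)] by auto
qed

lemma kn_holomorphic: "v \<in> cball 0 2 \<Longrightarrow> kn v holomorphic_on ball 0 (2 * r)"
  unfolding kern_num_def
  by (intro holomorphic_on_divide holomorphic_on_mult holomorphic_on_minus expm1_div_holomorphic)
    (use amp_small expm1_div_nonzero in auto)

lemma kn_circle:
  assumes "v \<in> cball 0 2" "norm u = r"
  shows "exp (amp X1 Y1 v * u) - 1 \<noteq> 0" "exp (amp X2 Y2 v * u) - 1 \<noteq> 0" "kn v u = u * k v u"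
proof -
  have u: "norm u < 2 * r" "u \<noteq> 0" using assms r by auto
  show "exp (amp X1 Y1 v * u) - 1 \<noteq> 0" "exp (amp X2 Y2 v * u) - 1 \<noteq> 0"
    using exp_eq_1_small amp_small[OF assms(1) u(1)] u(2) by fastforce+
  show "kn v u = u * k v u" using kern_eq[OF u(2)] u by simp
qed

lemma kn_holomorphic_parameter: "norm u = r \<Longrightarrow> (\<lambda>v. kn v u) holomorphic_on ball 0 2"
proof -
  assume u: "norm u = r"
  have "(\<lambda>v. u * k v u) holomorphic_on ball 0 2"
    unfolding kern_def bose_def
    by (intro holomorphic_intros kn_circle(1,2)[unfolded amp_def] ) (use kn_circle(1,2)[OF _ u] in \<open>auto simp: amp_def intro!: holomorphic_intros\<close>)
  then show ?thesis by (rule holomorphic_transform) (use kn_circle(3)[OF _ u] in auto)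
qed

lemma k_line_nonzero:
  assumes "v \<in> cball 0 2" "0 < t"
  shows "exp (amp X1 Y1 v * of_real t) - 1 \<noteq> 0" "exp (amp X2 Y2 v * of_real t) - 1 \<noteq> 0"
proof -
  have gen: "exp (b * of_real t) - 1 \<noteq> 0" if "0 < Re b" for b
  proof
    assume "exp (b * of_real t) - 1 = 0"
    then have "norm (exp (b * of_real t)) = 1" by simp
    then have "Re b * t = 0" by (simp add: norm_exp_eq_Re)
    then show False using that assms by simp
  qed
  show "exp (amp X1 Y1 v * of_real t) - 1 \<noteq> 0" "exp (amp X2 Y2 v * of_real t) - 1 \<noteq> 0"
    using norm_amp_bounds(1)[OF Y(1) assms(1)] norm_amp_bounds(1)[OF Y(2) assms(1)] X by (intro gen; linarith)+
qed

lemma k_holomorphic_parameter: "0 < t \<Longrightarrow> (\<lambda>v. k v (of_real t)) holomorphic_on ball 0 2"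
  unfolding kern_def bose_def
  by (intro holomorphic_intros) (use k_line_nonzero in \<open>auto simp: amp_def intro!: holomorphic_intros\<close>)

lemma k_measurable: "(\<lambda>t. k v (complex_of_real t)) \<in> borel_measurable borel"
  unfolding kern_def bose_def by measurable

lemma bounds:
  obtains C where "0 \<le> C" "\<And>v u. v \<in> cball 0 2 \<Longrightarrow> norm u = r \<Longrightarrow> norm (kn v u) \<le> C"
    "\<And>v t. v \<in> cball 0 2 \<Longrightarrow> r < t \<Longrightarrow> norm (k v (of_real t)) \<le> C * exp (- t)"
proof -
  let ?S = "cball 0 2 \<times> sphere 0 r :: (complex \<times> complex) set"
  have "continuous_on ?S (\<lambda>(v, u). u * k v u)"
    unfolding kern_def bose_def case_prod_beta amp_def
    by (intro continuous_intros) (use kn_circle(1,2) in \<open>auto simp: amp_def\<close>)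
  then have "compact ((\<lambda>(v, u). u * k v u) ` ?S)" by (rule compact_continuous_image) (intro compact_Times compact_cball compact_sphere)
  then obtain C1 where C1: "\<And>x. x \<in> (\<lambda>(v, u). u * k v u) ` ?S \<Longrightarrow> norm x \<le> C1" by (meson bounded_iff compact_imp_bounded)
  have b1: "norm (kn v u) \<le> C1" if "v \<in> cball 0 2" "norm u = r" for v u
    using C1[of "u * k v u"] kn_circle(3)[OF that] that by force
  \<comment> \<open>A lower bound for the real parts of both amplitudes. The total rate 2 |q| - 2
    \<open>\<kappa>\<close> is -(2 |q| + 4), which is below -1.\<close>
  define \<kappa> where "\<kappa> = 2 * \<bar>real_of_int q\<bar> + 2"
  define D where "D = 1 / (1 - exp (- (\<kappa> * r)))"
  have \<kappa>: "0 < \<kappa>" by (simp add: \<kappa>_def)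
  have D: "0 < D" using r \<kappa> by (simp add: D_def)
  have b2: "norm (k v (of_real t)) \<le> 2 * D\<^sup>2 * exp (- t)" if v: "v \<in> cball 0 2" and t: "r < t" for v t
  proof -
    have t0: "0 < t" using t r by simp
    have "norm (of_int q * v * of_real t) = \<bar>real_of_int q\<bar> * norm v * t" using t0 by (simp add: norm_mult)
    also have "\<dots> \<le> \<bar>real_of_int q\<bar> * 2 * t" using v t0 by (intro mult_right_mono mult_left_mono) auto
    finally have n: "norm (- (of_int q * v * of_real t)) \<le> 2 * \<bar>real_of_int q\<bar> * t" by (simp add: mult_ac)
    have "norm (exp (- (of_int q * v * of_real t))) \<le> exp (2 * \<bar>real_of_int q\<bar> * t)"
      using norm_exp[of "- (of_int q * v * of_real t)"] n by (meson exp_le_cancel_iff order_trans)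
    moreover have "1 \<le> exp (2 * \<bar>real_of_int q\<bar> * t)" using t0 by simp
    ultimately have N: "norm (1 - exp (- (of_int q * v * of_real t))) \<le> 2 * exp (2 * \<bar>real_of_int q\<bar> * t)"
      using norm_triangle_ineq4[of 1 "exp (- (of_int q * v * of_real t))"] unfolding norm_one by linarith
    have k1: "\<kappa> \<le> Re (amp X1 Y1 v)" "\<kappa> \<le> Re (amp X2 Y2 v)"
      using norm_amp_bounds(1)[OF Y(1) v] norm_amp_bounds(1)[OF Y(2) v] X by (auto simp: \<kappa>_def)
    have B: "norm (bose (b * of_real t)) \<le> D * exp (- (\<kappa> * t))" if "\<kappa> \<le> Re b" for b
      using norm_bose_le[OF r(1) less_imp_le[OF t] \<kappa> that] by (simp add: D_def)
    have "norm (k v (of_real t)) \<le> (2 * exp (2 * \<bar>real_of_int q\<bar> * t)) * ((D * exp (- (\<kappa> * t))) * (D * exp (- (\<kappa> * t))))"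
      unfolding kern_def norm_mult by (intro mult_mono N B k1 mult_nonneg_nonneg norm_ge_zero) (use D in auto)
    also have "\<dots> = 2 * D\<^sup>2 * exp (2 * \<bar>real_of_int q\<bar> * t - \<kappa> * t - \<kappa> * t)"
    proof -
      have e: "exp (x - y - y) = exp x * (exp (- y) * exp (- y))" for x y :: real by (simp flip: exp_add)
      show ?thesis unfolding e power2_eq_square by (simp only: mult_ac)
    qed
    also have "\<dots> \<le> 2 * D\<^sup>2 * exp (- t)"
    proof (intro mult_left_mono)
      have "2 * \<bar>real_of_int q\<bar> * t - \<kappa> * t - \<kappa> * t = - ((2 * \<bar>real_of_int q\<bar> + 4) * t)" by (simp add: \<kappa>_def algebra_simps)
      moreover have "1 * t \<le> (2 * \<bar>real_of_int q\<bar> + 4) * t" using t0 by (intro mult_right_mono) auto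
      ultimately show "exp (2 * \<bar>real_of_int q\<bar> * t - \<kappa> * t - \<kappa> * t) \<le> exp (- t)" by simp
    qed simp
    finally show ?thesis .
  qed
  define C where "C = max 0 C1 + 2 * D\<^sup>2"
  have C: "0 \<le> C" "C1 \<le> C" "2 * D\<^sup>2 \<le> C" 
    unfolding C_def using zero_le_power2[of D] max.cobounded1[of 0 C1] max.cobounded2[of C1 0] by linarith+
  show ?thesis
  proof (rule that[OF C(1)])
    show "norm (kn v u) \<le> C" if "v \<in> cball 0 2" "norm u = r" for v u using b1[OF that] C by linarith
    show "norm (k v (of_real t)) \<le> C * exp (- t)" if "v \<in> cball 0 2" "r < t" for v t
      by (rule order_trans[OF b2[OF that] mult_right_mono[OF C(3) exp_ge_zero]])
  qed
qed

definition hank :: "complex \<Rightarrow> complex \<Rightarrow> complex" where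
  "hank s v = hankel r (kn v) (\<lambda>t. k v (of_real t)) s"

lemma kn_continuous: "v \<in> cball 0 2 \<Longrightarrow> continuous_on (sphere 0 r) (kn v)"
  by (rule continuous_on_subset[OF holomorphic_on_imp_continuous_on[OF kn_holomorphic]]) (use r in auto)

lemma hank_holomorphic:
  assumes "v \<in> ball 0 2"
  shows "(\<lambda>s. hank s v) holomorphic_on UNIV"
proof -
  obtain C where "0 \<le> C" "\<And>v u. v \<in> cball 0 2 \<Longrightarrow> norm u = r \<Longrightarrow> norm (kn v u) \<le> C"
    and C: "\<And>v t. v \<in> cball 0 2 \<Longrightarrow> r < t \<Longrightarrow> norm (k v (of_real t)) \<le> C * exp (- t)"
    by (rule bounds) (rule that, assumption+)
  have v: "v \<in> cball 0 2" using assms by simp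
  show ?thesis unfolding hank_def
    by (rule hankel_holomorphic[OF r(1) kn_continuous[OF v] k_measurable C[OF v]])
qed

lemma hank_holomorphic_parameter: "hank s holomorphic_on ball 0 2"
proof -
  obtain C where "0 \<le> C" and C1: "\<And>v u. v \<in> cball 0 2 \<Longrightarrow> norm u = r \<Longrightarrow> norm (kn v u) \<le> C"
    and C: "\<And>v t. v \<in> cball 0 2 \<Longrightarrow> r < t \<Longrightarrow> norm (k v (of_real t)) \<le> C * exp (- t)"
    by (rule bounds) (rule that, assumption+)
  have v: "v \<in> cball 0 2" if "v \<in> ball 0 2" for v :: complex using that by simp
  show ?thesis unfolding hank_def [abs_def]
  proof (rule hankel_holomorphic_parameter[OF r(1) open_ball kn_continuous[OF v] kn_holomorphic_parameter C1[OF v] k_measurable _ C[OF v]])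
    show "(\<lambda>v. k v (of_real t)) holomorphic_on ball 0 2" if "r < t" for t
      using k_holomorphic_parameter[of t] that r by simp
  qed
qed

lemma hank_bounded: "\<exists>B. \<forall>s v. norm s \<le> S \<longrightarrow> v \<in> ball 0 2 \<longrightarrow> norm (hank s v) \<le> B"
proof -
  obtain C where C0: "0 \<le> C" and C1: "\<And>v u. v \<in> cball 0 2 \<Longrightarrow> norm u = r \<Longrightarrow> norm (kn v u) \<le> C"
    and C: "\<And>v t. v \<in> cball 0 2 \<Longrightarrow> r < t \<Longrightarrow> norm (k v (of_real t)) \<le> C * exp (- t)"
    by (rule bounds) (rule that, assumption+)
  show ?thesis
  proof (rule hankel_bound[OF r(1), where S = S])
  fix B :: real
  assume B: "\<And>F f C s. 0 \<le> C \<Longrightarrow> (\<And>u. norm u = r \<Longrightarrow> norm (F u) \<le> C) \<Longrightarrow> f \<in> borel_measurable borel \<Longrightarrow>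
     (\<And>t. r < t \<Longrightarrow> norm (f t) \<le> C * exp (- t)) \<Longrightarrow> norm s \<le> S \<Longrightarrow> norm (hankel r F f s) \<le> C * B"
  have "norm (hank s v) \<le> C * B" if "norm s \<le> S" "v \<in> ball 0 2" for s v
  proof -
    have v: "v \<in> cball 0 2" using that by simp
    show ?thesis unfolding hank_def by (rule B[OF C0 C1[OF v] k_measurable C[OF v] that(1)])
  qed
  then show "\<exists>B. \<forall>s v. norm s \<le> S \<longrightarrow> v \<in> ball 0 2 \<longrightarrow> norm (hank s v) \<le> B" by blast
  qed
qed

text \<open>The factor 1 - exp(-q v u) vanishes at v = 0. This is the origin of
  \<open>at_0\<close>.\<close>

lemma hank_0: "hank s 0 = 0"
proof -
  have "kn 0 = (\<lambda>u. 0)" by (simp add: kern_num_def expm1_div_def fun_eq_iff)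
  moreover have "(\<lambda>t. k 0 (of_real t)) = (\<lambda>t. 0)" by (simp add: kern_def fun_eq_iff)
  ultimately show ?thesis by (simp add: hank_def hankel_def mellin_def set_lebesgue_integral_def)
qed

lemma hank_eq:
  assumes "v \<in> ball 0 2" "1 < Re s"
  shows "hank s v = (exp (2 * pi * \<i> * s) - 1) * mellin {0<..} (\<lambda>t. k v (of_real t)) s"
    and "mellin_conv {0<..} (\<lambda>t. k v (of_real t)) s"
proof -
  obtain C where "0 \<le> C" "\<And>v u. v \<in> cball 0 2 \<Longrightarrow> norm u = r \<Longrightarrow> norm (kn v u) \<le> C"
    and C: "\<And>v t. v \<in> cball 0 2 \<Longrightarrow> r < t \<Longrightarrow> norm (k v (of_real t)) \<le> C * exp (- t)"
    by (rule bounds) (rule that, assumption+)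
  have v: "v \<in> cball 0 2" using assms by simp
  have near: "k v (of_real t) = kn v (of_real t) / of_real t" if "0 < t" for t using kern_eq that by simp
  have r2: "r < 2 * r" using r by simp
  show "hank s v = (exp (2 * pi * \<i> * s) - 1) * mellin {0<..} (\<lambda>t. k v (of_real t)) s"
    unfolding hank_def by (rule hankel_eq(1)[OF r(1) r2 kn_holomorphic[OF v] k_measurable near C[OF v] assms(2)])
  show "mellin_conv {0<..} (\<lambda>t. k v (of_real t)) s"
    by (rule hankel_eq(2)[OF r(1) r2 kn_holomorphic[OF v] k_measurable near C[OF v] assms(2)])
qed

end

section \<open>The continuation for quadratic irrationals\<close>

text \<open>From exp x - 1 = 2 exp(x/2) sinh(x/2) >= x exp(x/2). It keeps both the factor 1 / x and
  exponential decay.\<close>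

lemma bose_le_exp_half:
  assumes "0 < (x::real)"
  shows "bose x \<le> exp (- (x / 2)) / x"
proof -
  have "x / 2 \<le> (exp (x / 2) - inverse (exp (x / 2))) / 2" by (rule real_le_x_sinh) (use assms in simp)
  then have "x \<le> exp (x / 2) - inverse (exp (x / 2))" by simp
  then have "exp (x / 2) * x \<le> exp (x / 2) * (exp (x / 2) - inverse (exp (x / 2)))" by (intro mult_left_mono) auto
  also have "\<dots> = exp x - 1" by (simp add: right_diff_distrib flip: exp_add)
  finally have le: "exp (x / 2) * x \<le> exp x - 1" .
  have "bose x \<le> 1 / (exp (x / 2) * x)" unfolding bose_def by (rule frac_le[OF zero_le_one order_refl _ le]) (use assms in simp)
  also have "\<dots> = exp (- (x / 2)) / x" by (simp add: exp_minus inverse_eq_divide)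
  finally show ?thesis .
qed

lemma abs_one_minus_exp_le: "\<bar>1 - exp (- y)\<bar> \<le> \<bar>y\<bar> * exp \<bar>y\<bar>" for y :: real
proof (cases "0 \<le> y")
  case True
  have "1 - exp (- y) \<le> y" using exp_ge_add_one_self[of "- y"] by linarith
  also have "y \<le> y * exp y" using True mult_left_mono[of 1 "exp y" y] by simp
  finally show ?thesis using True by simp
next
  case False
  have "exp (- y) * (1 + y) \<le> exp (- y) * exp y" using exp_ge_add_one_self[of y] by (intro mult_left_mono) auto
  moreover have "exp (- y) * exp y = 1" by (simp flip: exp_add)
  ultimately have "exp (- y) - 1 \<le> - y * exp (- y)" by (simp add: algebra_simps)
  then show ?thesis using False by simp
qed

context irrational_number
begin

section \<open>Single terms and tails of the Lambert series\<close>

definition term_lambert :: "int \<Rightarrow> nat \<Rightarrow> real \<Rightarrow> complex" where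
  "term_lambert q k t = kern q (\<lambda>_. of_real (Q k)) (\<lambda>_. of_real (Q (Suc k))) 1 (of_real t)"

definition tail_lambert :: "int \<Rightarrow> nat \<Rightarrow> real \<Rightarrow> complex" where
  "tail_lambert q k0 t = (\<Sum>j. (-1) ^ (k0 + j) * term_lambert q (k0 + j) t)"

lemma term_lambert_eq:
  "term_lambert q k t = (1 - exp (- (of_int q * of_real t))) * of_real (bose (Q k * t) * bose (Q (Suc k) * t))"
  unfolding term_lambert_def kern_def of_real_mult[symmetric] bose_of_real by simp

text \<open>For negative q the first factor grows like exp(|q| t). The assumption lets half of the
  exponential decay of the bose factor pay for it and still leave exp(-t).\<close>

lemma norm_term_lambert:
  assumes t: "0 < t" and Qk: "2 * \<bar>real_of_int q\<bar> + 2 \<le> Q k"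
  shows "norm (term_lambert q k t) \<le> \<bar>real_of_int q\<bar> * (exp (- t) / t) * (1 / Q k)"
proof -
  define y where "y = real_of_int q * t"
  have y: "\<bar>y\<bar> = \<bar>real_of_int q\<bar> * t" using t by (simp add: y_def abs_mult)
  have pos: "0 < Q k * t" "0 < Q (Suc k) * t" using t Q_pos by simp_all
  have "norm (1 - exp (- (of_int q * complex_of_real t))) = \<bar>1 - exp (- y)\<bar>"
  proof -
    have "1 - exp (- (of_int q * complex_of_real t)) = of_real (1 - exp (- y))"
      by (simp add: y_def exp_of_real[symmetric])
    then show ?thesis by (simp only: norm_of_real)
  qed
  then have n: "norm (1 - exp (- (of_int q * complex_of_real t))) \<le> \<bar>y\<bar> * exp \<bar>y\<bar>" using abs_one_minus_exp_le[of y] by simp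
  have b1: "bose (Q k * t) \<le> exp (- (Q k * t / 2)) / (Q k * t)" by (rule bose_le_exp_half[OF pos(1)])
  have "bose (Q (Suc k) * t) \<le> 1 / (Q (Suc k) * t)" by (rule bose_le[OF pos(2)])
  also have "\<dots> \<le> 1 / t"
    by (rule frac_le[OF zero_le_one order_refl t]) (use t Q_ge_1[of "Suc k"] mult_right_mono[of 1 "Q (Suc k)" t] in simp)
  finally have b2: "bose (Q (Suc k) * t) \<le> 1 / t" .
  have bp: "0 < bose (Q k * t)" "0 < bose (Q (Suc k) * t)" using bose_pos pos by auto
  have "norm (term_lambert q k t) = norm (1 - exp (- (of_int q * complex_of_real t))) * (bose (Q k * t) * bose (Q (Suc k) * t))"
    unfolding term_lambert_eq norm_mult norm_of_real using bp by simp
  also have "\<dots> \<le> (\<bar>y\<bar> * exp \<bar>y\<bar>) * (exp (- (Q k * t / 2)) / (Q k * t) * (1 / t))"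
    by (intro mult_mono n b1 b2) (use bp t pos in auto)
  also have "\<dots> = (exp \<bar>y\<bar> * exp (- (Q k * t / 2))) * (\<bar>real_of_int q\<bar> * (1 / t) * (1 / Q k))"
    unfolding y using t by (simp add: field_simps)
  also have "\<dots> \<le> exp (- t) * (\<bar>real_of_int q\<bar> * (1 / t) * (1 / Q k))"
  proof (rule mult_right_mono)
    have "(2 * \<bar>real_of_int q\<bar> + 2) * t \<le> Q k * t" using Qk t by (intro mult_right_mono) auto
    then have "\<bar>y\<bar> - Q k * t / 2 \<le> - t" unfolding y by (simp add: algebra_simps)
    then show "exp \<bar>y\<bar> * exp (- (Q k * t / 2)) \<le> exp (- t)" by (simp flip: exp_add)
    show "0 \<le> \<bar>real_of_int q\<bar> * (1 / t) * (1 / Q k)" using t Q_pos[of k] by simp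
  qed
  finally show ?thesis by (simp add: mult_ac)
qed

lemma inverse_Q_shift_summable: "summable (\<lambda>j. 1 / Q (k0 + j))"
  using summable_inverse_Q summable_iff_shift[of "\<lambda>k. 1 / Q k" k0] by (simp add: add.commute)

lemma tail_lambert_summable:
  assumes "0 < t" "\<And>k. k0 \<le> k \<Longrightarrow> 2 * \<bar>real_of_int q\<bar> + 2 \<le> Q k"
  shows "summable (\<lambda>j. norm ((-1) ^ (k0 + j) * term_lambert q (k0 + j) t))"
    and "norm (tail_lambert q k0 t) \<le> \<bar>real_of_int q\<bar> * (exp (- t) / t) * (\<Sum>j. 1 / Q (k0 + j))"
proof -
  have le: "norm ((-1) ^ (k0 + j) * term_lambert q (k0 + j) t) \<le> \<bar>real_of_int q\<bar> * (exp (- t) / t) * (1 / Q (k0 + j))" for j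
    using norm_term_lambert[OF assms(1,2)] by (simp add: norm_mult norm_power)
  have g: "summable (\<lambda>j. \<bar>real_of_int q\<bar> * (exp (- t) / t) * (1 / Q (k0 + j)))"
    by (intro summable_mult inverse_Q_shift_summable)
  show s: "summable (\<lambda>j. norm ((-1) ^ (k0 + j) * term_lambert q (k0 + j) t))"
  proof (rule summable_comparison_test'[OF g, where N = 0])
    show "norm (norm ((-1) ^ (k0 + j) * term_lambert q (k0 + j) t)) \<le> \<bar>real_of_int q\<bar> * (exp (- t) / t) * (1 / Q (k0 + j))" for j
      using le[of j] by (simp only: real_norm_def abs_norm_cancel)
  qed
  have "norm (tail_lambert q k0 t) \<le> (\<Sum>j. norm ((-1) ^ (k0 + j) * term_lambert q (k0 + j) t))"
    unfolding tail_lambert_def by (rule summable_norm[OF s])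
  also have "\<dots> \<le> (\<Sum>j. \<bar>real_of_int q\<bar> * (exp (- t) / t) * (1 / Q (k0 + j)))" by (rule suminf_le[OF le s g])
  also have "\<dots> = \<bar>real_of_int q\<bar> * (exp (- t) / t) * (\<Sum>j. 1 / Q (k0 + j))" by (rule suminf_mult[OF inverse_Q_shift_summable])
  finally show "norm (tail_lambert q k0 t) \<le> \<bar>real_of_int q\<bar> * (exp (- t) / t) * (\<Sum>j. 1 / Q (k0 + j))" .
qed

lemma measurable_term_lambert [measurable]: "term_lambert q k \<in> borel_measurable borel"
  unfolding term_lambert_def [abs_def] kern_def bose_def by measurable

lemma measurable_tail_lambert [measurable]: "tail_lambert q k0 \<in> borel_measurable borel"
  unfolding tail_lambert_def [abs_def] by measurable

text \<open>What remains is \<open>E\<close>, a multiple of bose t and finitely many terms of the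
  series, each with at most a simple pole at 0. All amplitudes involved are at most
  \<open>Q k0\<close>, so radius 1 / \<open>Q k0\<close> avoids every other pole.\<close>

lemma A_lambert_diff_tail_near_0:
  obtains F R where "0 < R" "F holomorphic_on ball 0 R"
    "\<And>t. 0 < t \<Longrightarrow> of_real (A_lambert q t) - tail_lambert q k0 t = F (of_real t) / of_real t"
proof -
  obtain E where E: "E holomorphic_on UNIV"
    and AE: "\<And>t. 0 < t \<Longrightarrow> of_real (A_lambert q t) = (1 - exp (- (of_int q * of_real t))) * of_real (floor_lambert t)
       + E (of_real t) - of_int \<lfloor>\<beta> * of_int q\<rfloor> * bose (complex_of_real t)"
    by (rule A_lambert_eq_floor_lambert[of q]) (rule that, assumption+)
  define F where "F = (\<lambda>u. (\<Sum>k<k0. (-1) ^ k * kern_num q (\<lambda>_. of_real (Q k)) (\<lambda>_. of_real (Q (Suc k))) 1 u)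
     + u * E u - of_int \<lfloor>\<beta> * of_int q\<rfloor> / expm1_div 1 u)"
  have "F holomorphic_on ball 0 (1 / Q k0)"
  proof -
    have small: "norm (complex_of_real (Q k) * u) < 6" if "u \<in> ball 0 (1 / Q k0)" "k \<le> k0" for u k
    proof -
      have "Q k * norm u \<le> Q k0 * norm u" using Q_mono[OF that(2)] by (intro mult_right_mono) auto
      also have "\<dots> < 1" using that(1) Q_pos[of k0] by (simp add: field_simps)
      finally show ?thesis using Q_pos[of k] by (simp add: norm_mult)
    qed
    have "norm (1 * u) < 6" if "u \<in> ball 0 (1 / Q k0)" for u :: complex
    proof -
      have "1 / Q k0 \<le> 1" using Q_ge_1[of k0] by simp
      then show ?thesis using that by simp
    qed
    then have e1: "expm1_div 1 u \<noteq> 0" if "u \<in> ball 0 (1 / Q k0)" for u using expm1_div_nonzero[of 1 u] that by simp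
    have e: "expm1_div (of_real (Q k)) u \<noteq> 0" if "u \<in> ball 0 (1 / Q k0)" "k \<le> k0" for u k
      using expm1_div_nonzero[OF small[OF that]] Q_pos[of k] by simp
    show ?thesis unfolding F_def kern_num_def
      by (intro holomorphic_on_add holomorphic_on_diff holomorphic_on_sum holomorphic_on_mult holomorphic_on_divide
          holomorphic_on_minus expm1_div_holomorphic holomorphic_on_const holomorphic_on_ident holomorphic_on_subset[OF E])
        (use e e1 in auto)
  qed
  moreover have "of_real (A_lambert q t) - tail_lambert q k0 t = F (of_real t) / of_real t" if t: "0 < t" for t
  proof -
    define b where "b = (\<lambda>k. (-1) ^ k * (bose (Q k * t) * bose (Q (Suc k) * t)))"
    define w where "w = 1 - exp (- (of_int q * complex_of_real t))"
    have bs: "summable b"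
    proof (rule summable_comparison_test'[where N = 0])
      show "summable (\<lambda>k. 1 / t\<^sup>2 * (1 / Q k))" by (intro summable_mult summable_inverse_Q)
      fix k
      have pos: "0 < Q k * t" "0 < Q (Suc k) * t" using t Q_pos by simp_all
      have "norm (b k) = bose (Q k * t) * bose (Q (Suc k) * t)" using bose_pos[OF pos(1)] bose_pos[OF pos(2)] by (simp add: b_def abs_mult)
      also have "\<dots> \<le> (1 / (Q k * t)) * (1 / (Q (Suc k) * t))" using pos bose_pos[OF pos(2)] by (intro mult_mono bose_le) auto
      also have "\<dots> \<le> (1 / (Q k * t)) * (1 / t)"
        by (intro mult_left_mono frac_le[OF zero_le_one order_refl t])
          (use t pos Q_ge_1[of "Suc k"] mult_right_mono[of 1 "Q (Suc k)" t] in simp_all)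
      also have "\<dots> = 1 / t\<^sup>2 * (1 / Q k)" by (simp add: power2_eq_square)
      finally show "norm (b k) \<le> 1 / t\<^sup>2 * (1 / Q k)" .
    qed
    have tm: "(-1) ^ k * term_lambert q k t = w * of_real (b k)" for k by (simp add: term_lambert_eq b_def w_def)
    have bs': "summable (\<lambda>j. b (k0 + j))" using summable_iff_shift[of b k0] bs by (simp add: add.commute)
    have "tail_lambert q k0 t = (\<Sum>j. w * of_real (b (k0 + j)))" unfolding tail_lambert_def tm ..
    also have "\<dots> = w * of_real (\<Sum>j. b (k0 + j))"
      unfolding suminf_of_real[OF bs'] by (rule suminf_mult) (rule summable_of_real[OF bs'])
    finally have tl: "tail_lambert q k0 t = w * of_real (\<Sum>j. b (k0 + j))" .
    have "floor_lambert t = suminf b" unfolding floor_lambert_def b_def ..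
    also have "\<dots> = (\<Sum>j. b (j + k0)) + (\<Sum>k<k0. b k)" by (rule suminf_split_initial_segment[OF bs])
    finally have fl: "floor_lambert t = (\<Sum>k<k0. b k) + (\<Sum>j. b (k0 + j))" by (simp add: add.commute)
    have "w * of_real (\<Sum>k<k0. b k) = (\<Sum>k<k0. (-1) ^ k * term_lambert q k t)"
      unfolding tm of_real_sum sum_distrib_left ..
    also have "\<dots> = (\<Sum>k<k0. (-1) ^ k * kern_num q (\<lambda>_. of_real (Q k)) (\<lambda>_. of_real (Q (Suc k))) 1 (of_real t)) / of_real t"
      unfolding sum_divide_distrib term_lambert_def using t by (intro sum.cong refl) (simp add: kern_eq)
    finally have head: "w * of_real (\<Sum>k<k0. b k) = (\<Sum>k<k0. (-1) ^ k * kern_num q (\<lambda>_. of_real (Q k)) (\<lambda>_. of_real (Q (Suc k))) 1 (of_real t)) / of_real t" .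
    have bt: "bose (complex_of_real t) = 1 / expm1_div 1 (of_real t) / of_real t" using t by (simp add: bose_def expm1_div_def)
    have "of_real (A_lambert q t) - tail_lambert q k0 t = w * of_real (\<Sum>k<k0. b k) + E (of_real t) - of_int \<lfloor>\<beta> * of_int q\<rfloor> * bose (complex_of_real t)"
      unfolding AE[OF t] tl fl w_def[symmetric] by (simp add: distrib_left)
    also have "\<dots> = F (of_real t) / of_real t" unfolding head bt F_def using t by (simp add: add_divide_distrib diff_divide_distrib)
    finally show ?thesis .
  qed
  ultimately show ?thesis using Q_pos[of k0] by (intro that[of "1 / Q k0" F]) auto
qed

lemma mellin_tail_lambert:
  assumes s: "1 < Re s" and Qk: "\<And>k. k0 \<le> k \<Longrightarrow> 2 * \<bar>real_of_int q\<bar> + 2 \<le> Q k"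
    and conv: "\<And>j. mellin_conv {0<..} (term_lambert q (k0 + j)) s"
  shows "(\<lambda>j. (-1) ^ (k0 + j) * mellin {0<..} (term_lambert q (k0 + j)) s) sums mellin {0<..} (tail_lambert q k0) s"
    and "mellin_conv {0<..} (tail_lambert q k0) s"
proof -
  define W where "W = (\<lambda>t::real. t powr (Re s - 1 - 1) * exp (- (1 * t)))"
  define J where "J = (LINT t:{0<..}|lborel. W t)"
  have Wint: "set_integrable lborel {0<..} W"
  proof -
    have "mellin_conv {0<..} (\<lambda>t. of_real (exp (- (1 * t)))) (of_real (Re s - 1))" by (rule mellin_exp(2)) (use s in auto)
    then have "set_integrable lborel {0<..} (\<lambda>t. norm (complex_of_real t powr (of_real (Re s - 1) - 1) * of_real (exp (- (1 * t)))))"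
      unfolding mellin_conv_def by (rule set_integrable_norm)
    then show ?thesis
      by (rule set_integrable_cong[THEN iffD1, OF refl refl, rotated]) (simp add: W_def norm_mult norm_of_real_powr)
  qed
  have S: "({0<..} :: real set) \<subseteq> {0<..}" "({0<..} :: real set) \<in> sets borel" by auto
  let ?f = "\<lambda>j t. (-1) ^ (k0 + j) * term_lambert q (k0 + j) t"
  have c: "mellin_conv {0<..} (?f j) s" for j by (rule mellin_conv_cmult[OF conv])
  have pw: "summable (\<lambda>j. norm (?f j t))" if "t \<in> {0<..}" for t
    by (rule tail_lambert_summable(1)[OF _ Qk]) (use that in auto)
  have sm: "summable (\<lambda>j. LINT t:{0<..}|lborel. t powr (Re s - 1) * norm (?f j t))"
  proof (rule summable_comparison_test'[where N = 0])
    show "summable (\<lambda>j. \<bar>real_of_int q\<bar> * J * (1 / Q (k0 + j)))" by (intro summable_mult inverse_Q_shift_summable)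
    fix j
    have "(LINT t:{0<..}|lborel. t powr (Re s - 1) * norm (?f j t)) \<le> (LINT t:{0<..}|lborel. \<bar>real_of_int q\<bar> * (1 / Q (k0 + j)) * W t)"
      unfolding set_lebesgue_integral_def
    proof (rule integral_mono')
      show "integrable lborel (\<lambda>t. indicator {0<..} t *\<^sub>R (\<bar>real_of_int q\<bar> * (1 / Q (k0 + j)) * W t))"
        using set_integrable_mult_right[OF Wint, of "\<bar>real_of_int q\<bar> * (1 / Q (k0 + j))"] by (simp add: set_integrable_def)
      have Wpos: "0 \<le> \<bar>real_of_int q\<bar> * (1 / Q (k0 + j)) * W t" for t
        using Q_pos[of "k0 + j"] by (intro mult_nonneg_nonneg) (auto simp: W_def)
      show "0 \<le> indicator {0<..} t *\<^sub>R (\<bar>real_of_int q\<bar> * (1 / Q (k0 + j)) * W t)" for t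
        using Wpos[of t] by (auto simp: indicator_def)
      show "indicator {0<..} t *\<^sub>R (t powr (Re s - 1) * norm (?f j t)) \<le> indicator {0<..} t *\<^sub>R (\<bar>real_of_int q\<bar> * (1 / Q (k0 + j)) * W t)" for t
      proof (cases "0 < t")
        case True
        have "t powr (Re s - 1) * norm (?f j t) \<le> t powr (Re s - 1) * (\<bar>real_of_int q\<bar> * (exp (- t) / t) * (1 / Q (k0 + j)))"
          using norm_term_lambert[OF True Qk[of "k0 + j"]] by (intro mult_left_mono) (auto simp: norm_mult norm_power)
        also have "\<dots> = \<bar>real_of_int q\<bar> * (1 / Q (k0 + j)) * W t" using True by (simp add: W_def powr_diff power2_eq_square mult_ac)
        finally show ?thesis using True by simp
      qed simp
    qed
    also have "\<dots> = \<bar>real_of_int q\<bar> * J * (1 / Q (k0 + j))" unfolding J_def by simp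
    finally have "(LINT t:{0<..}|lborel. t powr (Re s - 1) * norm (?f j t)) \<le> \<bar>real_of_int q\<bar> * J * (1 / Q (k0 + j))" .
    moreover have "0 \<le> (LINT t:{0<..}|lborel. t powr (Re s - 1) * norm (?f j t))"
      unfolding set_lebesgue_integral_def by (rule Bochner_Integration.integral_nonneg) simp
    ultimately show "norm (LINT t:{0<..}|lborel. t powr (Re s - 1) * norm (?f j t)) \<le> \<bar>real_of_int q\<bar> * J * (1 / Q (k0 + j))" by simp
  qed
  show "(\<lambda>j. (-1) ^ (k0 + j) * mellin {0<..} (term_lambert q (k0 + j)) s) sums mellin {0<..} (tail_lambert q k0) s"
    using mellin_sums(1)[OF S c pw sm] unfolding mellin_cmult tail_lambert_def [abs_def] .
  show "mellin_conv {0<..} (tail_lambert q k0) s"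
    using mellin_sums(2)[OF S c pw sm] unfolding tail_lambert_def [abs_def] .
qed

lemma A_lambert_diff_tail_bound:
  assumes r: "0 < r" and Qk: "\<And>k. k0 \<le> k \<Longrightarrow> 2 * \<bar>real_of_int q\<bar> + 2 \<le> Q k"
  obtains C where "\<And>t. r < t \<Longrightarrow> norm (of_real (A_lambert q t) - tail_lambert q k0 t) \<le> C * exp (- t)"
proof -
  define S where "S = (\<Sum>j. 1 / Q (k0 + j))"
  have S: "0 \<le> S" unfolding S_def using Q_pos by (intro suminf_nonneg inverse_Q_shift_summable) (simp add: less_imp_le)
  have "norm (of_real (A_lambert q t) - tail_lambert q k0 t) \<le> (2 + exp 1 / r + \<bar>real_of_int q\<bar> / r * S) * exp (- t)" if t: "r < t" for t
  proof -
    have t0: "0 < t" using t r by simp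
    have "norm (complex_of_real (A_lambert q t)) \<le> (2 + exp 1 / r) * exp (- t)"
    proof (cases "1 < t")
      case True
      then have "norm (complex_of_real (A_lambert q t)) \<le> 2 * exp (- t)" using A_lambert_decay[of t q] by simp
      also have "\<dots> \<le> (2 + exp 1 / r) * exp (- t)" using r by (intro mult_right_mono) auto
      finally show ?thesis .
    next
      case False
      have "A_lambert q t \<le> 1 / t" using A_lambert_bounds(2)[OF t0, of q] bose_le[OF t0] by linarith
      also have "\<dots> \<le> 1 / r" by (rule frac_le) (use t r in auto)
      also have "\<dots> \<le> exp (1 - t) / r" using r False by (intro divide_right_mono) auto
      also have "\<dots> = exp 1 / r * exp (- t)" by (simp add: exp_diff exp_minus inverse_eq_divide)
      also have "\<dots> \<le> (2 + exp 1 / r) * exp (- t)" by (intro mult_right_mono) auto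
      finally show ?thesis using A_lambert_bounds(1)[OF t0, of q] by simp
    qed
    moreover have "norm (tail_lambert q k0 t) \<le> (\<bar>real_of_int q\<bar> / r * S) * exp (- t)"
    proof -
      have "norm (tail_lambert q k0 t) \<le> \<bar>real_of_int q\<bar> * (exp (- t) / t) * S"
        unfolding S_def by (rule tail_lambert_summable(2)[OF t0 Qk])
      also have "\<dots> \<le> \<bar>real_of_int q\<bar> * (exp (- t) / r) * S"
        using S t r by (intro mult_right_mono mult_left_mono frac_le) auto
      finally show ?thesis by (simp add: mult_ac)
    qed
    ultimately show ?thesis using norm_triangle_ineq4[of "of_real (A_lambert q t)" "tail_lambert q k0 t"]
      unfolding distrib_right by linarith
  qed
  then show ?thesis by (rule that)
qed

end

context irrational_number
begin

text \<open>The head of the series gives one loop integral \<open>I0\<close>. In the tail, the index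
  j = i + n l is scaled by \<open>\<epsilon>\<close>^n, which turns the n-th block of length l into
  \<open>\<epsilon>\<close>^(-n s) times the same function \<open>I\<close> at v =
  \<open>\<epsilon>\<close>^(-n).\<close>

lemma quadratic_decomposition:
  assumes quad: "quadratic_irrational \<alpha>"
  obtains \<epsilon> I I0 where "cf_eta \<alpha> = 1 / \<epsilon>" "geometric_family I \<epsilon>" "I0 holomorphic_on UNIV"
    "\<And>s. 1 < Re s \<Longrightarrow> (exp (2 * pi * \<i> * s) - 1) * (Gamma s * g_series \<alpha> q s) = I0 s + geometric_family.total I \<epsilon> s"
proof -
  obtain \<epsilon> p l X Y where eps: "1 < \<epsilon>" and eta: "cf_eta \<alpha> = 1 / \<epsilon>" and l: "0 < l" "even l"
    and QXY: "\<And>k. p \<le> k \<Longrightarrow> Q k = X k + Y k" and Xl: "\<And>k. p \<le> k \<Longrightarrow> X (k + l) = \<epsilon> * X k"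
    and Yl: "\<And>k. p \<le> k \<Longrightarrow> Y (k + l) = Y k / \<epsilon>" and Xpos: "\<And>k. p \<le> k \<Longrightarrow> 0 < (X k :: real)"
    by (rule quadratic_structure[OF quad]) (rule that, assumption+)
  \<comment> \<open>|Y| shrinks from period to period, so its maximum over the first period bounds
    it everywhere.\<close>
  define BY where "BY = Max ((\<lambda>i. \<bar>Y (p + i)\<bar>) ` {..<l})"
  have Yb: "\<bar>Y k\<bar> \<le> BY" if "p \<le> k" for k
    using that
  proof (induction k rule: less_induct)
    case (less k)
    show ?case
    proof (cases "k < p + l")
      case True
      then have "\<bar>Y (p + (k - p))\<bar> \<in> (\<lambda>i. \<bar>Y (p + i)\<bar>) ` {..<l}" using less.prems by (intro imageI) auto
      then show ?thesis unfolding BY_def using less.prems by (intro Max_ge) auto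
    next
      case False
      then have k: "p \<le> k - l" "k - l + l = k" "k - l < k" using l by auto
      have "Y k = Y (k - l) / \<epsilon>" using Yl[OF k(1)] k(2) by simp
      then have "\<bar>Y k\<bar> = \<bar>Y (k - l)\<bar> / \<epsilon>" using eps by (simp add: abs_divide)
      also have "\<dots> \<le> \<bar>Y (k - l)\<bar> / 1" using eps by (intro divide_left_mono) auto
      finally show ?thesis using less.IH[OF k(3,1)] by simp
    qed
  qed
  \<comment> \<open>X = Q - Y loses at most one BY, which leaves 8 BY to dominate 8 |Y| and 4 |q| +
    4 for the decay of the kernels.\<close>
  define W where "W = 9 * BY + 4 * \<bar>real_of_int q\<bar> + 4"
  have "eventually (\<lambda>n. W \<le> Q n) sequentially" using Q_filterlim by (simp add: filterlim_at_top)
  then obtain N where N: "\<And>n. N \<le> n \<Longrightarrow> W \<le> Q n" by (auto simp: eventually_at_top_linorder)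
  define k0 where "k0 = max p N"
  have pk: "p \<le> k" if "k0 \<le> k" for k using that by (simp add: k0_def)
  have Xk: "4 * \<bar>real_of_int q\<bar> + 4 \<le> X k" "8 * \<bar>Y k\<bar> \<le> X k" "2 * \<bar>real_of_int q\<bar> + 2 \<le> Q k" if k: "k0 \<le> k" for k
  proof -
    have "W \<le> Q k" using N k by (simp add: k0_def)
    then show "4 * \<bar>real_of_int q\<bar> + 4 \<le> X k" "8 * \<bar>Y k\<bar> \<le> X k" "2 * \<bar>real_of_int q\<bar> + 2 \<le> Q k"
      using QXY[OF pk[OF k]] Yb[OF pk[OF k]] unfolding W_def by linarith+
  qed
  define SX where "SX = (\<Sum>k=k0..k0+l. X k)"
  have SX: "X k \<le> SX" if "k \<in> {k0..k0+l}" for k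
    unfolding SX_def by (rule member_le_sum[OF that]) (use Xpos pk in \<open>auto simp: less_imp_le\<close>)
  have SX0: "0 < SX" using SX[of k0] Xpos[OF pk[of k0]] by simp
  \<comment> \<open>A single radius for all l kernels; SX dominates every X occurring in the block
    k0, ..., k0 + l.\<close>
  define r where "r = 1 / SX"
  have fam: "kernel_family q (X (k0 + i)) (Y (k0 + i)) (X (Suc (k0 + i))) (Y (Suc (k0 + i))) r" if i: "i < l" for i
  proof
    show "r * X (k0 + i) \<le> 1" using SX[of "k0 + i"] SX0 i by (simp add: r_def)
    show "r * X (Suc (k0 + i)) \<le> 1" using SX[of "Suc (k0 + i)"] SX0 i by (simp add: r_def)
    show "0 < r" using SX0 by (simp add: r_def)
  qed (use Xk in auto)
  define hk where "hk = (\<lambda>i. kernel_family.hank q (X (k0 + i)) (Y (k0 + i)) (X (Suc (k0 + i))) (Y (Suc (k0 + i))) r)"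
  define I where "I = (\<lambda>s v. \<Sum>i<l. (-1) ^ (k0 + i) * hk i s v)"
  have gf: "geometric_family I \<epsilon>"
  proof
    show "1 < \<epsilon>" by (rule eps)
    show "(\<lambda>s. I s v) holomorphic_on UNIV" if "v \<in> ball 0 2" for v
      unfolding I_def hk_def
      by (intro holomorphic_on_sum holomorphic_on_mult holomorphic_on_const kernel_family.hank_holomorphic[OF fam] that) simp
    show "I s holomorphic_on ball 0 2" for s
      unfolding I_def hk_def
      by (intro holomorphic_on_sum holomorphic_on_mult holomorphic_on_const kernel_family.hank_holomorphic_parameter[OF fam]) simp
    show "I s 0 = 0" for s
      unfolding I_def hk_def by (intro sum.neutral ballI) (simp add: kernel_family.hank_0[OF fam])
    fix S
    have "\<forall>i. \<exists>B. i < l \<longrightarrow> (\<forall>s v. norm s \<le> S \<longrightarrow> v \<in> ball 0 2 \<longrightarrow> norm (hk i s v) \<le> B)"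
      using kernel_family.hank_bounded[OF fam] unfolding hk_def by meson
    from choice[OF this] obtain B where B: "\<And>i s v. i < l \<Longrightarrow> norm s \<le> S \<Longrightarrow> v \<in> ball 0 2 \<Longrightarrow> norm (hk i s v) \<le> B i" by auto
    show "\<exists>B. \<forall>s v. norm s \<le> S \<longrightarrow> v \<in> ball 0 2 \<longrightarrow> norm (I s v) \<le> B"
    proof (intro exI allI impI)
      fix s v :: complex assume sv: "norm s \<le> S" "v \<in> ball 0 2"
      have "norm (I s v) \<le> (\<Sum>i<l. norm ((-1) ^ (k0 + i) * hk i s v))" unfolding I_def by (rule norm_sum)
      also have "\<dots> \<le> (\<Sum>i<l. B i)" using B sv by (intro sum_mono) (simp add: norm_mult norm_power)
      finally show "norm (I s v) \<le> (\<Sum>i<l. B i)" .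
    qed
  qed
  define e where "e = (\<lambda>n::nat. (1 / \<epsilon>) ^ n)"
  have e_ball: "complex_of_real (e n) \<in> ball 0 2" for n
  proof -
    have "0 \<le> e n" "e n \<le> 1" using eps by (auto simp: e_def intro!: power_le_one)
    then show ?thesis by simp
  qed
  have XYn: "X (k + n * l) = \<epsilon> ^ n * X k \<and> Y (k + n * l) = e n * Y k" if k: "p \<le> k" for k n
  proof (induction n)
    case (Suc n)
    have "p \<le> k + n * l" using k by simp
    from Xl[OF this] Yl[OF this] show ?case using Suc by (simp add: e_def add_ac)
  qed (simp add: e_def)
  have e_eps: "e n * \<epsilon> ^ n = 1" for n using eps by (simp add: e_def power_one_over)
  \<comment> \<open>The scaling identity behind \<open>amp\<close>: e n \<open>\<epsilon>\<close>^n
    = 1 turns v^2 Y \<open>\<epsilon>\<close>^n t into e n Y t.\<close>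
  have amp_eq: "amp (X k) (Y k) (of_real (e n)) * of_real (\<epsilon> ^ n * t) = of_real (Q (k + n * l)) * of_real t" if k: "p \<le> k" for k n t
  proof -
    have "(X k + (e n)\<^sup>2 * Y k) * (\<epsilon> ^ n * t) = (\<epsilon> ^ n * X k + (e n * \<epsilon> ^ n) * (e n * Y k)) * t"
      by (simp add: power2_eq_square algebra_simps)
    also have "\<dots> = Q (k + n * l) * t" unfolding e_eps using QXY[of "k + n * l"] XYn[OF k, of n] k by simp
    finally have "complex_of_real ((X k + (e n)\<^sup>2 * Y k) * (\<epsilon> ^ n * t)) = of_real (Q (k + n * l) * t)" by (rule arg_cong)
    then show ?thesis unfolding amp_def by (simp only: of_real_mult of_real_add of_real_power)
  qed
  have term_scaled: "term_lambert q (k0 + i + n * l) t =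
      kern q (amp (X (k0 + i)) (Y (k0 + i))) (amp (X (Suc (k0 + i))) (Y (Suc (k0 + i)))) (of_real (e n)) (of_real (\<epsilon> ^ n * t))" for i n t
  proof -
    have q: "of_int q * complex_of_real (e n) * complex_of_real (\<epsilon> ^ n * t) = of_int q * 1 * of_real t"
    proof -
      have "e n * (\<epsilon> ^ n * t) = t" using e_eps[of n] by (simp add: mult.assoc[symmetric])
      then have "complex_of_real (e n) * complex_of_real (\<epsilon> ^ n * t) = of_real t" by (simp only: of_real_mult[symmetric])
      then show ?thesis by (simp only: mult.assoc mult_1_left)
    qed
    have s: "Suc (k0 + i) + n * l = Suc (k0 + i + n * l)" by simp
    have p: "p \<le> k0 + i" "p \<le> Suc (k0 + i)" using pk[of "k0 + i"] by auto
    show ?thesis unfolding term_lambert_def kern_def amp_eq[OF p(1)] amp_eq[OF p(2)] q s ..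
  qed
  obtain F R where R: "0 < R" and F: "F holomorphic_on ball 0 R"
    and near: "\<And>t. 0 < t \<Longrightarrow> of_real (A_lambert q t) - tail_lambert q k0 t = F (of_real t) / of_real t"
    by (rule A_lambert_diff_tail_near_0[of q k0]) (rule that, assumption+)
  define f0 where "f0 = (\<lambda>t. of_real (A_lambert q t) - tail_lambert q k0 t)"
  have f0m: "f0 \<in> borel_measurable borel" unfolding f0_def by measurable
  have R2: "0 < R / 2" "R / 2 < R" using R by auto
  obtain C where C: "\<And>t. R / 2 < t \<Longrightarrow> norm (of_real (A_lambert q t) - tail_lambert q k0 t) \<le> C * exp (- t)"
    by (rule A_lambert_diff_tail_bound[of "R / 2" k0 q]) (rule R2(1), rule Xk(3), assumption, rule that, assumption)
  have f0C: "norm (f0 t) \<le> C * exp (- t)" if "R / 2 < t" for t using C[OF that] by (simp add: f0_def)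
  have f0F: "f0 t = F (of_real t) / of_real t" if "0 < t" for t using near[OF that] by (simp add: f0_def)
  define I0 where "I0 = hankel (R / 2) F f0"
  have I0: "I0 holomorphic_on UNIV" unfolding I0_def
  proof (rule hankel_holomorphic[OF R2(1) _ f0m f0C])
    show "continuous_on (sphere 0 (R / 2)) F"
      by (rule continuous_on_subset[OF holomorphic_on_imp_continuous_on[OF F]]) (use R in auto)
  qed
  have "(exp (2 * pi * \<i> * s) - 1) * (Gamma s * g_series \<alpha> q s) = I0 s + geometric_family.total I \<epsilon> s" if s: "1 < Re s" for s
  proof -
    define E where "E = exp (2 * pi * \<i> * s) - 1"
    define x where "x = exp (- (s * of_real (ln \<epsilon>)))"
    have xn: "of_real (\<epsilon> ^ n) powr (- s) = x ^ n" for n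
    proof -
      have "of_real (\<epsilon> ^ n) powr (- s) = exp (- s * of_real (ln (\<epsilon> ^ n)))"
        using eps by (simp add: powr_def Ln_of_real del: of_real_power)
      also have "ln (\<epsilon> ^ n) = real n * ln \<epsilon>" using eps by (simp add: ln_realpow)
      also have "exp (- s * of_real (real n * ln \<epsilon>)) = x ^ n"
        unfolding x_def exp_of_nat_mult[symmetric] by (simp add: mult_ac)
      finally show ?thesis .
    qed
    have mk: "E * mellin {0<..} (term_lambert q (k0 + i + n * l)) s = x ^ n * hk i s (of_real (e n))"
      "mellin_conv {0<..} (term_lambert q (k0 + i + n * l)) s" if i: "i < l" for i n
    proof -
      define K where "K = (\<lambda>t. kern q (amp (X (k0 + i)) (Y (k0 + i))) (amp (X (Suc (k0 + i))) (Y (Suc (k0 + i)))) (of_real (e n)) (of_real t))"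
      have t: "term_lambert q (k0 + i + n * l) = (\<lambda>t. K (\<epsilon> ^ n * t))"
        unfolding K_def by (rule ext) (rule term_scaled)
      have en: "0 < \<epsilon> ^ n" using eps by simp
      note h = kernel_family.hank_eq[OF fam[OF i] e_ball s, of n, folded K_def]
      show "mellin_conv {0<..} (term_lambert q (k0 + i + n * l)) s"
        unfolding t mellin_scale(2)[OF en, where f = K] by (rule h(2))
      have "E * mellin {0<..} (term_lambert q (k0 + i + n * l)) s = x ^ n * (E * mellin {0<..} K s)"
        unfolding t mellin_scale(1)[OF en, where f = K] xn by (simp only: mult_ac)
      then show "E * mellin {0<..} (term_lambert q (k0 + i + n * l)) s = x ^ n * hk i s (of_real (e n))"
        unfolding hk_def h(1) E_def .
    qed
    have conv: "mellin_conv {0<..} (term_lambert q (k0 + j)) s" for j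
      using mk(2)[of "j mod l" "j div l"] l(1) by (simp add: add.assoc)
    have Qk: "\<And>k. k0 \<le> k \<Longrightarrow> 2 * \<bar>real_of_int q\<bar> + 2 \<le> Q k" by (rule Xk(3))
    define M where "M = mellin {0<..} (tail_lambert q k0) s"
    note tl = mellin_tail_lambert[OF s Qk conv]
    define f where "f = (\<lambda>j. E * ((-1) ^ (k0 + j) * mellin {0<..} (term_lambert q (k0 + j)) s))"
    have "f sums (E * M)" unfolding f_def M_def by (rule sums_mult[OF tl(1)])
    \<comment> \<open>Regroups the convergent series into blocks of one period each.\<close>
    from sums_group[OF this l(1)] have grp: "(\<lambda>n. sum f {n * l..<n * l + l}) sums (E * M)" .
    have "sum f {n * l..<n * l + l} = x ^ n * I s (of_real (e n))" for n
    proof -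
      have "sum f {n * l..<n * l + l} = (\<Sum>i<l. f (i + n * l))"
        using sum.shift_bounds_nat_ivl[of f 0 "n * l" l] by (simp add: add.commute atLeast0LessThan)
      also have "\<dots> = (\<Sum>i<l. x ^ n * ((-1) ^ (k0 + i) * hk i s (of_real (e n))))"
      proof (intro sum.cong refl)
        fix i assume "i \<in> {..<l}"
        then have i: "i < l" by simp
        \<comment> \<open>Here the period has to be even: otherwise the sign would alternate from
          block to block and \<open>I\<close> would not be the same function in each.\<close>
        have sg: "(-1 :: complex) ^ (k0 + (i + n * l)) = (-1) ^ (k0 + i)" using l(2) by (simp add: minus_one_power_iff)
        have ix: "k0 + (i + n * l) = k0 + i + n * l" by simp
        have "f (i + n * l) = (-1) ^ (k0 + i) * (E * mellin {0<..} (term_lambert q (k0 + i + n * l)) s)"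
          unfolding f_def unfolding sg unfolding ix by (simp only: mult_ac)
        then show "f (i + n * l) = x ^ n * ((-1) ^ (k0 + i) * hk i s (of_real (e n)))"
          unfolding mk(1)[OF i] by (simp only: mult_ac)
      qed
      finally show ?thesis unfolding I_def sum_distrib_left .
    qed
    with grp have "(\<lambda>n. x ^ n * I s (of_real (e n))) sums (E * M)" by simp
    moreover have "(\<lambda>n. x ^ n * I s (of_real (e n))) sums geometric_family.total I \<epsilon> s"
      unfolding x_def e_def by (rule geometric_family.total_sums[OF gf]) (use s in simp)
    ultimately have tot: "geometric_family.total I \<epsilon> s = E * M" by (rule sums_unique2[symmetric])
    have near': "f0 t = F (of_real t) / of_real t" if "0 < t" "t \<le> R / 2" for t using f0F[OF that(1)] .
    note h0 = hankel_eq[OF R2 F f0m near' f0C s]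
    have "I0 s = E * mellin {0<..} f0 s" unfolding I0_def E_def by (rule h0(1))
    moreover have "mellin {0<..} (\<lambda>t. of_real (A_lambert q t)) s = mellin {0<..} f0 s + M"
      using mellin_add[OF h0(2) tl(2)] by (simp add: f0_def M_def)
    ultimately have "I0 s + geometric_family.total I \<epsilon> s = E * mellin {0<..} (\<lambda>t. of_real (A_lambert q t)) s"
      unfolding tot by (simp add: distrib_left)
    then show ?thesis unfolding mellin_A_lambert(1)[OF s] E_def by simp
  qed
  then show ?thesis by (rule that[OF eta gf I0])
qed

text \<open>The decomposition is divided by (exp(2 pi i s) - 1) Gamma(s). By the reflection formula
  the quotient of 1 by this is c(s) / (s - 1) with c holomorphic for Re s < 2, so in that half-plane
  only s = 1 and the zeros of the \<open>gf.den m\<close> remain as candidates for poles.\<close>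

lemma quadratic_continuation:
  assumes quad: "quadratic_irrational \<alpha>" and q: "q \<noteq> 0"
  obtains h where "h meromorphic_on UNIV" "\<And>s. 1 < Re s \<Longrightarrow> h s = g_series \<alpha> q s" "has_simple_pole h 1"
    "h holomorphic_on (- insert 1 (pole_lattice \<alpha>))"
    "\<And>z. z \<in> pole_lattice \<alpha> \<Longrightarrow> is_pole h z \<Longrightarrow> has_simple_pole h z"
proof -
  obtain \<epsilon> I I0 where eta: "cf_eta \<alpha> = 1 / \<epsilon>" and gf: "geometric_family I \<epsilon>" and I0: "I0 holomorphic_on UNIV"
    and eq: "\<And>s. 1 < Re s \<Longrightarrow> (exp (2 * pi * \<i> * s) - 1) * (Gamma s * g_series \<alpha> q s) = I0 s + geometric_family.total I \<epsilon> s"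
    by (rule quadratic_decomposition[OF quad, of q]) (rule that, assumption+)
  interpret gf: geometric_family I \<epsilon> by (rule gf)
  obtain g where g: "g holomorphic_on {s. - iota < Re s}" "g 1 = of_real (frac (\<alpha> * of_int q))"
    and gs: "\<And>s. 1 < Re s \<Longrightarrow> g_series \<alpha> q s = g s / (s - 1)"
    by (rule continuation[of q]) (rule that, assumption+)
  \<comment> \<open>exp(2 pi i s) - 1 is 2 i exp(pi i s) sin(pi s), and sin(pi s) = pi rGamma(s)
    rGamma(1 - s). Finally rGamma(1 - s) = (1 - s) rGamma(2 - s) splits off the pole at 1, whence
    the minus sign.\<close>
  define c where "c = (\<lambda>s. - (exp (- (pi * \<i> * s)) / (2 * pi * \<i>)) / rGamma (2 - s))"
  define P where "P = (\<lambda>s. c s * (I0 s + gf.total s))"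
  define W where "W = (\<lambda>s. P s / (s - 1))"
  \<comment> \<open>\<open>c\<close> is controlled only for Re s < 2, so further right the series
    itself is used. The two agree on the strip 1 < Re s < 2.\<close>
  define h where "h = (\<lambda>s. if 1 < Re s then g_series \<alpha> q s else W s)"
  have o2: "open {s. Re s < 2}" and o1: "open {s. 1 < Re s}" by (rule open_halfspace_Re_lt, rule open_halfspace_Re_gt)
  have c: "c holomorphic_on {s. Re s < 2}"
  proof -
    have "rGamma (2 - s) \<noteq> 0" if "Re s < 2" for s
      using Gamma_rGamma[of "2 - s"] that by auto
    then show ?thesis unfolding c_def by (intro holomorphic_intros) auto
  qed
  have Wg: "W s = g_series \<alpha> q s" if s: "1 < Re s" "Re s < 2" for s
  proof -
    have sn: "sin (pi * s) \<noteq> 0"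
    proof
      assume "sin (pi * s) = 0"
      then obtain n :: int where "complex_of_real pi * s = of_real (of_int n * pi)" unfolding sin_eq_0 by blast
      then have "s = of_int n" by (simp add: mult.commute)
      then have "1 < n" "n < 2" using s by auto
      then show False by linarith
    qed
    have r1: "rGamma (1 - s) = (1 - s) * rGamma (2 - s)" using rGamma_plus1[of "1 - s"] by simp
    have refl: "rGamma s * rGamma (1 - s) = sin (pi * s) / pi" by (rule rGamma_reflection_complex)
    have GG: "rGamma s * Gamma s = 1" using Gamma_rGamma[of s] s by simp
    have nz: "rGamma s \<noteq> 0" "rGamma (1 - s) \<noteq> 0" using refl sn by auto
    have E: "exp (- (pi * \<i> * s)) * (exp (2 * pi * \<i> * s) - 1) = 2 * \<i> * sin (pi * s)"
    proof -
      have "exp (- (pi * \<i> * s)) * (exp (2 * pi * \<i> * s) - 1) = exp (- (pi * \<i> * s) + 2 * pi * \<i> * s) - exp (- (pi * \<i> * s))"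
        unfolding exp_add by (simp only: right_diff_distrib mult_1_right)
      also have "\<dots> = exp (\<i> * (pi * s)) - exp (- (\<i> * (pi * s)))"
      proof -
        have a: "- (pi * \<i> * s) + 2 * pi * \<i> * s = \<i> * (pi * s)" and b: "- (pi * \<i> * s) = - (\<i> * (pi * s))"
          by (simp_all add: algebra_simps)
        show ?thesis unfolding a unfolding b by (simp add: mult_ac)
      qed
      finally show ?thesis by (simp add: sin_exp_eq)
    qed
    have "W s = exp (- (pi * \<i> * s)) / (2 * pi * \<i>) * (I0 s + gf.total s) / rGamma (1 - s)"
    proof -
      have "- x / y * v / w = x * v / (- w * y)" for x y v w :: complex by (simp add: divide_inverse mult_ac)
      moreover have "1 - s = - (s - 1)" by simp
      ultimately show ?thesis unfolding W_def P_def c_def r1 by (simp only: times_divide_eq_left)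
    qed
    also have "\<dots> = (exp (- (pi * \<i> * s)) * (exp (2 * pi * \<i> * s) - 1)) / (2 * pi * \<i>) * (Gamma s * g_series \<alpha> q s) / rGamma (1 - s)"
      unfolding eq[OF s(1), symmetric] by simp
    also have "\<dots> = (sin (pi * s) / pi) / rGamma (1 - s) * (Gamma s * g_series \<alpha> q s)"
      unfolding E by simp
    also have "\<dots> = (rGamma s * Gamma s) * g_series \<alpha> q s" unfolding refl[symmetric] using nz by simp
    finally show ?thesis unfolding GG by simp
  qed
  have hW: "h s = W s" if "Re s < 2" for s using Wg[of s] that by (simp add: h_def)
  have hg: "h s = g s / (s - 1)" if "1 < Re s" for s using gs[OF that] that by (simp add: h_def)
  have evW: "eventually (\<lambda>s. h s = W s) (nhds z)" if "Re z < 2" for z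
    by (rule eventually_mono[OF eventually_nhds_in_open[OF o2]]) (use that hW in auto)
  have evg: "eventually (\<lambda>s. h s = g s / (s - 1)) (nhds z)" if "1 < Re z" for z
    by (rule eventually_mono[OF eventually_nhds_in_open[OF o1]]) (use that hg in auto)
  have at: "eventually Pr (at z)" if "eventually Pr (nhds z)" for Pr and z :: complex
    using that unfolding eventually_at_filter by (rule eventually_mono) simp
  have cz: "c field_differentiable (at z)" if "Re z < 2" for z
    by (rule holomorphic_on_imp_differentiable_at[OF c o2]) (use that in simp)
  have I0z: "I0 field_differentiable (at z)" for z
    by (rule holomorphic_on_imp_differentiable_at[OF I0]) auto
  have gdiff: "(\<lambda>s. g s / (s - 1)) holomorphic_on {s. 1 < Re s}"
    by (intro holomorphic_intros holomorphic_on_subset[OF g(1)]) (use iota_nonneg in auto)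
  have den: "gf.den m z \<noteq> 0" if z: "z \<notin> pole_lattice \<alpha>" and m: "1 \<le> m" for m z
  proof
    assume "gf.den m z = 0"
    then have "exp (- ((z + of_nat m) * of_real (ln \<epsilon>))) = 1" by (simp add: gf.den_def)
    then obtain n :: int where n: "(Re z + real m) * ln \<epsilon> = 0" "- (Im z * ln \<epsilon>) = of_int (2 * n) * pi"
      unfolding exp_eq_1 by auto
    have le: "0 < ln \<epsilon>" by (rule gf.ln_eps)
    have lneta: "ln (cf_eta \<alpha>) = - ln \<epsilon>" unfolding eta using gf.eps by (simp add: ln_div)
    have Re: "Re z = - real m" using n(1) le by simp
    have Im: "Im z = 2 * pi * real_of_int n / ln (cf_eta \<alpha>)" using n(2) le unfolding lneta by (simp add: field_simps)
    have zz: "z = - of_nat m + of_real (2 * pi * real_of_int n / ln (cf_eta \<alpha>)) * \<i>"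
      using Re Im by (simp add: complex_eq_iff)
    show False
    proof (cases "0 \<le> n")
      case True
      then have rn: "real_of_int n = real (nat n)" by simp
      have "z = - of_nat m + of_real (2 * pi * real (nat n) / ln (cf_eta \<alpha>)) * \<i>" using zz unfolding rn .
      then have "z \<in> pole_lattice \<alpha>" unfolding pole_lattice_def
        by (rule_tac UnI1, rule_tac CollectI, intro exI conjI) (assumption, rule m)
      then show False using z by blast
    next
      case False
      then have rn: "real_of_int n = - real (nat (- n))" by simp
      have "z = - of_nat m - of_real (2 * pi * real (nat (- n)) / ln (cf_eta \<alpha>)) * \<i>"
        unfolding zz rn by simp
      then have "z \<in> pole_lattice \<alpha>" unfolding pole_lattice_def
        by (rule_tac UnI2, rule_tac CollectI, intro exI conjI) (assumption, rule m)
      then show False using z by blast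
    qed
  qed
  have mer: "h meromorphic_on {z}" for z
  proof (cases "Re z < 2")
    case True
    have "c meromorphic_on {z}" by (rule analytic_on_imp_meromorphic_on, rule holomorphic_on_imp_analytic_at[OF c o2]) (use True in simp)
    moreover have "I0 meromorphic_on {z}" by (rule analytic_on_imp_meromorphic_on, rule holomorphic_on_imp_analytic_at[OF I0]) auto
    moreover have "gf.total meromorphic_on {z}" by (rule meromorphic_on_subset[OF gf.total_meromorphic]) simp
    ultimately have "W meromorphic_on {z}" unfolding W_def P_def
      by (intro meromorphic_on_divide meromorphic_on_mult meromorphic_on_add meromorphic_on_diff meromorphic_on_const meromorphic_on_id)
    moreover have "h meromorphic_on {z} \<longleftrightarrow> W meromorphic_on {z}"
      by (rule meromorphic_on_cong) (use at[OF evW[OF True]] in auto)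
    ultimately show ?thesis by simp
  next
    case False
    then have z: "1 < Re z" by simp
    have "(\<lambda>s. g s / (s - 1)) meromorphic_on {z}"
      by (rule analytic_on_imp_meromorphic_on, rule holomorphic_on_imp_analytic_at[OF gdiff o1]) (use z in simp)
    moreover have "h meromorphic_on {z} \<longleftrightarrow> (\<lambda>s. g s / (s - 1)) meromorphic_on {z}"
      by (rule meromorphic_on_cong) (use at[OF evg[OF z]] in auto)
    ultimately show ?thesis by simp
  qed
  have fd_cong: "f field_differentiable (at z)" if "eventually (\<lambda>s. f s = f' s) (nhds z)" "f' field_differentiable (at z)" for f f' :: "complex \<Rightarrow> complex" and z
    using DERIV_cong_ev[OF refl that(1) refl] that(2) unfolding field_differentiable_def by blast
  have hol: "h field_differentiable (at z)" if z: "z \<notin> insert 1 (pole_lattice \<alpha>)" for z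
  proof (cases "Re z < 2")
    case True
    have "W field_differentiable (at z)" unfolding W_def P_def
    proof (rule field_differentiable_divide)
      show "(\<lambda>s. c s * (I0 s + gf.total s)) field_differentiable (at z)"
        by (intro field_differentiable_mult field_differentiable_add cz[OF True] I0z gf.total_differentiable den) (use z in auto)
      show "(\<lambda>s. s - 1) field_differentiable (at z)" by (intro derivative_intros)
      show "z - 1 \<noteq> 0" using z by simp
    qed
    then show ?thesis by (rule fd_cong[OF evW[OF True]])
  next
    case False
    then have z1: "1 < Re z" by simp
    show ?thesis by (rule fd_cong[OF evg[OF z1] holomorphic_on_imp_differentiable_at[OF gdiff o1]]) (use z1 in simp)
  qed
  have pole_re: "Re z \<le> -1" if "z \<in> pole_lattice \<alpha>" for z using that by (auto simp: pole_lattice_def)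
  have simple: "has_simple_pole h z" if z: "z \<in> pole_lattice \<alpha>" and pole: "is_pole h z" for z
  proof -
    have rz: "Re z < 2" "z - 1 \<noteq> 0" using pole_re[OF z] by auto
    obtain L where L: "((\<lambda>s. (s - z) * gf.total s) \<longlongrightarrow> L) (at z)" by (rule gf.total_simple)
    have tc: "(c \<longlongrightarrow> c z) (at z)" "(I0 \<longlongrightarrow> I0 z) (at z)"
      using field_differentiable_imp_continuous_at[OF cz[OF rz(1)]] field_differentiable_imp_continuous_at[OF I0z[of z]]
      by (simp_all add: continuous_at)
    have "((\<lambda>s. c s * ((s - z) * I0 s + (s - z) * gf.total s) / (s - 1)) \<longlongrightarrow> c z * ((z - z) * I0 z + L) / (z - 1)) (at z)"
      by (intro tendsto_intros tc L rz(2))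
    moreover have "eventually (\<lambda>s. c s * ((s - z) * I0 s + (s - z) * gf.total s) / (s - 1) = (s - z) * h s) (at z)"
      by (rule eventually_mono[OF at[OF evW[OF rz(1)]]]) (simp add: W_def P_def algebra_simps)
    ultimately have "((\<lambda>s. (s - z) * h s) \<longlongrightarrow> c z * ((z - z) * I0 z + L) / (z - 1)) (at z)" by (rule Lim_transform_eventually)
    then show ?thesis by (rule has_simple_pole_if_tendsto[OF mer _ pole])
  qed
  have pole1: "has_simple_pole h 1"
  proof -
    define S where "S = {s. 0 < Re s} \<inter> {s. Re s < 2}"
    have S: "open S" "1 \<in> S" unfolding S_def by (auto intro: open_Int open_halfspace_Re_gt open_halfspace_Re_lt)
    have PS: "P holomorphic_on S"
    proof -
      have "P field_differentiable (at z)" if "z \<in> S" for z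
      proof -
        have "z \<notin> pole_lattice \<alpha>" using pole_re[of z] that by (auto simp: S_def)
        then show ?thesis unfolding P_def
          by (intro field_differentiable_mult field_differentiable_add cz I0z gf.total_differentiable den) (use that in \<open>auto simp: S_def\<close>)
      qed
      then show ?thesis by (auto simp: holomorphic_on_def intro: field_differentiable_at_within)
    qed
    have contP: "isCont P 1" using holomorphic_on_imp_differentiable_at[OF PS S] field_differentiable_imp_continuous_at by blast
    have contg: "isCont g 1"
    proof -
      have "g field_differentiable (at 1)"
        by (rule holomorphic_on_imp_differentiable_at[OF g(1) open_halfspace_Re_gt]) (use iota_nonneg in simp)
      then show ?thesis by (rule field_differentiable_imp_continuous_at)
    qed
    \<comment> \<open>Points of the strip 1 < Re s < 2 tending to 1. They identify the value of
      \<open>P\<close> at 1 with that of \<open>g\<close>, the nonzero fractional part of \<alpha>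
      q.\<close>
    define x where "x = (\<lambda>n. complex_of_real (1 + inverse (real (Suc (Suc n)))))"
    have x: "x \<longlonglongrightarrow> 1"
    proof -
      have "(\<lambda>n. inverse (real (Suc (Suc n)))) \<longlonglongrightarrow> 0" using LIMSEQ_Suc[OF LIMSEQ_inverse_real_of_nat] .
      then have "x \<longlonglongrightarrow> complex_of_real (1 + 0)" unfolding x_def by (intro tendsto_intros)
      then show ?thesis by simp
    qed
    have "P (x n) = g (x n)" for n
    proof -
      have "inverse (real (Suc (Suc n))) < 1" by (simp add: inverse_eq_divide)
      then have xn: "1 < Re (x n)" "Re (x n) < 2" by (simp_all only: x_def Re_complex_of_real) simp_all
      have "x n - 1 \<noteq> 0" using xn by auto
      moreover have "P (x n) / (x n - 1) = g (x n) / (x n - 1)" using Wg[OF xn] gs[OF xn(1)] by (simp add: W_def)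
      ultimately show ?thesis by simp
    qed
    then have Px: "(\<lambda>n. P (x n)) = (\<lambda>n. g (x n))" by (rule ext)
    have "P 1 = g 1"
      using LIMSEQ_unique[OF isCont_tendsto_compose[OF contP x, unfolded Px] isCont_tendsto_compose[OF contg x]] .
    then have "P 1 \<noteq> 0" using g(2) frac_nonzero[OF q] by simp
    from simple_pole_quotient(1)[OF S PS this] have W1: "has_simple_pole W 1" by (simp add: W_def)
    have ev: "eventually (\<lambda>s. h s = W s) (at 1)" by (rule at[OF evW]) simp
    have "is_pole h 1 = is_pole W 1" "zorder h 1 = zorder W 1"
      by (rule is_pole_cong[OF ev refl], rule zorder_cong[OF ev refl])
    then show ?thesis using W1 by (simp add: has_simple_pole_def)
  qed
  show ?thesis
  proof (rule that[OF _ _ pole1 _ simple])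
    show "h meromorphic_on UNIV" by (subst meromorphic_on_meromorphic_at) (use mer in blast)
    show "h s = g_series \<alpha> q s" if "1 < Re s" for s using that by (simp add: h_def)
    show "h holomorphic_on (- insert 1 (pole_lattice \<alpha>))"
      unfolding holomorphic_on_def using hol by (auto intro: field_differentiable_at_within)
  qed
qed

end

lemma sigma_mu_eq:
  assumes "\<And>x. x < a \<Longrightarrow> \<not> (\<exists>h. meromorphic_continuation f x h)" "\<exists>h. meromorphic_continuation f a h"
  shows "sigma_mu f = ereal a"
  unfolding sigma_mu_def
proof (rule antisym)
  show "Inf {ereal x |x. \<exists>h. meromorphic_continuation f x h} \<le> ereal a" using assms(2) by (intro Inf_lower) auto
  show "ereal a \<le> Inf {ereal x |x. \<exists>h. meromorphic_continuation f x h}"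
    using assms(1) by (intro Inf_greatest) (auto simp: not_less[symmetric])
qed

theorem theorem1:
  fixes \<alpha> :: real and q :: int
  assumes "0 < \<alpha>" and "\<alpha> \<notin> \<rat>" and "q \<noteq> 0"
  shows
    "(\<forall>s::complex. 1 < Re s \<longrightarrow> (\<lambda>n. 1 / of_nat n powr s) summable_on A_set \<alpha> q) \<and>
     (\<exists>h. h holomorphic_on ({s. - (1 / cf_tau \<alpha>) < ereal (Re s)} - {1}) \<and>
          (\<forall>s. 1 < Re s \<longrightarrow> h s = g_series \<alpha> q s) \<and>
          has_simple_pole h 1 \<and> residue h 1 = of_real (frac (\<alpha> * of_int q))) \<and>
     (1 < cf_tau \<alpha> \<longrightarrow>
          is_natural_boundary (g_series \<alpha> q) {s. ereal (Re s) = - (1 / cf_tau \<alpha>)}) \<and>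
     (quadratic_irrational \<alpha> \<longrightarrow>
          (\<exists>h. h meromorphic_on UNIV \<and>
               (\<forall>s. 1 < Re s \<longrightarrow> h s = g_series \<alpha> q s) \<and>
               has_simple_pole h 1 \<and>
               h holomorphic_on (- insert 1 (pole_lattice \<alpha>)) \<and>
               (\<forall>z\<in>pole_lattice \<alpha>. is_pole h z \<longrightarrow> has_simple_pole h z)))"
proof -
  interpret irrational_number \<alpha> by unfold_locales (rule assms)
  obtain g where g: "g holomorphic_on {s. - iota < Re s}" "g 1 = of_real (frac (\<alpha> * of_int q))"
    and gs: "\<And>s. 1 < Re s \<Longrightarrow> g_series \<alpha> q s = g s / (s - 1)"
    by (rule continuation[of q]) (rule that, assumption+)
  have half: "{s. - (1 / cf_tau \<alpha>) < ereal (Re s)} = {s. - iota < Re s}" unfolding iota_eq by simp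
  have op: "open {s. - iota < Re s}" by (rule open_halfspace_Re_gt)
  have g1: "g 1 \<noteq> 0" using g(2) frac_nonzero[OF assms(3)] by simp
  have in1: "1 \<in> {s. - iota < Re s}" using iota_nonneg by simp
  note pole = simple_pole_quotient[OF op in1 g(1) g1]
  have hol: "(\<lambda>s. g s / (s - 1)) holomorphic_on ({s. - iota < Re s} - {1})"
    by (intro holomorphic_intros holomorphic_on_subset[OF g(1)]) auto
  have "\<exists>h. h holomorphic_on ({s. - (1 / cf_tau \<alpha>) < ereal (Re s)} - {1}) \<and>
          (\<forall>s. 1 < Re s \<longrightarrow> h s = g_series \<alpha> q s) \<and>
          has_simple_pole h 1 \<and> residue h 1 = of_real (frac (\<alpha> * of_int q))"
    unfolding half using hol pole g(2) gs by (intro exI[of _ "\<lambda>s. g s / (s - 1)"]) auto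
  moreover have "is_natural_boundary (g_series \<alpha> q) {s. ereal (Re s) = - (1 / cf_tau \<alpha>)}" if tau: "1 < cf_tau \<alpha>"
  proof -
    have iota1: "iota < 1"
    proof (rule cf_tau_cases)
      fix r assume r: "cf_tau \<alpha> = ereal r" "1 \<le> r" "iota = 1 / r"
      then have "1 < r" using tau by simp
      then show ?thesis using r(3) by simp
    qed simp
    have "sigma_mu (g_series \<alpha> q) = ereal (- iota)"
    proof (rule sigma_mu_eq)
      have "(\<lambda>s. g s / (s - 1)) meromorphic_on {s. - iota < Re s}"
        using analytic_on_imp_meromorphic_on[OF iffD2[OF analytic_on_open[OF op] g(1)]]
        by (intro meromorphic_on_divide meromorphic_on_diff meromorphic_on_id meromorphic_on_const)
      then show "\<exists>h. meromorphic_continuation (g_series \<alpha> q) (- iota) h"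
        unfolding meromorphic_continuation_def using gs by (intro exI[of _ "\<lambda>s. g s / (s - 1)"] conjI exI[of _ 1]) auto
      show "\<not> (\<exists>h. meromorphic_continuation (g_series \<alpha> q) x h)" if "x < - iota" for x
        using no_continuation[OF iota1 assms(3) _ that] unfolding meromorphic_continuation_def by blast
    qed
    then show ?thesis unfolding is_natural_boundary_def iota_eq by simp
  qed
  moreover have "\<exists>h. h meromorphic_on UNIV \<and> (\<forall>s. 1 < Re s \<longrightarrow> h s = g_series \<alpha> q s) \<and> has_simple_pole h 1 \<and>
       h holomorphic_on (- insert 1 (pole_lattice \<alpha>)) \<and> (\<forall>z\<in>pole_lattice \<alpha>. is_pole h z \<longrightarrow> has_simple_pole h z)"
    if quad: "quadratic_irrational \<alpha>"
  proof -
    obtain h where "h meromorphic_on UNIV" "\<And>s. 1 < Re s \<Longrightarrow> h s = g_series \<alpha> q s" "has_simple_pole h 1"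
      "h holomorphic_on (- insert 1 (pole_lattice \<alpha>))"
      "\<And>z. z \<in> pole_lattice \<alpha> \<Longrightarrow> is_pole h z \<Longrightarrow> has_simple_pole h z"
      by (rule quadratic_continuation[OF quad assms(3)]) (rule that, assumption+)
    then show ?thesis by (intro exI[of _ h]) simp
  qed
  ultimately show ?thesis using mellin_A_lambert(3) by simp
qed

end
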